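(* A compact shrinking generalized soliton admits a torsion-bounding function if and only if it is a Ricci soliton (i.e. $H=0$).
   Context: A generalized soliton $(M^n,g,H,X)$ consists of a Riemannian metric $g$, a closed $3$-form $H$ and a vector field $X$ on $M^n$ such that for some real constant $\lambda$, $$2\operatorname{Ric}_g-\tfrac12H^2=\lambda g-\mathcal{L}_Xg,\qquad \Delta_dH=\lambda H-\mathcal{L}_XH,$$ where $(H^2)_{ij}=g^{pq}g^{kl}H_{ipk}H_{jql}$ and $\Delta_d=dd^*+d^*d$. It is shrinking if $\lambda>0$; it need not be gradient. A generalized Ricci flow is a family $(g_t,H_t)$ with $H_t$ closed, $\partial_tg=-2\operatorname{Ric}+\frac12H^2$ and $\partial_tH=-\Delta_dH$. A shrinking generalized soliton on a compact manifold induces the generalized Ricci flow $g_t=(1-\lambda t)\phi_t^*g$, $H_t=(1-\lambda t)\phi_t^*H$, $t\in[0,1/\lambda)$, where $\phi_t$ is the family of diffeomorphisms generated by $(1-\lambda t)^{-1}X$ with $\phi_0=\mathrm{id}$. A torsion-bounding function for a generalized Ricci flow $(g_t,H_t)$ is a smooth function $\psi\ge0$ on space-time with $(\partial_t-\Delta_{g_t})\psi\le-|H_t|_{g_t}^2$, where $|H|^2=g^{ij}(H^2)_{ij}$. A shrinking generalized soliton admits a torsion-bounding function if its induced generalized Ricci flow on $[0,1/\lambda)$ does. *)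

theory Defs
  imports "HOL-Analysis.Analysis"
begin

section \<open>Smooth functions\<close>

text \<open>For open \<open>U\<close>, \<open>Ck_on k f U\<close> is the usual class $C^k$.\<close>

primrec Ck_on :: "nat \<Rightarrow> ('a::real_normed_vector \<Rightarrow> 'b::real_normed_vector) \<Rightarrow> 'a set \<Rightarrow> bool" where
  "Ck_on 0 f U \<longleftrightarrow> continuous_on U f"
| "Ck_on (Suc k) f U \<longleftrightarrow> (\<forall>x\<in>U. f differentiable (at x)) \<and>
     (\<forall>v. Ck_on k (\<lambda>x. frechet_derivative f (at x) v) U)"

text \<open>On an arbitrary set, smooth means locally extendable to a smooth function on an open set.
  The non-open sets that occur below are of the form $[0,T) \times V$ with \<open>V\<close> open, or relatively
  open subsets of these.\<close>

definition smooth_on :: "'a::real_normed_vector set \<Rightarrow> ('a \<Rightarrow> 'b::real_normed_vector) \<Rightarrow> bool" where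
  "smooth_on S f \<longleftrightarrow>
     (\<forall>x\<in>S. \<exists>U F. open U \<and> x \<in> U \<and> (\<forall>k. Ck_on k F U) \<and> (\<forall>z\<in>S \<inter> U. F z = f z))"


section \<open>Smooth manifolds\<close>

text \<open>A manifold is a whole topological type together with a smooth atlas. A chart is a pair of its
  domain and its coordinate map; only the values of the latter on the domain matter.\<close>

type_synonym ('m, 'n) chart = "'m set \<times> ('m \<Rightarrow> real ^ 'n)"

definition chart_inv :: "('m, 'n::finite) chart \<Rightarrow> real ^ 'n \<Rightarrow> 'm" where
  "chart_inv c = inv_into (fst c) (snd c)"

definition chart_img :: "('m, 'n::finite) chart \<Rightarrow> (real ^ 'n) set" where
  "chart_img c = snd c ` fst c"

definition smooth_atlas ::
  "('m::{t2_space, second_countable_topology}, 'n::finite) chart set \<Rightarrow> bool" where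
  "smooth_atlas A \<longleftrightarrow>
     (\<Union>c\<in>A. fst c) = UNIV \<and>
     (\<forall>c\<in>A. open (fst c) \<and> open (chart_img c) \<and>
        homeomorphism (fst c) (chart_img c) (snd c) (chart_inv c)) \<and>
     (\<forall>c\<in>A. \<forall>c'\<in>A. smooth_on (snd c ` (fst c \<inter> fst c')) (snd c' \<circ> chart_inv c))"

definition chart_at :: "('m, 'n::finite) chart set \<Rightarrow> 'm \<Rightarrow> ('m, 'n) chart" where
  "chart_at A p = (SOME c. c \<in> A \<and> p \<in> fst c)"

definition smooth_map ::
  "('m::topological_space, 'n::finite) chart set \<Rightarrow> ('m \<Rightarrow> 'm) \<Rightarrow> bool" where
  "smooth_map A f \<longleftrightarrow> continuous_on UNIV f \<and>
     (\<forall>c\<in>A. \<forall>c'\<in>A. smooth_on (snd c ` (fst c \<inter> f -` fst c')) (snd c' \<circ> f \<circ> chart_inv c))"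

definition diffeo ::
  "('m::topological_space, 'n::finite) chart set \<Rightarrow> ('m \<Rightarrow> 'm) \<Rightarrow> bool" where
  "diffeo A f \<longleftrightarrow> bij f \<and> smooth_map A f \<and> smooth_map A (inv f)"


section \<open>Tensor fields\<close>

text \<open>Components of a covariant tensor on an open set of \<open>real ^ 'n\<close>, as a function of the base
  point and of the list of lower indices.\<close>

type_synonym 'n cov = "real ^ 'n \<Rightarrow> 'n list \<Rightarrow> real"

definition pd :: "'n::finite \<Rightarrow> (real ^ 'n \<Rightarrow> real) \<Rightarrow> real ^ 'n \<Rightarrow> real" where
  "pd i f y = frechet_derivative f (at y) (axis i 1)"

text \<open>The components
  $(F^*T)_{i_1\dots i_k} = \partial_{i_1}F^{j_1}\cdots\partial_{i_k}F^{j_k}\,(T_{j_1\dots j_k}\circ F)$.\<close>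

definition comp_pullback :: "(real ^ 'n \<Rightarrow> real ^ 'n) \<Rightarrow> ('n::finite) cov \<Rightarrow> 'n cov" where
  "comp_pullback F T y is =
     (\<Sum>js | length js = length is.
        (\<Prod>m<length is. pd (is ! m) (\<lambda>z. F z $ (js ! m)) y) * T (F y) js)"

text \<open>A covariant \<open>k\<close>-tensor field on the manifold consists of its components in every chart of the
  atlas (expressed in the coordinates of that chart), subject to the tensor transformation law.
  Values off the image of the chart, or at index lists of a length other than \<open>k\<close>, are irrelevant.\<close>

definition tensor_field ::
  "('m, 'n::finite) chart set \<Rightarrow> nat \<Rightarrow> (('m, 'n) chart \<Rightarrow> 'n cov) \<Rightarrow> bool" where
  "tensor_field A k T \<longleftrightarrow>
     (\<forall>c\<in>A. \<forall>is. length is = k \<longrightarrow> smooth_on (chart_img c) (\<lambda>y. T c y is)) \<and>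
     (\<forall>c\<in>A. \<forall>c'\<in>A. \<forall>y\<in>snd c ` (fst c \<inter> fst c'). \<forall>is. length is = k \<longrightarrow>
        T c y is = comp_pullback (snd c' \<circ> chart_inv c) (T c') y is)"

definition tensor_eq ::
  "('m, 'n::finite) chart set \<Rightarrow> nat \<Rightarrow> (('m, 'n) chart \<Rightarrow> 'n cov) \<Rightarrow> (('m, 'n) chart \<Rightarrow> 'n cov) \<Rightarrow> bool" where
  "tensor_eq A k S T \<longleftrightarrow>
     (\<forall>c\<in>A. \<forall>y\<in>chart_img c. \<forall>is. length is = k \<longrightarrow> S c y is = T c y is)"

definition vector_field ::
  "('m, 'n::finite) chart set \<Rightarrow> (('m, 'n) chart \<Rightarrow> real ^ 'n \<Rightarrow> real ^ 'n) \<Rightarrow> bool" where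
  "vector_field A X \<longleftrightarrow>
     (\<forall>c\<in>A. smooth_on (chart_img c) (X c)) \<and>
     (\<forall>c\<in>A. \<forall>c'\<in>A. \<forall>y\<in>snd c ` (fst c \<inter> fst c').
        X c' ((snd c' \<circ> chart_inv c) y)
          = frechet_derivative (snd c' \<circ> chart_inv c) (at y) (X c y))"

definition riemannian_metric ::
  "('m, 'n::finite) chart set \<Rightarrow> (('m, 'n) chart \<Rightarrow> 'n cov) \<Rightarrow> bool" where
  "riemannian_metric A g \<longleftrightarrow> tensor_field A 2 g \<and>
     (\<forall>c\<in>A. \<forall>y\<in>chart_img c.
        (\<forall>i j. g c y [i, j] = g c y [j, i]) \<and>
        (\<forall>v::real ^ 'n. v \<noteq> 0 \<longrightarrow>
           0 < (\<Sum>i\<in>UNIV. \<Sum>j\<in>UNIV. g c y [i, j] * v $ i * v $ j)))"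

definition differential_form ::
  "('m, 'n::finite) chart set \<Rightarrow> nat \<Rightarrow> (('m, 'n) chart \<Rightarrow> 'n cov) \<Rightarrow> bool" where
  "differential_form A k \<omega> \<longleftrightarrow> tensor_field A k \<omega> \<and>
     (\<forall>c\<in>A. \<forall>y\<in>chart_img c. \<forall>is a b. length is = k \<longrightarrow> a < k \<longrightarrow> b < k \<longrightarrow> a \<noteq> b \<longrightarrow>
        \<omega> c y (is[a := is ! b, b := is ! a]) = - \<omega> c y is)"

text \<open>The pull-back of a tensor field; by the transformation law it does not depend on the chart
  selected around the image point.\<close>

definition pullback ::
  "('m, 'n::finite) chart set \<Rightarrow> ('m \<Rightarrow> 'm) \<Rightarrow> (('m, 'n) chart \<Rightarrow> 'n cov) \<Rightarrow> ('m, 'n) chart \<Rightarrow> 'n cov"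
  where
  "pullback A f T c y is =
     (let c' = chart_at A (f (chart_inv c y))
      in comp_pullback (snd c' \<circ> f \<circ> chart_inv c) (T c') y is)"


section \<open>Local formulas of Riemannian geometry\<close>

definition ginv :: "('n::finite) cov \<Rightarrow> real ^ 'n \<Rightarrow> 'n \<Rightarrow> 'n \<Rightarrow> real" where
  "ginv g y i j = matrix_inv (\<chi> a b. g y [a, b]) $ i $ j"

text \<open>\<open>christoffel g k i j y\<close> is $\Gamma^k_{ij}$ at \<open>y\<close>.\<close>

definition christoffel :: "('n::finite) cov \<Rightarrow> 'n \<Rightarrow> 'n \<Rightarrow> 'n \<Rightarrow> real ^ 'n \<Rightarrow> real" where
  "christoffel g k i j y =
     (1/2) * (\<Sum>l\<in>UNIV. ginv g y k l *
        (pd i (\<lambda>z. g z [j, l]) y + pd j (\<lambda>z. g z [i, l]) y - pd l (\<lambda>z. g z [i, j]) y))"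

text \<open>The \<open>l\<close>-th component of $R(\partial_i,\partial_j)\partial_k$, where
  $R(X,Y)Z = \nabla_X\nabla_Y Z - \nabla_Y\nabla_X Z - \nabla_{[X,Y]}Z$.\<close>

definition riemann :: "('n::finite) cov \<Rightarrow> 'n \<Rightarrow> 'n \<Rightarrow> 'n \<Rightarrow> 'n \<Rightarrow> real ^ 'n \<Rightarrow> real" where
  "riemann g l i j k y =
     pd i (christoffel g l j k) y - pd j (christoffel g l i k) y
     + (\<Sum>m\<in>UNIV. christoffel g l i m y * christoffel g m j k y
                 - christoffel g l j m y * christoffel g m i k y)"

definition ricci :: "('n::finite) cov \<Rightarrow> 'n cov" where
  "ricci g y is = (\<Sum>i\<in>UNIV. riemann g i i (is ! 0) (is ! 1) y)"

definition laplacian :: "('n::finite) cov \<Rightarrow> (real ^ 'n \<Rightarrow> real) \<Rightarrow> real ^ 'n \<Rightarrow> real" where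
  "laplacian g f y =
     (\<Sum>i\<in>UNIV. \<Sum>j\<in>UNIV. ginv g y i j *
        (pd i (pd j f) y - (\<Sum>k\<in>UNIV. christoffel g k i j y * pd k f y)))"

text \<open>\<open>cov_deriv g p T y is\<close> is $(\nabla_{\partial_p}T)_{is}$.\<close>

definition cov_deriv :: "('n::finite) cov \<Rightarrow> 'n \<Rightarrow> 'n cov \<Rightarrow> 'n cov" where
  "cov_deriv g p T y is =
     pd p (\<lambda>z. T z is) y
     - (\<Sum>m<length is. \<Sum>q\<in>UNIV. christoffel g q p (is ! m) y * T y (is[m := q]))"

definition lie_deriv :: "(real ^ 'n \<Rightarrow> real ^ 'n) \<Rightarrow> ('n::finite) cov \<Rightarrow> 'n cov" where
  "lie_deriv X T y is =
     (\<Sum>k\<in>UNIV. X y $ k * pd k (\<lambda>z. T z is) y)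
     + (\<Sum>m<length is. \<Sum>k\<in>UNIV. pd (is ! m) (\<lambda>z. X z $ k) y * T y (is[m := k]))"

text \<open>$(d\omega)_{i_0\dots i_k} = \sum_m (-1)^m\,\partial_{i_m}\omega_{i_0\dots\widehat{i_m}\dots i_k}$.\<close>

definition ext_deriv :: "('n::finite) cov \<Rightarrow> 'n cov" where
  "ext_deriv \<omega> y is =
     (\<Sum>m<length is. (-1) ^ m * pd (is ! m) (\<lambda>z. \<omega> z (take m is @ drop (Suc m) is)) y)"

text \<open>The adjoint $d^*$ of \<open>ext_deriv\<close> with respect to the usual $L^2$ inner product of forms:
  $(d^*\omega)_{i_2\dots i_k} = -g^{pq}\,\nabla_p\omega_{q i_2\dots i_k}$.\<close>

definition codiff :: "('n::finite) cov \<Rightarrow> 'n cov \<Rightarrow> 'n cov" where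
  "codiff g \<omega> y is = - (\<Sum>p\<in>UNIV. \<Sum>q\<in>UNIV. ginv g y p q * cov_deriv g p \<omega> y (q # is))"

definition hodge_laplacian :: "('n::finite) cov \<Rightarrow> 'n cov \<Rightarrow> 'n cov" where
  "hodge_laplacian g \<omega> y is =
     ext_deriv (codiff g \<omega>) y is + codiff g (ext_deriv \<omega>) y is"

definition H_squared :: "('n::finite) cov \<Rightarrow> 'n cov \<Rightarrow> 'n cov" where
  "H_squared g H y is =
     (\<Sum>p\<in>UNIV. \<Sum>q\<in>UNIV. \<Sum>k\<in>UNIV. \<Sum>l\<in>UNIV.
        ginv g y p q * ginv g y k l * H y [is ! 0, p, k] * H y [is ! 1, q, l])"

definition H_norm2 :: "('n::finite) cov \<Rightarrow> 'n cov \<Rightarrow> real ^ 'n \<Rightarrow> real" where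
  "H_norm2 g H y = (\<Sum>i\<in>UNIV. \<Sum>j\<in>UNIV. ginv g y i j * H_squared g H y [i, j])"


section \<open>Generalized solitons\<close>

definition closed_3form ::
  "('m, 'n::finite) chart set \<Rightarrow> (('m, 'n) chart \<Rightarrow> 'n cov) \<Rightarrow> bool" where
  "closed_3form A H \<longleftrightarrow>
     differential_form A 3 H \<and> tensor_eq A 4 (\<lambda>c. ext_deriv (H c)) (\<lambda>c y is. 0)"

definition generalized_soliton ::
  "('m, 'n::finite) chart set \<Rightarrow> (('m, 'n) chart \<Rightarrow> 'n cov) \<Rightarrow> (('m, 'n) chart \<Rightarrow> 'n cov) \<Rightarrow>
   (('m, 'n) chart \<Rightarrow> real ^ 'n \<Rightarrow> real ^ 'n) \<Rightarrow> real \<Rightarrow> bool" where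
  "generalized_soliton A g H X lam \<longleftrightarrow>
     riemannian_metric A g \<and> closed_3form A H \<and> vector_field A X \<and>
     tensor_eq A 2
       (\<lambda>c y is. 2 * ricci (g c) y is - (1/2) * H_squared (g c) (H c) y is)
       (\<lambda>c y is. lam * g c y is - lie_deriv (X c) (g c) y is) \<and>
     tensor_eq A 3
       (\<lambda>c. hodge_laplacian (g c) (H c))
       (\<lambda>c y is. lam * H c y is - lie_deriv (X c) (H c) y is)"

text \<open>\<open>\<phi>\<close> is a smooth family of diffeomorphisms, parametrized by the time interval \<open>I\<close> (which is
  $[0,T)$ below), that is generated by the time-dependent vector field \<open>V\<close> and starts at the identity.
  The derivative is one-sided at the left end point of \<open>I\<close>.\<close>

definition generated_diffeos ::
  "('m::topological_space, 'n::finite) chart set \<Rightarrow> real set \<Rightarrow>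
   (real \<Rightarrow> ('m, 'n) chart \<Rightarrow> real ^ 'n \<Rightarrow> real ^ 'n) \<Rightarrow> (real \<Rightarrow> 'm \<Rightarrow> 'm) \<Rightarrow> bool" where
  "generated_diffeos A I V \<phi> \<longleftrightarrow>
     (\<forall>t\<in>I. diffeo A (\<phi> t)) \<and>
     continuous_on (I \<times> UNIV) (\<lambda>(t, p). \<phi> t p) \<and>
     (\<forall>c\<in>A. \<forall>c'\<in>A.
        smooth_on {(t, y). t \<in> I \<and> y \<in> chart_img c \<and> \<phi> t (chart_inv c y) \<in> fst c'}
          (\<lambda>(t, y). snd c' (\<phi> t (chart_inv c y)))) \<and>
     \<phi> 0 = id \<and>
     (\<forall>t\<in>I. \<forall>p. \<forall>c\<in>A. \<phi> t p \<in> fst c \<longrightarrow>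
        ((\<lambda>s. snd c (\<phi> s p)) has_vector_derivative V t c (snd c (\<phi> t p))) (at t within I))"

text \<open>The conditions on a torsion-bounding function for a family $(G_t, K_t)$ of metrics and
  3-forms, $t \in I$. The time derivative is one-sided at the left end point of \<open>I\<close>.\<close>

definition torsion_bounding_function ::
  "('m, 'n::finite) chart set \<Rightarrow> real set \<Rightarrow> (real \<Rightarrow> ('m, 'n) chart \<Rightarrow> 'n cov) \<Rightarrow>
   (real \<Rightarrow> ('m, 'n) chart \<Rightarrow> 'n cov) \<Rightarrow> (real \<Rightarrow> 'm \<Rightarrow> real) \<Rightarrow> bool" where
  "torsion_bounding_function A I G K \<psi> \<longleftrightarrow>
     (\<forall>c\<in>A. smooth_on (I \<times> chart_img c) (\<lambda>(t, y). \<psi> t (chart_inv c y))) \<and>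
     (\<forall>t\<in>I. \<forall>p. 0 \<le> \<psi> t p) \<and>
     (\<forall>t\<in>I. \<forall>c\<in>A. \<forall>y\<in>chart_img c.
        vector_derivative (\<lambda>s. \<psi> s (chart_inv c y)) (at t within I)
          - laplacian (G t c) (\<lambda>z. \<psi> t (chart_inv c z)) y
        \<le> - H_norm2 (G t c) (K t c) y)"

text \<open>For a soliton with constant $\lambda =$ \<open>lam\<close> $> 0$ on a compact manifold, the
  family \<open>\<phi>\<close> exists and is unique, and $((1-\lambda t)\phi_t^*g, (1-\lambda t)\phi_t^*H)$ is the
  induced generalized Ricci flow.\<close>

definition admits_torsion_bounding_function ::
  "('m::topological_space, 'n::finite) chart set \<Rightarrow> (('m, 'n) chart \<Rightarrow> 'n cov) \<Rightarrow>
   (('m, 'n) chart \<Rightarrow> 'n cov) \<Rightarrow> (('m, 'n) chart \<Rightarrow> real ^ 'n \<Rightarrow> real ^ 'n) \<Rightarrow> real \<Rightarrow> bool" where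
  "admits_torsion_bounding_function A g H X lam \<longleftrightarrow>
     (\<exists>\<phi> \<psi>. generated_diffeos A {0..<1/lam} (\<lambda>t c y. (1 / (1 - lam * t)) *\<^sub>R X c y) \<phi> \<and>
        torsion_bounding_function A {0..<1/lam}
          (\<lambda>t c y is. (1 - lam * t) * pullback A (\<phi> t) g c y is)
          (\<lambda>t c y is. (1 - lam * t) * pullback A (\<phi> t) H c y is) \<psi>)"

end

theory Submission
  imports Defs
begin

text \<open>If \<open>H = 0\<close>, the flow of \<open>X\<close> provides the diffeomorphisms and \<open>\<psi> = 0\<close> is torsion-bounding.

  Conversely, let \<open>\<psi>\<close> be torsion-bounding. Since $g_t$ and $H_t$ are rescaled pull-backs, \<open>\<psi>\<close> transported by
  \<open>\<phi> t\<close> and expressed in the time \<open>s = - ln (1 - lam t) / lam\<close> satisfies $\partial_s f \le \Delta f - X f - |H|^2$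
  for the fixed metric $g$, and \<open>s\<close> ranges over $[0,\infty)$. As \<open>f\<close> is bounded, its upper half-relaxed limit as
  $s \to \infty$ is a bounded viscosity subsolution of $\Delta f - X f \ge |H|^2$. By Hopf's strong maximum
  principle it is constant on every component, hence \<open>H = 0\<close>.\<close>

section \<open>Calculus of $C^k$ functions\<close>

text \<open>The transported function is never formed: a test function \<Phi> given in a chart is
  pulled back by \<open>\<phi> t\<close> and compared with \<open>\<psi>\<close>, so that only
  derivatives of smooth coordinate expressions occur. Scaling metric and form by
  \<open>1 - lam * t\<close> divides both the Laplacian and the squared norm of the form by that
  number; the derivative of the rescaled time and the generating vector field carry the same factor,
  which therefore cancels and leaves an autonomous equation. The singular time becomes infinite
  rescaled time, and a bounded function cannot absorb a persistent source for that long. Two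
  obstacles shape the argument. As \<open>X\<close> need not be a gradient, \<Delta> - X has no
  explicit invariant density, so integration is replaced by the maximum principle. And no derivative
  of \<open>\<psi>\<close> is controlled near the singular time, so a limit can only be expected to
  be semicontinuous; it is handled through the predicate \<open>low\<close> and through contact with
  smooth test functions. Since the manifold may be disconnected, the maximum is taken over the
  component of one point at a time.\<close>

lemma Ck_on_cong:
  assumes "open U" "\<And>x. x \<in> U \<Longrightarrow> f x = g x"
  shows "Ck_on k f U \<longleftrightarrow> Ck_on k g U"
  using assms(2)
proof (induction k arbitrary: f g)
  case 0
  then show ?case by (simp cong: continuous_on_cong)
next
  case (Suc k)
  have d: "f differentiable (at x) \<longleftrightarrow> g differentiable (at x)" if "x \<in> U" for x
    using Suc.prems that assms(1) unfolding differentiable_def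
    by (metis has_derivative_transform_within_open)
  have fd: "frechet_derivative f (at x) = frechet_derivative g (at x)" if "x \<in> U" for x
  proof (cases "f differentiable (at x)")
    case True
    then show ?thesis
      using frechet_derivative_transform_within_open[OF True assms(1) that] Suc.prems by metis
  next
    \<comment> \<open>Without a derivative, \<open>frechet_derivative\<close> is a choice over the
      empty predicate; both sides are then the same arbitrary value.\<close>
    case False
    with d[OF that] have "\<And>D. \<not> (f has_derivative D) (at x)" "\<And>D. \<not> (g has_derivative D) (at x)"
      by (auto simp: differentiable_def)
    then show ?thesis by (simp add: frechet_derivative_def)
  qed
  have "Ck_on k (\<lambda>x. frechet_derivative f (at x) v) U \<longleftrightarrow> Ck_on k (\<lambda>x. frechet_derivative g (at x) v) U" for v
    by (rule Suc.IH) (simp add: fd)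
  then show ?case using d by simp
qed

lemma Ck_on_subset: "Ck_on k f U \<Longrightarrow> V \<subseteq> U \<Longrightarrow> Ck_on k f V"
  by (induction k arbitrary: f) (auto intro: continuous_on_subset)

lemma Ck_on_Suc_imp: "Ck_on (Suc k) f U \<Longrightarrow> Ck_on k f U"
proof (induction k arbitrary: f)
  case 0
  then show ?case
    by (auto intro!: continuous_at_imp_continuous_on differentiable_imp_continuous_within)
qed auto

lemma Ck_on_le: "Ck_on k f U \<Longrightarrow> j \<le> k \<Longrightarrow> Ck_on j f U"
proof (induction k)
  case (Suc k)
  then show ?case using Ck_on_Suc_imp le_Suc_eq by metis
qed simp

lemma Ck_on_imp_continuous_on: "Ck_on k f U \<Longrightarrow> continuous_on U f"
  using Ck_on_le[of k f U 0] by simp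

lemma Ck_on_local:
  assumes "\<And>x. x \<in> U \<Longrightarrow> \<exists>V. open V \<and> x \<in> V \<and> Ck_on k f V"
  shows "Ck_on k f U"
  using assms
proof (induction k arbitrary: f)
  case 0
  show ?case unfolding Ck_on.simps
  proof (rule continuous_at_imp_continuous_on, rule ballI)
    fix x assume "x \<in> U"
    then obtain V where "open V" "x \<in> V" "Ck_on 0 f V" using 0 by blast
    then show "isCont f x" by (simp add: continuous_on_eq_continuous_at)
  qed
next
  case (Suc k)
  have "f differentiable (at x)" if "x \<in> U" for x
    using Suc.prems[OF that] by auto
  moreover have "Ck_on k (\<lambda>x. frechet_derivative f (at x) v) U" for v
    by (rule Suc.IH) (use Suc.prems in fastforce)
  ultimately show ?case by simp
qed

text \<open>On an open set a local extension can be cut down to the set, where it is the function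
  itself. This passes from the smoothness used for atlases and tensors to the calculus of
  \<open>Ck_on\<close>.\<close>

lemma smooth_on_open:
  assumes "open S"
  shows "smooth_on S f \<longleftrightarrow> (\<forall>k. Ck_on k f S)"
proof
  assume sm: "smooth_on S f"
  show "\<forall>k. Ck_on k f S"
  proof (intro allI Ck_on_local)
    fix k x assume "x \<in> S"
    then obtain U F where *: "open U" "x \<in> U" "\<forall>k. Ck_on k F U" "\<forall>z\<in>S \<inter> U. F z = f z"
      using sm unfolding smooth_on_def by blast
    have "Ck_on k F (S \<inter> U)" using * Ck_on_subset by blast
    then have "Ck_on k f (S \<inter> U)"
      using Ck_on_cong[of "S \<inter> U" F f k] * assms by auto
    then show "\<exists>V. open V \<and> x \<in> V \<and> Ck_on k f V"
      using * assms \<open>x \<in> S\<close> by blast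
  qed
next
  assume "\<forall>k. Ck_on k f S"
  then show "smooth_on S f" unfolding smooth_on_def using assms by blast
qed

text \<open>Lets each closure property exhibit its own derivative \<open>D\<close> instead of
  computing \<open>frechet_derivative\<close> of a compound expression.\<close>

lemma Ck_on_SucI:
  assumes "open U" "\<And>x. x \<in> U \<Longrightarrow> (f has_derivative D x) (at x)"
    and "\<And>v. Ck_on k (\<lambda>x. D x v) U"
  shows "Ck_on (Suc k) f U"
proof -
  have "frechet_derivative f (at x) = D x" if "x \<in> U" for x
    using assms(2)[OF that] frechet_derivative_at by metis
  then have "Ck_on k (\<lambda>x. frechet_derivative f (at x) v) U" for v
    using Ck_on_cong[OF assms(1), of "\<lambda>x. frechet_derivative f (at x) v" "\<lambda>x. D x v"] assms(3) by simp
  then show ?thesis using assms(2) by (auto simp: differentiable_def)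
qed

lemma Ck_on_Suc_has_derivative:
  "Ck_on (Suc k) f U \<Longrightarrow> x \<in> U \<Longrightarrow> (f has_derivative frechet_derivative f (at x)) (at x)"
  by (simp add: frechet_derivative_works)

lemma Ck_on_const [simp]: "Ck_on k (\<lambda>x. c) U"
  by (induction k arbitrary: c) auto

lemma Ck_on_linear:
  assumes "bounded_linear l"
  shows "Ck_on k l U"
proof (cases k)
  case 0
  then show ?thesis using assms by (simp add: linear_continuous_on)
next
  case (Suc j)
  have "frechet_derivative l (at x) = l" for x
    using bounded_linear_imp_has_derivative[OF assms] frechet_derivative_at by metis
  then show ?thesis using Suc bounded_linear_imp_differentiable[OF assms] by auto
qed

lemma Ck_on_linear_comp:
  assumes "bounded_linear l" "open U" "Ck_on k f U"
  shows "Ck_on k (\<lambda>x. l (f x)) U"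
  using assms(3)
proof (induction k arbitrary: f)
  case 0
  then show ?case using assms(1) by (simp add: bounded_linear.continuous_on)
next
  case (Suc k)
  show ?case
  proof (rule Ck_on_SucI[OF assms(2)])
    show "((\<lambda>x. l (f x)) has_derivative (\<lambda>v. l (frechet_derivative f (at x) v))) (at x)" if "x \<in> U" for x
      using bounded_linear.has_derivative[OF assms(1)] Ck_on_Suc_has_derivative[OF Suc.prems that] by blast
  qed (use Suc in auto)
qed

lemma Ck_on_add:
  assumes "open U" "Ck_on k f U" "Ck_on k g U"
  shows "Ck_on k (\<lambda>x. f x + g x) U"
  using assms(2-)
proof (induction k arbitrary: f g)
  case 0
  then show ?case by (simp add: continuous_on_add)
next
  case (Suc k)
  show ?case
  proof (rule Ck_on_SucI[OF assms(1)])
    show "((\<lambda>x. f x + g x) has_derivative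
        (\<lambda>v. frechet_derivative f (at x) v + frechet_derivative g (at x) v)) (at x)" if "x \<in> U" for x
      using has_derivative_add Suc.prems Ck_on_Suc_has_derivative that by blast
  qed (use Suc in auto)
qed

lemma Ck_on_sum:
  assumes "open U" "\<And>i. i \<in> I \<Longrightarrow> Ck_on k (f i) U"
  shows "Ck_on k (\<lambda>x. \<Sum>i\<in>I. f i x) U"
  using assms(2)
  by (induction I rule: infinite_finite_induct) (auto intro!: Ck_on_add[OF assms(1)])

text \<open>The product rule expresses the derivative by the same bilinear map, with one factor
  differentiated and the other lowered by one order, so a single induction covers scalar multiples,
  real products and inner products.\<close>

lemma Ck_on_bilinear:
  assumes "bounded_bilinear B" "open U" "Ck_on k f U" "Ck_on k g U"
  shows "Ck_on k (\<lambda>x. B (f x) (g x)) U"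
  using assms(3-)
proof (induction k arbitrary: f g)
  case 0
  then show ?case using bounded_bilinear.continuous_on[OF assms(1)] by simp
next
  case (Suc k)
  show ?case
  proof (rule Ck_on_SucI[OF assms(2)])
    show "((\<lambda>x. B (f x) (g x)) has_derivative
        (\<lambda>v. B (f x) (frechet_derivative g (at x) v) + B (frechet_derivative f (at x) v) (g x))) (at x)"
      if "x \<in> U" for x
      by (intro bounded_bilinear.FDERIV[OF assms(1)]) (use Suc.prems Ck_on_Suc_has_derivative that in blast)+
    show "Ck_on k (\<lambda>x. B (f x) (frechet_derivative g (at x) v) + B (frechet_derivative f (at x) v) (g x)) U" for v
    proof (rule Ck_on_add[OF assms(2)])
      show "Ck_on k (\<lambda>x. B (f x) (frechet_derivative g (at x) v)) U"
        "Ck_on k (\<lambda>x. B (frechet_derivative f (at x) v) (g x)) U"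
        using Suc.IH[OF Ck_on_Suc_imp[OF Suc.prems(1)]] Suc.IH[OF _ Ck_on_Suc_imp[OF Suc.prems(2)]] Suc.prems
        by auto
    qed
  qed
qed

lemmas Ck_on_scaleR = Ck_on_bilinear[OF bounded_bilinear_scaleR]
lemmas Ck_on_mult = Ck_on_bilinear[OF bounded_bilinear_mult]
lemmas Ck_on_inner = Ck_on_bilinear[OF bounded_bilinear_inner]

lemma Ck_on_minus:
  assumes "open U" "Ck_on k f U"
  shows "Ck_on k (\<lambda>x. - f x) U"
  using Ck_on_linear_comp[OF bounded_linear_minus[OF bounded_linear_ident] assms] by simp

lemma Ck_on_diff:
  assumes "open U" "Ck_on k f U" "Ck_on k g U"
  shows "Ck_on k (\<lambda>x. f x - g x) U"
  using Ck_on_add[OF assms(1,2) Ck_on_minus[OF assms(1,3)]] by simp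

lemma Ck_on_Pair:
  assumes "open U" "Ck_on k f U" "Ck_on k g U"
  shows "Ck_on k (\<lambda>x. (f x, g x)) U"
proof -
  have "Ck_on k (\<lambda>x. (f x, 0) + (0, g x)) U"
    by (intro Ck_on_add assms Ck_on_linear_comp[OF _ assms(1,2)] Ck_on_linear_comp[OF _ assms(1,3)])
      (auto intro!: bounded_linear_Pair bounded_linear_zero bounded_linear_ident)
  then show ?thesis by simp
qed

lemma linear_sum_Basis:
  fixes l :: "'a::euclidean_space \<Rightarrow> 'b::real_normed_vector"
  assumes "linear l"
  shows "l w = (\<Sum>b\<in>Basis. (w \<bullet> b) *\<^sub>R l b)"
proof -
  have "l w = l (\<Sum>b\<in>Basis. (w \<bullet> b) *\<^sub>R b)" by (simp add: euclidean_representation)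
  also have "\<dots> = (\<Sum>b\<in>Basis. (w \<bullet> b) *\<^sub>R l b)"
    using assms by (simp add: linear_sum linear_cmul)
  finally show ?thesis .
qed

text \<open>In the chain rule the direction fed to the derivative of \<open>f\<close> varies with
  \<open>x\<close>, whereas \<open>Ck_on\<close> speaks of fixed directions. Expanding the direction
  in the basis of the finite-dimensional middle space removes the discrepancy.\<close>

lemma Ck_on_compose:
  fixes g :: "'a::real_normed_vector \<Rightarrow> 'b::euclidean_space"
  assumes "open U" "open V" "Ck_on k f V" "Ck_on k g U" "g ` U \<subseteq> V"
  shows "Ck_on k (\<lambda>x. f (g x)) U"
  using assms(3-4)
proof (induction k arbitrary: f)
  case 0
  then show ?case using assms(5) by (auto intro: continuous_on_compose2)
next
  case (Suc k)
  let ?D = "\<lambda>x v. frechet_derivative f (at (g x)) (frechet_derivative g (at x) v)"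
  have hf: "(f has_derivative frechet_derivative f (at (g x))) (at (g x))" if "x \<in> U" for x
    using Ck_on_Suc_has_derivative[OF Suc.prems(1)] that assms(5) by blast
  show ?case
  proof (rule Ck_on_SucI[OF assms(1)])
    show "((\<lambda>x. f (g x)) has_derivative ?D x) (at x)" if "x \<in> U" for x
      using has_derivative_compose[OF Ck_on_Suc_has_derivative[OF Suc.prems(2) that] hf[OF that]] .
    fix v
    have "Ck_on k (\<lambda>x. \<Sum>b\<in>Basis. (frechet_derivative g (at x) v \<bullet> b) *\<^sub>R frechet_derivative f (at (g x)) b) U"
    proof (intro Ck_on_sum Ck_on_scaleR Ck_on_inner assms(1))
      show "Ck_on k (\<lambda>x. frechet_derivative f (at (g x)) b) U" for b
        by (rule Suc.IH) (use Suc.prems Ck_on_Suc_imp in auto)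
    qed (use Suc.prems in auto)
    moreover have "?D x v = (\<Sum>b\<in>Basis. (frechet_derivative g (at x) v \<bullet> b) *\<^sub>R frechet_derivative f (at (g x)) b)"
      if "x \<in> U" for x
      using linear_sum_Basis has_derivative_linear[OF hf[OF that]] by blast
    ultimately show "Ck_on k (\<lambda>x. ?D x v) U"
      using Ck_on_cong[OF assms(1), of "\<lambda>x. ?D x v"] by simp
  qed
qed

lemma Ck_on_inverse: "Ck_on k (inverse :: real \<Rightarrow> real) {x. x \<noteq> 0}"
proof (induction k)
  case 0
  then show ?case by (auto intro!: continuous_intros)
next
  case (Suc k)
  have op: "open {x::real. x \<noteq> 0}" by (simp add: open_Collect_neq)
  show ?case
  proof (rule Ck_on_SucI[OF op])
    show "((inverse :: real \<Rightarrow> real) has_derivative (\<lambda>v. - (inverse x * v * inverse x))) (at x)" if "x \<in> {x. x \<noteq> 0}" for x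
      using that has_derivative_inverse'[of x UNIV] by simp
    show "Ck_on k (\<lambda>x. - (inverse x * v * inverse x)) {x::real. x \<noteq> 0}" for v
      by (intro Ck_on_minus Ck_on_mult op Suc) auto
  qed
qed

lemma Ck_on_ln: "Ck_on k (ln :: real \<Rightarrow> real) {0<..}"
proof (cases k)
  case 0
  then show ?thesis by (auto intro!: continuous_intros)
next
  case (Suc j)
  show ?thesis unfolding Suc
  proof (rule Ck_on_SucI)
    show "((ln :: real \<Rightarrow> real) has_derivative (\<lambda>v. v * inverse x)) (at x)" if "x \<in> {0<..}" for x
      using that by (auto intro!: derivative_eq_intros)
    show "Ck_on j (\<lambda>x. v * inverse x) {0::real<..}" for v
      by (intro Ck_on_mult Ck_on_const Ck_on_subset[OF Ck_on_inverse]) auto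
  qed auto
qed

lemma Ck_on_exp: "Ck_on k (exp :: real \<Rightarrow> real) UNIV"
proof (induction k)
  case 0
  then show ?case by (auto intro!: continuous_intros)
next
  case (Suc k)
  show ?case
  proof (rule Ck_on_SucI)
    show "((exp :: real \<Rightarrow> real) has_derivative (\<lambda>v. v * exp x)) (at x)" for x
      by (auto intro!: derivative_eq_intros)
    show "Ck_on k (\<lambda>x. v * exp x) (UNIV :: real set)" for v
      by (intro Ck_on_mult Ck_on_const Suc) auto
  qed auto
qed

text \<open>The increment is estimated by changing one coordinate at a time.\<close>

lemma continuous_partials_imp_has_derivative:
  fixes f :: "'a::euclidean_space \<Rightarrow> 'b::real_normed_vector"
  assumes "open U" "x0 \<in> U"
    and der: "\<And>b x. b \<in> Basis \<Longrightarrow> x \<in> U \<Longrightarrow> ((\<lambda>h. f (x + h *\<^sub>R b)) has_vector_derivative D b x) (at 0)"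
    and cont: "\<And>b. b \<in> Basis \<Longrightarrow> continuous_on U (D b)"
  shows "(f has_derivative (\<lambda>v. \<Sum>b\<in>Basis. (v \<bullet> b) *\<^sub>R D b x0)) (at x0)"
proof -
  have line: "((\<lambda>h. f (x + h *\<^sub>R b)) has_vector_derivative D b (x + t *\<^sub>R b)) (at t)"
    if "b \<in> Basis" "x + t *\<^sub>R b \<in> U" for b x t
  proof -
    have "((\<lambda>h. f (x + t *\<^sub>R b + h *\<^sub>R b)) has_vector_derivative D b (x + t *\<^sub>R b)) (at (t - t))"
      using der[OF that] by simp
    moreover have "((\<lambda>s. s - t) has_vector_derivative 1) (at t)"
      by (auto intro!: derivative_eq_intros)
    ultimately have "((\<lambda>s. f (x + t *\<^sub>R b + (s - t) *\<^sub>R b)) has_vector_derivative 1 *\<^sub>R D b (x + t *\<^sub>R b)) (at t)"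
      using vector_diff_chain_at[of "\<lambda>s. s - t" 1 t "\<lambda>h. f (x + t *\<^sub>R b + h *\<^sub>R b)"]
      by (fastforce simp: o_def)
    then show ?thesis by (simp add: algebra_simps)
  qed
  \<comment> \<open>Induction over the set of directions already moved along. The error is measured
    in the l1 norm of the coefficients, which adds up direction by direction.\<close>
  have main: "\<exists>\<delta>>0. \<forall>x c. dist x x0 < \<delta> \<longrightarrow> (\<Sum>b\<in>B. \<bar>c b\<bar>) < \<delta> \<longrightarrow>
        norm (f (x + (\<Sum>b\<in>B. c b *\<^sub>R b)) - f x - (\<Sum>b\<in>B. c b *\<^sub>R D b x0)) \<le> e * (\<Sum>b\<in>B. \<bar>c b\<bar>)"
    if "e > 0" "B \<subseteq> Basis" for e B
  proof -
    have "finite B" using that(2) finite_Basis finite_subset by blast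
    then show ?thesis using that(2)
    proof (induction B)
      case empty
      then show ?case by (auto intro!: exI[of _ 1])
    next
      case (insert a B)
      then obtain d1 where d1: "d1 > 0" "\<And>x c. dist x x0 < d1 \<Longrightarrow> (\<Sum>b\<in>B. \<bar>c b\<bar>) < d1 \<Longrightarrow>
        norm (f (x + (\<Sum>b\<in>B. c b *\<^sub>R b)) - f x - (\<Sum>b\<in>B. c b *\<^sub>R D b x0)) \<le> e * (\<Sum>b\<in>B. \<bar>c b\<bar>)"
        by blast
      have aB: "a \<in> Basis" using insert by auto
      then have "isCont (D a) x0"
        using cont assms(1,2) continuous_on_eq_continuous_at by blast
      then obtain d2 where d2: "d2 > 0" "\<And>x. dist x x0 < d2 \<Longrightarrow> dist (D a x) (D a x0) < e"
        unfolding continuous_at_eps_delta using \<open>e > 0\<close> by blast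
      obtain d3 where d3: "d3 > 0" "ball x0 d3 \<subseteq> U" using assms(1,2) open_contains_ball by blast
      \<comment> \<open>Halved because the start point may be off by \<open>d\<close> and the
        increment may add another \<open>d\<close>; every intermediate point stays within
        \<open>2 * d\<close>.\<close>
      define d where "d = min d1 (min d2 d3) / 2"
      have d: "d > 0" "2 * d \<le> d1" "2 * d \<le> d2" "2 * d \<le> d3"
        using d1 d2 d3 by (auto simp: d_def)
      show ?case
      proof (intro exI[of _ d] conjI allI impI d(1))
        fix x c
        assume x: "dist x x0 < d" and c: "(\<Sum>b\<in>insert a B. \<bar>c b\<bar>) < d"
        define y where "y = x + (\<Sum>b\<in>B. c b *\<^sub>R b)"
        have c': "\<bar>c a\<bar> + (\<Sum>b\<in>B. \<bar>c b\<bar>) < d" using c insert by simp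
        have sB: "0 \<le> (\<Sum>b\<in>B. \<bar>c b\<bar>)" by (simp add: sum_nonneg)
        have e1: "norm (f y - f x - (\<Sum>b\<in>B. c b *\<^sub>R D b x0)) \<le> e * (\<Sum>b\<in>B. \<bar>c b\<bar>)"
          unfolding y_def using d1(2)[of x c] x c' d by linarith
        have ny: "norm (\<Sum>b\<in>B. c b *\<^sub>R b) \<le> (\<Sum>b\<in>B. \<bar>c b\<bar>)"
          using insert by (intro sum_norm_le) auto
        have near: "dist (y + t *\<^sub>R a) x0 < 2 * d" if "\<bar>t\<bar> \<le> \<bar>c a\<bar>" for t
        proof -
          have "dist (y + t *\<^sub>R a) x0 = norm ((x - x0) + (\<Sum>b\<in>B. c b *\<^sub>R b) + t *\<^sub>R a)"
            by (simp add: dist_norm y_def algebra_simps)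
          also have "\<dots> \<le> norm (x - x0) + norm (\<Sum>b\<in>B. c b *\<^sub>R b) + \<bar>t\<bar>"
            using norm_triangle_ineq[of "x - x0 + (\<Sum>b\<in>B. c b *\<^sub>R b)" "t *\<^sub>R a"]
              norm_triangle_ineq[of "x - x0" "(\<Sum>b\<in>B. c b *\<^sub>R b)"] aB by simp
          also have "\<dots> < 2 * d" using x ny that c' by (simp add: dist_norm)
          finally show ?thesis .
        qed
        have e2: "norm (f (y + c a *\<^sub>R a) - f y - c a *\<^sub>R D a x0) \<le> e * \<bar>c a\<bar>"
        proof -
          let ?S = "{t. \<bar>t\<bar> \<le> \<bar>c a\<bar>}"
          let ?f = "\<lambda>t. f (y + t *\<^sub>R a) - t *\<^sub>R D a x0"
          have "?S = {- \<bar>c a\<bar>..\<bar>c a\<bar>}" by auto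
          then have cv: "convex ?S" by simp
          have dv: "(?f has_derivative (\<lambda>h. h *\<^sub>R (D a (y + t *\<^sub>R a) - D a x0))) (at t within ?S)" if "t \<in> ?S" for t
          proof -
            have "y + t *\<^sub>R a \<in> U" using near[of t] that d d3(2) by (auto simp: dist_commute)
            from line[OF aB this]
            have "(?f has_vector_derivative (D a (y + t *\<^sub>R a) - D a x0)) (at t)"
              by (auto intro!: derivative_eq_intros)
            then show ?thesis
              unfolding has_vector_derivative_def by (rule has_derivative_at_withinI)
          qed
          have bd: "onorm (\<lambda>h::real. h *\<^sub>R (D a (y + t *\<^sub>R a) - D a x0)) \<le> e" if "t \<in> ?S" for t
          proof (rule onorm_le)
            fix h :: real
            have "norm (D a (y + t *\<^sub>R a) - D a x0) \<le> e"
              using d2(2)[of "y + t *\<^sub>R a"] near[of t] that d by (auto simp: dist_norm)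
            from mult_left_mono[OF this, of "\<bar>h\<bar>"]
            show "norm (h *\<^sub>R (D a (y + t *\<^sub>R a) - D a x0)) \<le> e * norm h"
              by (simp add: mult.commute)
          qed
          have "norm (?f (c a) - ?f 0) \<le> e * norm (c a - 0)"
            by (rule differentiable_bound[OF cv dv bd]) auto
          then show ?thesis by (simp add: algebra_simps)
        qed
        have "norm (f (y + c a *\<^sub>R a) - f x - (c a *\<^sub>R D a x0 + (\<Sum>b\<in>B. c b *\<^sub>R D b x0)))
          \<le> e * \<bar>c a\<bar> + e * (\<Sum>b\<in>B. \<bar>c b\<bar>)"
          using norm_triangle_mono[OF e2 e1] by (simp add: algebra_simps)
        then show "norm (f (x + (\<Sum>b\<in>insert a B. c b *\<^sub>R b)) - f x - (\<Sum>b\<in>insert a B. c b *\<^sub>R D b x0))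
          \<le> e * (\<Sum>b\<in>insert a B. \<bar>c b\<bar>)"
          using insert by (simp add: y_def algebra_simps)
      qed
    qed
  qed
  show ?thesis
    unfolding has_derivative_at_alt
  proof (intro conjI allI impI)
    show "bounded_linear (\<lambda>v. \<Sum>b\<in>Basis. (v \<bullet> b) *\<^sub>R D b x0)"
      by (intro bounded_linear_sum bounded_linear_compose[OF bounded_linear_scaleR_left] bounded_linear_inner_left)
    fix e :: real assume "e > 0"
    \<comment> \<open>Compares norms: the l1 norm of a vector is at most \<open>n\<close> times its
      Euclidean norm, hence the tolerance \<open>e / n\<close> below.\<close>
    define n where "n = real DIM('a)"
    have n: "n > 0" by (simp add: n_def)
    obtain d where d: "d > 0" "\<And>x c. dist x x0 < d \<Longrightarrow> (\<Sum>b\<in>Basis. \<bar>c b\<bar>) < d \<Longrightarrow>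
        norm (f (x + (\<Sum>b\<in>Basis. c b *\<^sub>R b)) - f x - (\<Sum>b\<in>Basis. c b *\<^sub>R D b x0)) \<le> e / n * (\<Sum>b\<in>Basis. \<bar>c b\<bar>)"
      using main[of "e / n" Basis] \<open>e > 0\<close> n by auto
    have l1: "(\<Sum>b\<in>Basis. \<bar>v \<bullet> b\<bar>) \<le> n * norm v" for v :: 'a
      unfolding n_def by (rule sum_bounded_above) (auto simp: Basis_le_norm)
    show "\<exists>d>0. \<forall>y. norm (y - x0) < d \<longrightarrow>
       norm (f y - f x0 - (\<Sum>b\<in>Basis. ((y - x0) \<bullet> b) *\<^sub>R D b x0)) \<le> e * norm (y - x0)"
    proof (intro exI[of _ "d / n"] conjI allI impI)
      fix y assume y: "norm (y - x0) < d / n"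
      let ?c = "\<lambda>b. (y - x0) \<bullet> b"
      have "(\<Sum>b\<in>Basis. \<bar>?c b\<bar>) < d"
        using l1[of "y - x0"] y n by (simp add: pos_less_divide_eq mult.commute)
      then have "norm (f (x0 + (\<Sum>b\<in>Basis. ?c b *\<^sub>R b)) - f x0 - (\<Sum>b\<in>Basis. ?c b *\<^sub>R D b x0))
         \<le> e / n * (\<Sum>b\<in>Basis. \<bar>?c b\<bar>)"
        using d by auto
      also have "\<dots> \<le> e / n * (n * norm (y - x0))"
        using l1[of "y - x0"] \<open>e > 0\<close> n by (intro mult_left_mono) auto
      finally show "norm (f y - f x0 - (\<Sum>b\<in>Basis. ?c b *\<^sub>R D b x0)) \<le> e * norm (y - x0)"
        using n by (simp add: euclidean_representation)
    qed (use d n in auto)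
  qed
qed

section \<open>Smooth dependence of solutions of ordinary differential equations\<close>

text \<open>The contraction acts on bounded continuous functions of time and parameter together, so
  joint continuity comes with the fixed point and needs no separate argument.\<close>

lemma picard_parametric:
  fixes G :: "real \<Rightarrow> 'p::metric_space \<Rightarrow> 'f::euclidean_space \<Rightarrow> 'f"
  assumes a: "0 < a" and L: "0 \<le> L" "3 * a * L < 1"
    and cont: "continuous_on UNIV (\<lambda>(s, p, z). G s p z)"
    and lip: "\<And>s p z z'. norm (G s p z - G s p z') \<le> L * norm (z - z')"
    and bd: "\<And>s p. norm (G s p 0) \<le> B"
  shows "\<exists>u. continuous_on UNIV (\<lambda>(s, p). u s p) \<and> (\<forall>p. u 0 p = 0) \<and>
    (\<forall>p. \<forall>s\<in>{-a<..<a}. ((\<lambda>s. u s p) has_vector_derivative G s p (u s p)) (at s))"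
proof -
  \<comment> \<open>Clamping the time lets the integral operator act on functions on the whole line
    while only times in [-a, a] matter.\<close>
  define c where "c s = max (-a) (min s a)" for s :: real
  have c: "c s \<in> {-a..a}" for s using a by (auto simp: c_def)
  have cc: "continuous_on UNIV c" unfolding c_def by (intro continuous_intros)
  define g where "g u r p = G r p (apply_bcontfun u (r, p))" for u :: "(real \<times> 'p) \<Rightarrow>\<^sub>C 'f" and r p
  define I where "I u s p = integral {-a..s} (\<lambda>r. g u r p)" for u s p
  have cu: "continuous_on UNIV (\<lambda>x. apply_bcontfun u x)" for u :: "(real \<times> 'p) \<Rightarrow>\<^sub>C 'f" by simp
  have cg: "continuous_on UNIV (\<lambda>(r, p). g u r p)" for u
  proof -
    have "continuous_on UNIV (\<lambda>x. (\<lambda>(s, p, z). G s p z) (fst x, snd x, apply_bcontfun u x))"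
      by (rule continuous_on_compose2[OF cont]) (auto intro!: continuous_intros)
    then show ?thesis by (simp add: g_def case_prod_beta')
  qed
  have cg1: "continuous_on S (\<lambda>r. g u r p)" for u p S
    using continuous_on_compose2[OF cg[of u] continuous_on_Pair[OF continuous_on_id continuous_on_const[of S p]]]
    by simp
  define M where "M u = B + L * norm u" for u :: "(real \<times> 'p) \<Rightarrow>\<^sub>C 'f"
  have gM: "norm (g u r p) \<le> M u" for u r p
  proof -
    have "norm (g u r p) \<le> norm (G r p 0) + norm (g u r p - G r p 0)"
      by (metis add.commute diff_add_cancel norm_triangle_ineq)
    also have "norm (g u r p - G r p 0) \<le> L * norm (apply_bcontfun u (r, p) - 0)"
      unfolding g_def by (rule lip)
    also have "\<dots> \<le> L * norm u" using L norm_bounded[of u] by (auto intro: mult_left_mono)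
    finally show ?thesis using bd[of r p] by (simp add: M_def)
  qed
  have M0: "0 \<le> M u" for u using gM norm_ge_zero order_trans by metis
  have Ilip1: "norm (I u s' p - I u s p) \<le> M u * (s' - s)" if "-a \<le> s" "s \<le> s'" for u s s' p
  proof -
    have "I u s p + integral {s..s'} (\<lambda>r. g u r p) = I u s' p"
      unfolding I_def by (rule Henstock_Kurzweil_Integration.integral_combine)
        (use that in \<open>auto intro: integrable_continuous_real cg1\<close>)
    then have "I u s' p - I u s p = integral {s..s'} (\<lambda>r. g u r p)" by (simp add: algebra_simps)
    also have "norm \<dots> \<le> M u * (s' - s)"
      by (rule integral_bound) (use that gM in \<open>auto intro: cg1\<close>)
    finally show ?thesis .
  qed
  have Ilip: "norm (I u s' p - I u s p) \<le> M u * \<bar>s' - s\<bar>" if "-a \<le> s" "-a \<le> s'" for u s s' p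
  proof (cases "s \<le> s'")
    case True
    then show ?thesis using Ilip1[of s s' u p] that by simp
  next
    case False
    then show ?thesis using Ilip1[of s' s u p] that by (simp add: norm_minus_commute)
  qed
  have Ip: "continuous_on UNIV (\<lambda>p. I u s p)" for u s
  proof -
    have "continuous_on (UNIV \<times> cbox (-a) s) (\<lambda>(p, r). g u r p)"
      using continuous_on_compose2[OF cg[of u] continuous_on_swap[of "UNIV \<times> cbox (-a) s"]]
      by (auto simp: prod.swap_def case_prod_beta')
    from integral_continuous_on_param[OF this] show ?thesis by (simp add: I_def)
  qed
  \<comment> \<open>All integrals start at \<open>-a\<close>, which avoids oriented integrals for
    negative times; subtracting the value at 0 restores the initial condition.\<close>
  define J where "J u x = I u (c (fst x)) (snd x) - I u 0 (snd x)" for u and x :: "real \<times> 'p"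
  have CI: "continuous_on UNIV (\<lambda>x. I u (c (fst x)) (snd x))" for u
  proof (rule continuous_at_imp_continuous_on, rule ballI)
    fix x0 :: "real \<times> 'p"
    have 1: "((\<lambda>x. M u * \<bar>c (fst x) - c (fst x0)\<bar> + norm (I u (c (fst x0)) (snd x) - I u (c (fst x0)) (snd x0)))
        \<longlongrightarrow> M u * \<bar>c (fst x0) - c (fst x0)\<bar> + norm (I u (c (fst x0)) (snd x0) - I u (c (fst x0)) (snd x0))) (at x0)"
    proof (intro tendsto_intros)
      show "((\<lambda>x. c (fst x)) \<longlongrightarrow> c (fst x0)) (at x0)"
        using cc by (intro isCont_tendsto_compose[where g = c] tendsto_fst tendsto_ident_at)
          (simp add: continuous_on_eq_continuous_at)
      show "((\<lambda>x. I u (c (fst x0)) (snd x)) \<longlongrightarrow> I u (c (fst x0)) (snd x0)) (at x0)"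
        using Ip by (intro isCont_tendsto_compose[where g = "\<lambda>p. I u (c (fst x0)) p"] tendsto_snd tendsto_ident_at)
          (simp add: continuous_on_eq_continuous_at)
    qed
    have "((\<lambda>x. I u (c (fst x)) (snd x) - I u (c (fst x0)) (snd x0)) \<longlongrightarrow> 0) (at x0)"
    proof (rule Lim_null_comparison[OF _ 1[simplified]], rule always_eventually, rule allI)
      fix x
      show "norm (I u (c (fst x)) (snd x) - I u (c (fst x0)) (snd x0))
        \<le> M u * \<bar>c (fst x) - c (fst x0)\<bar> + norm (I u (c (fst x0)) (snd x) - I u (c (fst x0)) (snd x0))"
        using Ilip[of "c (fst x0)" "c (fst x)" u "snd x"] c
          norm_triangle_ineq[of "I u (c (fst x)) (snd x) - I u (c (fst x0)) (snd x)" "I u (c (fst x0)) (snd x) - I u (c (fst x0)) (snd x0)"]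
        by auto
    qed
    then show "isCont (\<lambda>x. I u (c (fst x)) (snd x)) x0"
      unfolding isCont_def by (simp add: Lim_null[symmetric])
  qed
  have I0: "continuous_on UNIV (\<lambda>x::real \<times> 'p. I u 0 (snd x))" for u
    using continuous_on_compose2[OF Ip[of u 0] continuous_on_snd[OF continuous_on_id]] by simp
  have CJ: "continuous_on UNIV (J u)" for u
    unfolding J_def using CI I0 by (intro continuous_on_diff)
  have BJ: "norm (J u x) \<le> M u * a" for u x
  proof -
    have "norm (J u x) \<le> M u * \<bar>c (fst x) - 0\<bar>"
      unfolding J_def by (rule Ilip) (use a c[of "fst x"] in auto)
    also have "\<dots> \<le> M u * a" using M0[of u] c[of "fst x"] by (intro mult_left_mono) auto
    finally show ?thesis .
  qed
  define T where "T u = Bcontfun (J u)" for u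
  have T: "apply_bcontfun (T u) = J u" for u
    unfolding T_def using bcontfun_normI[OF CJ BJ] by (simp add: Bcontfun_inverse)
  have "\<exists>!u. T u = u"
  proof (rule banach_fix_type)
    \<comment> \<open>The 3 is 2 + 1: the two integrals in \<open>J\<close> run over intervals of
      length at most \<open>2 * a\<close> and \<open>a\<close>.\<close>
    show "0 \<le> 3 * a * L" "3 * a * L < 1" using a L by auto
    show "\<forall>u w. dist (T u) (T w) \<le> 3 * a * L * dist u w"
    proof (intro allI dist_bound)
      fix u w :: "(real \<times> 'p) \<Rightarrow>\<^sub>C 'f" and x
      have gd: "norm (g u r p - g w r p) \<le> L * dist u w" for r p
      proof -
        have "norm (g u r p - g w r p) \<le> L * dist (u (r, p)) (w (r, p))"
          using lip[of r p "u (r, p)" "w (r, p)"] by (simp add: g_def dist_norm)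
        also have "\<dots> \<le> L * dist u w" using L dist_bounded by (intro mult_left_mono) auto
        finally show ?thesis .
      qed
      have Id: "norm (I u s p - I w s p) \<le> L * dist u w * (s - (-a))" if "-a \<le> s" for s p
      proof -
        have "I u s p - I w s p = integral {-a..s} (\<lambda>r. g u r p - g w r p)"
          unfolding I_def by (rule Henstock_Kurzweil_Integration.integral_diff[symmetric])
            (auto intro: integrable_continuous_real cg1)
        also have "norm \<dots> \<le> L * dist u w * (s - (-a))"
          by (rule integral_bound) (use that gd in \<open>auto intro!: continuous_on_diff cg1\<close>)
        finally show ?thesis .
      qed
      have "dist (T u x) (T w x) = norm ((I u (c (fst x)) (snd x) - I w (c (fst x)) (snd x)) - (I u 0 (snd x) - I w 0 (snd x)))"
        by (simp add: T J_def dist_norm algebra_simps)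
      also have "\<dots> \<le> L * dist u w * (c (fst x) - (-a)) + L * dist u w * (0 - (-a))"
      proof -
        have "-a \<le> c (fst x)" "-a \<le> 0" using a c[of "fst x"] by auto
        from add_mono[OF Id[OF this(1)] Id[OF this(2)]] show ?thesis
          using norm_triangle_ineq4 order_trans by blast
      qed
      also have "\<dots> \<le> L * dist u w * (2 * a) + L * dist u w * a"
        using c[of "fst x"] L by (intro add_mono mult_left_mono) auto
      finally show "dist (T u x) (T w x) \<le> 3 * a * L * dist u w" by (simp add: algebra_simps)
    qed
  qed
  then obtain u where u: "T u = u" by blast
  then have ux: "apply_bcontfun u (s, p) = I u (c s) p - I u 0 p" for s p
    using T[of u] by (simp add: J_def)
  show ?thesis
  proof (intro exI[of _ "\<lambda>s p. apply_bcontfun u (s, p)"] conjI allI ballI)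
    show "continuous_on UNIV (\<lambda>(s, p). apply_bcontfun u (s, p))" using cu[of u] by (simp add: case_prod_beta')
    show "apply_bcontfun u (0, p) = 0" for p using ux[of 0 p] a by (simp add: c_def)
    fix p s assume s: "s \<in> {-a<..<a}"
    have "((\<lambda>t. I u t p) has_vector_derivative g u s p) (at s within {-a..a})"
      unfolding I_def by (rule integral_has_vector_derivative) (use s in \<open>auto intro: cg1\<close>)
    then have "((\<lambda>t. I u t p) has_vector_derivative g u s p) (at s)"
      using s at_within_Icc_at[of "-a" s a] by simp
    then have "((\<lambda>t. I u t p - I u 0 p) has_vector_derivative g u s p) (at s)"
      by (auto intro!: derivative_eq_intros)
    then have "((\<lambda>t. apply_bcontfun u (t, p)) has_vector_derivative g u s p) (at s)"
      by (rule has_vector_derivative_transform_within_open[OF _ open_greaterThanLessThan s])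
        (auto simp: ux c_def)
    then show "((\<lambda>s. apply_bcontfun u (s, p)) has_vector_derivative G s p (apply_bcontfun u (s, p))) (at s)"
      by (simp add: g_def)
  qed
qed

section \<open>Short-time Gronwall estimate and uniform linearisation\<close>

lemma gronwall_short:
  fixes w :: "real \<Rightarrow> 'f::real_normed_vector"
  assumes b: "0 \<le> b" and w0: "w 0 = 0"
    and der: "\<And>s. s \<in> {-b..b} \<Longrightarrow> (w has_vector_derivative w' s) (at s within {-b..b})"
    and bd: "\<And>s. s \<in> {-b..b} \<Longrightarrow> norm (w' s) \<le> L * norm (w s) + \<eta>"
    and L: "0 \<le> L" "b * L \<le> 1/2" and s: "s \<in> {-b..b}"
  shows "norm (w s) \<le> 2 * b * \<eta>"
proof -
  have "continuous_on {-b..b} w"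
    using der has_vector_derivative_continuous continuous_on_eq_continuous_within by metis
  then have "continuous_on {-b..b} (\<lambda>s. norm (w s))" by (intro continuous_intros)
  then obtain s1 where s1: "s1 \<in> {-b..b}" "\<And>s. s \<in> {-b..b} \<Longrightarrow> norm (w s) \<le> norm (w s1)"
    using continuous_attains_sup[of "{-b..b}" "\<lambda>s. norm (w s)"] b by auto
  let ?M = "norm (w s1)"
  have bd': "norm (w' s) \<le> L * ?M + \<eta>" if "s \<in> {-b..b}" for s
    using bd[OF that] mult_left_mono[OF s1(2)[OF that] L(1)] by linarith
  have pos: "0 \<le> L * ?M + \<eta>" using bd'[OF s1(1)] norm_ge_zero order_trans by metis
  have "norm (w s1 - w 0) \<le> (L * ?M + \<eta>) * norm (s1 - 0)"
  proof (rule differentiable_bound[where S = "{-b..b}" and f' = "\<lambda>s h. h *\<^sub>R w' s"])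
    show "onorm (\<lambda>h::real. h *\<^sub>R w' s) \<le> L * ?M + \<eta>" if "s \<in> {-b..b}" for s
    proof (rule onorm_le)
      fix h :: real
      show "norm (h *\<^sub>R w' s) \<le> (L * ?M + \<eta>) * norm h"
        using mult_left_mono[OF bd'[OF that], of "\<bar>h\<bar>"] by (simp add: mult.commute)
    qed
  qed (use der s1 b in \<open>auto simp: has_vector_derivative_def\<close>)
  also have "\<dots> \<le> (L * ?M + \<eta>) * b" using s1(1) pos by (intro mult_left_mono) auto
  also have "\<dots> = b * L * ?M + b * \<eta>" by (simp add: algebra_simps)
  also have "\<dots> \<le> 1/2 * ?M + b * \<eta>" using mult_right_mono[OF L(2), of ?M] by simp
  finally have "?M \<le> 2 * b * \<eta>" using w0 by simp
  then show ?thesis using s1(2)[OF s] by linarith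
qed

lemma norm_le_sum_Basis:
  fixes l :: "'a::euclidean_space \<Rightarrow> 'b::real_normed_vector"
  assumes "linear l" "\<And>b. b \<in> Basis \<Longrightarrow> norm (l b) \<le> M"
  shows "norm (l w) \<le> real DIM('a) * M * norm w"
proof -
  have "norm (l w) = norm (\<Sum>b\<in>Basis. (w \<bullet> b) *\<^sub>R l b)"
    using linear_sum_Basis[OF assms(1)] by metis
  also have "\<dots> \<le> (\<Sum>b\<in>(Basis::'a set). norm w * M)"
    by (intro sum_norm_le) (auto intro!: mult_mono Basis_le_norm assms(2))
  finally show ?thesis by (simp add: mult_ac)
qed

text \<open>Near each point the mean value inequality is applied to \<open>f\<close> minus its
  linearisation there, and a finite subcover makes the radius uniform. The increments may leave
  \<open>K\<close>, but not \<open>U\<close>.\<close>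

lemma Ck_on_uniformly_differentiable:
  fixes f :: "'a::euclidean_space \<Rightarrow> 'b::real_normed_vector"
  assumes "open U" "Ck_on (Suc 0) f U" "compact K" "K \<subseteq> U" "\<eta> > 0"
  shows "\<exists>\<delta>>0. \<forall>x\<in>K. \<forall>w. norm w < \<delta> \<longrightarrow>
    norm (f (x + w) - f x - frechet_derivative f (at x) w) \<le> \<eta> * norm w"
proof -
  let ?D = "\<lambda>x. frechet_derivative f (at x)"
  define n where "n = real DIM('a)"
  have n: "n > 0" by (simp add: n_def)
  have hd: "(f has_derivative ?D x) (at x)" if "x \<in> U" for x
    using Ck_on_Suc_has_derivative[OF assms(2) that] .
  have pt: "\<exists>d>0. \<forall>x\<in>ball x0 d. \<forall>w. norm w < d \<longrightarrow> norm (f (x + w) - f x - ?D x w) \<le> \<eta> * norm w"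
    if "x0 \<in> K" for x0
  proof -
    have x0: "x0 \<in> U" using that assms by auto
    have "\<forall>\<^sub>F x in nhds x0. \<forall>b\<in>Basis. dist (?D x b) (?D x0 b) < \<eta> / (2 * n)"
    proof (rule eventually_ball_finite, simp, rule ballI)
      fix b :: 'a
      have "isCont (\<lambda>x. ?D x b) x0"
        using assms(1,2) x0 by (simp add: continuous_on_eq_continuous_at)
      then show "\<forall>\<^sub>F x in nhds x0. dist (?D x b) (?D x0 b) < \<eta> / (2 * n)"
        using assms(5) n tendstoD[of "\<lambda>x. ?D x b" "?D x0 b" "nhds x0" "\<eta> / (2 * n)"]
        tendsto_at_iff_tendsto_nhds[of "\<lambda>x. ?D x b" x0]
        by (simp add: isCont_def)
    qed
    then obtain d1 where d1: "d1 > 0" "\<And>x b. dist x x0 < d1 \<Longrightarrow> b \<in> Basis \<Longrightarrow> dist (?D x b) (?D x0 b) < \<eta> / (2 * n)"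
      unfolding eventually_nhds_metric by blast
    obtain d2 where d2: "d2 > 0" "ball x0 d2 \<subseteq> U" using assms(1) x0 open_contains_ball by blast
    define d where "d = min d1 d2 / 2"
    have d: "d > 0" "2 * d \<le> d1" "2 * d \<le> d2" using d1 d2 by (auto simp: d_def)
    \<comment> \<open>Smallness on basis vectors becomes an operator bound at the cost of the factor
      \<open>n\<close>. Half of \<eta> is spent on the mean value inequality, half on replacing the
      derivative at \<open>x0\<close> by the one at \<open>x\<close>.\<close>
    have close: "norm (?D x w - ?D x0 w) \<le> \<eta> / 2 * norm w" if "x \<in> ball x0 (2 * d)" for x w :: 'a
    proof -
      have xU: "x \<in> U" using that d d2 by auto
      have "linear (\<lambda>w. ?D x w - ?D x0 w)"
        using has_derivative_linear[OF hd[OF xU]] has_derivative_linear[OF hd[OF x0]] by (rule linear_compose_sub)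
      moreover have "norm (?D x b - ?D x0 b) \<le> \<eta> / (2 * n)" if "b \<in> Basis" for b
        using d1(2)[OF _ that, of x] \<open>x \<in> ball x0 (2 * d)\<close> d(2) by (auto simp: dist_norm norm_minus_commute)
      ultimately have "norm (?D x w - ?D x0 w) \<le> n * (\<eta> / (2 * n)) * norm w"
        unfolding n_def by (rule norm_le_sum_Basis)
      then show ?thesis using n by simp
    qed
    show ?thesis
    proof (intro exI[of _ d] conjI ballI allI impI d(1))
      fix x w :: 'a assume x: "x \<in> ball x0 d" and w: "norm w < d"
      let ?B = "ball x0 (2 * d)"
      let ?h = "\<lambda>z. f z - ?D x0 z"
      have lx0: "linear (?D x0)" using has_derivative_linear[OF hd[OF x0]] .
      have "dist x0 (x + w) \<le> dist x0 x + norm w"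
        using dist_triangle[of x0 "x + w" x] by (simp add: dist_norm)
      then have xw: "x + w \<in> ?B" "x \<in> ?B" using x w d(1) by auto
      have "norm (?h (x + w) - ?h x) \<le> \<eta> / 2 * norm (x + w - x)"
      proof (rule differentiable_bound[OF convex_ball, where f' = "\<lambda>z v. ?D z v - ?D x0 v"])
        fix z assume z: "z \<in> ?B"
        then have "z \<in> U" using d d2 by auto
        from hd[OF this] bounded_linear_imp_has_derivative[OF has_derivative_bounded_linear[OF hd[OF x0]]]
        show "(?h has_derivative (\<lambda>v. ?D z v - ?D x0 v)) (at z within ?B)"
          using has_derivative_at_withinI[OF has_derivative_diff] by blast
        show "onorm (\<lambda>v. ?D z v - ?D x0 v) \<le> \<eta> / 2"
          by (rule onorm_le) (use close[OF z] in auto)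
      qed (use xw in auto)
      then have 1: "norm (f (x + w) - f x - ?D x0 w) \<le> \<eta> / 2 * norm w"
        by (simp add: linear_add[OF lx0] algebra_simps)
      have 2: "norm (?D x w - ?D x0 w) \<le> \<eta> / 2 * norm w" using close xw by blast
      have "f (x + w) - f x - ?D x w = (f (x + w) - f x - ?D x0 w) - (?D x w - ?D x0 w)" by simp
      also have "norm \<dots> \<le> \<eta> / 2 * norm w + \<eta> / 2 * norm w"
        using norm_triangle_ineq4 1 2 by (meson add_mono order_trans)
      finally show "norm (f (x + w) - f x - ?D x w) \<le> \<eta> * norm w" by simp
    qed
  qed
  then obtain d where d: "\<And>x0. x0 \<in> K \<Longrightarrow> d x0 > 0"
     "\<And>x0 x w. x0 \<in> K \<Longrightarrow> x \<in> ball x0 (d x0) \<Longrightarrow> norm w < d x0 \<Longrightarrow> norm (f (x + w) - f x - ?D x w) \<le> \<eta> * norm w"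
    using bchoice[of K "\<lambda>x0 d. d > 0 \<and> (\<forall>x\<in>ball x0 d. \<forall>w. norm w < d \<longrightarrow> norm (f (x + w) - f x - ?D x w) \<le> \<eta> * norm w)"]
    by blast
  have "K \<subseteq> (\<Union>x0\<in>K. ball x0 (d x0))" using d(1) by force
  then obtain F where F: "F \<subseteq> K" "finite F" "K \<subseteq> (\<Union>x0\<in>F. ball x0 (d x0))"
    using compactE_image[OF assms(3), of K "\<lambda>x0. ball x0 (d x0)"] by auto
  \<comment> \<open>The 1 keeps the minimum meaningful when \<open>K\<close>, and hence the
    subcover, is empty.\<close>
  define e where "e = Min (insert 1 (d ` F))"
  have "e > 0" using F d(1) by (auto simp: e_def)
  moreover have e: "e \<le> d x" if "x \<in> F" for x using F that by (auto simp: e_def)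
  moreover have "norm (f (x + w) - f x - ?D x w) \<le> \<eta> * norm w" if "x \<in> K" "norm w < e" for x w
  proof -
    obtain x0 where "x0 \<in> F" "x \<in> ball x0 (d x0)" using F(3) \<open>x \<in> K\<close> by blast
    moreover have "norm w < d x0" using e \<open>x0 \<in> F\<close> that(2) by fastforce
    ultimately show ?thesis using F(1) d(2) by blast
  qed
  ultimately show ?thesis by blast
qed

lemma has_vector_derivative_at_0_iff_tendsto:
  fixes f :: "real \<Rightarrow> 'a::real_normed_vector"
  shows "((\<lambda>h. f h) has_vector_derivative D) (at 0) \<longleftrightarrow> ((\<lambda>h. (f h - f 0) /\<^sub>R h) \<longlongrightarrow> D) (at 0)"
proof -
  have "norm ((f y - f 0 - y *\<^sub>R D) /\<^sub>R norm y) = norm ((f y - f 0) /\<^sub>R y - D)" if "y \<noteq> 0" for y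
  proof -
    have "(f y - f 0) /\<^sub>R y - D = (f y - f 0 - y *\<^sub>R D) /\<^sub>R y"
      using that by (simp add: scaleR_diff_right)
    then show ?thesis by simp
  qed
  then have ev: "\<forall>\<^sub>F y in at 0. norm ((f y - f 0 - y *\<^sub>R D) /\<^sub>R norm y) = norm ((f y - f 0) /\<^sub>R y - D)"
    by (auto simp: eventually_at_filter)
  have "((\<lambda>h. f h) has_vector_derivative D) (at 0) \<longleftrightarrow>
    ((\<lambda>y. norm ((f y - f 0 - y *\<^sub>R D) /\<^sub>R norm y)) \<longlongrightarrow> 0) (at 0)"
    unfolding has_vector_derivative_def has_derivative_def
    by (subst tendsto_norm_zero_iff) (simp add: bounded_linear_scaleR_left)
  also have "\<dots> \<longleftrightarrow> ((\<lambda>y. norm ((f y - f 0) /\<^sub>R y - D)) \<longlongrightarrow> 0) (at 0)"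
    by (rule tendsto_cong[OF ev])
  also have "\<dots> \<longleftrightarrow> ((\<lambda>h. (f h - f 0) /\<^sub>R h) \<longlongrightarrow> D) (at 0)"
    by (subst tendsto_norm_zero_iff) (simp add: Lim_null[symmetric])
  finally show ?thesis .
qed

text \<open>Turns the Lipschitz condition on the right-hand side of an equation into the bound on
  its partial derivative that the linearised equation needs.\<close>

lemma has_derivative_norm_le_lipschitz:
  assumes "(f has_derivative D) (at x)" "open U" "x \<in> U"
    and lip: "\<And>h. x + h *\<^sub>R v \<in> U \<Longrightarrow> norm (f (x + h *\<^sub>R v) - f x) \<le> C * \<bar>h\<bar>"
  shows "norm (D v) \<le> C"
proof -
  have "((\<lambda>h. f (x + h *\<^sub>R v)) has_vector_derivative D v) (at 0)"
  proof -
    have "((\<lambda>h. x + h *\<^sub>R v) has_derivative (\<lambda>h. h *\<^sub>R v)) (at 0)"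
      by (auto intro!: derivative_eq_intros)
    from has_derivative_compose[OF this, of f D] assms(1)
    have "((\<lambda>h. f (x + h *\<^sub>R v)) has_derivative (\<lambda>h. D (h *\<^sub>R v))) (at 0)" by simp
    then show ?thesis
      using linear_cmul[OF has_derivative_linear[OF assms(1)]] by (simp add: has_vector_derivative_def)
  qed
  then have "((\<lambda>h. norm ((f (x + h *\<^sub>R v) - f x) /\<^sub>R h)) \<longlongrightarrow> norm (D v)) (at 0)"
    by (intro tendsto_norm) (simp add: has_vector_derivative_at_0_iff_tendsto)
  moreover have "\<forall>\<^sub>F h in at 0. norm ((f (x + h *\<^sub>R v) - f x) /\<^sub>R h) \<le> C"
  proof -
    have "isCont (\<lambda>h. x + h *\<^sub>R v) 0" by (intro continuous_intros)
    then have "\<forall>\<^sub>F h in at 0. x + h *\<^sub>R v \<in> U"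
      unfolding isCont_def using assms(2,3) by (intro topological_tendstoD) auto
    then show ?thesis
    proof (rule eventually_rev_mp[OF _ eventually_rev_mp[OF eventually_neq_at_within]], intro always_eventually allI impI)
      fix h :: real assume "h \<noteq> 0" "x + h *\<^sub>R v \<in> U"
      then show "norm ((f (x + h *\<^sub>R v) - f x) /\<^sub>R h) \<le> C"
        using lip[of h] by (simp add: divide_simps)
    qed
  qed
  ultimately show ?thesis
    by (intro tendsto_upperbound[of "\<lambda>h. norm ((f (x + h *\<^sub>R v) - f x) /\<^sub>R h)" "norm (D v)" "at 0"]) auto
qed

lemma linear_frechet_derivative:
  "Ck_on (Suc k) f U \<Longrightarrow> x \<in> U \<Longrightarrow> linear (frechet_derivative f (at x))"
  using Ck_on_Suc_has_derivative has_derivative_linear by blast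

section \<open>Differentiability in the parameter\<close>

text \<open>The candidate derivative \<open>Z\<close> in the direction \<open>v\<close> solves the
  variational equation with zero initial value. It is produced by Picard iteration, and
  \<open>gronwall_short\<close> shows that the error of the first-order expansion is o(h). The
  smaller time \<open>b\<close> and the closed ball supply the compactness for the bounds.\<close>

lemma ode_parameter_derivative_local:
  fixes u :: "real \<Rightarrow> 'e::euclidean_space \<Rightarrow> 'f::euclidean_space" and G :: "real \<times> 'e \<times> 'f \<Rightarrow> 'f"
  assumes V: "open V" and W: "open W" and G: "Ck_on (Suc 0) G W" and a: "0 < a"
    and cu: "continuous_on ({-a<..<a} \<times> V) (\<lambda>(s, y). u s y)"
    and inW: "\<And>s y. s \<in> {-a<..<a} \<Longrightarrow> y \<in> V \<Longrightarrow> (s, y, u s y) \<in> W"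
    and u0: "\<And>y. y \<in> V \<Longrightarrow> u 0 y = 0"
    and ode: "\<And>s y. s \<in> {-a<..<a} \<Longrightarrow> y \<in> V \<Longrightarrow>
      ((\<lambda>s. u s y) has_vector_derivative G (s, y, u s y)) (at s)"
    and bound: "\<And>s y z. s \<in> {-a<..<a} \<Longrightarrow> y \<in> V \<Longrightarrow>
      norm (frechet_derivative G (at (s, y, u s y)) (0, 0, z)) \<le> L * norm z"
    and L: "0 \<le> L" "4 * a * L \<le> 1"
    and b: "0 < b" "b < a" and cb: "cball y1 \<rho> \<subseteq> V" and "\<rho> > 0"
  shows "\<exists>Z. continuous_on UNIV (\<lambda>(s, y). Z s y) \<and> (\<forall>y. Z 0 y = 0) \<and>
    (\<forall>s\<in>{-b<..<b}. \<forall>y\<in>ball y1 \<rho>.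
      ((\<lambda>s. Z s y) has_vector_derivative frechet_derivative G (at (s, y, u s y)) (0, v, Z s y)) (at s) \<and>
      ((\<lambda>h. u s (y + h *\<^sub>R v)) has_vector_derivative Z s y) (at 0))"
proof -
  let ?D = "\<lambda>s y. frechet_derivative G (at (s, y, u s y))"
  let ?\<Omega> = "{-a<..<a} \<times> V"
  have linD: "linear (?D s y)" if "s \<in> {-a<..<a}" "y \<in> V" for s y
    using linear_frechet_derivative[OF G inW[OF that]] .
  have contP: "continuous_on ?\<Omega> (\<lambda>(s, y). (s, y, u s y))"
    using continuous_on_Pair[OF continuous_on_fst[OF continuous_on_id] continuous_on_Pair[OF continuous_on_snd[OF continuous_on_id] cu]]
    by (simp add: case_prod_beta')
  have contD: "continuous_on ?\<Omega> (\<lambda>(s, y). ?D s y w)" for w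
  proof -
    have "continuous_on W (\<lambda>p. frechet_derivative G (at p) w)" using G by (simp del: split_paired_All)
    moreover have "(\<lambda>(s, y). (s, y, u s y)) ` ?\<Omega> \<subseteq> W" using inW by auto
    ultimately have "continuous_on ?\<Omega> (\<lambda>x. frechet_derivative G (at ((\<lambda>(s, y). (s, y, u s y)) x)) w)"
      by (rule continuous_on_compose2[OF _ contP])
    then show ?thesis by (simp add: case_prod_beta')
  qed
  \<comment> \<open>Picard iteration wants coefficients defined and bounded for all times and
    parameters: time is clamped, and the parameter is projected to the closed ball.\<close>
  define c where "c s = max (-b) (min s b)" for s :: real
  define \<pi> where "\<pi> = closest_point (cball y1 \<rho>)"
  have c: "c s \<in> {-b..b}" for s using b by (auto simp: c_def)
  have ca: "c s \<in> {-a<..<a}" for s using c[of s] b by auto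
  have \<pi>: "\<pi> y \<in> cball y1 \<rho>" for y
    unfolding \<pi>_def by (rule closest_point_in_set) (use \<open>\<rho> > 0\<close> in auto)
  then have \<pi>V: "\<pi> y \<in> V" for y using cb by blast
  have cc: "continuous_on UNIV c" unfolding c_def by (intro continuous_intros)
  have c\<pi>: "continuous_on UNIV \<pi>"
    unfolding \<pi>_def by (rule continuous_on_closest_point) (use \<open>\<rho> > 0\<close> in auto)
  have contcp: "continuous_on UNIV (\<lambda>(s, y). (c s, \<pi> y))"
    using continuous_on_Pair[OF continuous_on_compose2[OF cc continuous_on_fst[OF continuous_on_id]]
        continuous_on_compose2[OF c\<pi> continuous_on_snd[OF continuous_on_id]]]
    by (simp add: case_prod_beta')
  have contDc: "continuous_on UNIV (\<lambda>(s, y). ?D (c s) (\<pi> y) w)" for w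
  proof -
    have "range (\<lambda>(s, y). (c s, \<pi> y)) \<subseteq> ?\<Omega>" using ca \<pi>V by auto
    from continuous_on_compose2[OF contD contcp this] show ?thesis by (simp add: case_prod_beta')
  qed
  define Gl where "Gl s y z = ?D (c s) (\<pi> y) (0, v, z)" for s y z
  have Gl_split: "Gl s y z = ?D (c s) (\<pi> y) (0, v, 0) + ?D (c s) (\<pi> y) (0, 0, z)" for s y z
    using linear_add[OF linD[OF ca \<pi>V], of s y "(0, v, 0)" "(0, 0, z)"] by (simp add: Gl_def)
  have linz: "linear (\<lambda>z. ?D (c s) (\<pi> y) (0, 0, z))" for s y
  proof (rule linearI)
    show "?D (c s) (\<pi> y) (0, 0, z + z') = ?D (c s) (\<pi> y) (0, 0, z) + ?D (c s) (\<pi> y) (0, 0, z')" for z z'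
      using linear_add[OF linD[OF ca \<pi>V], of s y "(0, 0, z)" "(0, 0, z')"] by simp
    show "?D (c s) (\<pi> y) (0, 0, r *\<^sub>R z) = r *\<^sub>R ?D (c s) (\<pi> y) (0, 0, z)" for r z
      using linear_cmul[OF linD[OF ca \<pi>V], of s y r "(0, 0, z)"] by simp
  qed
  have Gl_cont: "continuous_on UNIV (\<lambda>(s, y, z). Gl s y z)"
  proof -
    have 1: "Gl s y z = ?D (c s) (\<pi> y) (0, v, 0) + (\<Sum>e\<in>Basis. (z \<bullet> e) *\<^sub>R ?D (c s) (\<pi> y) (0, 0, e))" for s y z
      unfolding Gl_split using linear_sum_Basis[OF linz, of s y z] by simp
    have 2: "continuous_on UNIV (\<lambda>x :: real \<times> 'e \<times> 'f. ?D (c (fst x)) (\<pi> (fst (snd x))) w)" for w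
    proof -
      have "continuous_on UNIV (\<lambda>x :: real \<times> 'e \<times> 'f. (fst x, fst (snd x)))" by (intro continuous_intros)
      from continuous_on_compose2[OF contDc[of w] this] show ?thesis by simp
    qed
    show ?thesis unfolding case_prod_beta' 1
      by (intro continuous_on_add continuous_on_sum continuous_on_scaleR continuous_on_inner 2 continuous_on_const
         continuous_on_snd continuous_on_id)
  qed
  have Gl_lip: "norm (Gl s y z - Gl s y z') \<le> L * norm (z - z')" for s y z z'
    using linear_diff[OF linz, of s y z z'] bound[OF ca \<pi>V, of s y "z - z'"] by (simp add: Gl_split)
  obtain B where Gl_bd: "\<And>s y. norm (Gl s y 0) \<le> B"
  proof -
    have "compact ({-b..b} \<times> cball y1 \<rho>)" by (intro compact_Times) auto
    moreover have "continuous_on ({-b..b} \<times> cball y1 \<rho>) (\<lambda>(s, y). ?D s y (0, v, 0))"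
      by (rule continuous_on_subset[OF contD]) (use b cb in auto)
    ultimately have "bounded ((\<lambda>(s, y). ?D s y (0, v, 0)) ` ({-b..b} \<times> cball y1 \<rho>))"
      using compact_continuous_image compact_imp_bounded by blast
    then obtain B where "\<And>x. x \<in> {-b..b} \<times> cball y1 \<rho> \<Longrightarrow> norm ((\<lambda>(s, y). ?D s y (0, v, 0)) x) \<le> B"
      unfolding bounded_iff by blast
    then have "norm (?D (c s) (\<pi> y) (0, v, 0)) \<le> B" for s y using c \<pi> by fastforce
    then have "norm (Gl s y 0) \<le> B" for s y by (simp add: Gl_def)
    then show ?thesis by (rule that)
  qed
  have L3: "3 * b * L < 1"
  proof -
    have "3 * (b * L) \<le> 3 * (a * L)" using b L by (simp add: mult_right_mono)
    then show ?thesis using L(2) by linarith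
  qed
  obtain Z where Z: "continuous_on UNIV (\<lambda>(s, y). Z s y)" "\<And>y. Z 0 y = 0"
    "\<And>y s. s \<in> {-b<..<b} \<Longrightarrow> ((\<lambda>s. Z s y) has_vector_derivative Gl s y (Z s y)) (at s)"
  proof -
    from picard_parametric[OF b(1) L(1) L3 Gl_cont Gl_lip Gl_bd] obtain Z where
      "continuous_on UNIV (\<lambda>(s, y). Z s y) \<and> (\<forall>y. Z 0 y = 0) \<and>
        (\<forall>y. \<forall>s\<in>{-b<..<b}. ((\<lambda>s. Z s y) has_vector_derivative Gl s y (Z s y)) (at s))" ..
    then show ?thesis by (intro that[of Z]) simp_all
  qed
  have Zode: "((\<lambda>s. Z s y) has_vector_derivative ?D s y (0, v, Z s y)) (at s)"
    if "s \<in> {-b<..<b}" "y \<in> ball y1 \<rho>" for s y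
  proof -
    have "c s = s" using that by (auto simp: c_def)
    moreover have "\<pi> y = y" unfolding \<pi>_def by (rule closest_point_self) (use that in auto)
    ultimately show ?thesis using Z(3)[OF that(1), of y] by (simp add: Gl_def)
  qed
  have Zder: "((\<lambda>h. u s (y + h *\<^sub>R v)) has_vector_derivative Z s y) (at 0)"
    if s: "s \<in> {-b<..<b}" and y: "y \<in> ball y1 \<rho>" for s y
  proof -
    \<comment> \<open>A closed interval strictly inside the one on which \<open>Z\<close> solves its
      equation, and containing \<open>s\<close>.\<close>
    define b' where "b' = (\<bar>s\<bar> + b) / 2"
    have b': "0 < b'" "b' < b" "\<bar>s\<bar> < b'" using s b by (auto simp: b'_def)
    let ?I = "{-b'..b'}"
    have Ia: "r \<in> ?I \<Longrightarrow> r \<in> {-a<..<a}" "r \<in> ?I \<Longrightarrow> r \<in> {-b<..<b}" for r using b' b by auto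
    have yV: "y \<in> V" using y cb by auto
    define \<rho>' where "\<rho>' = \<rho> - dist y1 y"
    have \<rho>': "\<rho>' > 0" using y by (simp add: \<rho>'_def)
    have cby: "cball y \<rho>' \<subseteq> V"
    proof
      fix x assume "x \<in> cball y \<rho>'"
      then have "dist y1 x \<le> \<rho>" using dist_triangle[of y1 x y] by (simp add: \<rho>'_def dist_commute)
      then show "x \<in> V" using cb by auto
    qed
    have contZ: "continuous_on ?I (\<lambda>r. Z r y)"
      using continuous_on_compose2[OF Z(1) continuous_on_Pair[OF continuous_on_id continuous_on_const[of ?I y]]] by simp
    then have "bounded ((\<lambda>r. Z r y) ` ?I)" by (intro compact_imp_bounded compact_continuous_image) auto
    then obtain C where C: "\<And>r. r \<in> ?I \<Longrightarrow> norm (Z r y) \<le> C" unfolding bounded_iff by blast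
    have "norm (Z 0 y) \<le> C" using C[of 0] b' by simp
    then have C0: "0 \<le> C" using norm_ge_zero[of "Z 0 y"] by linarith
    show ?thesis
      unfolding has_vector_derivative_def has_derivative_at_alt
    proof (intro conjI allI impI)
      show "bounded_linear (\<lambda>h. h *\<^sub>R Z s y)" by (rule bounded_linear_scaleR_left)
      fix e :: real assume "e > 0"
      define N where "N = 1 + norm v + C"
      have N: "N > 0" using C0 by (simp add: N_def add_pos_nonneg)
      \<comment> \<open>The first bound keeps the constant \<open>L + \<eta>\<close> admissible in
        \<open>gronwall_short\<close>; the second turns its conclusion into the error
        \<open>e * \<bar>h\<bar>\<close>.\<close>
      define \<eta> where "\<eta> = min (1 / (4 * a)) (e / (2 * a * N))"
      have \<eta>: "\<eta> > 0" "a * \<eta> \<le> 1/4" "2 * a * (\<eta> * N) \<le> e"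
      proof -
        show "\<eta> > 0" using a N \<open>e > 0\<close> by (simp add: \<eta>_def)
        have "a * \<eta> \<le> a * (1 / (4 * a))" using a by (intro mult_left_mono) (auto simp: \<eta>_def)
        then show "a * \<eta> \<le> 1/4" using a by simp
        have "(2 * a * N) * \<eta> \<le> (2 * a * N) * (e / (2 * a * N))"
          using a N by (intro mult_left_mono) (auto simp: \<eta>_def)
        then show "2 * a * (\<eta> * N) \<le> e" using a N by (simp add: mult_ac)
      qed
      let ?K = "(\<lambda>r. (r, y, u r y)) ` ?I"
      have "continuous_on ?I (\<lambda>r. (r, y, u r y))"
      proof -
        have "(\<lambda>r. (r, y)) ` ?I \<subseteq> ?\<Omega>" using Ia yV by auto
        from continuous_on_compose2[OF contP continuous_on_Pair[OF continuous_on_id continuous_on_const] this]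
        show ?thesis by simp
      qed
      then have cK: "compact ?K" by (intro compact_continuous_image) auto
      have KW: "?K \<subseteq> W" using inW Ia yV by auto
      from Ck_on_uniformly_differentiable[OF W G cK KW \<eta>(1)] obtain d1 where "d1 > 0" and
        d1': "\<forall>x\<in>?K. \<forall>w. norm w < d1 \<longrightarrow> norm (G (x + w) - G x - frechet_derivative G (at x) w) \<le> \<eta> * norm w"
        by blast
      have d1: "d1 > 0"
        "\<And>r w. r \<in> ?I \<Longrightarrow> norm w < d1 \<Longrightarrow>
          norm (G ((r, y, u r y) + w) - G (r, y, u r y) - ?D r y w) \<le> \<eta> * norm w"
        using \<open>d1 > 0\<close> d1'[rule_format, OF imageI] by blast+
      have "compact (?I \<times> cball y \<rho>')" by (intro compact_Times) auto
      moreover have "continuous_on (?I \<times> cball y \<rho>') (\<lambda>(s, y). u s y)"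
        by (rule continuous_on_subset[OF cu]) (use Ia cby in auto)
      ultimately have uc: "uniformly_continuous_on (?I \<times> cball y \<rho>') (\<lambda>(s, y). u s y)"
        by (rule compact_uniformly_continuous[rotated])
      have "d1 / 2 > 0" using d1(1) by simp
      from uc[unfolded uniformly_continuous_on_def, rule_format, OF this] obtain d2 where d2: "d2 > 0"
        "\<And>x x'. x \<in> ?I \<times> cball y \<rho>' \<Longrightarrow> x' \<in> ?I \<times> cball y \<rho>' \<Longrightarrow> dist x' x < d2 \<Longrightarrow>
          dist ((\<lambda>(s, y). u s y) x') ((\<lambda>(s, y). u s y) x) < d1 / 2"
        by blast
      \<comment> \<open>Keeps the shifted parameter in the ball around \<open>y\<close>, within the
        modulus of uniform continuity \<open>d2\<close>, and short enough for both halves of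
        \<open>d1\<close>: one for the parameter increment, one for the increment of the
        solution.\<close>
      define d where "d = min \<rho>' (min d2 (d1 / 2)) / (1 + norm v)"
      have v1: "1 + norm v > 0" by (simp add: add_pos_nonneg)
      have d: "d > 0" using \<rho>' d1 d2 v1 by (simp add: d_def)
      show "\<exists>d>0. \<forall>h. norm (h - 0) < d \<longrightarrow>
        norm (u s (y + h *\<^sub>R v) - u s (y + 0 *\<^sub>R v) - (h - 0) *\<^sub>R Z s y) \<le> e * norm (h - 0)"
      proof (intro exI[of _ d] conjI allI impI d)
        fix h :: real assume h: "norm (h - 0) < d"
        have "\<bar>h\<bar> * norm v \<le> \<bar>h\<bar> * (1 + norm v)" by (intro mult_left_mono) auto
        also have "\<dots> < d * (1 + norm v)" using h v1 by (intro mult_strict_right_mono) auto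
        also have "\<dots> = min \<rho>' (min d2 (d1 / 2))" using v1 by (simp add: d_def)
        finally have hv: "\<bar>h\<bar> * norm v < \<rho>'" "\<bar>h\<bar> * norm v < d2" "\<bar>h\<bar> * norm v < d1 / 2" by auto
        have yh: "y + h *\<^sub>R v \<in> cball y \<rho>'" using hv by (simp add: dist_norm)
        then have yhV: "y + h *\<^sub>R v \<in> V" using cby by auto
        define \<Delta> where "\<Delta> r = u r (y + h *\<^sub>R v) - u r y" for r
        have small: "norm (\<Delta> r) < d1 / 2" if "r \<in> ?I" for r
          using d2(2)[of "(r, y)" "(r, y + h *\<^sub>R v)"] that yh \<rho>' hv by (simp add: \<Delta>_def dist_norm dist_Pair_Pair)
        \<comment> \<open>The error of the first-order expansion in \<open>h\<close>;
          \<open>w'\<close> is its time derivative.\<close>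
        define w where "w r = \<Delta> r - h *\<^sub>R Z r y" for r
        define w' where "w' r = G (r, y + h *\<^sub>R v, u r (y + h *\<^sub>R v)) - G (r, y, u r y) - h *\<^sub>R ?D r y (0, v, Z r y)" for r
        have "norm (w s) \<le> 2 * b' * (\<eta> * \<bar>h\<bar> * (norm v + C))"
        proof (rule gronwall_short[where L = "L + \<eta>" and w' = w'])
          show "0 \<le> b'" "0 \<le> L + \<eta>" "s \<in> ?I" using b' L \<eta> by auto
          show "w 0 = 0" using u0 yV yhV Z(2) by (simp add: w_def \<Delta>_def)
          have "b' * (L + \<eta>) \<le> a * (L + \<eta>)" using b b' L \<eta> by (intro mult_right_mono) auto
          then show "b' * (L + \<eta>) \<le> 1 / 2" using L(2) \<eta>(2) by (simp add: algebra_simps)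
          fix r assume r: "r \<in> ?I"
          show "(w has_vector_derivative w' r) (at r within ?I)"
            unfolding w_def w'_def \<Delta>_def
            by (rule has_vector_derivative_at_within)
              (intro has_vector_derivative_diff bounded_linear.has_vector_derivative[OF bounded_linear_scaleR_right]
                ode[OF Ia(1)[OF r] yhV] ode[OF Ia(1)[OF r] yV] Zode[OF Ia(2)[OF r] y])
          let ?w = "(0::real, h *\<^sub>R v, \<Delta> r)"
          have nw: "norm ?w \<le> \<bar>h\<bar> * norm v + norm (\<Delta> r)"
            using norm_Pair_le[of "h *\<^sub>R v" "\<Delta> r"] by (simp add: norm_Pair)
          have lw: "?D r y ?w = h *\<^sub>R ?D r y (0, v, Z r y) + ?D r y (0, 0, w r)"
            using linear_add[OF linD[OF Ia(1)[OF r] yV], of "h *\<^sub>R (0, v, Z r y)" "(0, 0, w r)"]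
              linear_cmul[OF linD[OF Ia(1)[OF r] yV], of h "(0, v, Z r y)"] by (simp add: w_def)
          have "norm ?w < d1" using nw small[OF r] hv by linarith
          then have 1: "norm (w' r - ?D r y (0, 0, w r)) \<le> \<eta> * norm ?w"
          proof -
            have "w' r - ?D r y (0, 0, w r) = G ((r, y, u r y) + ?w) - G (r, y, u r y) - ?D r y ?w"
              unfolding lw by (simp add: w'_def \<Delta>_def)
            then show ?thesis using d1(2)[OF r \<open>norm ?w < d1\<close>] by simp
          qed
          have "norm (\<Delta> r) \<le> norm (w r) + \<bar>h\<bar> * norm (Z r y)"
            using norm_triangle_ineq[of "w r" "h *\<^sub>R Z r y"] by (simp add: w_def)
          also have "\<bar>h\<bar> * norm (Z r y) \<le> \<bar>h\<bar> * C" using C[OF r] by (intro mult_left_mono) auto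
          finally have "norm ?w \<le> norm (w r) + \<bar>h\<bar> * (norm v + C)" using nw by (simp add: algebra_simps)
          then have "\<eta> * norm ?w \<le> \<eta> * (norm (w r) + \<bar>h\<bar> * (norm v + C))" using \<eta> by (intro mult_left_mono) auto
          then have "norm (w' r - ?D r y (0, 0, w r)) \<le> \<eta> * norm (w r) + \<eta> * \<bar>h\<bar> * (norm v + C)"
            using 1 by (simp add: algebra_simps)
          moreover have "norm (?D r y (0, 0, w r)) \<le> L * norm (w r)" using bound[OF Ia(1)[OF r] yV] .
          moreover have "norm (w' r) \<le> norm (w' r - ?D r y (0, 0, w r)) + norm (?D r y (0, 0, w r))"
            using norm_triangle_ineq[of "w' r - ?D r y (0, 0, w r)" "?D r y (0, 0, w r)"] by simp
          ultimately show "norm (w' r) \<le> (L + \<eta>) * norm (w r) + \<eta> * \<bar>h\<bar> * (norm v + C)"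
            by (simp add: algebra_simps)
        qed
        also have "\<dots> \<le> 2 * a * (\<eta> * \<bar>h\<bar> * N)"
          using b b' \<eta> C0 by (intro mult_mono) (auto simp: N_def)
        also have "\<dots> = 2 * a * (\<eta> * N) * \<bar>h\<bar>" by simp
        also have "\<dots> \<le> e * \<bar>h\<bar>" using \<eta>(3) by (rule mult_right_mono) simp
        finally show "norm (u s (y + h *\<^sub>R v) - u s (y + 0 *\<^sub>R v) - (h - 0) *\<^sub>R Z s y) \<le> e * norm (h - 0)"
          by (simp add: w_def \<Delta>_def)
      qed
    qed
  qed
  show ?thesis
    by (intro exI[of _ Z] conjI allI ballI Z(1,2) Zode Zder)
qed

text \<open>The local derivatives fit together by themselves: each is the directional derivative of
  \<open>u\<close>, which depends on \<open>u\<close> alone.\<close>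

lemma ode_parameter_derivative:
  fixes u :: "real \<Rightarrow> 'e::euclidean_space \<Rightarrow> 'f::euclidean_space" and G :: "real \<times> 'e \<times> 'f \<Rightarrow> 'f"
  assumes V: "open V" and W: "open W" and G: "Ck_on (Suc 0) G W" and a: "0 < a"
    and cu: "continuous_on ({-a<..<a} \<times> V) (\<lambda>(s, y). u s y)"
    and inW: "\<And>s y. s \<in> {-a<..<a} \<Longrightarrow> y \<in> V \<Longrightarrow> (s, y, u s y) \<in> W"
    and u0: "\<And>y. y \<in> V \<Longrightarrow> u 0 y = 0"
    and ode: "\<And>s y. s \<in> {-a<..<a} \<Longrightarrow> y \<in> V \<Longrightarrow>
      ((\<lambda>s. u s y) has_vector_derivative G (s, y, u s y)) (at s)"
    and bound: "\<And>s y z. s \<in> {-a<..<a} \<Longrightarrow> y \<in> V \<Longrightarrow>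
      norm (frechet_derivative G (at (s, y, u s y)) (0, 0, z)) \<le> L * norm z"
    and L: "0 \<le> L" "4 * a * L \<le> 1"
  shows "\<exists>Z. continuous_on ({-a<..<a} \<times> V) (\<lambda>(s, y). Z s y) \<and> (\<forall>y\<in>V. Z 0 y = 0) \<and>
    (\<forall>s\<in>{-a<..<a}. \<forall>y\<in>V.
      ((\<lambda>s. Z s y) has_vector_derivative frechet_derivative G (at (s, y, u s y)) (0, v, Z s y)) (at s) \<and>
      ((\<lambda>h. u s (y + h *\<^sub>R v)) has_vector_derivative Z s y) (at 0))"
proof -
  define Z where "Z s y = vector_derivative (\<lambda>h. u s (y + h *\<^sub>R v)) (at 0)" for s y
  have loc: "\<exists>b \<rho> Z0. 0 < b \<and> 0 < \<rho> \<and> s1 \<in> {-b<..<b} \<and> continuous_on UNIV (\<lambda>(s, y). Z0 s y) \<and> (\<forall>y. Z0 0 y = 0) \<and>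
    (\<forall>s\<in>{-b<..<b}. \<forall>y\<in>ball y1 \<rho>. Z s y = Z0 s y \<and>
      ((\<lambda>s. Z0 s y) has_vector_derivative frechet_derivative G (at (s, y, u s y)) (0, v, Z0 s y)) (at s) \<and>
      ((\<lambda>h. u s (y + h *\<^sub>R v)) has_vector_derivative Z0 s y) (at 0))"
    if s1: "s1 \<in> {-a<..<a}" and y1: "y1 \<in> V" for s1 y1
  proof -
    define b where "b = (\<bar>s1\<bar> + a) / 2"
    have b: "0 < b" "b < a" "s1 \<in> {-b<..<b}" using s1 a by (auto simp: b_def abs_if field_simps)
    obtain \<rho> where \<rho>: "\<rho> > 0" "cball y1 \<rho> \<subseteq> V" using V y1 open_contains_cball by blast
    obtain Z0 where Z0: "continuous_on UNIV (\<lambda>(s, y). Z0 s y)" "\<forall>y. Z0 0 y = 0"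
      "\<And>s y. s \<in> {-b<..<b} \<Longrightarrow> y \<in> ball y1 \<rho> \<Longrightarrow>
        ((\<lambda>s. Z0 s y) has_vector_derivative frechet_derivative G (at (s, y, u s y)) (0, v, Z0 s y)) (at s) \<and>
        ((\<lambda>h. u s (y + h *\<^sub>R v)) has_vector_derivative Z0 s y) (at 0)"
      using ode_parameter_derivative_local[OF V W G a cu inW u0 ode bound L b(1,2) \<rho>(2,1), of v] by blast
    have "Z s y = Z0 s y" if "s \<in> {-b<..<b}" "y \<in> ball y1 \<rho>" for s y
      unfolding Z_def using Z0(3)[OF that] by (blast intro: vector_derivative_at)
    then show ?thesis using b \<rho> Z0 by blast
  qed
  show ?thesis
  proof (intro exI[of _ Z] conjI ballI)
    show "continuous_on ({-a<..<a} \<times> V) (\<lambda>(s, y). Z s y)"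
    proof (rule continuous_at_imp_continuous_on, rule ballI)
      fix x assume "x \<in> {-a<..<a} \<times> V"
      then obtain s1 y1 where x: "x = (s1, y1)" "s1 \<in> {-a<..<a}" "y1 \<in> V" by auto
      from loc[OF x(2,3)] obtain b \<rho> Z0 where *: "0 < \<rho>" "s1 \<in> {-b<..<b}" "continuous_on UNIV (\<lambda>(s, y). Z0 s y)"
        "\<And>s y. s \<in> {-b<..<b} \<Longrightarrow> y \<in> ball y1 \<rho> \<Longrightarrow> Z s y = Z0 s y" by blast
      let ?B = "{-b<..<b} \<times> ball y1 \<rho>"
      have "continuous_on ?B (\<lambda>(s, y). Z0 s y)" using *(3) continuous_on_subset by blast
      then have "continuous_on ?B (\<lambda>(s, y). Z s y)"
        by (rule continuous_on_eq) (use *(4) in auto)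
      moreover have "open ?B" "x \<in> ?B" using x * by (auto intro!: open_Times)
      ultimately show "isCont (\<lambda>(s, y). Z s y) x" using continuous_on_eq_continuous_at by blast
    qed
    show "Z 0 y = 0" if "y \<in> V" for y
    proof -
      have "0 \<in> {-a<..<a}" using a by auto
      from loc[OF this that] show ?thesis by force
    qed
    fix s y assume s: "s \<in> {-a<..<a}" and y: "y \<in> V"
    from loc[OF s y] obtain b \<rho> Z0 where *: "0 < \<rho>" "s \<in> {-b<..<b}"
      "\<And>s' y'. s' \<in> {-b<..<b} \<Longrightarrow> y' \<in> ball y \<rho> \<Longrightarrow> Z s' y' = Z0 s' y' \<and>
      ((\<lambda>s. Z0 s y') has_vector_derivative frechet_derivative G (at (s', y', u s' y')) (0, v, Z0 s' y')) (at s') \<and>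
      ((\<lambda>h. u s' (y' + h *\<^sub>R v)) has_vector_derivative Z0 s' y') (at 0)"
      by blast
    have yb: "y \<in> ball y \<rho>" using * by simp
    show "((\<lambda>h. u s (y + h *\<^sub>R v)) has_vector_derivative Z s y) (at 0)"
      using *(3)[OF *(2) yb] by simp
    have "((\<lambda>s. Z0 s y) has_vector_derivative frechet_derivative G (at (s, y, u s y)) (0, v, Z s y)) (at s)"
      using *(3)[OF *(2) yb] by simp
    then show "((\<lambda>s. Z s y) has_vector_derivative frechet_derivative G (at (s, y, u s y)) (0, v, Z s y)) (at s)"
      by (rule has_vector_derivative_transform_within_open[OF _ open_greaterThanLessThan *(2)])
        (use *(3) yb in auto)
  qed
qed

text \<open>The parameter derivatives of a solution solve a linear equation of the same shape, over the
  same time interval and with the same Lipschitz constant, so that the order of differentiability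
  can be raised by induction.\<close>

lemma ode_solution_Ck:
  fixes u :: "real \<Rightarrow> 'e::euclidean_space \<Rightarrow> 'f::euclidean_space" and G :: "real \<times> 'e \<times> 'f \<Rightarrow> 'f"
  assumes V: "open V" and a: "0 < a" and L: "0 \<le> L" "4 * a * L \<le> 1"
    and "open W" "Ck_on k G W"
    and "continuous_on ({-a<..<a} \<times> V) (\<lambda>(s, y). u s y)"
    and "\<And>s y. s \<in> {-a<..<a} \<Longrightarrow> y \<in> V \<Longrightarrow> (s, y, u s y) \<in> W"
    and "\<And>y. y \<in> V \<Longrightarrow> u 0 y = 0"
    and "\<And>s y. s \<in> {-a<..<a} \<Longrightarrow> y \<in> V \<Longrightarrow>
      ((\<lambda>s. u s y) has_vector_derivative G (s, y, u s y)) (at s)"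
    and "\<And>s y z z'. (s, y, z) \<in> W \<Longrightarrow> (s, y, z') \<in> W \<Longrightarrow> norm (G (s, y, z) - G (s, y, z')) \<le> L * norm (z - z')"
  shows "Ck_on k (\<lambda>(s, y). u s y) ({-a<..<a} \<times> V)"
  using assms(5-)
proof (induction k arbitrary: G W u)
  case 0
  then show ?case by simp
next
  case (Suc k)
  note W = Suc.prems(1) and G = Suc.prems(2) and cu = Suc.prems(3) and inW = Suc.prems(4)
    and u0 = Suc.prems(5) and ode = Suc.prems(6) and lip = Suc.prems(7)
  let ?\<Omega> = "{-a<..<a} \<times> V"
  let ?D = "\<lambda>s y. frechet_derivative G (at (s, y, u s y))"
  have op: "open ?\<Omega>" using V by (intro open_Times) auto
  have G1: "Ck_on (Suc 0) G W" by (rule Ck_on_le[OF G]) simp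
  have uk: "Ck_on k (\<lambda>(s, y). u s y) ?\<Omega>"
    by (rule Suc.IH[OF W Ck_on_Suc_imp[OF G] cu inW u0 ode lip])
  have Pk: "Ck_on k (\<lambda>(s, y). (s, y, u s y)) ?\<Omega>"
  proof -
    have "Ck_on k (\<lambda>x. (fst x, snd x, (\<lambda>(s, y). u s y) x)) ?\<Omega>"
      by (intro Ck_on_Pair op uk Ck_on_linear bounded_linear_fst bounded_linear_snd)
    then show ?thesis by (simp add: case_prod_beta')
  qed
  have PW: "(\<lambda>(s, y). (s, y, u s y)) ` ?\<Omega> \<subseteq> W" using inW by auto
  have linD: "linear (?D s y)" if "s \<in> {-a<..<a}" "y \<in> V" for s y
    using linear_frechet_derivative[OF G inW[OF that]] .
  have bound: "norm (?D s y (0, 0, z)) \<le> L * norm z" if sy: "s \<in> {-a<..<a}" "y \<in> V" for s y z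
  proof (rule has_derivative_norm_le_lipschitz[OF Ck_on_Suc_has_derivative[OF G inW[OF sy]] W inW[OF sy]])
    fix h assume "(s, y, u s y) + h *\<^sub>R (0, 0, z) \<in> W"
    then show "norm (G ((s, y, u s y) + h *\<^sub>R (0, 0, z)) - G (s, y, u s y)) \<le> L * norm z * \<bar>h\<bar>"
      using lip[of s y "u s y + h *\<^sub>R z" "u s y"] inW[OF sy] by (simp add: mult_ac)
  qed
  have ex: "\<forall>v. \<exists>Z. continuous_on ?\<Omega> (\<lambda>(s, y). Z s y) \<and> (\<forall>y\<in>V. Z 0 y = 0) \<and>
    (\<forall>s\<in>{-a<..<a}. \<forall>y\<in>V.
      ((\<lambda>s. Z s y) has_vector_derivative ?D s y (0, v, Z s y)) (at s) \<and>
      ((\<lambda>h. u s (y + h *\<^sub>R v)) has_vector_derivative Z s y) (at 0))"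
    by (intro allI ode_parameter_derivative[OF V W G1 a cu inW u0 ode bound L])
  obtain Z where Z: "\<And>v. continuous_on ?\<Omega> (\<lambda>(s, y). Z v s y)" "\<And>v y. y \<in> V \<Longrightarrow> Z v 0 y = 0"
    "\<And>v s y. s \<in> {-a<..<a} \<Longrightarrow> y \<in> V \<Longrightarrow> ((\<lambda>s. Z v s y) has_vector_derivative ?D s y (0, v, Z v s y)) (at s)"
    "\<And>v s y. s \<in> {-a<..<a} \<Longrightarrow> y \<in> V \<Longrightarrow> ((\<lambda>h. u s (y + h *\<^sub>R v)) has_vector_derivative Z v s y) (at 0)"
    using choice[OF ex] by blast
  have Zk: "Ck_on k (\<lambda>(s, y). Z v s y) ?\<Omega>" for v
  proof -
    let ?W = "{-a<..<a} \<times> V \<times> (UNIV :: 'f set)"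
    let ?G = "\<lambda>(s, y, z). ?D s y (0, v, z)"
    have opW: "open ?W" using V by (intro open_Times) auto
    have Dk: "Ck_on k (\<lambda>(s, y, z). ?D s y w) ?W" for w
    proof -
      have "Ck_on k (\<lambda>p. frechet_derivative G (at p) w) W" using G by (simp del: split_paired_All)
      from Ck_on_compose[OF op W this Pk PW]
      have 1: "Ck_on k (\<lambda>(s, y). ?D s y w) ?\<Omega>" by (simp add: case_prod_beta')
      have h1: "Ck_on k (\<lambda>x. (fst x, fst (snd x))) ?W"
        by (intro Ck_on_Pair opW Ck_on_linear bounded_linear_fst
            bounded_linear_compose[OF bounded_linear_fst bounded_linear_snd])
      have h2: "(\<lambda>x. (fst x, fst (snd x))) ` ?W \<subseteq> ?\<Omega>" by auto
      from Ck_on_compose[OF opW op 1 h1 h2] show ?thesis by (simp add: case_prod_beta')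
    qed
    have linz: "linear (\<lambda>z. ?D s y (0, 0, z))" if "s \<in> {-a<..<a}" "y \<in> V" for s y
    proof (rule linearI)
      show "?D s y (0, 0, z + z') = ?D s y (0, 0, z) + ?D s y (0, 0, z')" for z z'
        using linear_add[OF linD[OF that], of "(0, 0, z)" "(0, 0, z')"] by simp
      show "?D s y (0, 0, r *\<^sub>R z) = r *\<^sub>R ?D s y (0, 0, z)" for r z
        using linear_cmul[OF linD[OF that], of r "(0, 0, z)"] by simp
    qed
    \<comment> \<open>The right-hand side of the variational equation must be \<open>Ck_on k\<close>
      jointly in time, parameter and \<open>z\<close>; since it is affine in \<open>z\<close>, it is
      expanded in the basis of the \<open>z\<close>-space.\<close>
    have split: "?D s y (0, v, z) = ?D s y (0, v, 0) + ?D s y (0, 0, z)" if "s \<in> {-a<..<a}" "y \<in> V" for s y z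
      using linear_add[OF linD[OF that], of "(0, v, 0)" "(0, 0, z)"] by simp
    have "Ck_on k (\<lambda>x. (\<lambda>(s, y, z). ?D s y (0, v, 0)) x +
        (\<Sum>e\<in>Basis. (snd (snd x) \<bullet> e) *\<^sub>R (\<lambda>(s, y, z). ?D s y (0, 0, e)) x)) ?W"
      by (intro Ck_on_add Ck_on_sum Ck_on_scaleR Ck_on_inner opW Dk Ck_on_const Ck_on_linear
          bounded_linear_compose[OF bounded_linear_snd bounded_linear_snd])
    moreover have "?G x = (\<lambda>(s, y, z). ?D s y (0, v, 0)) x +
        (\<Sum>e\<in>Basis. (snd (snd x) \<bullet> e) *\<^sub>R (\<lambda>(s, y, z). ?D s y (0, 0, e)) x)" if xW: "x \<in> ?W" for x
    proof -
      obtain s y z where x: "x = (s, y, z)" by (cases x)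
      then have sy: "s \<in> {-a<..<a}" "y \<in> V" using xW by auto
      show ?thesis unfolding x using split[OF sy, of z] linear_sum_Basis[OF linz[OF sy], of z] by simp
    qed
    ultimately have Gk: "Ck_on k ?G ?W"
      by (subst Ck_on_cong[OF opW])
    show ?thesis
    proof (rule Suc.IH[OF opW Gk Z(1)])
      show "norm (?G (s, y, z) - ?G (s, y, z')) \<le> L * norm (z - z')"
        if "(s, y, z) \<in> ?W" "(s, y, z') \<in> ?W" for s y z z'
      proof -
        have sy: "s \<in> {-a<..<a}" "y \<in> V" using that by auto
        show ?thesis
          using linear_diff[OF linD[OF sy], of "(0, v, z)" "(0, v, z')"] bound[OF sy, of "z - z'"] by simp
      qed
    qed (use Z in auto)
  qed
  \<comment> \<open>The partial derivatives of the solution: basis vectors of the product with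
    vanishing second part point in the time direction, where the equation itself gives the
    derivative; the others are parameter directions.\<close>
  define E where "E b x = (if snd b = 0 then G (fst x, snd x, u (fst x) (snd x)) else Z (snd b) (fst x) (snd x))"
    for b :: "real \<times> 'e" and x
  have Ek: "Ck_on k (E b) ?\<Omega>" for b
  proof (cases "snd b = 0")
    case True
    from Ck_on_compose[OF op W Ck_on_Suc_imp[OF G] Pk PW]
    show ?thesis using True by (simp add: E_def[abs_def] case_prod_beta')
  next
    case False
    then show ?thesis using Zk by (simp add: E_def[abs_def] case_prod_beta')
  qed
  have der: "((\<lambda>(s, y). u s y) has_derivative (\<lambda>v. \<Sum>b\<in>Basis. (v \<bullet> b) *\<^sub>R E b x)) (at x)" if "x \<in> ?\<Omega>" for x
  proof (rule continuous_partials_imp_has_derivative[OF op that])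
    show "continuous_on ?\<Omega> (E b)" for b using Ek Ck_on_imp_continuous_on by blast
    fix b :: "real \<times> 'e" and x assume b: "b \<in> Basis" and x: "x \<in> ?\<Omega>"
    obtain s y where sy: "x = (s, y)" "s \<in> {-a<..<a}" "y \<in> V" using x by auto
    consider "b = (1, 0)" | e where "b = (0, e)" "e \<in> Basis" using b by (auto simp: Basis_prod_def)
    then show "((\<lambda>h. (\<lambda>(s, y). u s y) (x + h *\<^sub>R b)) has_vector_derivative E b x) (at 0)"
    proof cases
      case 1
      have "((\<lambda>s. u s y) has_vector_derivative G (s, y, u s y)) (at (s + 0))" using ode sy by simp
      moreover have "((\<lambda>h. s + h) has_vector_derivative 1) (at 0)" by (auto intro!: derivative_eq_intros)
      ultimately have "((\<lambda>h. u (s + h) y) has_vector_derivative 1 *\<^sub>R G (s, y, u s y)) (at 0)"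
        using vector_diff_chain_at[of "\<lambda>h. s + h" 1 0 "\<lambda>s. u s y"] by (fastforce simp: o_def)
      then show ?thesis using 1 sy by (simp add: E_def)
    next
      case 2
      then show ?thesis using Z(4)[OF sy(2,3), of e] sy nonzero_Basis by (auto simp: E_def)
    qed
  qed
  show ?case
    by (rule Ck_on_SucI[OF op der], assumption) (intro Ck_on_sum Ck_on_scaleR op Ek Ck_on_const)
qed

section \<open>Local flows and uniqueness\<close>

lemma Ck_on_lipschitz_cball:
  fixes f :: "'a::euclidean_space \<Rightarrow> 'b::real_normed_vector"
  assumes "Ck_on (Suc 0) f U" "cball x r \<subseteq> U"
  obtains L where "0 \<le> L" "\<And>y z. y \<in> cball x r \<Longrightarrow> z \<in> cball x r \<Longrightarrow> norm (f y - f z) \<le> L * norm (y - z)"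
proof -
  let ?D = "\<lambda>x. frechet_derivative f (at x)"
  have "\<exists>M. \<forall>y\<in>cball x r. norm (?D y b) \<le> M" for b
  proof -
    have "continuous_on U (\<lambda>y. ?D y b)" using assms(1) by simp
    then have "continuous_on (cball x r) (\<lambda>y. ?D y b)" using assms(2) continuous_on_subset by blast
    then have "bounded ((\<lambda>y. ?D y b) ` cball x r)" by (intro compact_imp_bounded compact_continuous_image) auto
    then show ?thesis unfolding bounded_iff by auto
  qed
  then obtain M where M: "\<And>b y. y \<in> cball x r \<Longrightarrow> norm (?D y b) \<le> M b" by metis
  define K where "K = (\<Sum>b\<in>Basis. \<bar>M b\<bar>)"
  have K: "norm (?D y b) \<le> K" if "b \<in> Basis" "y \<in> cball x r" for b y
  proof -
    have "\<bar>M b\<bar> \<le> K" unfolding K_def using that by (intro member_le_sum) auto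
    then show ?thesis using M[OF that(2), of b] by linarith
  qed
  let ?L = "real DIM('a) * K"
  show ?thesis
  proof (rule that[of ?L])
    show "0 \<le> ?L" unfolding K_def by (intro mult_nonneg_nonneg sum_nonneg) auto
    fix y z assume yz: "y \<in> cball x r" "z \<in> cball x r"
    show "norm (f y - f z) \<le> ?L * norm (y - z)"
    proof (rule differentiable_bound[OF convex_cball _ _ yz])
      fix w assume w: "w \<in> cball x r"
      then have "w \<in> U" using assms(2) by auto
      show "(f has_derivative ?D w) (at w within cball x r)"
        using Ck_on_Suc_has_derivative[OF assms(1) \<open>w \<in> U\<close>] has_derivative_at_withinI by blast
      show "onorm (?D w) \<le> ?L"
        by (rule onorm_le) (use norm_le_sum_Basis[OF linear_frechet_derivative[OF assms(1) \<open>w \<in> U\<close>]] K w in auto)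
    qed
  qed
qed

text \<open>The field is composed with the projection to a closed ball, which makes it bounded and
  globally Lipschitz, and the solution is written as start point plus displacement. The speed bound
  then keeps solutions in the region where the cut-off is invisible.\<close>

lemma local_flow_exists:
  fixes f :: "'e::euclidean_space \<Rightarrow> 'e"
  assumes U: "open U" and f: "\<And>k. Ck_on k f U" and y0: "y0 \<in> U"
  obtains a r Y where "0 < a" "0 < r" "ball y0 r \<subseteq> U"
    "\<And>s y. s \<in> {-a<..<a} \<Longrightarrow> y \<in> ball y0 r \<Longrightarrow> Y s y \<in> U"
    "\<And>s y. s \<in> {-a<..<a} \<Longrightarrow> y \<in> ball y0 r \<Longrightarrow> ((\<lambda>s. Y s y) has_vector_derivative f (Y s y)) (at s)"
    "\<And>y. y \<in> ball y0 r \<Longrightarrow> Y 0 y = y"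
    "\<And>k. Ck_on k (\<lambda>(s, y). Y s y) ({-a<..<a} \<times> ball y0 r)"
proof -
  obtain R where R: "R > 0" "cball y0 R \<subseteq> U" using U y0 open_contains_cball by blast
  define r where "r = R / 2"
  have r: "r > 0" "R = 2 * r" using R by (auto simp: r_def)
  obtain L where L: "0 \<le> L" "\<And>y z. y \<in> cball y0 R \<Longrightarrow> z \<in> cball y0 R \<Longrightarrow> norm (f y - f z) \<le> L * norm (y - z)"
    using Ck_on_lipschitz_cball[OF f R(2)] by blast
  have "continuous_on (cball y0 R) f" using Ck_on_imp_continuous_on[OF f] R continuous_on_subset by blast
  then have "bounded (f ` cball y0 R)" by (intro compact_imp_bounded compact_continuous_image) auto
  then obtain B where B: "\<And>y. y \<in> cball y0 R \<Longrightarrow> norm (f y) \<le> B" unfolding bounded_iff by blast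
  have "norm (f y0) \<le> B" using B[of y0] R by simp
  then have B0: "0 \<le> B" using norm_ge_zero[of "f y0"] by linarith
  \<comment> \<open>The first term makes the displacement less than \<open>r\<close>, so that
    solutions from the ball of radius \<open>r\<close> stay in that of radius \<open>2 * r\<close>;
    the second gives the condition \<open>4 * a * L \<le> 1\<close> for regularity.\<close>
  define a where "a = min (r / (B + 1)) (1 / (4 * L + 1))"
  have a: "0 < a" using r B0 L by (simp add: a_def)
  have aB: "a * B < r"
  proof -
    have "a * (B + 1) \<le> r / (B + 1) * (B + 1)" using B0 by (intro mult_right_mono) (auto simp: a_def)
    also have "\<dots> = r" using B0 by simp
    finally show ?thesis using B0 a by (simp add: algebra_simps)
  qed
  have aL: "4 * a * L \<le> 1"
  proof -
    have "a * (4 * L + 1) \<le> 1 / (4 * L + 1) * (4 * L + 1)" using L by (intro mult_right_mono) (auto simp: a_def)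
    then show ?thesis using L a by (simp add: algebra_simps)
  qed
  define \<pi> where "\<pi> = closest_point (cball y0 R)"
  have \<pi>: "\<pi> y \<in> cball y0 R" for y unfolding \<pi>_def by (rule closest_point_in_set) (use R in auto)
  have \<pi>id: "\<pi> y = y" if "y \<in> cball y0 R" for y unfolding \<pi>_def using closest_point_self[OF that] .
  have \<pi>lip: "norm (\<pi> y - \<pi> z) \<le> norm (y - z)" for y z
    using closest_point_lipschitz[of "cball y0 R" y z] R by (simp add: \<pi>_def dist_norm)
  define F where "F y = f (\<pi> y)" for y
  have Flip: "norm (F y - F z) \<le> L * norm (y - z)" for y z
    unfolding F_def using L(2)[OF \<pi> \<pi>, of y z] mult_left_mono[OF \<pi>lip[of y z] L(1)] by linarith
  have FB: "norm (F y) \<le> B" for y unfolding F_def using B \<pi> by blast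
  have cF: "continuous_on UNIV F"
    unfolding F_def
    by (rule continuous_on_compose2[OF Ck_on_imp_continuous_on[OF f]])
      (use \<pi> R in \<open>auto simp: \<pi>_def intro!: continuous_on_closest_point\<close>)
  have cG: "continuous_on UNIV (\<lambda>(s::real, y, z). F (y + z))"
    unfolding case_prod_beta' by (rule continuous_on_compose2[OF cF]) (auto intro!: continuous_intros)
  have "0 \<le> a * L" using a L by simp
  then have aL3: "3 * a * L < 1" using aL by simp
  obtain u where u: "continuous_on UNIV (\<lambda>(s, y). u s y)" "\<And>y. u 0 y = 0"
    "\<And>y s. s \<in> {-a<..<a} \<Longrightarrow> ((\<lambda>s. u s y) has_vector_derivative F (y + u s y)) (at s)"
  proof -
    have "norm (F (y + z) - F (y + z')) \<le> L * norm (z - z')" for y z z'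
      using Flip[of "y + z" "y + z'"] by simp
    from picard_parametric[OF a L(1) aL3 cG this FB] obtain u where
      "continuous_on UNIV (\<lambda>(s, y). u s y) \<and> (\<forall>y. u 0 y = 0) \<and>
        (\<forall>y. \<forall>s\<in>{-a<..<a}. ((\<lambda>s. u s y) has_vector_derivative F (y + u s y)) (at s))" ..
    then show ?thesis by (intro that[of u]) simp_all
  qed
  have ub: "norm (u s y) < r" if s: "s \<in> {-a<..<a}" for s y
  proof -
    have "norm (u s y - u 0 y) \<le> B * norm (s - 0)"
    proof (rule differentiable_bound[where S = "{-a<..<a}" and f' = "\<lambda>s h. h *\<^sub>R F (y + u s y)"])
      show "onorm (\<lambda>h::real. h *\<^sub>R F (y + u t y)) \<le> B" for t
      proof (rule onorm_le)
        fix h :: real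
        show "norm (h *\<^sub>R F (y + u t y)) \<le> B * norm h"
          using mult_left_mono[OF FB[of "y + u t y"], of "\<bar>h\<bar>"] by (simp add: mult.commute)
      qed
      show "((\<lambda>s. u s y) has_derivative (\<lambda>h. h *\<^sub>R F (y + u t y))) (at t within {-a<..<a})"
        if "t \<in> {-a<..<a}" for t
        using u(3)[OF that] has_derivative_at_withinI unfolding has_vector_derivative_def by blast
    qed (use s a in auto)
    also have "\<dots> \<le> B * a" using s B0 by (intro mult_left_mono) auto
    finally show ?thesis using u(2) aB by (simp add: mult.commute)
  qed
  define Y where "Y s y = y + u s y" for s y
  have Yb: "Y s y \<in> ball y0 R" if "s \<in> {-a<..<a}" "y \<in> ball y0 r" for s y
  proof -
    have "dist y0 (Y s y) \<le> dist y0 y + norm (u s y)"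
      using dist_triangle[of y0 "y + u s y" y] by (simp add: Y_def dist_norm)
    then show ?thesis using ub[OF that(1), of y] that(2) r by simp
  qed
  have YF: "F (y + u s y) = f (Y s y)" if "s \<in> {-a<..<a}" "y \<in> ball y0 r" for s y
    using \<pi>id Yb[OF that] by (auto simp: F_def Y_def)
  let ?\<Omega> = "{-a<..<a} \<times> ball y0 r"
  have uk: "Ck_on k (\<lambda>(s, y). u s y) ?\<Omega>" for k
  proof -
    \<comment> \<open>Regularity is derived from \<open>f\<close> on the open set where
      \<open>y + z\<close> lies in the ball; the cut-off field \<open>F\<close> is merely
      Lipschitz.\<close>
    let ?W = "(\<lambda>(s::real, y, z). y + z) -` ball y0 R"
    let ?G = "\<lambda>x::real \<times> 'e \<times> 'e. f (fst (snd x) + snd (snd x))"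
    have W: "open ?W"
      by (intro open_vimage) (auto simp: case_prod_beta' intro!: continuous_intros)
    have h: "Ck_on k (\<lambda>x::real \<times> 'e \<times> 'e. fst (snd x) + snd (snd x)) ?W"
      by (intro Ck_on_linear bounded_linear_add
          bounded_linear_compose[OF bounded_linear_fst bounded_linear_snd]
          bounded_linear_compose[OF bounded_linear_snd bounded_linear_snd])
    have "ball y0 R \<subseteq> U" using R by auto
    then have G: "Ck_on k ?G ?W"
      by (intro Ck_on_compose[OF W open_ball Ck_on_subset[OF f] h]) auto
    show ?thesis
    proof (rule ode_solution_Ck[OF open_ball a L(1) aL W G])
      show "continuous_on ?\<Omega> (\<lambda>(s, y). u s y)" using u(1) continuous_on_subset by blast
      show "(s, y, u s y) \<in> ?W" if "s \<in> {-a<..<a}" "y \<in> ball y0 r" for s y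
        using Yb[OF that] by (simp add: Y_def)
      show "((\<lambda>s. u s y) has_vector_derivative ?G (s, y, u s y)) (at s)"
        if "s \<in> {-a<..<a}" "y \<in> ball y0 r" for s y
        using u(3)[OF that(1), of y] YF[OF that] by (simp add: Y_def)
      show "norm (?G (s, y, z) - ?G (s, y, z')) \<le> L * norm (z - z')"
        if "(s, y, z) \<in> ?W" "(s, y, z') \<in> ?W" for s y z z'
        using L(2)[of "y + z" "y + z'"] that by simp
    qed (use u in auto)
  qed
  have op: "open ?\<Omega>" by (intro open_Times) auto
  show ?thesis
  proof (rule that[OF a r(1), of Y])
    show "ball y0 r \<subseteq> U" using R r by auto
    show "Y s y \<in> U" if "s \<in> {-a<..<a}" "y \<in> ball y0 r" for s y using Yb[OF that] R by auto
    show "((\<lambda>s. Y s y) has_vector_derivative f (Y s y)) (at s)"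
      if "s \<in> {-a<..<a}" "y \<in> ball y0 r" for s y
    proof -
      have "((\<lambda>s. y + u s y) has_vector_derivative F (y + u s y)) (at s)"
        using u(3)[OF that(1), of y] by (auto intro!: derivative_eq_intros)
      then show ?thesis using YF[OF that] by (simp add: Y_def)
    qed
    show "Y 0 y = y" for y using u by (simp add: Y_def)
    show "Ck_on k (\<lambda>(s, y). Y s y) ?\<Omega>" for k
    proof -
      have "Ck_on k (\<lambda>x. snd x + (\<lambda>(s, y). u s y) x) ?\<Omega>"
        by (intro Ck_on_add op uk Ck_on_linear bounded_linear_snd)
      then show ?thesis by (simp add: Y_def case_prod_beta')
    qed
  qed
qed

text \<open>The difference starts at zero and its derivative is bounded by \<open>L\<close> times
  itself, so \<open>gronwall_short\<close> with \<eta> = 0 makes it vanish.\<close>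

lemma ode_unique_local:
  fixes f :: "'e::euclidean_space \<Rightarrow> 'e"
  assumes U: "open U" and f: "Ck_on (Suc 0) f U" and x0: "\<alpha> s0 = x0" "\<beta> s0 = x0" "x0 \<in> U" and d: "d > 0"
    and \<alpha>: "\<And>s. \<bar>s - s0\<bar> < d \<Longrightarrow> (\<alpha> has_vector_derivative f (\<alpha> s)) (at s)"
    and \<beta>: "\<And>s. \<bar>s - s0\<bar> < d \<Longrightarrow> (\<beta> has_vector_derivative f (\<beta> s)) (at s)"
  shows "\<exists>d'>0. \<forall>s. \<bar>s - s0\<bar> < d' \<longrightarrow> \<alpha> s = \<beta> s"
proof -
  obtain R where R: "R > 0" "cball x0 R \<subseteq> U" using U x0 open_contains_cball by blast
  obtain L where L: "0 \<le> L" "\<And>y z. y \<in> cball x0 R \<Longrightarrow> z \<in> cball x0 R \<Longrightarrow> norm (f y - f z) \<le> L * norm (y - z)"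
    using Ck_on_lipschitz_cball[OF f R(2)] by blast
  have near: "\<exists>e>0. \<forall>s. \<bar>s - s0\<bar> < e \<longrightarrow> \<gamma> s \<in> cball x0 R"
    if "\<gamma> s0 = x0" "(\<gamma> has_vector_derivative v) (at s0)" for \<gamma> v
  proof -
    have "isCont \<gamma> s0" by (rule has_vector_derivative_continuous[OF that(2)])
    from this[unfolded continuous_at_eps_delta, rule_format, OF R(1)]
    obtain e where e: "e > 0" "\<And>s. \<bar>s - s0\<bar> < e \<Longrightarrow> dist (\<gamma> s) (\<gamma> s0) < R"
      unfolding dist_real_def by blast
    have "\<gamma> s \<in> cball x0 R" if "\<bar>s - s0\<bar> < e" for s
      using e(2)[OF that] \<open>\<gamma> s0 = x0\<close> by (simp add: dist_commute)
    then show ?thesis using e(1) by blast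
  qed
  obtain e1 where e1: "e1 > 0" "\<And>s. \<bar>s - s0\<bar> < e1 \<Longrightarrow> \<alpha> s \<in> cball x0 R"
  proof -
    have "(\<alpha> has_vector_derivative f (\<alpha> s0)) (at s0)" using \<alpha>[of s0] d by simp
    from near[OF x0(1) this] show ?thesis using that by blast
  qed
  obtain e2 where e2: "e2 > 0" "\<And>s. \<bar>s - s0\<bar> < e2 \<Longrightarrow> \<beta> s \<in> cball x0 R"
  proof -
    have "(\<beta> has_vector_derivative f (\<beta> s0)) (at s0)" using \<beta>[of s0] d by simp
    from near[OF x0(2) this] show ?thesis using that by blast
  qed
  define b where "b = min (1 / (2 * L + 1)) (min d (min e1 e2) / 2)"
  have b: "b > 0" "b < d" "b < e1" "b < e2" using L d e1 e2 by (auto simp: b_def)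
  have "b * (2 * L + 1) \<le> 1 / (2 * L + 1) * (2 * L + 1)" using L by (intro mult_right_mono) (auto simp: b_def)
  then have bL: "b * L \<le> 1 / 2" using L b by (simp add: algebra_simps)
  have "\<alpha> s = \<beta> s" if s: "\<bar>s - s0\<bar> < b" for s
  proof -
    define w where "w t = \<alpha> (s0 + t) - \<beta> (s0 + t)" for t
    have sh: "((\<lambda>t. \<gamma> (s0 + t)) has_vector_derivative v) (at t)" if "(\<gamma> has_vector_derivative v) (at (s0 + t))"
      for \<gamma> :: "real \<Rightarrow> 'e" and v t
    proof -
      have "((\<lambda>t. s0 + t) has_vector_derivative 1) (at t)" by (auto intro!: derivative_eq_intros)
      from vector_diff_chain_at[OF this that] show ?thesis by (simp add: o_def)
    qed
    have "norm (w (s - s0)) \<le> 2 * b * 0"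
    proof (rule gronwall_short[where L = L and w' = "\<lambda>t. f (\<alpha> (s0 + t)) - f (\<beta> (s0 + t))"])
      fix t assume t: "t \<in> {-b..b}"
      then have t': "\<bar>s0 + t - s0\<bar> < d" "\<bar>s0 + t - s0\<bar> < e1" "\<bar>s0 + t - s0\<bar> < e2" using b by auto
      show "(w has_vector_derivative f (\<alpha> (s0 + t)) - f (\<beta> (s0 + t))) (at t within {-b..b})"
        unfolding w_def
        by (rule has_vector_derivative_at_within)
          (intro has_vector_derivative_diff sh[OF \<alpha>[OF t'(1)]] sh[OF \<beta>[OF t'(1)]])
      show "norm (f (\<alpha> (s0 + t)) - f (\<beta> (s0 + t))) \<le> L * norm (w t) + 0"
        using L(2)[OF e1(2)[OF t'(2)] e2(2)[OF t'(3)]] by (simp add: w_def)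
    qed (use b bL L s x0 in \<open>auto simp: w_def\<close>)
    then show ?thesis by (simp add: w_def)
  qed
  then show ?thesis using b by blast
qed

section \<open>The flow of a vector field on a compact manifold\<close>

lemma Ck_on_compose_preimage:
  fixes g :: "'a::real_normed_vector \<Rightarrow> 'b::euclidean_space"
  assumes "open U" "open V" "Ck_on k f V" "Ck_on k g U"
  shows "Ck_on k (\<lambda>x. f (g x)) (U \<inter> g -` V)"
proof -
  have "open (U \<inter> g -` V)"
    using continuous_open_preimage[OF Ck_on_imp_continuous_on[OF assms(4)] assms(1,2)] .
  then show ?thesis
    by (rule Ck_on_compose[OF _ assms(2,3) Ck_on_subset[OF assms(4)]]) auto
qed

lemma open_preimage_Ck_on:
  assumes "open U" "open V" "Ck_on k g U"
  shows "open (U \<inter> g -` V)"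
  using continuous_open_preimage[OF Ck_on_imp_continuous_on[OF assms(3)] assms(1,2)] .

lemma has_vector_derivative_shift:
  assumes "(\<gamma> has_vector_derivative v) (at (s + t))"
  shows "((\<lambda>r. \<gamma> (r + t)) has_vector_derivative v) (at s)"
proof -
  have "((\<lambda>r. r + t) has_vector_derivative 1) (at s)" by (auto intro!: derivative_eq_intros)
  from vector_diff_chain_at[OF this assms] show ?thesis by (simp add: o_def)
qed

section \<open>Charts and transition maps\<close>

locale smooth_manifold =
  fixes A :: "('m::{t2_space, second_countable_topology}, 'n::finite) chart set"
  assumes atlas: "smooth_atlas A"
begin

lemma chart_exists: "\<exists>c\<in>A. p \<in> fst c"
  using atlas unfolding smooth_atlas_def by blast

lemma open_chart_dom: "c \<in> A \<Longrightarrow> open (fst c)"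
  and open_chart_img: "c \<in> A \<Longrightarrow> open (chart_img c)"
  and chart_homeo: "c \<in> A \<Longrightarrow> homeomorphism (fst c) (chart_img c) (snd c) (chart_inv c)"
  using atlas unfolding smooth_atlas_def by blast+

lemma chart_inv_left: "c \<in> A \<Longrightarrow> p \<in> fst c \<Longrightarrow> chart_inv c (snd c p) = p"
  by (rule homeomorphism_apply1[OF chart_homeo])

lemma chart_inv_right: "c \<in> A \<Longrightarrow> y \<in> chart_img c \<Longrightarrow> snd c (chart_inv c y) = y"
  by (rule homeomorphism_apply2[OF chart_homeo])

lemma chart_inv_in: "c \<in> A \<Longrightarrow> y \<in> chart_img c \<Longrightarrow> chart_inv c y \<in> fst c"
  using homeomorphism_image2[OF chart_homeo] by blast

lemma chart_in: "p \<in> fst c \<Longrightarrow> snd c p \<in> chart_img c"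
  unfolding chart_img_def by (rule imageI)

lemma chart_continuous: "c \<in> A \<Longrightarrow> continuous_on (fst c) (snd c)"
  by (rule homeomorphism_cont1[OF chart_homeo])

lemma chart_inv_continuous: "c \<in> A \<Longrightarrow> continuous_on (chart_img c) (chart_inv c)"
  by (rule homeomorphism_cont2[OF chart_homeo])

lemma isCont_chart_inv: "c \<in> A \<Longrightarrow> y \<in> chart_img c \<Longrightarrow> isCont (chart_inv c) y"
  by (rule continuous_on_interior[OF chart_inv_continuous]) (simp_all add: open_chart_img interior_open)

lemma image_chart_eq:
  assumes c: "c \<in> A" and V: "V \<subseteq> fst c"
  shows "snd c ` V = chart_img c \<inter> chart_inv c -` V"
proof (intro set_eqI iffI)
  fix y assume "y \<in> snd c ` V"
  then obtain p where p: "p \<in> V" "y = snd c p" by blast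
  have pc: "p \<in> fst c" using p V by blast
  show "y \<in> chart_img c \<inter> chart_inv c -` V"
    using p chart_inv_left[OF c pc] chart_in[OF pc] by simp
next
  fix y assume y: "y \<in> chart_img c \<inter> chart_inv c -` V"
  have "y = snd c (chart_inv c y)" using chart_inv_right[OF c, of y] y by simp
  then show "y \<in> snd c ` V" by (rule image_eqI) (use y in simp)
qed

lemma image_chart_inv_eq:
  assumes c: "c \<in> A" and V: "V \<subseteq> chart_img c"
  shows "chart_inv c ` V = fst c \<inter> snd c -` V"
proof (intro set_eqI iffI)
  fix p assume "p \<in> chart_inv c ` V"
  then obtain y where y: "y \<in> V" "p = chart_inv c y" by blast
  have yc: "y \<in> chart_img c" using y V by blast
  show "p \<in> fst c \<inter> snd c -` V"
    using y chart_inv_right[OF c yc] chart_inv_in[OF c yc] by simp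
next
  fix p assume p: "p \<in> fst c \<inter> snd c -` V"
  have "p = chart_inv c (snd c p)" using chart_inv_left[OF c, of p] p by simp
  then show "p \<in> chart_inv c ` V" by (rule image_eqI) (use p in simp)
qed

lemma open_chart_image: "c \<in> A \<Longrightarrow> open V \<Longrightarrow> V \<subseteq> fst c \<Longrightarrow> open (snd c ` V)"
  unfolding image_chart_eq by (rule continuous_open_preimage[OF chart_inv_continuous open_chart_img])

lemma open_chart_inv_image: "c \<in> A \<Longrightarrow> open V \<Longrightarrow> V \<subseteq> chart_img c \<Longrightarrow> open (chart_inv c ` V)"
  unfolding image_chart_inv_eq by (rule continuous_open_preimage[OF chart_continuous open_chart_dom])

abbreviation overlap :: "('m, 'n) chart \<Rightarrow> ('m, 'n) chart \<Rightarrow> (real ^ 'n) set" where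
  "overlap c c' \<equiv> snd c ` (fst c \<inter> fst c')"

lemma overlap_iff: "c \<in> A \<Longrightarrow> y \<in> overlap c c' \<longleftrightarrow> y \<in> chart_img c \<and> chart_inv c y \<in> fst c'"
  using image_chart_eq[of c "fst c \<inter> fst c'"] chart_inv_in[of c y] by auto

lemma open_overlap: "c \<in> A \<Longrightarrow> c' \<in> A \<Longrightarrow> open (overlap c c')"
  by (rule open_chart_image) (simp_all add: open_Int open_chart_dom)

lemma Ck_on_transition:
  assumes "c \<in> A" "c' \<in> A"
  shows "Ck_on k (\<lambda>y. snd c' (chart_inv c y)) (overlap c c')"
proof -
  have "smooth_on (overlap c c') (snd c' \<circ> chart_inv c)"
    using atlas assms unfolding smooth_atlas_def by blast
  then have "\<forall>k. Ck_on k (snd c' \<circ> chart_inv c) (overlap c c')"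
    using smooth_on_open[OF open_overlap[OF assms]] by blast
  then show ?thesis by (simp add: o_def)
qed

end

section \<open>Integral curves\<close>

locale manifold_vector_field = smooth_manifold A
  for A :: "('m::{t2_space, second_countable_topology}, 'n::finite) chart set" +
  fixes X :: "('m, 'n) chart \<Rightarrow> real ^ 'n \<Rightarrow> real ^ 'n"
  assumes vf: "vector_field A X"
begin

lemma Ck_on_vf: "c \<in> A \<Longrightarrow> Ck_on k (X c) (chart_img c)"
  using vf smooth_on_open[OF open_chart_img] unfolding vector_field_def by blast

lemma vf_transition:
  assumes "c \<in> A" "c' \<in> A" "y \<in> overlap c c'"
  shows "X c' (snd c' (chart_inv c y)) = frechet_derivative (\<lambda>y. snd c' (chart_inv c y)) (at y) (X c y)"
proof -
  have "X c' ((snd c' \<circ> chart_inv c) y) = frechet_derivative (snd c' \<circ> chart_inv c) (at y) (X c y)"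
    using vf assms unfolding vector_field_def by blast
  then show ?thesis by (simp add: o_def)
qed

text \<open>A condition at a single instant, so that curves on different intervals can be glued.
  Continuity is demanded separately because the coordinate map says nothing about points outside its
  domain.\<close>

definition icurve_at :: "(real \<Rightarrow> 'm) \<Rightarrow> real \<Rightarrow> bool" where
  "icurve_at \<gamma> s \<longleftrightarrow> isCont \<gamma> s \<and>
    (\<exists>c\<in>A. \<gamma> s \<in> fst c \<and> ((\<lambda>r. snd c (\<gamma> r)) has_vector_derivative X c (snd c (\<gamma> s))) (at s))"

lemma eventually_in_dom:
  fixes \<gamma> :: "real \<Rightarrow> 'm"
  assumes "isCont \<gamma> s" "c \<in> A" "\<gamma> s \<in> fst c"
  shows "\<exists>d>0. \<forall>r. \<bar>r - s\<bar> < d \<longrightarrow> \<gamma> r \<in> fst c"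
proof -
  have "\<forall>\<^sub>F r in nhds s. \<gamma> r \<in> fst c"
    using assms(1) open_chart_dom[OF assms(2)] assms(3)
    unfolding isCont_def tendsto_at_iff_tendsto_nhds by (rule topological_tendstoD)
  then show ?thesis by (simp add: eventually_nhds_metric dist_real_def)
qed

text \<open>The transformation law of a vector field is the chain rule for the transition map, so
  one chart is as good as another.\<close>

lemma icurve_at_chart:
  assumes "icurve_at \<gamma> s" "c' \<in> A" "\<gamma> s \<in> fst c'"
  shows "((\<lambda>r. snd c' (\<gamma> r)) has_vector_derivative X c' (snd c' (\<gamma> s))) (at s)"
proof -
  obtain c where c: "c \<in> A" "\<gamma> s \<in> fst c" "((\<lambda>r. snd c (\<gamma> r)) has_vector_derivative X c (snd c (\<gamma> s))) (at s)"
    and ct: "isCont \<gamma> s"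
    using assms(1) unfolding icurve_at_def by blast
  obtain d where d: "d > 0" "\<And>r. \<bar>r - s\<bar> < d \<Longrightarrow> \<gamma> r \<in> fst c"
    using eventually_in_dom[OF ct c(1,2)] by blast
  let ?y = "snd c (\<gamma> s)"
  let ?T = "\<lambda>y. snd c' (chart_inv c y)"
  have y: "?y \<in> overlap c c'" using c(2) assms(3) by blast
  have "(?T has_derivative frechet_derivative ?T (at ?y)) (at ?y)"
    using Ck_on_Suc_has_derivative[OF Ck_on_transition[OF c(1) assms(2), of "Suc 0"] y] .
  from has_derivative_compose[OF c(3)[unfolded has_vector_derivative_def] this]
  have "((\<lambda>r. ?T (snd c (\<gamma> r))) has_derivative (\<lambda>h. frechet_derivative ?T (at ?y) (h *\<^sub>R X c ?y))) (at s)" .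
  moreover have "linear (frechet_derivative ?T (at ?y))"
    using linear_frechet_derivative[OF Ck_on_transition[OF c(1) assms(2), of "Suc 0"] y] .
  ultimately have "((\<lambda>r. ?T (snd c (\<gamma> r))) has_vector_derivative frechet_derivative ?T (at ?y) (X c ?y)) (at s)"
    unfolding has_vector_derivative_def by (simp add: linear_cmul)
  moreover have "frechet_derivative ?T (at ?y) (X c ?y) = X c' (snd c' (\<gamma> s))"
    using vf_transition[OF c(1) assms(2) y] chart_inv_left[OF c(1,2)] by simp
  ultimately have "((\<lambda>r. ?T (snd c (\<gamma> r))) has_vector_derivative X c' (snd c' (\<gamma> s))) (at s)" by simp
  then show ?thesis
  proof (rule has_vector_derivative_transform_within_open[where S = "ball s d"])
    fix r assume "r \<in> ball s d"
    then have "\<gamma> r \<in> fst c" using d(2) by (simp add: dist_real_def abs_minus_commute)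
    then show "?T (snd c (\<gamma> r)) = snd c' (\<gamma> r)" using chart_inv_left[OF c(1)] by simp
  qed (use d in auto)
qed

lemma icurve_at_cong:
  assumes "icurve_at \<gamma> s" "open S" "s \<in> S" "\<And>r. r \<in> S \<Longrightarrow> \<gamma> r = \<delta> r"
  shows "icurve_at \<delta> s"
proof -
  obtain c where c: "c \<in> A" "\<gamma> s \<in> fst c" "((\<lambda>r. snd c (\<gamma> r)) has_vector_derivative X c (snd c (\<gamma> s))) (at s)"
    and ct: "isCont \<gamma> s"
    using assms(1) unfolding icurve_at_def by blast
  have e: "\<forall>\<^sub>F r in nhds s. \<gamma> r = \<delta> r"
    unfolding eventually_nhds using assms(2-4) by blast
  have "isCont \<delta> s" using ct isCont_cong[OF e] by blast
  moreover have "((\<lambda>r. snd c (\<delta> r)) has_vector_derivative X c (snd c (\<gamma> s))) (at s)"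
    by (rule has_vector_derivative_transform_within_open[OF c(3) assms(2,3)]) (simp add: assms(4))
  ultimately show ?thesis
    unfolding icurve_at_def using c(1,2) assms(4)[OF assms(3)] by auto
qed

lemma icurve_at_shift:
  assumes "icurve_at \<gamma> (s + t)"
  shows "icurve_at (\<lambda>r. \<gamma> (r + t)) s"
proof -
  obtain c where c: "c \<in> A" "\<gamma> (s + t) \<in> fst c"
    "((\<lambda>r. snd c (\<gamma> r)) has_vector_derivative X c (snd c (\<gamma> (s + t)))) (at (s + t))"
    and ct: "isCont \<gamma> (s + t)"
    using assms unfolding icurve_at_def by blast
  have "isCont (\<lambda>r. \<gamma> (r + t)) s"
    using isCont_o2[of s "\<lambda>r. r + t" \<gamma>] ct by simp
  then show ?thesis
    unfolding icurve_at_def using c(1,2) has_vector_derivative_shift[OF c(3)] by blast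
qed

lemma icurve_unique_local:
  assumes \<alpha>: "\<And>r. r \<in> J \<Longrightarrow> icurve_at \<alpha> r" and \<beta>: "\<And>r. r \<in> J \<Longrightarrow> icurve_at \<beta> r"
    and J: "open J" "s \<in> J" and eq: "\<alpha> s = \<beta> s"
  shows "\<exists>d>0. \<forall>r. \<bar>r - s\<bar> < d \<longrightarrow> \<alpha> r = \<beta> r"
proof -
  obtain c where c: "c \<in> A" "\<alpha> s \<in> fst c" using chart_exists by blast
  obtain d0 where d0: "d0 > 0" "ball s d0 \<subseteq> J" using J open_contains_ball by blast
  have ct: "isCont \<alpha> s" "isCont \<beta> s" using \<alpha>[OF J(2)] \<beta>[OF J(2)] unfolding icurve_at_def by auto
  obtain d1 where d1: "d1 > 0" "\<And>r. \<bar>r - s\<bar> < d1 \<Longrightarrow> \<alpha> r \<in> fst c"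
    using eventually_in_dom[OF ct(1) c] by blast
  obtain d2 where d2: "d2 > 0" "\<And>r. \<bar>r - s\<bar> < d2 \<Longrightarrow> \<beta> r \<in> fst c"
    using eventually_in_dom[OF ct(2) c(1)] c(2) unfolding eq by blast
  define d where "d = min d0 (min d1 d2)"
  have d: "d > 0" "\<And>r. \<bar>r - s\<bar> < d \<Longrightarrow> \<alpha> r \<in> fst c" "\<And>r. \<bar>r - s\<bar> < d \<Longrightarrow> \<beta> r \<in> fst c"
    using d0(1) d1 d2 by (simp_all add: d_def)
  have dJ: "r \<in> J" if "\<bar>r - s\<bar> < d" for r
  proof -
    have "r \<in> ball s d0" using that by (simp add: d_def dist_real_def abs_minus_commute)
    then show ?thesis using d0(2) by blast
  qed
  have "\<exists>d'>0. \<forall>r. \<bar>r - s\<bar> < d' \<longrightarrow> snd c (\<alpha> r) = snd c (\<beta> r)"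
  proof (rule ode_unique_local[OF open_chart_img[OF c(1)] Ck_on_vf[OF c(1)], where ?d = d])
    show "snd c (\<alpha> s) = snd c (\<alpha> s)" "snd c (\<beta> s) = snd c (\<alpha> s)" "snd c (\<alpha> s) \<in> chart_img c" "d > 0"
      using eq chart_in[OF c(2)] d(1) by simp_all
    show "((\<lambda>r. snd c (\<alpha> r)) has_vector_derivative X c (snd c (\<alpha> r))) (at r)" if "\<bar>r - s\<bar> < d" for r
      using icurve_at_chart[OF \<alpha>[OF dJ[OF that]] c(1) d(2)[OF that]] .
    show "((\<lambda>r. snd c (\<beta> r)) has_vector_derivative X c (snd c (\<beta> r))) (at r)" if "\<bar>r - s\<bar> < d" for r
      using icurve_at_chart[OF \<beta>[OF dJ[OF that]] c(1) d(3)[OF that]] .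
  qed
  then obtain d' where d': "d' > 0" "\<And>r. \<bar>r - s\<bar> < d' \<Longrightarrow> snd c (\<alpha> r) = snd c (\<beta> r)" by blast
  have "\<alpha> r = \<beta> r" if "\<bar>r - s\<bar> < min d d'" for r
  proof -
    have r: "\<bar>r - s\<bar> < d" "\<bar>r - s\<bar> < d'" using that by auto
    have "\<alpha> r = chart_inv c (snd c (\<alpha> r))" by (rule chart_inv_left[OF c(1) d(2)[OF r(1)], symmetric])
    also have "\<dots> = chart_inv c (snd c (\<beta> r))" by (simp only: d'(2)[OF r(2)])
    also have "\<dots> = \<beta> r" by (rule chart_inv_left[OF c(1) d(3)[OF r(1)]])
    finally show ?thesis .
  qed
  then show ?thesis using d(1) d'(1) by (intro exI[of _ "min d d'"]) auto
qed

text \<open>The set of agreement is open by local uniqueness, and its complement is open because the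
  space is Hausdorff; an interval admits no such splitting.\<close>

lemma icurve_unique:
  assumes \<alpha>: "\<And>r. r \<in> J \<Longrightarrow> icurve_at \<alpha> r" and \<beta>: "\<And>r. r \<in> J \<Longrightarrow> icurve_at \<beta> r"
    and J: "open J" "connected J" "s0 \<in> J" and eq: "\<alpha> s0 = \<beta> s0" and s: "s \<in> J"
  shows "\<alpha> s = \<beta> s"
proof (rule ccontr)
  assume ne: "\<alpha> s \<noteq> \<beta> s"
  let ?S = "{r \<in> J. \<alpha> r = \<beta> r}" and ?N = "{r \<in> J. \<alpha> r \<noteq> \<beta> r}"
  have S: "open ?S"
  proof (subst open_contains_ball, rule ballI)
    fix r assume r: "r \<in> ?S"
    then have rJ: "r \<in> J" and re: "\<alpha> r = \<beta> r" by auto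
    obtain d where d: "d > 0" "\<And>q. \<bar>q - r\<bar> < d \<Longrightarrow> \<alpha> q = \<beta> q"
      using icurve_unique_local[of J \<alpha> \<beta>, OF \<alpha> \<beta> J(1) rJ re] by blast
    obtain d0 where d0: "d0 > 0" "ball r d0 \<subseteq> J" using J(1) rJ open_contains_ball by blast
    have "ball r (min d d0) \<subseteq> ?S"
    proof
      fix q assume q: "q \<in> ball r (min d d0)"
      then have "q \<in> ball r d0" "\<bar>q - r\<bar> < d" by (simp_all add: dist_real_def abs_minus_commute)
      then show "q \<in> ?S" using d(2) d0(2) by blast
    qed
    then show "\<exists>e>0. ball r e \<subseteq> ?S" using d(1) d0(1) by (intro exI[of _ "min d d0"]) simp
  qed
  have N: "open ?N"
  proof (subst open_subopen, rule ballI)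
    fix r assume "r \<in> ?N"
    then have rJ: "r \<in> J" and rn: "\<alpha> r \<noteq> \<beta> r" by auto
    have ct: "isCont \<alpha> r" "isCont \<beta> r" using \<alpha>[OF rJ] \<beta>[OF rJ] unfolding icurve_at_def by auto
    obtain U V where UV: "open U" "open V" "\<alpha> r \<in> U" "\<beta> r \<in> V" "U \<inter> V = {}"
      using hausdorff[OF rn] by blast
    have "\<forall>\<^sub>F q in nhds r. \<alpha> q \<in> U"
      using topological_tendstoD[OF ct(1)[unfolded isCont_def tendsto_at_iff_tendsto_nhds] UV(1,3)] .
    moreover have "\<forall>\<^sub>F q in nhds r. \<beta> q \<in> V"
      using topological_tendstoD[OF ct(2)[unfolded isCont_def tendsto_at_iff_tendsto_nhds] UV(2,4)] .
    moreover have "\<forall>\<^sub>F q in nhds r. q \<in> J" by (rule eventually_nhds_in_open[OF J(1) rJ])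
    ultimately have "\<forall>\<^sub>F q in nhds r. q \<in> ?N"
      by eventually_elim (use UV(5) in auto)
    then show "\<exists>T. open T \<and> r \<in> T \<and> T \<subseteq> ?N" unfolding eventually_nhds by blast
  qed
  have "?S \<inter> J = {} \<or> ?N \<inter> J = {}"
    by (rule connectedD[OF J(2) S N]) auto
  moreover have "s0 \<in> ?S \<inter> J" "s \<in> ?N \<inter> J" using J(3) eq s ne by simp_all
  ultimately show False by blast
qed

text \<open>The intersection of two intervals is an interval, so agreement at one time spreads over
  the entire overlap.\<close>

lemma icurve_glue:
  assumes \<alpha>: "\<And>r. r \<in> I \<Longrightarrow> icurve_at \<alpha> r" and \<beta>: "\<And>r. r \<in> J \<Longrightarrow> icurve_at \<beta> r"
    and I: "open I" "connected I" and J: "open J" "connected J"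
    and s: "s0 \<in> I" "s0 \<in> J" "\<alpha> s0 = \<beta> s0"
  shows "\<exists>\<gamma>. (\<forall>r\<in>I \<union> J. icurve_at \<gamma> r) \<and> (\<forall>r\<in>I. \<gamma> r = \<alpha> r)"
proof (intro exI[of _ "\<lambda>r. if r \<in> I then \<alpha> r else \<beta> r"] conjI ballI)
  have IJ: "connected (I \<inter> J)" using I J by (simp add: is_interval_connected_1[symmetric] is_interval_Int)
  have agree: "\<alpha> r = \<beta> r" if "r \<in> I" "r \<in> J" for r
    by (rule icurve_unique[of "I \<inter> J" \<alpha> \<beta> s0 r]) (use \<alpha> \<beta> I J s IJ that in auto)
  fix r assume r: "r \<in> I \<union> J"
  show "icurve_at (\<lambda>r. if r \<in> I then \<alpha> r else \<beta> r) r"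
  proof (cases "r \<in> I")
    case True
    show ?thesis by (rule icurve_at_cong[OF \<alpha>[OF True] I(1) True]) simp
  next
    case False
    then have rJ: "r \<in> J" using r by auto
    show ?thesis by (rule icurve_at_cong[OF \<beta>[OF rJ] J(1) rJ]) (simp add: agree)
  qed
qed auto

section \<open>Flow boxes\<close>

definition flow_box :: "real \<Rightarrow> ('m, 'n) chart \<Rightarrow> 'm set \<Rightarrow> (real \<Rightarrow> real ^ 'n \<Rightarrow> real ^ 'n) \<Rightarrow> bool" where
  "flow_box a c V Y \<longleftrightarrow> c \<in> A \<and> open V \<and> V \<subseteq> fst c \<and>
    (\<forall>k. Ck_on k (\<lambda>(s, y). Y s y) ({-a<..<a} \<times> snd c ` V)) \<and>
    (\<forall>s\<in>{-a<..<a}. \<forall>y\<in>snd c ` V. Y s y \<in> chart_img c \<and> Y 0 y = y \<and>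
      ((\<lambda>s. Y s y) has_vector_derivative X c (Y s y)) (at s))"

lemma flow_box_exists: "\<exists>a>0. \<exists>c V Y. p \<in> V \<and> flow_box a c V Y"
proof -
  obtain c where c: "c \<in> A" "p \<in> fst c" using chart_exists by blast
  obtain a r Y where *: "0 < a" "0 < r" "ball (snd c p) r \<subseteq> chart_img c"
    "\<And>s y. s \<in> {-a<..<a} \<Longrightarrow> y \<in> ball (snd c p) r \<Longrightarrow> Y s y \<in> chart_img c"
    "\<And>s y. s \<in> {-a<..<a} \<Longrightarrow> y \<in> ball (snd c p) r \<Longrightarrow> ((\<lambda>s. Y s y) has_vector_derivative X c (Y s y)) (at s)"
    "\<And>y. y \<in> ball (snd c p) r \<Longrightarrow> Y 0 y = y"
    "\<And>k. Ck_on k (\<lambda>(s, y). Y s y) ({-a<..<a} \<times> ball (snd c p) r)"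
    using local_flow_exists[OF open_chart_img[OF c(1)] Ck_on_vf[OF c(1)] chart_in[OF c(2)]] by metis
  let ?V = "chart_inv c ` ball (snd c p) r"
  have im: "snd c ` ?V = ball (snd c p) r"
    using chart_inv_right[OF c(1)] *(3) by (force simp: image_image)
  have "p = chart_inv c (snd c p)" using chart_inv_left[OF c] by simp
  then have "p \<in> ?V" using *(2) by (intro image_eqI[where x = "snd c p"]) auto
  moreover have "flow_box a c ?V Y"
    unfolding flow_box_def im using * c open_chart_inv_image[OF c(1) open_ball *(3)] chart_inv_in[OF c(1)]
    by blast
  ultimately show ?thesis using *(1) by blast
qed

lemma flow_box_mono:
  assumes "flow_box a c V Y" "b \<le> a"
  shows "flow_box b c V Y"
proof -
  have "{-b<..<b} \<times> snd c ` V \<subseteq> {-a<..<a} \<times> snd c ` V" "{-b<..<b} \<subseteq> {-a<..<a}" using assms(2) by auto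
  then show ?thesis using assms(1) Ck_on_subset unfolding flow_box_def by blast
qed

text \<open>Compactness turns local lifetimes into one common lifetime. This is what lets every
  integral curve be continued forever.\<close>

lemma uniform_flow_box:
  assumes "compact (UNIV :: 'm set)"
  shows "\<exists>\<epsilon>>0. \<forall>p. \<exists>c V Y. p \<in> V \<and> flow_box \<epsilon> c V Y"
proof -
  have "\<forall>p. \<exists>a. \<exists>V. a > 0 \<and> p \<in> V \<and> (\<exists>c Y. flow_box a c V Y)"
  proof
    fix p
    obtain a c V Y where "a > 0" "p \<in> V" "flow_box a c V Y" using flow_box_exists by blast
    then show "\<exists>a. \<exists>V. a > 0 \<and> p \<in> V \<and> (\<exists>c Y. flow_box a c V Y)" by (intro exI conjI)
  qed
  from choice[OF this] obtain a where "\<forall>p. \<exists>V. a p > 0 \<and> p \<in> V \<and> (\<exists>c Y. flow_box (a p) c V Y)" ..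
  from choice[OF this] obtain W where aW: "\<forall>p. a p > 0 \<and> p \<in> W p \<and> (\<exists>c Y. flow_box (a p) c (W p) Y)" ..
  have a0: "a p > 0" and pW: "p \<in> W p" and box: "\<exists>c Y. flow_box (a p) c (W p) Y" for p
    using aW[rule_format, of p] by simp_all
  have oW: "open (W p)" for p
    using box[of p] unfolding flow_box_def by (elim exE conjE)
  have cov: "UNIV \<subseteq> (\<Union>p\<in>UNIV. W p)" using pW by (intro subsetI UN_I) simp_all
  from compactE_image[OF assms, of UNIV W, OF oW cov]
  obtain F where F: "finite F" "UNIV \<subseteq> (\<Union>p\<in>F. W p)" .
  define e where "e = Min (insert 1 (a ` F))"
  have fin: "finite (insert 1 (a ` F))" using F(1) by simp
  have epos: "e > 0"
    unfolding e_def by (subst Min_gr_iff[OF fin]) (use a0 in auto)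
  have le: "e \<le> a p" if "p \<in> F" for p
    unfolding e_def by (rule Min_le[OF fin]) (use that in simp)
  have "\<exists>c V Y. p \<in> V \<and> flow_box e c V Y" for p
  proof -
    have "p \<in> (\<Union>p\<in>F. W p)" using F(2) by (rule subsetD) simp
    then obtain q where q: "q \<in> F" "p \<in> W q" by (rule UN_E)
    from box[of q] obtain c Y where "flow_box (a q) c (W q) Y" by (elim exE)
    from flow_box_mono[OF this le[OF q(1)]] show ?thesis using q(2) by (intro exI conjI)
  qed
  then show ?thesis using epos by (intro exI[of _ e] conjI allI)
qed

lemma flow_box_icurve:
  assumes fb: "flow_box a c V Y" and p: "p \<in> V" and s: "s \<in> {-a<..<a}"
  shows "icurve_at (\<lambda>s. chart_inv c (Y s (snd c p))) s"
proof -
  let ?y = "snd c p"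
  have c: "c \<in> A" and y: "?y \<in> snd c ` V" using fb p unfolding flow_box_def by auto
  have img: "Y r ?y \<in> chart_img c" if "r \<in> {-a<..<a}" for r using fb y that unfolding flow_box_def by blast
  have der: "((\<lambda>s. Y s ?y) has_vector_derivative X c (Y s ?y)) (at s)" using fb y s unfolding flow_box_def by blast
  have "isCont (\<lambda>s. Y s ?y) s" by (rule has_vector_derivative_continuous[OF der])
  from isCont_o2[OF this isCont_chart_inv[OF c img[OF s]]]
  have "isCont (\<lambda>s. chart_inv c (Y s ?y)) s" .
  moreover have "((\<lambda>r. snd c (chart_inv c (Y r ?y))) has_vector_derivative X c (Y s ?y)) (at s)"
    by (rule has_vector_derivative_transform_within_open[OF der open_greaterThanLessThan s])
      (use img chart_inv_right[OF c] in auto)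
  ultimately show ?thesis
    unfolding icurve_at_def using c chart_inv_in[OF c img[OF s]] chart_inv_right[OF c img[OF s]] by auto
qed

end

section \<open>The complete flow on a compact manifold\<close>

locale compact_vector_field = manifold_vector_field A X
  for A :: "('m::{t2_space, second_countable_topology}, 'n::finite) chart set"
    and X :: "('m, 'n) chart \<Rightarrow> real ^ 'n \<Rightarrow> real ^ 'n" +
  assumes compact_M: "compact (UNIV :: 'm set)"
begin

definition \<epsilon> :: real where
  "\<epsilon> = (SOME e. e > 0 \<and> (\<forall>p. \<exists>c V Y. p \<in> V \<and> flow_box e c V Y))"

lemma eps_pos: "\<epsilon> > 0" and eps_box: "\<exists>c V Y. p \<in> V \<and> flow_box \<epsilon> c V Y"
  using someI_ex[OF uniform_flow_box[OF compact_M]] unfolding \<epsilon>_def by blast+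

lemma short_curve: "\<exists>\<gamma>. (\<forall>r\<in>{-\<epsilon><..<\<epsilon>}. icurve_at \<gamma> r) \<and> \<gamma> 0 = p"
proof -
  obtain c V Y where fb: "p \<in> V" "flow_box \<epsilon> c V Y" using eps_box by blast
  have c: "c \<in> A" "p \<in> fst c" and "snd c p \<in> snd c ` V" "0 \<in> {-\<epsilon><..<\<epsilon>}"
    using fb eps_pos unfolding flow_box_def by auto
  then have "Y 0 (snd c p) = snd c p" using fb(2) unfolding flow_box_def by blast
  then show ?thesis
    using flow_box_icurve[OF fb(2,1)] chart_inv_left[OF c]
    by (intro exI[of _ "\<lambda>s. chart_inv c (Y s (snd c p))"]) auto
qed

lemma short_curve_shifted: "\<exists>\<gamma>. (\<forall>r\<in>{t-\<epsilon><..<t+\<epsilon>}. icurve_at \<gamma> r) \<and> \<gamma> t = p"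
proof -
  obtain \<gamma> where \<gamma>: "\<And>r. r \<in> {-\<epsilon><..<\<epsilon>} \<Longrightarrow> icurve_at \<gamma> r" "\<gamma> 0 = p" using short_curve by blast
  show ?thesis
  proof (intro exI[of _ "\<lambda>r. \<gamma> (r + (-t))"] conjI ballI icurve_at_shift)
    fix r assume "r \<in> {t-\<epsilon><..<t+\<epsilon>}"
    then show "icurve_at \<gamma> (r + - t)" by (intro \<gamma>(1)) auto
  qed (use \<gamma> in auto)
qed

text \<open>Every step glues a fresh curve of lifetime \<epsilon> to each end, and gains
  \<epsilon>/2 on both sides.\<close>

lemma long_curve:
  "\<exists>\<gamma>. (\<forall>r\<in>{-(\<epsilon>/2 * (real n + 1))<..<\<epsilon>/2 * (real n + 1)}. icurve_at \<gamma> r) \<and> \<gamma> 0 = p"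
proof (induction n)
  case 0
  obtain \<gamma> where \<gamma>: "\<And>r. r \<in> {-\<epsilon><..<\<epsilon>} \<Longrightarrow> icurve_at \<gamma> r" "\<gamma> 0 = p" using short_curve by blast
  show ?case
  proof (intro exI[of _ \<gamma>] conjI ballI \<gamma>)
    fix r assume "r \<in> {-(\<epsilon>/2 * (real 0 + 1))<..<\<epsilon>/2 * (real 0 + 1)}"
    then show "r \<in> {-\<epsilon><..<\<epsilon>}" using eps_pos by auto
  qed
next
  case (Suc n)
  define a where "a = \<epsilon>/2 * (real n + 1)"
  have a: "\<epsilon>/2 \<le> a" "\<epsilon>/2 * (real (Suc n) + 1) = a + \<epsilon>/2" using eps_pos by (auto simp: a_def algebra_simps)
  let ?I = "{-a<..<a}"
  obtain \<gamma> where \<gamma>: "\<And>r. r \<in> ?I \<Longrightarrow> icurve_at \<gamma> r" "\<gamma> 0 = p" using Suc unfolding a_def by blast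
  \<comment> \<open>The gluing time lies inside the present interval, and the new curve reaches t +
    \<epsilon> = a + 3\<epsilon>/4, beyond the required a + \<epsilon>/2.\<close>
  define t where "t = a - \<epsilon>/4"
  have t: "t \<in> ?I" "-t \<in> ?I" "0 \<in> ?I" using a eps_pos by (auto simp: t_def)
  let ?J = "{t-\<epsilon><..<t+\<epsilon>}" and ?K = "{-t-\<epsilon><..<-t+\<epsilon>}"
  obtain \<beta> where \<beta>: "\<And>r. r \<in> ?J \<Longrightarrow> icurve_at \<beta> r" "\<beta> t = \<gamma> t" using short_curve_shifted by blast
  obtain \<gamma>1 where \<gamma>1: "\<And>r. r \<in> ?I \<union> ?J \<Longrightarrow> icurve_at \<gamma>1 r" "\<And>r. r \<in> ?I \<Longrightarrow> \<gamma>1 r = \<gamma> r"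
  proof -
    have tJ: "t \<in> ?J" using eps_pos by simp
    from icurve_glue[of ?I \<gamma> ?J \<beta>, OF \<gamma>(1) \<beta>(1) open_greaterThanLessThan connected_Ioo
        open_greaterThanLessThan connected_Ioo t(1) tJ \<beta>(2)[symmetric]]
    show ?thesis using that by blast
  qed
  obtain \<beta>' where \<beta>': "\<And>r. r \<in> ?K \<Longrightarrow> icurve_at \<beta>' r" "\<beta>' (-t) = \<gamma>1 (-t)" using short_curve_shifted by blast
  have IJ: "connected (?I \<union> ?J)" using t eps_pos by (intro connected_Un) auto
  obtain \<gamma>2 where \<gamma>2: "\<And>r. r \<in> (?I \<union> ?J) \<union> ?K \<Longrightarrow> icurve_at \<gamma>2 r" "\<And>r. r \<in> ?I \<union> ?J \<Longrightarrow> \<gamma>2 r = \<gamma>1 r"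
  proof -
    have tK: "-t \<in> ?I \<union> ?J" "-t \<in> ?K" using eps_pos t(2) by simp_all
    from icurve_glue[of "?I \<union> ?J" \<gamma>1 ?K \<beta>', OF \<gamma>1(1) \<beta>'(1) open_Un[OF open_greaterThanLessThan open_greaterThanLessThan]
        IJ open_greaterThanLessThan connected_Ioo tK \<beta>'(2)[symmetric]]
    show ?thesis using that by blast
  qed
  show ?case unfolding a(2)
  proof (intro exI[of _ \<gamma>2] conjI ballI \<gamma>2(1))
    fix r assume "r \<in> {-(a + \<epsilon>/2)<..<a + \<epsilon>/2}"
    then show "r \<in> (?I \<union> ?J) \<union> ?K" using eps_pos a(1) by (auto simp: t_def)
  next
    show "\<gamma>2 0 = p" using \<gamma>2(2)[of 0] \<gamma>1(2)[of 0] \<gamma>(2) t by simp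
  qed
qed

lemma curve_exists: "\<exists>\<gamma>. (\<forall>r\<in>{-b<..<b}. icurve_at \<gamma> r) \<and> \<gamma> 0 = p"
proof -
  obtain n where n: "b / (\<epsilon>/2) < real n" using reals_Archimedean2 by blast
  have "b < \<epsilon>/2 * real n" using n eps_pos by (simp add: field_simps)
  also have "\<dots> \<le> \<epsilon>/2 * (real n + 1)" using eps_pos by simp
  finally have b: "b < \<epsilon>/2 * (real n + 1)" .
  obtain \<gamma> where \<gamma>: "\<And>r. r \<in> {-(\<epsilon>/2 * (real n + 1))<..<\<epsilon>/2 * (real n + 1)} \<Longrightarrow> icurve_at \<gamma> r" "\<gamma> 0 = p"
    using long_curve[of n p] by blast
  show ?thesis
  proof (intro exI[of _ \<gamma>] conjI ballI \<gamma>)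
    fix r assume "r \<in> {-b<..<b}"
    then show "r \<in> {-(\<epsilon>/2 * (real n + 1))<..<\<epsilon>/2 * (real n + 1)}" using b by auto
  qed
qed

text \<open>Curves have been constructed on bounded intervals only, so the curve is chosen anew for
  each \<open>s\<close>, on an interval that contains \<open>s\<close> in its interior; uniqueness
  makes the choice immaterial.\<close>

definition flow :: "real \<Rightarrow> 'm \<Rightarrow> 'm" where
  "flow s p = (SOME \<gamma>. (\<forall>r\<in>{-(\<bar>s\<bar>+1)<..<\<bar>s\<bar>+1}. icurve_at \<gamma> r) \<and> \<gamma> 0 = p) s"

lemma flow_eq:
  assumes \<gamma>: "\<And>r. r \<in> {-b<..<b} \<Longrightarrow> icurve_at \<gamma> r" "\<gamma> 0 = p" and s: "\<bar>s\<bar> < b"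
  shows "flow s p = \<gamma> s"
proof -
  define \<delta> where "\<delta> = (SOME \<gamma>. (\<forall>r\<in>{-(\<bar>s\<bar>+1)<..<\<bar>s\<bar>+1}. icurve_at \<gamma> r) \<and> \<gamma> 0 = p)"
  have \<delta>: "\<And>r. r \<in> {-(\<bar>s\<bar>+1)<..<\<bar>s\<bar>+1} \<Longrightarrow> icurve_at \<delta> r" "\<delta> 0 = p"
    using someI_ex[OF curve_exists[of "\<bar>s\<bar>+1" p]] unfolding \<delta>_def by blast+
  define b' where "b' = min b (\<bar>s\<bar> + 1)"
  have "\<delta> s = \<gamma> s"
    by (rule icurve_unique[of "{-b'<..<b'}" \<delta> \<gamma> 0 s]) (use \<gamma> \<delta> s in \<open>auto simp: b'_def\<close>)
  then show ?thesis by (simp add: flow_def \<delta>_def)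
qed

lemma flow_zero [simp]: "flow 0 p = p"
proof -
  obtain \<gamma> where \<gamma>: "\<And>r. r \<in> {-1<..<1} \<Longrightarrow> icurve_at \<gamma> r" "\<gamma> 0 = p"
    using curve_exists[of 1 p] by blast
  have "\<bar>0\<bar> < (1::real)" by simp
  from flow_eq[OF \<gamma> this] have "flow 0 p = \<gamma> 0" .
  then show ?thesis using \<gamma>(2) by (rule trans)
qed

lemma icurve_at_flow: "icurve_at (\<lambda>s. flow s p) s"
proof -
  obtain \<gamma> where \<gamma>: "\<And>r. r \<in> {-(\<bar>s\<bar>+1)<..<\<bar>s\<bar>+1} \<Longrightarrow> icurve_at \<gamma> r" "\<gamma> 0 = p"
    using curve_exists[of "\<bar>s\<bar>+1" p] by blast
  have s: "s \<in> {-(\<bar>s\<bar>+1)<..<\<bar>s\<bar>+1}" by auto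
  show ?thesis
    by (rule icurve_at_cong[OF \<gamma>(1)[OF s] open_greaterThanLessThan s], rule flow_eq[symmetric, OF \<gamma>]) auto
qed

lemma flow_unique: "(\<And>r. icurve_at \<gamma> r) \<Longrightarrow> \<gamma> 0 = p \<Longrightarrow> flow s p = \<gamma> s"
  by (rule flow_eq[of "\<bar>s\<bar> + 1"]) auto

text \<open>Both sides are integral curves in \<open>s\<close> with the same value at
  \<open>s = 0\<close>, the left one because \<open>X\<close> does not depend on time.\<close>

lemma flow_add: "flow (s + t) p = flow s (flow t p)"
  using flow_unique[of "\<lambda>r. flow (r + t) p" "flow t p" s] icurve_at_shift[OF icurve_at_flow] by simp

lemma flow_box_flow:
  assumes fb: "flow_box \<epsilon> c V Y" and p: "p \<in> V" and s: "s \<in> {-\<epsilon><..<\<epsilon>}"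
  shows "flow s p = chart_inv c (Y s (snd c p))"
proof (rule flow_eq[of \<epsilon>])
  show "icurve_at (\<lambda>s. chart_inv c (Y s (snd c p))) r" if "r \<in> {-\<epsilon><..<\<epsilon>}" for r
    using flow_box_icurve[OF fb p that] .
  have "c \<in> A" "p \<in> fst c" "snd c p \<in> snd c ` V" using fb p unfolding flow_box_def by auto
  moreover have "Y 0 (snd c p) = snd c p" using fb calculation(3) s unfolding flow_box_def by blast
  ultimately show "chart_inv c (Y 0 (snd c p)) = p" using chart_inv_left by simp
qed (use s in auto)

section \<open>Smoothness of the flow\<close>

text \<open>The two charts are existential so that an inductive step may end in the chart of a flow
  box; \<open>flow_Ck\<close> later passes to arbitrary charts.\<close>

definition flow_smooth_at :: "real \<Rightarrow> 'm \<Rightarrow> bool" where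
  "flow_smooth_at s0 p0 \<longleftrightarrow> (\<exists>c\<in>A. \<exists>c'\<in>A. \<exists>N. open N \<and> (s0, snd c p0) \<in> N \<and> p0 \<in> fst c \<and>
     (\<forall>(s, y)\<in>N. y \<in> chart_img c \<and> flow s (chart_inv c y) \<in> fst c') \<and>
     (\<forall>k. Ck_on k (\<lambda>(s, y). snd c' (flow s (chart_inv c y))) N))"

lemma flow_box_Y:
  assumes fb: "flow_box \<epsilon> c V Y" and y: "y \<in> snd c ` V" and s: "s \<in> {-\<epsilon><..<\<epsilon>}"
  shows "y \<in> chart_img c" "chart_inv c y \<in> V" "flow s (chart_inv c y) \<in> fst c" "snd c (flow s (chart_inv c y)) = Y s y"
proof -
  have c: "c \<in> A" "V \<subseteq> fst c" and Y: "Y s y \<in> chart_img c" using fb y s unfolding flow_box_def by auto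
  obtain p where p: "p \<in> V" "y = snd c p" using y by auto
  have "p \<in> fst c" using p c by auto
  then show "y \<in> chart_img c" "chart_inv c y \<in> V" using p chart_in[of p c] chart_inv_left[OF c(1), of p] by auto
  have "flow s (chart_inv c y) = chart_inv c (Y s y)"
    using flow_box_flow[OF fb p(1) s] p chart_inv_left[OF c(1) \<open>p \<in> fst c\<close>] by simp
  then show "flow s (chart_inv c y) \<in> fst c" "snd c (flow s (chart_inv c y)) = Y s y"
    using chart_inv_in[OF c(1) Y] chart_inv_right[OF c(1) Y] by auto
qed

lemma flow_smooth_at_0: "flow_smooth_at 0 p"
proof -
  obtain c V Y where fb: "p \<in> V" "flow_box \<epsilon> c V Y" using eps_box by blast
  have c: "c \<in> A" "V \<subseteq> fst c" "open V" and Yk: "\<And>k. Ck_on k (\<lambda>(s, y). Y s y) ({-\<epsilon><..<\<epsilon>} \<times> snd c ` V)"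
    using fb(2) unfolding flow_box_def by auto
  let ?N = "{-\<epsilon><..<\<epsilon>} \<times> snd c ` V"
  have N: "open ?N" using open_chart_image[OF c(1,3,2)] by (intro open_Times) auto
  have "Ck_on k (\<lambda>(s, y). snd c (flow s (chart_inv c y))) ?N" for k
    using Yk[of k] by (subst Ck_on_cong[OF N, where g = "\<lambda>(s, y). Y s y"]) (use flow_box_Y[OF fb(2)] in auto)
  moreover have "\<forall>(s, y)\<in>?N. y \<in> chart_img c \<and> flow s (chart_inv c y) \<in> fst c"
    using flow_box_Y[OF fb(2)] by blast
  moreover have "(0, snd c p) \<in> ?N" "p \<in> fst c" using fb(1) eps_pos c by auto
  ultimately show ?thesis unfolding flow_smooth_at_def using c(1) N by blast
qed

text \<open>Near the time \<open>s1 + s2\<close> the flow is the fixed smooth map of time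
  \<open>s1\<close> followed by the flow in a box around the image point for the short time
  \<open>s - s1\<close>.\<close>

lemma flow_smooth_at_step:
  assumes "flow_smooth_at s1 p0" "\<bar>s2\<bar> < \<epsilon>"
  shows "flow_smooth_at (s1 + s2) p0"
proof -
  obtain c c' N where c: "c \<in> A" "c' \<in> A" "open N" "(s1, snd c p0) \<in> N" "p0 \<in> fst c"
    "\<And>s y. (s, y) \<in> N \<Longrightarrow> y \<in> chart_img c" "\<And>s y. (s, y) \<in> N \<Longrightarrow> flow s (chart_inv c y) \<in> fst c'"
    "\<And>k. Ck_on k (\<lambda>(s, y). snd c' (flow s (chart_inv c y))) N"
    using assms(1) unfolding flow_smooth_at_def by blast
  obtain d V Y where fb: "flow s1 p0 \<in> V" "flow_box \<epsilon> d V Y" using eps_box by blast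
  have d: "d \<in> A" "V \<subseteq> fst d" "open V" and Yk: "\<And>k. Ck_on k (\<lambda>(s, y). Y s y) ({-\<epsilon><..<\<epsilon>} \<times> snd d ` V)"
    using fb(2) unfolding flow_box_def by auto
  let ?g = "\<lambda>y. snd c' (flow s1 (chart_inv c y))"
  let ?N1 = "(\<lambda>y. (s1, y)) -` N"
  have lin: "Ck_on k (\<lambda>y. (s1, y)) S" if "open S" for k and S :: "(real ^ 'n) set"
    by (intro Ck_on_Pair that Ck_on_const Ck_on_linear bounded_linear_ident)
  have N1: "open ?N1" using c(3) by (intro open_vimage continuous_intros)
  have gk: "Ck_on k ?g ?N1" for k
    using Ck_on_compose[OF N1 c(3) c(8) lin[OF N1], of k] by auto
  let ?O = "snd c' ` (fst c' \<inter> V)"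
  have O: "open ?O" "?O \<subseteq> overlap c' d"
    using open_chart_image[OF c(2), of "fst c' \<inter> V"] open_chart_dom[OF c(2)] d by (auto intro: open_Int)
  let ?T = "\<lambda>y. snd d (chart_inv c' y)"
  \<comment> \<open>The start points that are in the flow box at time \<open>s1\<close>;
    \<open>?T\<close> passes from the chart \<open>c'\<close> to the chart \<open>d\<close> of the
    box.\<close>
  let ?N2 = "?N1 \<inter> ?g -` ?O"
  have N2: "open ?N2" by (rule open_preimage_Ck_on[OF N1 O(1) gk])
  have zk: "Ck_on k (\<lambda>y. ?T (?g y)) ?N2" for k
    by (rule Ck_on_compose_preimage[OF N1 O(1) Ck_on_subset[OF Ck_on_transition[OF c(2) d(1)] O(2)] gk])
  have zeq: "flow s1 (chart_inv c y) \<in> V" "?T (?g y) = snd d (flow s1 (chart_inv c y))" if "y \<in> ?N2" for y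
  proof -
    have f: "flow s1 (chart_inv c y) \<in> fst c'" using that c(7) by auto
    then have e: "chart_inv c' (?g y) = flow s1 (chart_inv c y)" by (rule chart_inv_left[OF c(2)])
    have "?g y \<in> ?O" using that by blast
    then obtain q where q: "q \<in> fst c' \<inter> V" "?g y = snd c' q" by (rule imageE)
    then have "chart_inv c' (?g y) = q" using chart_inv_left[OF c(2), of q] by simp
    then show "flow s1 (chart_inv c y) \<in> V" using e q by simp
    show "?T (?g y) = snd d (flow s1 (chart_inv c y))" using e by simp
  qed
  let ?M = "(\<lambda>x. (fst x - s1, snd x)) -` ({-\<epsilon><..<\<epsilon>} \<times> ?N2)"
  have M: "open ?M" using N2 by (intro open_vimage open_Times continuous_intros) auto
  have sndM: "Ck_on k (\<lambda>x. ?T (?g (snd x))) ?M" for k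
    by (rule Ck_on_compose[OF M N2 zk Ck_on_linear[OF bounded_linear_snd]]) auto
  have fstM: "Ck_on k (\<lambda>x. fst x - s1) ?M" for k
    by (intro Ck_on_diff M Ck_on_linear bounded_linear_fst Ck_on_const)
  have opB: "open ({-\<epsilon><..<\<epsilon>} \<times> snd d ` V)" using open_chart_image[OF d(1,3,2)] by (intro open_Times) auto
  have "Ck_on k (\<lambda>x. (\<lambda>(s, y). Y s y) (fst x - s1, ?T (?g (snd x)))) ?M" for k
    by (rule Ck_on_compose[OF M opB Yk Ck_on_Pair[OF M fstM sndM]]) (use zeq in auto)
  moreover have key: "flow s (chart_inv c y) \<in> fst d \<and> snd d (flow s (chart_inv c y)) = Y (s - s1) (?T (?g y))"
    if "(s, y) \<in> ?M" for s y
  proof -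
    have y: "y \<in> ?N2" and s: "s - s1 \<in> {-\<epsilon><..<\<epsilon>}" using that by auto
    let ?q = "flow s1 (chart_inv c y)"
    have q: "?q \<in> V" "?q \<in> fst d" using zeq(1)[OF y] d(2) by auto
    have e: "chart_inv d (snd d ?q) = ?q" using chart_inv_left[OF d(1) q(2)] .
    have "flow s (chart_inv c y) = flow (s - s1) ?q"
      using flow_add[of "s - s1" s1 "chart_inv c y"] by simp
    then show ?thesis
      using flow_box_Y(3,4)[OF fb(2) imageI[OF q(1)] s] e zeq(2)[OF y] by simp
  qed
  ultimately have "Ck_on k (\<lambda>(s, y). snd d (flow s (chart_inv c y))) ?M" for k
    by (subst Ck_on_cong[OF M, where g = "\<lambda>x. (\<lambda>(s, y). Y s y) (fst x - s1, ?T (?g (snd x)))"]) auto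
  moreover have "(s1 + s2, snd c p0) \<in> ?M"
  proof -
    have "chart_inv c (snd c p0) = p0" using chart_inv_left[OF c(1,5)] .
    moreover have "flow s1 p0 \<in> fst c'" using c(7)[OF c(4)] calculation by simp
    ultimately have "snd c p0 \<in> ?N2" using c(4) fb(1) by auto
    then show ?thesis using assms(2) by auto
  qed
  moreover have "\<forall>(s, y)\<in>?M. y \<in> chart_img c \<and> flow s (chart_inv c y) \<in> fst d"
  proof
    fix x assume "x \<in> ?M"
    then obtain s y where m: "x = (s, y)" "(s, y) \<in> ?M" by (cases x) blast
    have "(s1, y) \<in> N" using m(2) by auto
    then show "case x of (s, y) \<Rightarrow> y \<in> chart_img c \<and> flow s (chart_inv c y) \<in> fst d"
      using key[OF m(2)] c(6) m(1) by simp
  qed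
  ultimately show ?thesis unfolding flow_smooth_at_def using c(1,5) d(1) M by blast
qed

text \<open>The time \<open>s\<close> is cut into equal steps shorter than the common lifetime
  \<epsilon>.\<close>

lemma flow_smooth_at: "flow_smooth_at s p"
proof -
  obtain n where n: "\<bar>s\<bar> / \<epsilon> < real n" using reals_Archimedean2 by blast
  have "0 \<le> \<bar>s\<bar> / \<epsilon>" using eps_pos by simp
  then have n0: "real n > 0" using n by linarith
  have small: "\<bar>s / real n\<bar> < \<epsilon>" using n n0 eps_pos by (simp add: field_simps)
  have "flow_smooth_at (real k * (s / real n)) p" for k
  proof (induction k)
    case 0
    show ?case using flow_smooth_at_0 by simp
  next
    case (Suc k)
    from flow_smooth_at_step[OF Suc small] show ?case by (simp add: algebra_simps add_divide_distrib)
  qed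
  from this[of n] show ?thesis using n0 by simp
qed

definition flow_dom :: "('m, 'n) chart \<Rightarrow> ('m, 'n) chart \<Rightarrow> (real \<times> (real ^ 'n)) set" where
  "flow_dom c c' = {(s, y). y \<in> chart_img c \<and> flow s (chart_inv c y) \<in> fst c'}"

lemma flow_continuous: "continuous_on UNIV (\<lambda>(s, p). flow s p)"
proof (rule continuous_at_imp_continuous_on, rule ballI)
  fix x :: "real \<times> 'm"
  obtain s0 p0 where x: "x = (s0, p0)" by (cases x)
  obtain c c' N where c: "c \<in> A" "c' \<in> A" "open N" "(s0, snd c p0) \<in> N" "p0 \<in> fst c"
    "\<And>s y. (s, y) \<in> N \<Longrightarrow> y \<in> chart_img c" "\<And>s y. (s, y) \<in> N \<Longrightarrow> flow s (chart_inv c y) \<in> fst c'"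
    "\<And>k. Ck_on k (\<lambda>(s, y). snd c' (flow s (chart_inv c y))) N"
    using flow_smooth_at[of s0 p0] unfolding flow_smooth_at_def by blast
  let ?\<Theta> = "\<lambda>(s, y). snd c' (flow s (chart_inv c y))"
  let ?h = "\<lambda>x. (fst x, snd c (snd x))"
  let ?S = "(UNIV \<times> fst c) \<inter> ?h -` N"
  have h: "continuous_on (UNIV \<times> fst c) ?h"
    by (intro continuous_on_Pair continuous_on_fst continuous_on_id
        continuous_on_compose2[OF chart_continuous[OF c(1)] continuous_on_snd[OF continuous_on_id]]) auto
  have S: "open ?S" by (rule continuous_open_preimage[OF h _ c(3)]) (simp add: open_Times open_chart_dom[OF c(1)])
  have "continuous_on ?S (\<lambda>x. ?\<Theta> (?h x))"
    by (rule continuous_on_compose2[OF Ck_on_imp_continuous_on[OF c(8)] continuous_on_subset[OF h]]) auto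
  then have "continuous_on ?S (\<lambda>x. chart_inv c' (?\<Theta> (?h x)))"
  proof (rule continuous_on_compose2[OF chart_inv_continuous[OF c(2)]])
    show "(\<lambda>x. ?\<Theta> (?h x)) ` ?S \<subseteq> chart_img c'" using c(7) chart_in[of _ c'] by auto
  qed
  moreover have "chart_inv c' (?\<Theta> (?h x)) = (\<lambda>(s, p). flow s p) x" if "x \<in> ?S" for x
  proof -
    obtain s p where x: "x = (s, p)" by (cases x)
    then have sp: "x = (s, p)" "p \<in> fst c" "(s, snd c p) \<in> N" using that by auto
    then show ?thesis using c(7)[OF sp(3)] chart_inv_left[OF c(1) sp(2)] chart_inv_left[OF c(2), of "flow s p"] by simp
  qed
  ultimately have "continuous_on ?S (\<lambda>(s, p). flow s p)" by (rule continuous_on_eq)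
  moreover have "x \<in> ?S" using x c by auto
  ultimately show "isCont (\<lambda>(s, p). flow s p) x" using S continuous_on_eq_continuous_at by blast
qed

lemma open_flow_dom:
  assumes c: "c \<in> A" "c' \<in> A"
  shows "open (flow_dom c c')"
proof -
  let ?f = "\<lambda>x. (\<lambda>(s, p). flow s p) (fst x, chart_inv c (snd x))"
  have "continuous_on (UNIV \<times> chart_img c) ?f"
    by (intro continuous_on_compose2[OF flow_continuous] continuous_on_Pair continuous_on_fst continuous_on_id
        continuous_on_compose2[OF chart_inv_continuous[OF c(1)] continuous_on_snd[OF continuous_on_id]]) auto
  then have "open ((UNIV \<times> chart_img c) \<inter> ?f -` fst c')"
    by (rule continuous_open_preimage[OF _ open_Times[OF open_UNIV open_chart_img[OF c(1)]] open_chart_dom[OF c(2)]])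
  moreover have "flow_dom c c' = (UNIV \<times> chart_img c) \<inter> ?f -` fst c'"
    by (auto simp: flow_dom_def)
  ultimately show ?thesis by simp
qed

lemma flow_Ck:
  assumes c1: "c1 \<in> A" and c2: "c2 \<in> A"
  shows "Ck_on k (\<lambda>(s, y). snd c2 (flow s (chart_inv c1 y))) (flow_dom c1 c2)"
proof (rule Ck_on_local)
  fix x assume "x \<in> flow_dom c1 c2"
  then obtain s0 y0 where x: "x = (s0, y0)" "y0 \<in> chart_img c1" "flow s0 (chart_inv c1 y0) \<in> fst c2"
    by (auto simp: flow_dom_def)
  let ?p0 = "chart_inv c1 y0"
  obtain c c' N where c: "c \<in> A" "c' \<in> A" "open N" "(s0, snd c ?p0) \<in> N" "?p0 \<in> fst c"
    "\<And>s y. (s, y) \<in> N \<Longrightarrow> y \<in> chart_img c" "\<And>s y. (s, y) \<in> N \<Longrightarrow> flow s (chart_inv c y) \<in> fst c'"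
    "\<And>k. Ck_on k (\<lambda>(s, y). snd c' (flow s (chart_inv c y))) N"
    using flow_smooth_at[of s0 ?p0] unfolding flow_smooth_at_def by blast
  let ?\<Theta> = "\<lambda>(s, y). snd c' (flow s (chart_inv c y))"
  let ?U = "UNIV \<times> overlap c1 c" and ?h = "\<lambda>x. (fst x, snd c (chart_inv c1 (snd x)))"
  have U: "open ?U" by (intro open_Times open_overlap c1 c(1)) auto
  have "Ck_on k (\<lambda>x. snd c (chart_inv c1 (snd x))) ?U" for k
    by (rule Ck_on_compose[OF U open_overlap[OF c1 c(1)] Ck_on_transition[OF c1 c(1)] Ck_on_linear[OF bounded_linear_snd]]) auto
  then have h: "Ck_on k ?h ?U" for k by (rule Ck_on_Pair[OF U Ck_on_linear[OF bounded_linear_fst]])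
  let ?U' = "?U \<inter> ?h -` N"
  have U': "open ?U'" by (rule open_preimage_Ck_on[OF U c(3) h])
  have \<Theta>h: "Ck_on k (\<lambda>x. ?\<Theta> (?h x)) ?U'" for k by (rule Ck_on_compose_preimage[OF U c(3) c(8) h])
  let ?U'' = "?U' \<inter> (\<lambda>x. ?\<Theta> (?h x)) -` overlap c' c2"
  have U'': "open ?U''" by (rule open_preimage_Ck_on[OF U' open_overlap[OF c(2) c2] \<Theta>h])
  have "Ck_on k (\<lambda>x. snd c2 (chart_inv c' (?\<Theta> (?h x)))) ?U''"
    by (rule Ck_on_compose_preimage[OF U' open_overlap[OF c(2) c2] Ck_on_transition[OF c(2) c2] \<Theta>h])
  moreover have "snd c2 (chart_inv c' (?\<Theta> (?h x))) = (\<lambda>(s, y). snd c2 (flow s (chart_inv c1 y))) x" if "x \<in> ?U''" for x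
  proof -
    obtain s y where sy: "x = (s, y)" by (cases x)
    have y: "y \<in> overlap c1 c" "(s, snd c (chart_inv c1 y)) \<in> N" using that sy by auto
    have "chart_inv c1 y \<in> fst c" using y(1) overlap_iff[OF c1] by auto
    then have e: "chart_inv c (snd c (chart_inv c1 y)) = chart_inv c1 y" by (rule chart_inv_left[OF c(1)])
    then have "flow s (chart_inv c1 y) \<in> fst c'" using c(7)[OF y(2)] by simp
    then show ?thesis using e chart_inv_left[OF c(2)] sy by simp
  qed
  ultimately have "Ck_on k (\<lambda>(s, y). snd c2 (flow s (chart_inv c1 y))) ?U''"
    by (subst Ck_on_cong[OF U'', where g = "\<lambda>x. snd c2 (chart_inv c' (?\<Theta> (?h x)))"]) auto
  moreover have "x \<in> ?U''"
  proof -
    have "y0 \<in> overlap c1 c" using overlap_iff[OF c1] x(2) c(5) by blast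
    moreover have e: "chart_inv c (snd c ?p0) = ?p0" using chart_inv_left[OF c(1,5)] .
    moreover have "flow s0 ?p0 \<in> fst c'" using c(7)[OF c(4)] e by simp
    ultimately show ?thesis using c(4) x by auto
  qed
  ultimately show "\<exists>V. open V \<and> x \<in> V \<and> Ck_on k (\<lambda>(s, y). snd c2 (flow s (chart_inv c1 y))) V"
    using U'' by blast
qed

lemma smooth_map_flow: "smooth_map A (flow s)"
  unfolding smooth_map_def
proof (intro conjI ballI)
  show "continuous_on UNIV (flow s)"
    using continuous_on_compose2[OF flow_continuous continuous_on_Pair[OF continuous_on_const[of UNIV s] continuous_on_id]]
    by simp
  fix c c' assume c: "c \<in> A" "c' \<in> A"
  let ?S = "snd c ` (fst c \<inter> flow s -` fst c')"
  have S: "?S = (\<lambda>y. (s, y)) -` flow_dom c c'"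
  proof (intro set_eqI iffI)
    fix y assume "y \<in> ?S"
    then show "y \<in> (\<lambda>y. (s, y)) -` flow_dom c c'"
      using chart_inv_left[OF c(1)] chart_in[of _ c] by (auto simp: flow_dom_def)
  next
    fix y assume "y \<in> (\<lambda>y. (s, y)) -` flow_dom c c'"
    then have y: "y \<in> chart_img c" "flow s (chart_inv c y) \<in> fst c'" by (auto simp: flow_dom_def)
    then show "y \<in> ?S"
      using chart_inv_right[OF c(1) y(1)] chart_inv_in[OF c(1) y(1)]
      by (intro image_eqI[where x = "chart_inv c y"]) auto
  qed
  have oS: "open ?S" unfolding S using open_flow_dom[OF c] by (intro open_vimage continuous_intros)
  have "Ck_on k (\<lambda>y. (\<lambda>(s, y). snd c' (flow s (chart_inv c y))) (s, y)) ?S" for k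
    by (rule Ck_on_compose[OF oS open_flow_dom[OF c] flow_Ck[OF c] Ck_on_Pair[OF oS Ck_on_const Ck_on_linear[OF bounded_linear_ident]]])
      (use S in auto)
  then show "smooth_on ?S (snd c' \<circ> flow s \<circ> chart_inv c)"
    unfolding smooth_on_open[OF oS] by (simp add: o_def)
qed

lemma diffeo_flow: "diffeo A (flow s)"
proof -
  have 1: "flow s \<circ> flow (-s) = id" "flow (-s) \<circ> flow s = id"
    using flow_add[of s "-s"] flow_add[of "-s" s] by (auto simp: fun_eq_iff)
  then have "bij (flow s)" "inv (flow s) = flow (-s)"
    using o_bij inv_unique_comp by blast+
  then show ?thesis unfolding diffeo_def using smooth_map_flow by simp
qed

section \<open>Time change\<close>

text \<open>The generating field is a time-dependent multiple of \<open>X\<close>, so its flow is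
  that of \<open>X\<close> run at another speed; \<open>\<sigma>\<close> is the primitive of
  \<open>1 / (1 - lam * t)\<close> that vanishes at 0.\<close>

lemma generated_diffeos_exist:
  assumes "lam > 0"
  shows "\<exists>\<phi>. generated_diffeos A {0..<1/lam} (\<lambda>t c y. (1 / (1 - lam * t)) *\<^sub>R X c y) \<phi>"
proof -
  define \<sigma> where "\<sigma> t = - ln (1 - lam * t) / lam" for t
  define \<phi> where "\<phi> t = flow (\<sigma> t)" for t
  \<comment> \<open>The time change is smooth on the open half-line \<open>?J\<close>, so smoothness
    up to the end point 0 of \<open>?I\<close> is obtained by restriction.\<close>
  let ?I = "{0..<1/lam}" and ?J = "{..<1/lam}"
  have pos: "1 - lam * t > 0" if "t \<in> ?J" for t using that assms by (simp add: field_simps)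
  have J: "open ?J" by simp
  have \<sigma>k: "Ck_on k \<sigma> ?J" for k
  proof -
    have 1: "Ck_on k (\<lambda>t. 1 - lam * t) ?J"
      by (intro Ck_on_diff J Ck_on_const Ck_on_mult Ck_on_linear bounded_linear_ident)
    have 2: "Ck_on k (\<lambda>t. ln (1 - lam * t)) ?J"
      by (rule Ck_on_compose[OF J _ Ck_on_ln 1]) (use pos in auto)
    have "Ck_on k (\<lambda>t. - ln (1 - lam * t) * (1 / lam)) ?J"
      by (intro Ck_on_mult J Ck_on_minus 2 Ck_on_const)
    then show ?thesis by (simp add: \<sigma>_def[abs_def])
  qed
  have \<sigma>d: "(\<sigma> has_vector_derivative 1 / (1 - lam * t)) (at t)" if "t \<in> ?J" for t
    using pos[OF that] assms unfolding \<sigma>_def has_real_derivative_iff_has_vector_derivative[symmetric]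
    by (auto intro!: derivative_eq_intros simp: field_simps)
  have cont: "continuous_on (?J \<times> UNIV) (\<lambda>(t, p). \<phi> t p)"
  proof -
    have "continuous_on (?J \<times> UNIV) (\<lambda>x::real \<times> 'm. (\<sigma> (fst x), snd x))"
      by (intro continuous_on_Pair continuous_on_snd continuous_on_id
        continuous_on_compose2[OF Ck_on_imp_continuous_on[OF \<sigma>k] continuous_on_fst[OF continuous_on_id]]) auto
    from continuous_on_compose2[OF flow_continuous this] show ?thesis by (simp add: \<phi>_def case_prod_beta')
  qed
  have IJ: "?I \<subseteq> ?J" by auto
  show ?thesis
  proof (intro exI[of _ \<phi>], unfold generated_diffeos_def, intro conjI ballI allI impI)
    show "diffeo A (\<phi> t)" for t unfolding \<phi>_def by (rule diffeo_flow)
    show "continuous_on (?I \<times> UNIV) (\<lambda>(t, p). \<phi> t p)"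
      by (rule continuous_on_subset[OF cont]) auto
    show "\<phi> 0 = id" by (auto simp: \<phi>_def \<sigma>_def)
  next
    fix c c' assume c: "c \<in> A" "c' \<in> A"
    let ?S = "{(t, y). t \<in> ?I \<and> y \<in> chart_img c \<and> \<phi> t (chart_inv c y) \<in> fst c'}"
    let ?P = "?J \<times> (UNIV :: (real ^ 'n) set)"
    let ?h = "\<lambda>x. (\<sigma> (fst x), snd x)"
    have P: "open ?P" by (intro open_Times) auto
    have "Ck_on k (\<lambda>x. \<sigma> (fst x)) ?P" for k
      by (rule Ck_on_compose[OF P J \<sigma>k Ck_on_linear[OF bounded_linear_fst]]) auto
    then have h: "Ck_on k ?h ?P" for k by (rule Ck_on_Pair[OF P _ Ck_on_linear[OF bounded_linear_snd]])
    let ?W = "?P \<inter> ?h -` flow_dom c c'"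
    have W: "open ?W" by (rule open_preimage_Ck_on[OF P open_flow_dom[OF c] h])
    have "Ck_on k (\<lambda>x. (\<lambda>(s, y). snd c' (flow s (chart_inv c y))) (?h x)) ?W" for k
      by (rule Ck_on_compose_preimage[OF P open_flow_dom[OF c] flow_Ck[OF c] h])
    then have "Ck_on k (\<lambda>(t, y). snd c' (\<phi> t (chart_inv c y))) ?W" for k
      by (simp add: \<phi>_def case_prod_beta')
    moreover have "?S \<subseteq> ?W" using IJ by (auto simp: flow_dom_def \<phi>_def)
    ultimately show "smooth_on ?S (\<lambda>(t, y). snd c' (\<phi> t (chart_inv c y)))"
      unfolding smooth_on_def using W by blast
  next
    fix t p c assume t: "t \<in> ?I" and c: "c \<in> A" and p: "\<phi> t p \<in> fst c"
    have tJ: "t \<in> ?J" using t by auto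
    have "((\<lambda>s. snd c (flow s p)) has_vector_derivative X c (snd c (flow (\<sigma> t) p))) (at (\<sigma> t))"
      by (rule icurve_at_chart[OF icurve_at_flow c]) (use p in \<open>simp add: \<phi>_def\<close>)
    from vector_diff_chain_at[OF \<sigma>d[OF tJ] this]
    have "((\<lambda>s. snd c (\<phi> s p)) has_vector_derivative (1 / (1 - lam * t)) *\<^sub>R X c (snd c (\<phi> t p))) (at t)"
      by (simp add: \<phi>_def o_def)
    then show "((\<lambda>s. snd c (\<phi> s p)) has_vector_derivative (1 / (1 - lam * t)) *\<^sub>R X c (snd c (\<phi> t p))) (at t within ?I)"
      by (rule has_vector_derivative_at_within)
  qed
qed

end

section \<open>Change of coordinates\<close>

lemma finite_lists_of_length [simp]: "finite {xs :: 'a::finite list. length xs = n}"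
  using finite_lists_length_eq[of "UNIV :: 'a set" n] by simp

lemma sum_lists_Suc:
  fixes f :: "'a::finite list \<Rightarrow> 'b::comm_monoid_add"
  shows "(\<Sum>js | length js = Suc n. f js) = (\<Sum>a\<in>UNIV. \<Sum>js | length js = n. f (a # js))"
proof -
  have "{js :: 'a list. length js = Suc n} = (\<lambda>(a, js). a # js) ` (UNIV \<times> {js. length js = n})"
    by (auto simp: length_Suc_conv image_iff)
  moreover have "inj_on (\<lambda>(a, js). a # js) (UNIV \<times> {js :: 'a list. length js = n})"
    by (auto simp: inj_on_def)
  ultimately show ?thesis
    by (simp add: sum.reindex sum.cartesian_product case_prod_beta')
qed

lemma sum_lists_2: "(\<Sum>js :: 'a::finite list | length js = 2. f js) = (\<Sum>a\<in>UNIV. \<Sum>b\<in>UNIV. f [a, b])"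
  by (simp add: numeral_2_eq_2 sum_lists_Suc)

lemma sum_lists_3:
  "(\<Sum>js :: 'a::finite list | length js = 3. f js) = (\<Sum>a\<in>UNIV. \<Sum>b\<in>UNIV. \<Sum>c\<in>UNIV. f [a, b, c])"
  by (simp add: numeral_3_eq_3 sum_lists_Suc)

text \<open>Multiplying out \<open>k\<close> sums produces one product for each index list of length
  \<open>k\<close>, which is the form of the sums in \<open>comp_pullback\<close>.\<close>

lemma prod_sum_lists:
  fixes f :: "nat \<Rightarrow> 'a::finite \<Rightarrow> real"
  shows "(\<Prod>m<k. \<Sum>l\<in>UNIV. f m l) = (\<Sum>ls | length ls = k. \<Prod>m<k. f m (ls ! m))"
proof (induction k arbitrary: f)
  case (Suc k)
  have "(\<Prod>m<Suc k. \<Sum>l\<in>UNIV. f m l) = (\<Sum>l\<in>UNIV. f 0 l) * (\<Prod>m<k. \<Sum>l\<in>UNIV. f (Suc m) l)"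
    by (simp only: prod.lessThan_Suc_shift)
  also have "\<dots> = (\<Sum>a\<in>UNIV. \<Sum>ls | length ls = k. f 0 a * (\<Prod>m<k. f (Suc m) (ls ! m)))"
    by (simp only: Suc.IH sum_product)
  also have "\<dots> = (\<Sum>ls | length ls = Suc k. \<Prod>m<Suc k. f m (ls ! m))"
    by (simp add: sum_lists_Suc prod.lessThan_Suc_shift del: prod.lessThan_Suc)
  finally show ?case .
qed simp

section \<open>Partial derivatives and functoriality of the pull-back\<close>

lemma Ck_on_pd: "Ck_on (Suc k) f U \<Longrightarrow> Ck_on k (pd i f) U"
  by (simp add: pd_def[abs_def])

lemma pd_cong:
  assumes "open U" "y \<in> U" "f differentiable (at y)" "\<And>x. x \<in> U \<Longrightarrow> f x = g x"
  shows "pd i f y = pd i g y"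
  using frechet_derivative_transform_within_open[OF assms(3,1,2), of g] assms(4) by (simp add: pd_def)

lemma pd_eq: "(f has_derivative D) (at y) \<Longrightarrow> pd i f y = D (axis i 1)"
  unfolding pd_def using frechet_derivative_at by metis

lemma pd_const [simp]: "pd i (\<lambda>z. c) y = 0"
  by (simp add: pd_def)

lemma pd_mult:
  assumes "f differentiable (at y)" "g differentiable (at y)"
  shows "pd i (\<lambda>z. f z * g z) y = pd i f y * g y + f y * pd i g y"
proof -
  have "((\<lambda>z. f z * g z) has_derivative
      (\<lambda>h. f y * frechet_derivative g (at y) h + frechet_derivative f (at y) h * g y)) (at y)"
    by (intro has_derivative_mult) (use assms in \<open>simp_all add: frechet_derivative_works\<close>)
  from pd_eq[OF this] show ?thesis by (simp add: pd_def)
qed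

lemma pd_add:
  assumes "f differentiable (at y)" "g differentiable (at y)"
  shows "pd i (\<lambda>z. f z + g z) y = pd i f y + pd i g y"
proof -
  have "((\<lambda>z. f z + g z) has_derivative
      (\<lambda>h. frechet_derivative f (at y) h + frechet_derivative g (at y) h)) (at y)"
    by (intro has_derivative_add) (use assms in \<open>simp_all add: frechet_derivative_works\<close>)
  from pd_eq[OF this] show ?thesis by (simp add: pd_def)
qed

lemma pd_cmult:
  assumes "f differentiable (at y)"
  shows "pd i (\<lambda>z. c * f z) y = c * pd i f y"
  using pd_mult[of "\<lambda>z. c" y f i] assms by simp

lemma pd_diff:
  assumes "f differentiable (at y)" "g differentiable (at y)"
  shows "pd i (\<lambda>z. f z - g z) y = pd i f y - pd i g y"
  using pd_add[of f y "\<lambda>z. (-1) * g z" i] pd_cmult[of g y i "-1"] assms by simp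

lemma pd_sum:
  assumes "\<And>a. a \<in> I \<Longrightarrow> f a differentiable (at y)"
  shows "pd i (\<lambda>z. \<Sum>a\<in>I. f a z) y = (\<Sum>a\<in>I. pd i (f a) y)"
proof -
  have "((\<lambda>z. \<Sum>a\<in>I. f a z) has_derivative (\<lambda>h. \<Sum>a\<in>I. frechet_derivative (f a) (at y) h)) (at y)"
    by (intro has_derivative_sum) (use assms in \<open>simp_all add: frechet_derivative_works\<close>)
  from pd_eq[OF this] show ?thesis by (simp add: pd_def)
qed

lemma pd_sum_sum:
  fixes t :: "'a::finite \<Rightarrow> 'b::finite \<Rightarrow> real ^ 'n \<Rightarrow> real"
  assumes "\<And>a b. t a b differentiable (at y)"
  shows "pd i (\<lambda>z. \<Sum>a\<in>UNIV. \<Sum>b\<in>UNIV. t a b z) y = (\<Sum>a\<in>UNIV. \<Sum>b\<in>UNIV. pd i (t a b) y)"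
proof -
  have "(\<lambda>z. \<Sum>b\<in>UNIV. t a b z) differentiable (at y)" for a
    by (rule differentiable_sum) (simp_all add: assms)
  then show ?thesis by (simp add: pd_sum assms)
qed

lemma frechet_derivative_pd:
  fixes f :: "real ^ 'n \<Rightarrow> real"
  assumes "f differentiable (at y)"
  shows "frechet_derivative f (at y) w = (\<Sum>l\<in>UNIV. w $ l * pd l f y)"
proof -
  have lin: "linear (frechet_derivative f (at y))"
    using assms has_derivative_linear frechet_derivative_works by blast
  have "w = (\<Sum>l\<in>UNIV. w $ l *\<^sub>R axis l 1)"
    by (simp add: vec_eq_iff axis_def if_distrib cong: if_cong)
  then have "frechet_derivative f (at y) w = frechet_derivative f (at y) (\<Sum>l\<in>UNIV. w $ l *\<^sub>R axis l 1)"
    by simp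
  also have "\<dots> = (\<Sum>l\<in>UNIV. w $ l * pd l f y)"
    by (simp add: linear_sum[OF lin] linear_cmul[OF lin] pd_def)
  finally show ?thesis .
qed

lemma frechet_derivative_component:
  fixes F :: "'a::real_normed_vector \<Rightarrow> real ^ 'n"
  assumes "F differentiable (at y)"
  shows "frechet_derivative F (at y) v $ l = frechet_derivative (\<lambda>z. F z $ l) (at y) v"
    and "(\<lambda>z. F z $ l) differentiable (at y)"
proof -
  have "((\<lambda>z. F z $ l) has_derivative (\<lambda>v. frechet_derivative F (at y) v $ l)) (at y)"
    using assms by (intro bounded_linear.has_derivative[OF bounded_linear_vec_nth])
      (simp add: frechet_derivative_works)
  then show "frechet_derivative F (at y) v $ l = frechet_derivative (\<lambda>z. F z $ l) (at y) v"
    "(\<lambda>z. F z $ l) differentiable (at y)"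
    using frechet_derivative_at by (metis, auto simp: differentiable_def)
qed

lemma pd_compose:
  fixes f :: "real ^ 'n \<Rightarrow> real" and F :: "real ^ 'k \<Rightarrow> real ^ 'n"
  assumes f: "f differentiable (at (F y))" and F: "F differentiable (at y)"
  shows "pd i (\<lambda>z. f (F z)) y = (\<Sum>l\<in>UNIV. pd i (\<lambda>z. F z $ l) y * pd l f (F y))"
proof -
  have "((\<lambda>z. f (F z)) has_derivative (\<lambda>v. frechet_derivative f (at (F y)) (frechet_derivative F (at y) v))) (at y)"
    by (rule has_derivative_compose) (use assms in \<open>simp_all add: frechet_derivative_works\<close>)
  moreover have "frechet_derivative F (at y) (axis i 1) $ l = pd i (\<lambda>z. F z $ l) y" for l
    unfolding pd_def by (rule frechet_derivative_component(1)[OF F])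
  ultimately show ?thesis
    using pd_eq[of "\<lambda>z. f (F z)"] frechet_derivative_pd[OF f, of "frechet_derivative F (at y) (axis i 1)"] by simp
qed

text \<open>The chain rule turns every Jacobian factor into a sum over intermediate indices;
  multiplying out and exchanging the two sums over lists gives the iterated pull-back.\<close>

lemma comp_pullback_compose:
  fixes F1 F2 :: "real ^ 'n \<Rightarrow> real ^ 'n"
  assumes F1: "F1 differentiable (at y)" and F2: "F2 differentiable (at (F1 y))"
  shows "comp_pullback (\<lambda>z. F2 (F1 z)) T y is = comp_pullback F1 (comp_pullback F2 T) y is"
proof -
  let ?k = "length is"
  let ?A = "\<lambda>m l. pd (is ! m) (\<lambda>z. F1 z $ l) y" and ?B = "\<lambda>l j. pd l (\<lambda>z. F2 z $ j) (F1 y)"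
  have ch: "pd i (\<lambda>z. F2 (F1 z) $ j) y = (\<Sum>l\<in>UNIV. pd i (\<lambda>z. F1 z $ l) y * ?B l j)" for i j
    by (rule pd_compose[OF frechet_derivative_component(2)[OF F2] F1])
  have "comp_pullback (\<lambda>z. F2 (F1 z)) T y is =
      (\<Sum>js | length js = ?k. (\<Prod>m<?k. \<Sum>l\<in>UNIV. ?A m l * ?B l (js ! m)) * T (F2 (F1 y)) js)"
    by (simp add: comp_pullback_def ch)
  also have "\<dots> = (\<Sum>js | length js = ?k. \<Sum>ls | length ls = ?k.
      (\<Prod>m<?k. ?A m (ls ! m) * ?B (ls ! m) (js ! m)) * T (F2 (F1 y)) js)"
    by (simp add: prod_sum_lists sum_distrib_right)
  also have "\<dots> = (\<Sum>ls | length ls = ?k. \<Sum>js | length js = ?k.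
      (\<Prod>m<?k. ?A m (ls ! m) * ?B (ls ! m) (js ! m)) * T (F2 (F1 y)) js)"
    by (rule sum.swap)
  also have "\<dots> = comp_pullback F1 (comp_pullback F2 T) y is"
    unfolding comp_pullback_def
  proof (intro sum.cong refl)
    fix ls assume "ls \<in> {ls :: 'n list. length ls = ?k}"
    then have k: "length ls = ?k" by simp
    show "(\<Sum>js | length js = ?k. (\<Prod>m<?k. ?A m (ls ! m) * ?B (ls ! m) (js ! m)) * T (F2 (F1 y)) js) =
      (\<Prod>m<?k. ?A m (ls ! m)) * (\<Sum>js | length js = length ls. (\<Prod>m<length ls. ?B (ls ! m) (js ! m)) * T (F2 (F1 y)) js)"
      by (simp add: k prod.distrib sum_distrib_left mult.assoc)
  qed
  finally show ?thesis .
qed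

lemma DERIV_line:
  assumes "f differentiable (at (x + s *\<^sub>R v))"
  shows "((\<lambda>s. f (x + s *\<^sub>R v)) has_real_derivative frechet_derivative f (at (x + s *\<^sub>R v)) v) (at s)"
proof -
  have fd: "(f has_derivative frechet_derivative f (at (x + s *\<^sub>R v))) (at (x + s *\<^sub>R v))"
    using assms by (simp add: frechet_derivative_works)
  have "((\<lambda>s. x + s *\<^sub>R v) has_derivative (\<lambda>h. h *\<^sub>R v)) (at s)" by (auto intro!: derivative_eq_intros)
  from has_derivative_compose[OF this fd]
  have "((\<lambda>s. f (x + s *\<^sub>R v)) has_derivative (\<lambda>h. frechet_derivative f (at (x + s *\<^sub>R v)) (h *\<^sub>R v))) (at s)" .
  then show ?thesis
    using linear_cmul[OF has_derivative_linear[OF fd]]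
    by (simp add: has_field_derivative_def mult.commute[of _ "frechet_derivative f (at (x + s *\<^sub>R v)) v"])
qed

section \<open>Symmetry of second derivatives\<close>

text \<open>The mean value theorem is applied along \<open>u\<close> to the increment of
  \<open>f\<close> in the direction \<open>v\<close>, and then along \<open>v\<close> to the
  derivative in the direction \<open>u\<close>.\<close>

lemma mixed_second_difference:
  fixes f :: "'a::real_normed_vector \<Rightarrow> real"
  assumes C2: "Ck_on (Suc (Suc 0)) f (ball y r)" and h: "0 < h" "h * (norm u + norm v) < r"
  shows "\<exists>p\<in>cball y (h * (norm u + norm v)).
    f (y + h *\<^sub>R u + h *\<^sub>R v) - f (y + h *\<^sub>R u) - f (y + h *\<^sub>R v) + f y =
      h * h * frechet_derivative (\<lambda>x. frechet_derivative f (at x) u) (at p) v"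
proof -
  have near: "y + s *\<^sub>R u + t *\<^sub>R v \<in> cball y (h * (norm u + norm v))" if "0 \<le> s" "s \<le> h" "0 \<le> t" "t \<le> h" for s t
  proof -
    have "y - (y + s *\<^sub>R u + t *\<^sub>R v) = - (s *\<^sub>R u + t *\<^sub>R v)" by simp
    then have "dist y (y + s *\<^sub>R u + t *\<^sub>R v) = norm (s *\<^sub>R u + t *\<^sub>R v)" by (simp only: dist_norm norm_minus_cancel)
    also have "\<dots> \<le> norm (s *\<^sub>R u) + norm (t *\<^sub>R v)" by (rule norm_triangle_ineq)
    also have "\<dots> \<le> h * norm u + h * norm v" using that by (auto intro!: add_mono mult_right_mono)
    finally show ?thesis by (simp add: algebra_simps)
  qed
  then have nb: "y + s *\<^sub>R u + t *\<^sub>R v \<in> ball y r" if "0 \<le> s" "s \<le> h" "0 \<le> t" "t \<le> h" for s t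
    using that h(2) by (force simp: mem_cball mem_ball)
  have df: "f differentiable (at x)" if "x \<in> ball y r" for x using C2 that by simp
  have ddf: "(\<lambda>x. frechet_derivative f (at x) u) differentiable (at x)" if "x \<in> ball y r" for x using C2 that by simp
  let ?g = "\<lambda>s. f (y + h *\<^sub>R v + s *\<^sub>R u) - f (y + s *\<^sub>R u)"
  let ?D = "\<lambda>x. frechet_derivative f (at x) u"
  have "\<exists>z. 0 < z \<and> z < h \<and> ?g h - ?g 0 = (h - 0) * (?D (y + h *\<^sub>R v + z *\<^sub>R u) - ?D (y + z *\<^sub>R u))"
  proof (rule MVT2[OF h(1)])
    fix s assume s: "0 \<le> s" "s \<le> h"
    have 1: "y + h *\<^sub>R v + s *\<^sub>R u \<in> ball y r" using nb[of s h] s h(1) by (simp add: algebra_simps)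
    have 2: "y + s *\<^sub>R u \<in> ball y r" using nb[of s 0] s h(1) by simp
    show "(?g has_real_derivative (?D (y + h *\<^sub>R v + s *\<^sub>R u) - ?D (y + s *\<^sub>R u))) (at s)"
      by (intro DERIV_diff DERIV_line df 1 2)
  qed
  then obtain z where z: "0 < z" "z < h" "?g h - ?g 0 = h * (?D (y + h *\<^sub>R v + z *\<^sub>R u) - ?D (y + z *\<^sub>R u))" by auto
  have "\<exists>w. 0 < w \<and> w < h \<and> ?D (y + z *\<^sub>R u + h *\<^sub>R v) - ?D (y + z *\<^sub>R u + 0 *\<^sub>R v) =
      (h - 0) * frechet_derivative ?D (at (y + z *\<^sub>R u + w *\<^sub>R v)) v"
  proof (rule MVT2[OF h(1)])
    fix t assume "0 \<le> t" "t \<le> h"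
    then have "y + z *\<^sub>R u + t *\<^sub>R v \<in> ball y r" using nb[of z t] z by simp
    from DERIV_line[OF ddf[OF this]]
    show "((\<lambda>t. ?D (y + z *\<^sub>R u + t *\<^sub>R v)) has_real_derivative frechet_derivative ?D (at (y + z *\<^sub>R u + t *\<^sub>R v)) v) (at t)" .
  qed
  then obtain w where w: "0 < w" "w < h" "?D (y + z *\<^sub>R u + h *\<^sub>R v) - ?D (y + z *\<^sub>R u) =
      h * frechet_derivative ?D (at (y + z *\<^sub>R u + w *\<^sub>R v)) v" by auto
  show ?thesis
  proof (rule bexI[of _ "y + z *\<^sub>R u + w *\<^sub>R v"])
    have e: "y + h *\<^sub>R v + z *\<^sub>R u = y + z *\<^sub>R u + h *\<^sub>R v" "y + h *\<^sub>R v + h *\<^sub>R u = y + h *\<^sub>R u + h *\<^sub>R v"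
      by (simp_all add: algebra_simps)
    show "f (y + h *\<^sub>R u + h *\<^sub>R v) - f (y + h *\<^sub>R u) - f (y + h *\<^sub>R v) + f y =
      h * h * frechet_derivative ?D (at (y + z *\<^sub>R u + w *\<^sub>R v)) v"
      using z(3) w(3) unfolding e by simp
  qed (use near[of z w] z w in auto)
qed

text \<open>The second difference is symmetric in \<open>u\<close> and \<open>v\<close>, so the two
  mixed derivatives coincide at points \<open>p\<close> and \<open>q\<close> arbitrarily near
  \<open>y\<close>; continuity at \<open>y\<close> excludes a gap.\<close>

lemma second_derivative_symmetric:
  fixes f :: "'a::real_normed_vector \<Rightarrow> real"
  assumes U: "open U" "y \<in> U" and C2: "Ck_on (Suc (Suc 0)) f U"
  shows "frechet_derivative (\<lambda>x. frechet_derivative f (at x) u) (at y) v =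
         frechet_derivative (\<lambda>x. frechet_derivative f (at x) v) (at y) u" (is "?A y = ?B y")
proof (rule ccontr)
  assume ne: "?A y \<noteq> ?B y"
  define e where "e = \<bar>?A y - ?B y\<bar> / 2"
  have e: "e > 0" using ne by (simp add: e_def)
  have c: "isCont ?A y" "isCont ?B y" using C2 U by (simp_all add: continuous_on_eq_continuous_at)
  obtain d1 where d1: "d1 > 0" "\<And>x. dist x y < d1 \<Longrightarrow> dist (?A x) (?A y) < e"
    using c(1)[unfolded continuous_at_eps_delta, rule_format, OF e] by blast
  obtain d2 where d2: "d2 > 0" "\<And>x. dist x y < d2 \<Longrightarrow> dist (?B x) (?B y) < e"
    using c(2)[unfolded continuous_at_eps_delta, rule_format, OF e] by blast
  note d = d1 d2
  obtain r where r: "r > 0" "ball y r \<subseteq> U" using U open_contains_ball by blast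
  define \<rho> where "\<rho> = min r (min d1 d2)"
  define h where "h = \<rho> / (norm u + norm v + 1) / 2"
  have \<rho>: "\<rho> > 0" using r d by (simp add: \<rho>_def)
  have n: "norm u + norm v + 1 > 0" by (simp add: add_nonneg_pos)
  have h: "h > 0" using \<rho> n by (simp add: h_def)
  have "h * (norm u + norm v) \<le> h * (norm u + norm v + 1)" using h by simp
  also have "\<dots> = \<rho> / (norm u + norm v + 1) * (norm u + norm v + 1) / 2" by (simp only: h_def times_divide_eq_left)
  also have "\<dots> = \<rho> / 2" using n by simp
  also have "\<dots> < \<rho>" using \<rho> by simp
  finally have hr: "h * (norm u + norm v) < \<rho>" .
  then have hr1: "h * (norm u + norm v) < r" by (simp add: \<rho>_def)
  have C2': "Ck_on (Suc (Suc 0)) f (ball y r)" using C2 r(2) Ck_on_subset by blast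
  obtain p where p: "p \<in> cball y (h * (norm u + norm v))"
    "f (y + h *\<^sub>R u + h *\<^sub>R v) - f (y + h *\<^sub>R u) - f (y + h *\<^sub>R v) + f y = h * h * ?A p"
    using mixed_second_difference[OF C2' h hr1] by blast
  have hr2: "h * (norm v + norm u) < r" using hr1 by (simp add: add.commute)
  obtain q where q: "q \<in> cball y (h * (norm v + norm u))"
    "f (y + h *\<^sub>R v + h *\<^sub>R u) - f (y + h *\<^sub>R v) - f (y + h *\<^sub>R u) + f y = h * h * ?B q"
    using mixed_second_difference[OF C2' h hr2] by blast
  have "h * h * ?A p = h * h * ?B q" using p(2) q(2) by (simp add: algebra_simps)
  then have "?A p = ?B q" using h by simp
  moreover have "dist p y < \<rho>" "dist q y < \<rho>" using p(1) q(1) hr by (simp_all add: dist_commute add.commute)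
  then have "dist (?A p) (?A y) < e" "dist (?B q) (?B y) < e" using d by (simp_all add: \<rho>_def)
  moreover have "False" if "a = c" "\<bar>a - b\<bar> < \<bar>b - d\<bar> / 2" "\<bar>c - d\<bar> < \<bar>b - d\<bar> / 2" for a b c d :: real
    using that abs_triangle_ineq[of "b - a" "c - d"] by (simp add: abs_minus_commute)
  ultimately show False unfolding e_def dist_real_def by blast
qed

lemma pd_commute:
  assumes "open U" "y \<in> U" "Ck_on (Suc (Suc 0)) f U"
  shows "pd i (pd j f) y = pd j (pd i f) y"
  using second_derivative_symmetric[OF assms] by (simp add: pd_def[abs_def])

section \<open>Contractions and the inverse metric\<close>

text \<open>Iterated traces are written with this operator so that rearranging them is
  \<open>contract_swap\<close> and moving Jacobians onto the inverse metric is
  \<open>contract_pull\<close>.\<close>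

definition contract :: "('n::finite \<Rightarrow> 'n \<Rightarrow> real) \<Rightarrow> ('n \<Rightarrow> 'n \<Rightarrow> real) \<Rightarrow> real" where
  "contract P f = (\<Sum>i\<in>UNIV. \<Sum>j\<in>UNIV. P i j * f i j)"

lemma sum_sum_swap:
  fixes t :: "'a::finite \<Rightarrow> 'b::finite \<Rightarrow> 'c::finite \<Rightarrow> 'd::finite \<Rightarrow> real"
  shows "(\<Sum>i\<in>UNIV. \<Sum>j\<in>UNIV. \<Sum>a\<in>UNIV. \<Sum>b\<in>UNIV. t i j a b) =
    (\<Sum>a\<in>UNIV. \<Sum>b\<in>UNIV. \<Sum>i\<in>UNIV. \<Sum>j\<in>UNIV. t i j a b)"
proof -
  have "(\<Sum>i\<in>UNIV. \<Sum>j\<in>UNIV. \<Sum>a\<in>UNIV. \<Sum>b\<in>UNIV. t i j a b) = (\<Sum>i\<in>UNIV. \<Sum>a\<in>UNIV. \<Sum>j\<in>UNIV. \<Sum>b\<in>UNIV. t i j a b)"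
    by (intro sum.cong refl sum.swap)
  also have "\<dots> = (\<Sum>a\<in>UNIV. \<Sum>i\<in>UNIV. \<Sum>j\<in>UNIV. \<Sum>b\<in>UNIV. t i j a b)" by (rule sum.swap)
  also have "\<dots> = (\<Sum>a\<in>UNIV. \<Sum>i\<in>UNIV. \<Sum>b\<in>UNIV. \<Sum>j\<in>UNIV. t i j a b)"
    by (intro sum.cong refl sum.swap)
  also have "\<dots> = (\<Sum>a\<in>UNIV. \<Sum>b\<in>UNIV. \<Sum>i\<in>UNIV. \<Sum>j\<in>UNIV. t i j a b)"
    by (intro sum.cong refl sum.swap)
  finally show ?thesis .
qed

lemma contract_swap:
  "contract P (\<lambda>i j. contract R (\<lambda>p q. f i j p q)) = contract R (\<lambda>p q. contract P (\<lambda>i j. f i j p q))"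
proof -
  have "contract P (\<lambda>i j. contract R (\<lambda>p q. f i j p q)) =
    (\<Sum>i\<in>UNIV. \<Sum>j\<in>UNIV. \<Sum>p\<in>UNIV. \<Sum>q\<in>UNIV. P i j * (R p q * f i j p q))"
    by (simp only: contract_def sum_distrib_left)
  also have "\<dots> = (\<Sum>p\<in>UNIV. \<Sum>q\<in>UNIV. \<Sum>i\<in>UNIV. \<Sum>j\<in>UNIV. P i j * (R p q * f i j p q))"
    by (rule sum_sum_swap)
  also have "\<dots> = contract R (\<lambda>p q. contract P (\<lambda>i j. f i j p q))"
    by (simp only: contract_def sum_distrib_left mult.left_commute)
  finally show ?thesis .
qed

text \<open>The hypothesis is the transformation law of an inverse metric with Jacobian
  \<open>J\<close>; the conclusion says that traces of pulled-back bilinear forms are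
  invariant.\<close>

lemma contract_pull:
  assumes Q: "\<And>a b. (\<Sum>i\<in>UNIV. \<Sum>j\<in>UNIV. J a i * P i j * J b j) = Q a b"
  shows "contract P (\<lambda>i j. \<Sum>a\<in>UNIV. \<Sum>b\<in>UNIV. J a i * J b j * h a b) = contract Q h"
proof -
  have "contract P (\<lambda>i j. \<Sum>a\<in>UNIV. \<Sum>b\<in>UNIV. J a i * J b j * h a b) =
    (\<Sum>i\<in>UNIV. \<Sum>j\<in>UNIV. \<Sum>a\<in>UNIV. \<Sum>b\<in>UNIV. J a i * P i j * J b j * h a b)"
    by (simp only: contract_def sum_distrib_left) (simp only: mult_ac)
  also have "\<dots> = (\<Sum>a\<in>UNIV. \<Sum>b\<in>UNIV. \<Sum>i\<in>UNIV. \<Sum>j\<in>UNIV. J a i * P i j * J b j * h a b)"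
    by (rule sum_sum_swap)
  also have "\<dots> = contract Q h"
    by (simp only: contract_def Q[symmetric] sum_distrib_right)
  finally show ?thesis .
qed

lemma contract_pull_product:
  assumes Q: "\<And>a b. (\<Sum>i\<in>UNIV. \<Sum>j\<in>UNIV. J a i * P i j * J b j) = Q a b"
  shows "contract P (\<lambda>i j. (\<Sum>a\<in>UNIV. J a i * x a) * (\<Sum>b\<in>UNIV. J b j * y b)) = contract Q (\<lambda>a b. x a * y b)"
proof -
  have "(\<Sum>a\<in>UNIV. J a i * x a) * (\<Sum>b\<in>UNIV. J b j * y b) = (\<Sum>a\<in>UNIV. \<Sum>b\<in>UNIV. J a i * J b j * (x a * y b))" for i j
    by (simp only: sum_product) (simp only: mult_ac)
  then show ?thesis by (simp only: contract_pull[OF Q])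
qed

lemma H_norm2_contract:
  "H_norm2 g H y = contract (ginv g y) (\<lambda>i j. contract (ginv g y) (\<lambda>p q. contract (ginv g y) (\<lambda>k l.
      H y [i, p, k] * H y [j, q, l])))"
  by (simp add: H_norm2_def H_squared_def contract_def sum_distrib_left mult.assoc)

lemma laplacian_contract:
  "laplacian g f y = contract (ginv g y) (\<lambda>i j. pd i (pd j f) y - (\<Sum>k\<in>UNIV. christoffel g k i j y * pd k f y))"
  by (simp add: laplacian_def contract_def)

lemma matrix_inv_eqI:
  fixes M N :: "real ^ 'n ^ 'n"
  assumes "M ** N = mat 1"
  shows "matrix_inv M = N"
proof -
  have NM: "N ** M = mat 1" using assms matrix_left_right_inverse by blast
  have "\<exists>B. M ** B = mat 1 \<and> B ** M = mat 1" using assms NM by blast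
  then have "M ** matrix_inv M = mat 1 \<and> matrix_inv M ** M = mat 1"
    unfolding matrix_inv_def by (rule someI_ex)
  then have "matrix_inv M = matrix_inv M ** (M ** N)" using assms by simp
  also have "\<dots> = N" using \<open>M ** matrix_inv M = mat 1 \<and> matrix_inv M ** M = mat 1\<close>
    by (simp add: matrix_mul_assoc)
  finally show ?thesis .
qed

locale metric_at =
  fixes g :: "('n::finite) cov" and y :: "real ^ 'n"
  assumes g_sym: "g y [i, j] = g y [j, i]"
    and g_pos: "v \<noteq> 0 \<Longrightarrow> 0 < (\<Sum>i\<in>UNIV. \<Sum>j\<in>UNIV. g y [i, j] * v $ i * v $ j)"
begin

abbreviation gm :: "real ^ 'n ^ 'n" where "gm \<equiv> \<chi> a b. g y [a, b]"

lemma gm_inverse_exists: "\<exists>N. N ** gm = mat 1"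
proof -
  have lin: "linear ((*v) gm)" by simp
  have "v = 0" if "gm *v v = 0" for v
  proof (rule ccontr)
    assume "v \<noteq> 0"
    from g_pos[OF this] have "0 < (\<Sum>i\<in>UNIV. v $ i * (gm *v v) $ i)"
      by (simp add: matrix_vector_mult_def sum_distrib_left mult_ac)
    then show False using that by simp
  qed
  then have "inj ((*v) gm)" using linear_injective_0[OF lin] by blast
  then show ?thesis using matrix_left_invertible_injective by blast
qed

lemma ginv_matrix: "gm ** matrix_inv gm = mat 1" "matrix_inv gm ** gm = mat 1"
proof -
  obtain N where N: "N ** gm = mat 1" using gm_inverse_exists by blast
  then have N': "gm ** N = mat 1" using matrix_left_right_inverse by blast
  then show "gm ** matrix_inv gm = mat 1" "matrix_inv gm ** gm = mat 1"
    using N matrix_inv_eqI[OF N'] by simp_all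
qed

lemma ginv_left: "(\<Sum>b\<in>UNIV. ginv g y a b * g y [b, c]) = (if a = c then 1 else 0)"
  using ginv_matrix(2) by (simp add: vec_eq_iff matrix_matrix_mult_def ginv_def mat_def)

lemma ginv_sym: "ginv g y i j = ginv g y j i"
proof -
  have "transpose gm = gm" by (simp add: vec_eq_iff transpose_def g_sym)
  then have "gm ** transpose (matrix_inv gm) = mat 1"
    using ginv_matrix(2) matrix_transpose_mul[of "matrix_inv gm" gm] by (simp add: transpose_mat)
  then have "matrix_inv gm = transpose (matrix_inv gm)" by (rule matrix_inv_eqI)
  then have "matrix_inv gm $ i $ j = transpose (matrix_inv gm) $ i $ j" by simp
  then show ?thesis by (simp add: ginv_def transpose_def)
qed

text \<open>If v = g w, the inverse form evaluated at v is the form g evaluated at w.\<close>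

lemma ginv_pos:
  assumes "v \<noteq> 0"
  shows "0 < (\<Sum>i\<in>UNIV. \<Sum>j\<in>UNIV. ginv g y i j * v $ i * v $ j)"
proof -
  define w where "w = matrix_inv gm *v v"
  have v: "v = gm *v w" by (simp add: w_def matrix_vector_mul_assoc ginv_matrix)
  then have "w \<noteq> 0" using assms by auto
  from g_pos[OF this] have "0 < (\<Sum>i\<in>UNIV. w $ i * (gm *v w) $ i)"
    by (simp add: matrix_vector_mult_def sum_distrib_left mult_ac)
  also have "\<dots> = (\<Sum>i\<in>UNIV. w $ i * v $ i)" using v by simp
  also have "\<dots> = (\<Sum>i\<in>UNIV. \<Sum>j\<in>UNIV. ginv g y i j * v $ i * v $ j)"
    by (simp add: w_def matrix_vector_mult_def sum_distrib_left sum_distrib_right ginv_def mult_ac)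
  finally show ?thesis .
qed

lemma ginv_nonneg: "0 \<le> (\<Sum>i\<in>UNIV. \<Sum>j\<in>UNIV. ginv g y i j * v i * v j)"
proof (cases "(\<chi> i. v i) = 0")
  case True
  then show ?thesis by (simp add: vec_eq_iff)
next
  case False
  from ginv_pos[OF this] show ?thesis by simp
qed

lemma scaled:
  assumes "\<tau> > 0"
  shows "ginv (\<lambda>y is. \<tau> * g y is) y i j = ginv g y i j / \<tau>"
proof -
  have "(\<chi> a b. \<tau> * g y [a, b]) ** ((1/\<tau>) *\<^sub>R matrix_inv gm) = mat 1"
    using ginv_matrix(1) assms
    by (simp add: vec_eq_iff matrix_matrix_mult_def sum_distrib_left mult_ac)
  from matrix_inv_eqI[OF this] show ?thesis by (simp add: ginv_def)
qed

end

text \<open>Two positive semidefinite forms have a nonnegative Frobenius product; one eliminates the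
  indices one at a time, splitting off a rank-one form as in the Cholesky decomposition.\<close>

lemma frobenius_nonneg:
  fixes P B :: "'a \<Rightarrow> 'a \<Rightarrow> real"
  assumes "finite S"
    and "\<And>i j. i \<in> S \<Longrightarrow> j \<in> S \<Longrightarrow> P i j = P j i"
    and "\<And>v. 0 \<le> (\<Sum>i\<in>S. \<Sum>j\<in>S. P i j * v i * v j)"
    and "\<And>v. 0 \<le> (\<Sum>i\<in>S. \<Sum>j\<in>S. B i j * v i * v j)"
  shows "0 \<le> (\<Sum>i\<in>S. \<Sum>j\<in>S. P i j * B i j)"
  using assms
proof (induction S arbitrary: P rule: finite_induct)
  case empty
  then show ?case by simp
next
  case (insert a S)
  note fin = insert.hyps(1) and aS = insert.hyps(2) and sym = insert.prems(1) and psd = insert.prems(2) and B = insert.prems(3)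
  have expand: "(\<Sum>i\<in>insert a S. \<Sum>j\<in>insert a S. f i j) =
     f a a + (\<Sum>j\<in>S. f a j) + (\<Sum>i\<in>S. f i a) + (\<Sum>i\<in>S. \<Sum>j\<in>S. f i j)" for f :: "'a \<Rightarrow> 'a \<Rightarrow> real"
    using fin aS by (simp add: sum.distrib)
  have B': "0 \<le> (\<Sum>i\<in>S. \<Sum>j\<in>S. B i j * v i * v j)" for v
  proof -
    define w where "w = v(a := 0)"
    have "w i = v i" if "i \<in> S" for i using that aS by (auto simp: w_def)
    moreover have "w a = 0" by (simp add: w_def)
    ultimately show ?thesis using B[of w] unfolding expand by (simp cong: sum.cong)
  qed
  have paa: "0 \<le> P a a"
  proof -
    define w where "w = (\<lambda>i. if i = a then 1 else 0 :: real)"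
    have "w i = 0" if "i \<in> S" for i using that aS by (auto simp: w_def)
    moreover have "w a = 1" by (simp add: w_def)
    ultimately show ?thesis using psd[of w] unfolding expand by (simp cong: sum.cong)
  qed
  have quad: "0 \<le> P a a * t * t + 2 * t * (\<Sum>i\<in>S. P a i * v i) + (\<Sum>i\<in>S. \<Sum>j\<in>S. P i j * v i * v j)" for t v
  proof -
    define w where "w = v(a := t)"
    have wS: "w i = v i" if "i \<in> S" for i using that aS by (auto simp: w_def)
    have wa: "w a = t" by (simp add: w_def)
    have 1: "(\<Sum>j\<in>S. P a j * w a * w j) = t * (\<Sum>i\<in>S. P a i * v i)"
      using wS wa by (simp add: sum_distrib_left mult_ac cong: sum.cong)
    have 2: "(\<Sum>i\<in>S. P i a * w i * w a) = t * (\<Sum>i\<in>S. P a i * v i)"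
      unfolding sum_distrib_left by (rule sum.cong) (use wS wa sym in \<open>simp_all add: mult_ac\<close>)
    have 3: "(\<Sum>i\<in>S. \<Sum>j\<in>S. P i j * w i * w j) = (\<Sum>i\<in>S. \<Sum>j\<in>S. P i j * v i * v j)"
      using wS by (simp cong: sum.cong)
    show ?thesis using psd[of w] unfolding expand unfolding 1 2 3 unfolding wa by simp
  qed
  show ?case
  proof (cases "P a a = 0")
    case True
    have "P a i = 0" if "i \<in> S" for i
    proof (rule ccontr)
      assume ne: "P a i \<noteq> 0"
      define v where "v j = (if j = i then 1 else 0 :: real)" for j
      have s1: "(\<Sum>j\<in>S. P a j * v j) = P a i" using that fin by (simp add: v_def if_distrib cong: if_cong)
      \<comment> \<open>As \<open>P a a = 0\<close>, the form is affine in the coefficient of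
        \<open>a\<close>, and the coefficient \<open>- (c + 1) / (2 * P a i)\<close> brings its
        value down to -1.\<close>
      define c where "c = (\<Sum>k\<in>S. \<Sum>j\<in>S. P k j * v k * v j)"
      have "0 \<le> 2 * (- (c + 1) / (2 * P a i)) * P a i + c"
        using quad[of "- (c + 1) / (2 * P a i)" v] True s1 by (simp add: c_def)
      also have "\<dots> = -1" using ne by (simp add: field_simps)
      finally show False by simp
    qed
    moreover have "P i a = 0" if "i \<in> S" for i using calculation[OF that] sym[of i a] that by simp
    ultimately have "(\<Sum>i\<in>insert a S. \<Sum>j\<in>insert a S. P i j * B i j) = (\<Sum>i\<in>S. \<Sum>j\<in>S. P i j * B i j)"
      unfolding expand using True by (simp cong: sum.cong)
    moreover have "0 \<le> (\<Sum>i\<in>S. \<Sum>j\<in>S. P i j * B i j)"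
    proof (rule insert.IH)
      show "0 \<le> (\<Sum>i\<in>S. \<Sum>j\<in>S. P i j * v i * v j)" for v using quad[of 0 v] by simp
    qed (use sym B' in auto)
    ultimately show ?thesis by simp
  next
    case False
    then have pos: "P a a > 0" using paa by simp
    \<comment> \<open>The Schur complement of the entry \<open>P a a\<close>. It is semidefinite
      because \<open>quad\<close> at the minimising coefficient \<open>- q / P a a\<close> completes
      the square.\<close>
    define R where "R i j = P i j - P a i * P a j / P a a" for i j
    have R: "0 \<le> (\<Sum>i\<in>S. \<Sum>j\<in>S. R i j * B i j)"
    proof (rule insert.IH)
      show "R i j = R j i" if "i \<in> S" "j \<in> S" for i j using sym[of i j] that by (simp add: R_def mult.commute)
      show "0 \<le> (\<Sum>i\<in>S. \<Sum>j\<in>S. R i j * v i * v j)" for v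
      proof -
        define q where "q = (\<Sum>i\<in>S. P a i * v i)"
        have "(\<Sum>i\<in>S. \<Sum>j\<in>S. P a i * P a j / P a a * v i * v j) = q * q / P a a"
          by (simp add: q_def sum_product sum_divide_distrib mult_ac)
        then have "(\<Sum>i\<in>S. \<Sum>j\<in>S. R i j * v i * v j) = (\<Sum>i\<in>S. \<Sum>j\<in>S. P i j * v i * v j) - q * q / P a a"
          by (simp add: R_def left_diff_distrib sum_subtractf)
        moreover have "P a a * (- q / P a a) * (- q / P a a) + 2 * (- q / P a a) * q = - (q * q / P a a)"
          using pos by (simp add: field_simps)
        ultimately show ?thesis using quad[of "- q / P a a" v] by (simp add: q_def)
      qed
    qed (use B' in auto)
    \<comment> \<open>The rank-one part that was split off contributes the form \<open>B\<close> at
      the vector \<open>P a\<close>, divided by \<open>P a a\<close>, which is nonnegative.\<close>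
    have "(\<Sum>i\<in>insert a S. \<Sum>j\<in>insert a S. P i j * B i j) =
      (\<Sum>i\<in>insert a S. \<Sum>j\<in>insert a S. R i j * B i j) + (\<Sum>i\<in>insert a S. \<Sum>j\<in>insert a S. B i j * P a i * P a j) / P a a"
      unfolding sum_divide_distrib sum.distrib[symmetric]
      by (intro sum.cong refl) (use pos in \<open>simp add: R_def field_simps\<close>)
    moreover have "(\<Sum>i\<in>insert a S. \<Sum>j\<in>insert a S. R i j * B i j) = (\<Sum>i\<in>S. \<Sum>j\<in>S. R i j * B i j)"
    proof -
      have "R a j = 0" for j using pos by (simp add: R_def)
      moreover have "R i a = 0" if "i \<in> S" for i using pos sym[of i a] that by (simp add: R_def)
      ultimately show ?thesis unfolding expand by (simp cong: sum.cong)
    qed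
    moreover have "0 \<le> (\<Sum>i\<in>insert a S. \<Sum>j\<in>insert a S. B i j * P a i * P a j) / P a a"
      using B[of "P a"] pos by simp
    ultimately show ?thesis using R by simp
  qed
qed

context metric_at
begin

lemma contract_ginv_nonneg:
  assumes "\<And>v. 0 \<le> (\<Sum>i\<in>UNIV. \<Sum>j\<in>UNIV. B i j * v i * v j)"
  shows "0 \<le> contract (ginv g y) B"
  unfolding contract_def
  by (rule frobenius_nonneg) (use ginv_nonneg ginv_sym assms in auto)

lemma ginv_lower_bound: "\<exists>\<kappa>>0. \<forall>v. \<kappa> * (\<Sum>i\<in>UNIV. v i * v i) \<le> (\<Sum>i\<in>UNIV. \<Sum>j\<in>UNIV. ginv g y i j * v i * v j)"
proof -
  let ?q = "\<lambda>v :: real ^ 'n. \<Sum>i\<in>UNIV. \<Sum>j\<in>UNIV. ginv g y i j * v $ i * v $ j"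
  have ne: "sphere (0 :: real ^ 'n) 1 \<noteq> {}" by simp
  have "continuous_on (sphere 0 1) ?q" by (intro continuous_intros)
  from continuous_attains_inf[OF compact_sphere ne this]
  obtain w where w: "w \<in> sphere 0 1" "\<And>v. v \<in> sphere 0 1 \<Longrightarrow> ?q w \<le> ?q v" by blast
  have "w \<noteq> 0" using w(1) by auto
  then have pos: "?q w > 0" by (rule ginv_pos)
  have "?q w * (\<Sum>i\<in>UNIV. v i * v i) \<le> (\<Sum>i\<in>UNIV. \<Sum>j\<in>UNIV. ginv g y i j * v i * v j)" for v
  proof -
    define u where "u = (\<chi> i. v i)"
    have n: "(\<Sum>i\<in>UNIV. v i * v i) = norm u * norm u"
      using power2_norm_eq_inner[of u] by (simp add: u_def inner_vec_def power2_eq_square)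
    show ?thesis
    proof (cases "u = 0")
      case True
      then have "v i = 0" for i by (simp add: u_def vec_eq_iff)
      then show ?thesis by simp
    next
      case False
      then have nu: "norm u > 0" by simp
      have "?q w \<le> ?q ((1 / norm u) *\<^sub>R u)" by (rule w(2)) (use nu in simp)
      also have "\<dots> = ?q u / (norm u * norm u)" by (simp add: sum_divide_distrib)
      finally have "?q w * (norm u * norm u) \<le> ?q u" using nu by (simp add: field_simps)
      then show ?thesis unfolding n by (simp add: u_def)
    qed
  qed
  then show ?thesis using pos by blast
qed

text \<open>Subtracting \<kappa> times the identity leaves the inverse metric semidefinite, so its
  Frobenius product with a semidefinite form stays nonnegative.\<close>

lemma contract_ginv_lower_bound:
  "\<exists>\<kappa>>0. \<forall>B. (\<forall>v. 0 \<le> (\<Sum>i\<in>UNIV. \<Sum>j\<in>UNIV. B i j * v i * v j)) \<longrightarrow>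
    \<kappa> * (\<Sum>i\<in>UNIV. B i i) \<le> contract (ginv g y) B"
proof -
  obtain \<kappa> where \<kappa>: "\<kappa> > 0" "\<And>v. \<kappa> * (\<Sum>i\<in>UNIV. v i * v i) \<le> (\<Sum>i\<in>UNIV. \<Sum>j\<in>UNIV. ginv g y i j * v i * v j)"
    using ginv_lower_bound by blast
  let ?P = "\<lambda>i j. ginv g y i j - (if i = j then \<kappa> else 0)"
  have diag: "(\<Sum>i\<in>UNIV. \<Sum>j\<in>UNIV. (if i = j then \<kappa> else 0) * f i j) = \<kappa> * (\<Sum>i\<in>UNIV. f i i)" for f :: "'n \<Rightarrow> 'n \<Rightarrow> real"
    by (simp add: if_distrib[of "\<lambda>x. x * _"] sum_distrib_left cong: if_cong)
  have "\<kappa> * (\<Sum>i\<in>UNIV. B i i) \<le> contract (ginv g y) B"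
    if "\<And>v. 0 \<le> (\<Sum>i\<in>UNIV. \<Sum>j\<in>UNIV. B i j * v i * v j)" for B
  proof -
    have "0 \<le> (\<Sum>i\<in>UNIV. \<Sum>j\<in>UNIV. ?P i j * B i j)"
    proof (rule frobenius_nonneg)
      show "0 \<le> (\<Sum>i\<in>UNIV. \<Sum>j\<in>UNIV. ?P i j * v i * v j)" for v
        using \<kappa>(2)[of v] diag[of "\<lambda>i j. v i * v j"] by (simp add: left_diff_distrib sum_subtractf mult.assoc)
    qed (use ginv_sym that in auto)
    then show ?thesis using diag[of B] by (simp add: contract_def left_diff_distrib sum_subtractf)
  qed
  then show ?thesis using \<kappa>(1) by blast
qed

lemma sum_square_form:
  "(\<Sum>i\<in>UNIV. \<Sum>j\<in>UNIV. f i * f j * v i * v j) = (\<Sum>i\<in>UNIV. f i * v i) * (\<Sum>i\<in>UNIV. f i * v i)"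
  for f v :: "'n \<Rightarrow> real"
  by (simp add: sum_product mult_ac)

lemma form_contract:
  "(\<Sum>i\<in>UNIV. \<Sum>j\<in>UNIV. contract (ginv g y) (\<lambda>p q. f i j p q) * v i * v j) =
    contract (ginv g y) (\<lambda>p q. \<Sum>i\<in>UNIV. \<Sum>j\<in>UNIV. f i j p q * v i * v j)" for v :: "'n \<Rightarrow> real"
proof -
  have "contract (\<lambda>i j. v i * v j) (\<lambda>i j. contract (ginv g y) (\<lambda>p q. f i j p q)) =
    contract (ginv g y) (\<lambda>p q. contract (\<lambda>i j. v i * v j) (\<lambda>i j. f i j p q))"
    by (rule contract_swap)
  moreover have "contract (\<lambda>i j. v i * v j) F = (\<Sum>i\<in>UNIV. \<Sum>j\<in>UNIV. F i j * v i * v j)" for F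
    unfolding contract_def by (intro sum.cong refl) simp
  ultimately show ?thesis by simp
qed

text \<open>The lower bound for traces is used once for each of the three slots. At every stage the
  remaining form must be semidefinite; it is a trace of forms that are squares, which
  \<open>p3\<close>, \<open>p2\<close> and \<open>p1\<close> establish from the inside out. The
  result makes vanishing of the norm force vanishing of all components.\<close>

lemma H_norm2_lower_bound: "\<exists>\<kappa>>0. \<kappa> * (\<Sum>i\<in>UNIV. \<Sum>p\<in>UNIV. \<Sum>k\<in>UNIV. H y [i, p, k] * H y [i, p, k]) \<le> H_norm2 g H y"
proof -
  let ?c = "contract (ginv g y)"
  obtain \<kappa> where \<kappa>: "\<kappa> > 0" and lb: "\<And>B. (\<And>v. 0 \<le> (\<Sum>i\<in>UNIV. \<Sum>j\<in>UNIV. B i j * v i * v j)) \<Longrightarrow>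
    \<kappa> * (\<Sum>i\<in>UNIV. B i i) \<le> ?c B"
    using contract_ginv_lower_bound by blast
  define h where "h i p k = H y [i, p, k]" for i p k
  have p3: "0 \<le> (\<Sum>k\<in>UNIV. \<Sum>l\<in>UNIV. (f k * f l) * v k * v l)" for f v :: "'n \<Rightarrow> real"
    using sum_square_form[of f v] by simp
  have prod: "(\<Sum>p\<in>UNIV. \<Sum>q\<in>UNIV. f p k * f q l * v p * v q) = (\<Sum>p\<in>UNIV. f p k * v p) * (\<Sum>p\<in>UNIV. f p l * v p)"
    for f :: "'n \<Rightarrow> 'n \<Rightarrow> real" and v k l
    by (simp add: sum_product mult_ac)
  have p2: "0 \<le> (\<Sum>p\<in>UNIV. \<Sum>q\<in>UNIV. ?c (\<lambda>k l. f p k * f q l) * v p * v q)" for f :: "'n \<Rightarrow> 'n \<Rightarrow> real" and v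
    unfolding form_contract prod by (rule contract_ginv_nonneg) (rule p3)
  have p1: "0 \<le> (\<Sum>i\<in>UNIV. \<Sum>j\<in>UNIV. ?c (\<lambda>p q. ?c (\<lambda>k l. h i p k * h j q l)) * v i * v j)" for v
  proof -
    have "(\<Sum>i\<in>UNIV. \<Sum>j\<in>UNIV. h i p k * h j q l * v i * v j) = (\<Sum>i\<in>UNIV. h i p k * v i) * (\<Sum>i\<in>UNIV. h i q l * v i)" for p q k l
      by (simp add: sum_product mult_ac)
    then show ?thesis unfolding form_contract
      by (simp only:) (rule contract_ginv_nonneg, rule p2)
  qed
  have "\<kappa> * (\<kappa> * (\<kappa> * (\<Sum>i\<in>UNIV. \<Sum>p\<in>UNIV. \<Sum>k\<in>UNIV. h i p k * h i p k)))
    = \<kappa> * (\<Sum>i\<in>UNIV. \<kappa> * (\<Sum>p\<in>UNIV. \<kappa> * (\<Sum>k\<in>UNIV. h i p k * h i p k)))"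
    by (simp add: sum_distrib_left)
  also have "\<dots> \<le> \<kappa> * (\<Sum>i\<in>UNIV. \<kappa> * (\<Sum>p\<in>UNIV. ?c (\<lambda>k l. h i p k * h i p l)))"
    using \<kappa> by (intro mult_left_mono sum_mono lb p3) auto
  also have "\<dots> \<le> \<kappa> * (\<Sum>i\<in>UNIV. ?c (\<lambda>p q. ?c (\<lambda>k l. h i p k * h i q l)))"
    using \<kappa> by (intro mult_left_mono sum_mono lb p2) auto
  also have "\<dots> \<le> ?c (\<lambda>i j. ?c (\<lambda>p q. ?c (\<lambda>k l. h i p k * h j q l)))"
    by (intro lb p1)
  finally show ?thesis
    unfolding H_norm2_contract h_def using \<kappa> by (intro exI[of _ "\<kappa> * (\<kappa> * \<kappa>)"]) (simp add: mult.assoc)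
qed

lemma H_norm2_nonneg: "0 \<le> H_norm2 g H y"
proof -
  obtain \<kappa> where \<kappa>: "\<kappa> > 0" "\<kappa> * (\<Sum>i\<in>UNIV. \<Sum>p\<in>UNIV. \<Sum>k\<in>UNIV. H y [i, p, k] * H y [i, p, k]) \<le> H_norm2 g H y"
    using H_norm2_lower_bound by blast
  have "0 \<le> \<kappa> * (\<Sum>i\<in>UNIV. \<Sum>p\<in>UNIV. \<Sum>k\<in>UNIV. H y [i, p, k] * H y [i, p, k])"
    using \<kappa>(1) by (intro mult_nonneg_nonneg[OF less_imp_le] sum_nonneg zero_le_square)
  then show ?thesis using \<kappa>(2) by linarith
qed

lemma H_norm2_eq_0:
  assumes "H_norm2 g H y \<le> 0"
  shows "H y [i, p, k] = 0"
proof -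
  obtain \<kappa> where \<kappa>: "\<kappa> > 0" "\<kappa> * (\<Sum>i\<in>UNIV. \<Sum>p\<in>UNIV. \<Sum>k\<in>UNIV. H y [i, p, k] * H y [i, p, k]) \<le> H_norm2 g H y"
    using H_norm2_lower_bound by blast
  have "H y [i, p, k] * H y [i, p, k] \<le> (\<Sum>k\<in>UNIV. H y [i, p, k] * H y [i, p, k])"
    by (rule member_le_sum) auto
  also have "\<dots> \<le> (\<Sum>p\<in>UNIV. \<Sum>k\<in>UNIV. H y [i, p, k] * H y [i, p, k])"
    by (rule member_le_sum) (auto intro: sum_nonneg)
  also have "\<dots> \<le> (\<Sum>i\<in>UNIV. \<Sum>p\<in>UNIV. \<Sum>k\<in>UNIV. H y [i, p, k] * H y [i, p, k])"
    by (rule member_le_sum) (auto intro!: sum_nonneg)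
  also have "\<dots> \<le> 0" using \<kappa> assms by (smt (verit) mult_pos_pos)
  finally have "H y [i, p, k] * H y [i, p, k] = 0"
    by (rule order.antisym[OF _ zero_le_square])
  then show ?thesis by simp
qed

end

section \<open>Invariance under diffeomorphisms\<close>

lemma differentiable_component:
  fixes F :: "real ^ 'n \<Rightarrow> real ^ 'n"
  assumes "Ck_on (Suc k) F U" "open U"
  shows "Ck_on (Suc k) (\<lambda>z. F z $ a) U"
  by (rule Ck_on_linear_comp[OF bounded_linear_vec_nth assms(2,1)])

text \<open>\<open>F\<close> is the coordinate expression of a diffeomorphism near \<open>y\<close>,
  and \<open>K\<close> is a right inverse of its Jacobian at \<open>y\<close>; the Jacobian is
  square, so this is all that is recorded of the inverse map.\<close>

locale coordinate_change = metric_at g "F y"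
  for g :: "('n::finite) cov" and F :: "real ^ 'n \<Rightarrow> real ^ 'n" and y :: "real ^ 'n" +
  fixes U V :: "(real ^ 'n) set" and K :: "'n \<Rightarrow> 'n \<Rightarrow> real"
  assumes U: "open U" "y \<in> U" and V: "open V" and FV: "F ` U \<subseteq> V"
    and F: "Ck_on (Suc (Suc 0)) F U"
    and g: "Ck_on (Suc 0) (\<lambda>z. g z [i, j]) V"
    and g_sym_near: "z \<in> V \<Longrightarrow> g z [i, j] = g z [j, i]"
    and K: "(\<Sum>i\<in>UNIV. pd i (\<lambda>z. F z $ a) y * K i b) = (if a = b then 1 else 0)"
begin

abbreviation J :: "'n \<Rightarrow> 'n \<Rightarrow> real" where "J a i \<equiv> pd i (\<lambda>z. F z $ a) y"
abbreviation S :: "'n \<Rightarrow> 'n \<Rightarrow> 'n \<Rightarrow> real" where "S a i j \<equiv> pd i (pd j (\<lambda>z. F z $ a)) y"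
abbreviation G :: "'n cov" where "G \<equiv> comp_pullback F g"
abbreviation dg :: "'n \<Rightarrow> 'n \<Rightarrow> 'n \<Rightarrow> real" where "dg c a b \<equiv> pd c (\<lambda>z. g z [a, b]) (F y)"

lemma Fy: "F y \<in> V" using U FV by blast

lemma G2: "G z [i, j] = (\<Sum>a\<in>UNIV. \<Sum>b\<in>UNIV. pd i (\<lambda>z. F z $ a) z * pd j (\<lambda>z. F z $ b) z * g (F z) [a, b])"
  unfolding comp_pullback_def using sum_lists_2[of "\<lambda>js. (\<Prod>m<2. pd ([i, j] ! m) (\<lambda>z. F z $ (js ! m)) z) * g (F z) js"]
  by (simp add: numeral_2_eq_2 lessThan_Suc mult_ac)

lemma S_sym: "S a i j = S a j i"
  by (rule pd_commute[OF U differentiable_component[OF F U(1)]])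

lemma F_diff: "F differentiable (at y)"
  using F U(2) by simp

lemma J_diff: "pd i (\<lambda>z. F z $ a) differentiable (at y)"
  using Ck_on_pd[OF differentiable_component[OF F U(1)], of i a] U(2) by simp

lemma g_diff: "(\<lambda>z. g z [a, b]) differentiable (at (F y))"
  using g Fy by simp

lemma gF_diff: "(\<lambda>z. g (F z) [a, b]) differentiable (at y)"
  using differentiable_chain_at[OF F_diff g_diff] by (simp add: o_def)

lemma pd_gF: "pd k (\<lambda>z. g (F z) [a, b]) y = (\<Sum>c\<in>UNIV. J c k * dg c a b)"
  by (rule pd_compose[OF g_diff F_diff])

lemma pd_G:
  "pd k (\<lambda>z. G z [i, j]) y =
    (\<Sum>a\<in>UNIV. \<Sum>b\<in>UNIV. S a k i * J b j * g (F y) [a, b]) +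
    (\<Sum>a\<in>UNIV. \<Sum>b\<in>UNIV. J a i * S b k j * g (F y) [a, b]) +
    (\<Sum>a\<in>UNIV. \<Sum>b\<in>UNIV. J a i * J b j * (\<Sum>c\<in>UNIV. J c k * dg c a b))"
proof -
  have d1: "(\<lambda>z. pd i (\<lambda>z. F z $ a) z * pd j (\<lambda>z. F z $ b) z) differentiable (at y)" for a b
    by (intro differentiable_mult J_diff)
  have d2: "(\<lambda>z. pd i (\<lambda>z. F z $ a) z * pd j (\<lambda>z. F z $ b) z * g (F z) [a, b]) differentiable (at y)" for a b
    by (rule differentiable_mult[OF d1 gF_diff])
  have "pd k (\<lambda>z. G z [i, j]) y =
    (\<Sum>a\<in>UNIV. \<Sum>b\<in>UNIV. pd k (\<lambda>z. pd i (\<lambda>z. F z $ a) z * pd j (\<lambda>z. F z $ b) z * g (F z) [a, b]) y)"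
    unfolding G2
    by (rule pd_sum_sum) (rule d2)
  also have "\<dots> = (\<Sum>a\<in>UNIV. \<Sum>b\<in>UNIV. S a k i * J b j * g (F y) [a, b] + J a i * S b k j * g (F y) [a, b] +
      J a i * J b j * (\<Sum>c\<in>UNIV. J c k * dg c a b))"
    by (intro sum.cong refl)
      (simp only: pd_mult[OF d1 gF_diff] pd_mult[OF J_diff J_diff] pd_gF distrib_right)
  finally show ?thesis by (simp only: sum.distrib)
qed

text \<open>The combination of first derivatives in the Christoffel symbols is designed so that
  second derivatives of \<open>F\<close> survive in one combination only; the rest is the same
  combination for \<open>g\<close>, transformed as a tensor.\<close>

lemma Koszul_G:
  "pd i (\<lambda>z. G z [j, l]) y + pd j (\<lambda>z. G z [i, l]) y - pd l (\<lambda>z. G z [i, j]) y =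
    (\<Sum>c\<in>UNIV. J c l * (2 * (\<Sum>a\<in>UNIV. S a i j * g (F y) [a, c]) +
      (\<Sum>a\<in>UNIV. \<Sum>b\<in>UNIV. J a i * J b j * (dg a b c + dg b a c - dg c a b))))"
proof -
  define T where "T k i j = (\<Sum>a\<in>UNIV. \<Sum>b\<in>UNIV. S a k i * J b j * g (F y) [a, b])" for k i j
  define R where "R k i j = (\<Sum>a\<in>UNIV. \<Sum>b\<in>UNIV. J a i * J b j * (\<Sum>c\<in>UNIV. J c k * dg c a b))" for k i j
  have T2: "(\<Sum>a\<in>UNIV. \<Sum>b\<in>UNIV. J a i * S b k j * g (F y) [a, b]) = T k j i" for k i j
    unfolding T_def by (subst sum.swap, intro sum.cong refl) (simp add: g_sym mult_ac)
  have dG: "pd k (\<lambda>z. G z [i, j]) y = T k i j + T k j i + R k i j" for k i j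
    unfolding pd_G T2 T_def R_def by simp
  \<comment> \<open>Of the six terms with second derivatives of \<open>F\<close>, four cancel by
    this symmetry and the other two coincide.\<close>
  have Tsym: "T k i j = T i k j" for k i j unfolding T_def using S_sym by simp
  have "pd i (\<lambda>z. G z [j, l]) y + pd j (\<lambda>z. G z [i, l]) y - pd l (\<lambda>z. G z [i, j]) y =
    2 * T i j l + (R i j l + R j i l - R l i j)"
    unfolding dG using Tsym[of j i l] Tsym[of l i j] Tsym[of l j i] by simp
  moreover have "T i j l = (\<Sum>c\<in>UNIV. J c l * (\<Sum>a\<in>UNIV. S a i j * g (F y) [a, c]))"
    unfolding T_def by (subst sum.swap) (simp add: sum_distrib_left mult_ac)
  moreover have "R i j l = (\<Sum>c\<in>UNIV. J c l * (\<Sum>a\<in>UNIV. \<Sum>b\<in>UNIV. J a i * J b j * dg a b c))"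
  proof -
    have "R i j l = (\<Sum>b\<in>UNIV. \<Sum>c\<in>UNIV. \<Sum>a\<in>UNIV. J c l * (J a i * J b j * dg a b c))"
      unfolding R_def by (simp add: sum_distrib_left mult_ac)
    also have "\<dots> = (\<Sum>c\<in>UNIV. \<Sum>b\<in>UNIV. \<Sum>a\<in>UNIV. J c l * (J a i * J b j * dg a b c))" by (rule sum.swap)
    also have "\<dots> = (\<Sum>c\<in>UNIV. \<Sum>a\<in>UNIV. \<Sum>b\<in>UNIV. J c l * (J a i * J b j * dg a b c))"
      by (rule sum.cong[OF refl], rule sum.swap)
    finally show ?thesis by (simp only: sum_distrib_left)
  qed
  moreover have "R j i l = (\<Sum>c\<in>UNIV. J c l * (\<Sum>a\<in>UNIV. \<Sum>b\<in>UNIV. J a i * J b j * dg b a c))"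
  proof -
    have "R j i l = (\<Sum>a\<in>UNIV. \<Sum>c\<in>UNIV. \<Sum>b\<in>UNIV. J c l * (J a i * J b j * dg b a c))"
      unfolding R_def by (simp add: sum_distrib_left mult_ac)
    also have "\<dots> = (\<Sum>c\<in>UNIV. \<Sum>a\<in>UNIV. \<Sum>b\<in>UNIV. J c l * (J a i * J b j * dg b a c))" by (rule sum.swap)
    finally show ?thesis by (simp only: sum_distrib_left)
  qed
  moreover have "R l i j = (\<Sum>c\<in>UNIV. J c l * (\<Sum>a\<in>UNIV. \<Sum>b\<in>UNIV. J a i * J b j * dg c a b))"
  proof -
    have "R l i j = (\<Sum>a\<in>UNIV. \<Sum>b\<in>UNIV. \<Sum>c\<in>UNIV. J c l * (J a i * J b j * dg c a b))"
      unfolding R_def by (simp add: sum_distrib_left mult_ac)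
    also have "\<dots> = (\<Sum>a\<in>UNIV. \<Sum>c\<in>UNIV. \<Sum>b\<in>UNIV. J c l * (J a i * J b j * dg c a b))"
      by (rule sum.cong[OF refl], rule sum.swap)
    also have "\<dots> = (\<Sum>c\<in>UNIV. \<Sum>a\<in>UNIV. \<Sum>b\<in>UNIV. J c l * (J a i * J b j * dg c a b))" by (rule sum.swap)
    finally show ?thesis by (simp only: sum_distrib_left)
  qed
  ultimately show ?thesis
    by (simp only: distrib_left right_diff_distrib sum.distrib sum_subtractf sum_distrib_left[symmetric]
        mult.left_commute[of _ 2])
qed

lemma JK_matrix:
  "(\<chi> a i. J a i) ** (\<chi> i a. K i a) = mat 1" "(\<chi> i a. K i a) ** (\<chi> a i. J a i) = mat 1"
proof -
  show "(\<chi> a i. J a i) ** (\<chi> i a. K i a) = mat 1"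
    using K by (simp add: vec_eq_iff matrix_matrix_mult_def mat_def)
  then show "(\<chi> i a. K i a) ** (\<chi> a i. J a i) = mat 1"
    using matrix_left_right_inverse by blast
qed

text \<open>In matrix form G is the product of the transposed Jacobian, g and the Jacobian, so its
  inverse is obtained from \<open>K\<close>, and the outer Jacobians cancel against
  \<open>K\<close>.\<close>

lemma ginv_G: "(\<Sum>i\<in>UNIV. \<Sum>j\<in>UNIV. J a i * ginv G y i j * J b j) = ginv g (F y) a b"
proof -
  let ?J = "\<chi> a i. J a i :: real ^ 'n ^ 'n" and ?K = "\<chi> i a. K i a :: real ^ 'n ^ 'n"
  let ?gi = "matrix_inv gm"
  have G: "(\<chi> i j. G y [i, j]) = transpose ?J ** gm ** ?J"
  proof -
    have "G y [i, j] = (\<Sum>b\<in>UNIV. (\<Sum>a\<in>UNIV. J a i * g (F y) [a, b]) * J b j)" for i j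
      unfolding G2 by (subst sum.swap) (simp add: sum_distrib_left sum_distrib_right mult_ac)
    then show ?thesis by (simp add: vec_eq_iff matrix_matrix_mult_def transpose_def)
  qed
  have "(transpose ?J ** gm ** ?J) ** (?K ** ?gi ** transpose ?K) =
    transpose ?J ** (gm ** ((?J ** ?K) ** ?gi)) ** transpose ?K"
    by (simp only: matrix_mul_assoc)
  also have "\<dots> = transpose (?K ** ?J)"
    by (simp only: JK_matrix(1) matrix_mul_lid matrix_mul_rid ginv_matrix matrix_transpose_mul)
  finally have "(transpose ?J ** gm ** ?J) ** (?K ** ?gi ** transpose ?K) = mat 1"
    by (simp add: JK_matrix transpose_mat)
  from matrix_inv_eqI[OF this] have Gi: "matrix_inv (\<chi> i j. G y [i, j]) = ?K ** ?gi ** transpose ?K"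
    unfolding G .
  have "?J ** matrix_inv (\<chi> i j. G y [i, j]) ** transpose ?J = (?J ** ?K) ** ?gi ** transpose (?J ** ?K)"
    unfolding Gi by (simp only: matrix_mul_assoc matrix_transpose_mul)
  also have "\<dots> = ?gi" by (simp add: JK_matrix transpose_mat)
  finally have "(?J ** matrix_inv (\<chi> i j. G y [i, j]) ** transpose ?J) $ a $ b = ?gi $ a $ b" by simp
  then have "(\<Sum>j\<in>UNIV. \<Sum>i\<in>UNIV. J a i * ginv G y i j * J b j) = ginv g (F y) a b"
    by (simp add: matrix_matrix_mult_def transpose_def ginv_def sum_distrib_right)
  then show ?thesis by (subst sum.swap) simp
qed

text \<open>The inhomogeneous law of the Christoffel symbols, multiplied by the Jacobian so that the
  inverse Jacobian does not appear. The term \<open>S d i j\<close> is the one that compensates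
  second derivatives of \<open>F\<close> in Hessians.\<close>

lemma christoffel_transform:
  "(\<Sum>k\<in>UNIV. christoffel G k i j y * J d k) =
    S d i j + (\<Sum>a\<in>UNIV. \<Sum>b\<in>UNIV. J a i * J b j * christoffel g d a b (F y))"
proof -
  define Q where "Q c = (\<Sum>a\<in>UNIV. \<Sum>b\<in>UNIV. J a i * J b j * (dg a b c + dg b a c - dg c a b))" for c
  define M where "M c = 2 * (\<Sum>a\<in>UNIV. S a i j * g (F y) [a, c]) + Q c" for c
  let ?gi = "ginv g (F y)"
  have "christoffel G k i j y = 1/2 * (\<Sum>l\<in>UNIV. ginv G y k l * (\<Sum>c\<in>UNIV. J c l * M c))" for k
    unfolding christoffel_def Koszul_G M_def Q_def by simp
  then have "(\<Sum>k\<in>UNIV. christoffel G k i j y * J d k) =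
    1/2 * (\<Sum>k\<in>UNIV. \<Sum>l\<in>UNIV. \<Sum>c\<in>UNIV. J d k * ginv G y k l * J c l * M c)"
    by (simp add: sum_distrib_left sum_distrib_right mult_ac)
  also have "(\<Sum>k\<in>UNIV. \<Sum>l\<in>UNIV. \<Sum>c\<in>UNIV. J d k * ginv G y k l * J c l * M c) =
    (\<Sum>k\<in>UNIV. \<Sum>c\<in>UNIV. \<Sum>l\<in>UNIV. J d k * ginv G y k l * J c l * M c)"
    by (rule sum.cong[OF refl], rule sum.swap)
  also have "\<dots> = (\<Sum>c\<in>UNIV. \<Sum>k\<in>UNIV. \<Sum>l\<in>UNIV. J d k * ginv G y k l * J c l * M c)" by (rule sum.swap)
  also have "\<dots> = (\<Sum>c\<in>UNIV. ?gi d c * M c)"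
    by (simp only: ginv_G[symmetric] sum_distrib_right)
  finally have 1: "(\<Sum>k\<in>UNIV. christoffel G k i j y * J d k) = 1/2 * (\<Sum>c\<in>UNIV. ?gi d c * M c)" .
  have "(\<Sum>c\<in>UNIV. ?gi d c * (\<Sum>a\<in>UNIV. S a i j * g (F y) [a, c])) =
    (\<Sum>c\<in>UNIV. \<Sum>a\<in>UNIV. S a i j * (?gi d c * g (F y) [c, a]))"
    by (simp add: sum_distrib_left mult_ac g_sym[of _ _])
  also have "\<dots> = (\<Sum>a\<in>UNIV. \<Sum>c\<in>UNIV. S a i j * (?gi d c * g (F y) [c, a]))" by (rule sum.swap)
  also have "\<dots> = (\<Sum>a\<in>UNIV. S a i j * (if d = a then 1 else 0))"
    by (simp only: sum_distrib_left[symmetric] ginv_left)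
  also have "\<dots> = S d i j" by (simp add: if_distrib cong: if_cong)
  finally have 2: "(\<Sum>c\<in>UNIV. ?gi d c * (\<Sum>a\<in>UNIV. S a i j * g (F y) [a, c])) = S d i j" .
  have "(\<Sum>c\<in>UNIV. ?gi d c * Q c) =
    (\<Sum>c\<in>UNIV. \<Sum>a\<in>UNIV. \<Sum>b\<in>UNIV. J a i * J b j * (?gi d c * (dg a b c + dg b a c - dg c a b)))"
    unfolding Q_def sum_distrib_left by (intro sum.cong refl) (simp only: mult_ac)
  also have "\<dots> = (\<Sum>a\<in>UNIV. \<Sum>c\<in>UNIV. \<Sum>b\<in>UNIV. J a i * J b j * (?gi d c * (dg a b c + dg b a c - dg c a b)))"
    by (rule sum.swap)
  also have "\<dots> = (\<Sum>a\<in>UNIV. \<Sum>b\<in>UNIV. \<Sum>c\<in>UNIV. J a i * J b j * (?gi d c * (dg a b c + dg b a c - dg c a b)))"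
    by (rule sum.cong[OF refl], rule sum.swap)
  also have "\<dots> = 2 * (\<Sum>a\<in>UNIV. \<Sum>b\<in>UNIV. J a i * J b j * christoffel g d a b (F y))"
    unfolding christoffel_def sum_distrib_left by (intro sum.cong refl) simp
  finally have 3: "(\<Sum>c\<in>UNIV. ?gi d c * Q c) = 2 * (\<Sum>a\<in>UNIV. \<Sum>b\<in>UNIV. J a i * J b j * christoffel g d a b (F y))" .
  have "(\<Sum>c\<in>UNIV. ?gi d c * M c) = 2 * S d i j + (\<Sum>c\<in>UNIV. ?gi d c * Q c)"
    unfolding M_def 2[symmetric] sum_distrib_left distrib_left sum.distrib by (simp only: mult_ac)
  then show ?thesis unfolding 1 3 by simp
qed

lemma pd_Phi:
  assumes \<Phi>: "Ck_on (Suc (Suc 0)) \<Phi> UNIV" and z: "z \<in> U"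
  shows "pd j (\<lambda>z. \<Phi> (F z)) z = (\<Sum>a\<in>UNIV. pd j (\<lambda>z. F z $ a) z * pd a \<Phi> (F z))"
  by (rule pd_compose) (use \<Phi> F z in auto)

lemma pd_pd_Phi:
  assumes \<Phi>: "Ck_on (Suc (Suc 0)) \<Phi> UNIV"
  shows "pd i (pd j (\<lambda>z. \<Phi> (F z))) y =
    (\<Sum>a\<in>UNIV. S a i j * pd a \<Phi> (F y)) + (\<Sum>a\<in>UNIV. \<Sum>b\<in>UNIV. J a i * J b j * pd a (pd b \<Phi>) (F y))"
proof -
  have dP: "pd a \<Phi> differentiable (at (F y))" for a using Ck_on_pd[OF \<Phi>, of a] by simp
  have dPF: "(\<lambda>z. pd a \<Phi> (F z)) differentiable (at y)" for a
    using differentiable_chain_at[OF F_diff dP] by (simp add: o_def)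
  have ds: "(\<lambda>z. pd j (\<lambda>z. F z $ a) z * pd a \<Phi> (F z)) differentiable (at y)" for a
    by (intro differentiable_mult J_diff dPF)
  have "pd i (pd j (\<lambda>z. \<Phi> (F z))) y = pd i (\<lambda>z. \<Sum>a\<in>UNIV. pd j (\<lambda>z. F z $ a) z * pd a \<Phi> (F z)) y"
    by (rule pd_cong[OF U, symmetric]) (use ds pd_Phi[OF \<Phi>] in \<open>auto intro!: differentiable_sum\<close>)
  also have "\<dots> = (\<Sum>a\<in>UNIV. S a i j * pd a \<Phi> (F y) + J a j * (\<Sum>b\<in>UNIV. J b i * pd b (pd a \<Phi>) (F y)))"
    by (subst pd_sum[OF ds]) (intro sum.cong refl, simp add: pd_mult[OF J_diff dPF] pd_compose[OF dP F_diff])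
  also have "\<dots> = (\<Sum>a\<in>UNIV. S a i j * pd a \<Phi> (F y)) +
    (\<Sum>a\<in>UNIV. \<Sum>b\<in>UNIV. J b i * J a j * pd b (pd a \<Phi>) (F y))"
    by (simp add: sum.distrib sum_distrib_left mult_ac)
  also have "(\<Sum>a\<in>UNIV. \<Sum>b\<in>UNIV. J b i * J a j * pd b (pd a \<Phi>) (F y)) =
    (\<Sum>a\<in>UNIV. \<Sum>b\<in>UNIV. J a i * J b j * pd a (pd b \<Phi>) (F y))" by (rule sum.swap)
  finally show ?thesis .
qed

text \<open>The second derivatives of \<open>F\<close> in \<open>pd_pd_Phi\<close> cancel against
  those in \<open>christoffel_transform\<close>, so the covariant Hessian is a tensor and its trace
  is invariant.\<close>

lemma laplacian_pullback:
  assumes \<Phi>: "Ck_on (Suc (Suc 0)) \<Phi> UNIV"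
  shows "laplacian G (\<lambda>z. \<Phi> (F z)) y = laplacian g \<Phi> (F y)"
proof -
  have hess: "pd i (pd j (\<lambda>z. \<Phi> (F z))) y - (\<Sum>k\<in>UNIV. christoffel G k i j y * pd k (\<lambda>z. \<Phi> (F z)) y) =
    (\<Sum>a\<in>UNIV. \<Sum>b\<in>UNIV. J a i * J b j *
      (pd a (pd b \<Phi>) (F y) - (\<Sum>d\<in>UNIV. christoffel g d a b (F y) * pd d \<Phi> (F y))))" for i j
  proof -
    have "(\<Sum>k\<in>UNIV. christoffel G k i j y * pd k (\<lambda>z. \<Phi> (F z)) y) =
      (\<Sum>k\<in>UNIV. \<Sum>d\<in>UNIV. (christoffel G k i j y * J d k) * pd d \<Phi> (F y))"
      by (simp add: pd_Phi[OF \<Phi> U(2)] sum_distrib_left mult_ac)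
    also have "\<dots> = (\<Sum>d\<in>UNIV. \<Sum>k\<in>UNIV. (christoffel G k i j y * J d k) * pd d \<Phi> (F y))" by (rule sum.swap)
    also have "\<dots> = (\<Sum>d\<in>UNIV. S d i j * pd d \<Phi> (F y)) +
      (\<Sum>d\<in>UNIV. \<Sum>a\<in>UNIV. \<Sum>b\<in>UNIV. J a i * J b j * (christoffel g d a b (F y) * pd d \<Phi> (F y)))"
      by (simp only: sum_distrib_right[symmetric] christoffel_transform distrib_right sum.distrib)
        (simp only: sum_distrib_right mult.assoc)
    also have "(\<Sum>d\<in>UNIV. \<Sum>a\<in>UNIV. \<Sum>b\<in>UNIV. J a i * J b j * (christoffel g d a b (F y) * pd d \<Phi> (F y))) =
      (\<Sum>a\<in>UNIV. \<Sum>d\<in>UNIV. \<Sum>b\<in>UNIV. J a i * J b j * (christoffel g d a b (F y) * pd d \<Phi> (F y)))" by (rule sum.swap)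
    also have "\<dots> = (\<Sum>a\<in>UNIV. \<Sum>b\<in>UNIV. \<Sum>d\<in>UNIV. J a i * J b j * (christoffel g d a b (F y) * pd d \<Phi> (F y)))"
      by (rule sum.cong[OF refl], rule sum.swap)
    finally show ?thesis
      unfolding pd_pd_Phi[OF \<Phi>] by (simp add: right_diff_distrib sum_subtractf sum_distrib_left)
  qed
  show ?thesis unfolding laplacian_contract hess by (rule contract_pull[OF ginv_G])
qed

lemma comp_pullback_3:
  "comp_pullback F H y [i, p, k] = (\<Sum>c\<in>UNIV. J c k * (\<Sum>b\<in>UNIV. J b p * (\<Sum>a\<in>UNIV. J a i * H (F y) [a, b, c])))"
proof -
  have "comp_pullback F H y [i, p, k] = (\<Sum>a\<in>UNIV. \<Sum>b\<in>UNIV. \<Sum>c\<in>UNIV. J c k * (J b p * (J a i * H (F y) [a, b, c])))"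
    unfolding comp_pullback_def
    using sum_lists_3[of "\<lambda>js. (\<Prod>m<3. pd ([i, p, k] ! m) (\<lambda>z. F z $ (js ! m)) y) * H (F y) js"]
    by (simp add: numeral_3_eq_3 lessThan_Suc mult_ac)
  also have "\<dots> = (\<Sum>a\<in>UNIV. \<Sum>c\<in>UNIV. \<Sum>b\<in>UNIV. J c k * (J b p * (J a i * H (F y) [a, b, c])))"
    by (rule sum.cong[OF refl], rule sum.swap)
  also have "\<dots> = (\<Sum>c\<in>UNIV. \<Sum>a\<in>UNIV. \<Sum>b\<in>UNIV. J c k * (J b p * (J a i * H (F y) [a, b, c])))"
    by (rule sum.swap)
  also have "\<dots> = (\<Sum>c\<in>UNIV. \<Sum>b\<in>UNIV. \<Sum>a\<in>UNIV. J c k * (J b p * (J a i * H (F y) [a, b, c])))"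
    by (rule sum.cong[OF refl], rule sum.swap)
  finally show ?thesis by (simp only: sum_distrib_left)
qed

text \<open>\<open>contract_pull_product\<close> clears the Jacobians of the innermost contraction
  only. \<open>contract_swap\<close> brings each pair of slots to the inside in turn, and finally
  restores the order.\<close>

lemma H_norm2_pullback: "H_norm2 G (comp_pullback F H) y = H_norm2 g H (F y)"
proof -
  let ?P = "contract (ginv G y)" and ?Q = "contract (ginv g (F y))"
  define Y where "Y i b c = (\<Sum>a\<in>UNIV. J a i * H (F y) [a, b, c])" for i b c
  define X where "X i p c = (\<Sum>b\<in>UNIV. J b p * Y i b c)" for i p c
  have "H_norm2 G (comp_pullback F H) y =
    ?P (\<lambda>i j. ?P (\<lambda>p q. ?P (\<lambda>k l. (\<Sum>c\<in>UNIV. J c k * X i p c) * (\<Sum>c\<in>UNIV. J c l * X j q c))))"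
    unfolding H_norm2_contract comp_pullback_3 X_def Y_def by (rule refl)
  also have "\<dots> = ?P (\<lambda>i j. ?P (\<lambda>p q. ?Q (\<lambda>c f. X i p c * X j q f)))"
    by (simp only: contract_pull_product[OF ginv_G])
  also have "\<dots> = ?P (\<lambda>i j. ?Q (\<lambda>c f. ?P (\<lambda>p q. (\<Sum>b\<in>UNIV. J b p * Y i b c) * (\<Sum>b\<in>UNIV. J b q * Y j b f))))"
    by (subst contract_swap) (simp only: X_def)
  also have "\<dots> = ?P (\<lambda>i j. ?Q (\<lambda>c f. ?Q (\<lambda>b e. Y i b c * Y j e f)))"
    by (simp only: contract_pull_product[OF ginv_G])
  also have "\<dots> = ?Q (\<lambda>c f. ?P (\<lambda>i j. ?Q (\<lambda>b e. Y i b c * Y j e f)))" by (rule contract_swap)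
  also have "\<dots> = ?Q (\<lambda>c f. ?Q (\<lambda>b e. ?P (\<lambda>i j. (\<Sum>a\<in>UNIV. J a i * H (F y) [a, b, c]) * (\<Sum>a\<in>UNIV. J a j * H (F y) [a, e, f]))))"
    by (subst contract_swap) (simp only: Y_def)
  also have "\<dots> = ?Q (\<lambda>c f. ?Q (\<lambda>b e. ?Q (\<lambda>a d. H (F y) [a, b, c] * H (F y) [d, e, f])))"
    by (simp only: contract_pull_product[OF ginv_G])
  also have "\<dots> = ?Q (\<lambda>c f. ?Q (\<lambda>a d. ?Q (\<lambda>b e. H (F y) [a, b, c] * H (F y) [d, e, f])))"
    by (subst contract_swap) (rule refl)
  also have "\<dots> = ?Q (\<lambda>a d. ?Q (\<lambda>c f. ?Q (\<lambda>b e. H (F y) [a, b, c] * H (F y) [d, e, f])))" by (rule contract_swap)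
  also have "\<dots> = ?Q (\<lambda>a d. ?Q (\<lambda>b e. ?Q (\<lambda>c f. H (F y) [a, b, c] * H (F y) [d, e, f])))"
    by (subst contract_swap) (rule refl)
  finally show ?thesis by (simp only: H_norm2_contract)
qed

end

section \<open>Locality and constant scaling\<close>

lemma frechet_derivative_cong:
  assumes "open U" "y \<in> U" "\<And>x. x \<in> U \<Longrightarrow> f x = g x"
  shows "frechet_derivative f (at y) = frechet_derivative g (at y)"
proof -
  have "(f has_derivative D) (at y) \<longleftrightarrow> (g has_derivative D) (at y)" for D
    using has_derivative_transform_within_open[OF _ assms(1,2), of f D UNIV g]
      has_derivative_transform_within_open[OF _ assms(1,2), of g D UNIV f] assms(3) by auto
  then show ?thesis by (simp add: frechet_derivative_def)
qed

lemma pd_cong_open: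
  assumes "open U" "y \<in> U" "\<And>x. x \<in> U \<Longrightarrow> f x = g x"
  shows "pd i f y = pd i g y"
  unfolding pd_def using frechet_derivative_cong[OF assms] by simp

lemma pd_pd_cong_open:
  assumes "open U" "y \<in> U" "\<And>x. x \<in> U \<Longrightarrow> f x = g x"
  shows "pd i (pd j f) y = pd i (pd j g) y"
  by (rule pd_cong_open[OF assms(1,2)]) (rule pd_cong_open[OF assms(1) _ assms(3)])

lemma ginv_cong: "(\<And>i j. G y [i, j] = G' y [i, j]) \<Longrightarrow> ginv G y = ginv G' y"
  by (simp add: ginv_def fun_eq_iff)

lemma laplacian_cong:
  assumes U: "open U" "y \<in> U" and f: "\<And>z. z \<in> U \<Longrightarrow> f z = f' z"
    and G: "\<And>z i j. z \<in> U \<Longrightarrow> G z [i, j] = G' z [i, j]"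
  shows "laplacian G f y = laplacian G' f' y"
proof -
  have gi: "ginv G y = ginv G' y" by (rule ginv_cong) (rule G[OF U(2)])
  have pG: "pd k (\<lambda>z. G z [i, j]) y = pd k (\<lambda>z. G' z [i, j]) y" for k i j
    by (rule pd_cong_open[OF U]) (rule G)
  have pf: "pd k f y = pd k f' y" for k by (rule pd_cong_open[OF U]) (rule f)
  have ppf: "pd i (pd j f) y = pd i (pd j f') y" for i j by (rule pd_pd_cong_open[OF U]) (rule f)
  show ?thesis unfolding laplacian_def christoffel_def gi pG pf ppf by (rule refl)
qed

lemma H_norm2_cong:
  assumes "\<And>i j. G y [i, j] = G' y [i, j]" "\<And>i j k. H y [i, j, k] = H' y [i, j, k]"
  shows "H_norm2 G H y = H_norm2 G' H' y"
  unfolding H_norm2_contract ginv_cong[of G y G', OF assms(1)] assms(2) by (rule refl)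

lemma comp_pullback_cong:
  assumes U: "open U" "y \<in> U" and F: "\<And>z. z \<in> U \<Longrightarrow> F z = F' z"
    and T: "\<And>js. length js = length is \<Longrightarrow> T (F y) js = T' (F y) js"
  shows "comp_pullback F T y is = comp_pullback F' T' y is"
proof -
  have "pd i (\<lambda>z. F z $ a) y = pd i (\<lambda>z. F' z $ a) y" for i a
    by (rule pd_cong_open[OF U]) (simp add: F)
  moreover have "F y = F' y" using F U(2) by simp
  ultimately show ?thesis unfolding comp_pullback_def using T by (intro sum.cong) auto
qed

lemma comp_pullback_scale:
  "comp_pullback F (\<lambda>z is. \<tau> * T z is) y is = \<tau> * comp_pullback F T y is"
  unfolding comp_pullback_def sum_distrib_left by (intro sum.cong refl) simp

context metric_at
begin

text \<open>Christoffel symbols do not change when the metric is multiplied by a constant, so only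
  the outer inverse metric scales.\<close>

lemma laplacian_scaled:
  assumes "\<tau> > 0" "\<And>i j. (\<lambda>z. g z [i, j]) differentiable (at y)"
  shows "laplacian (\<lambda>z is. \<tau> * g z is) f y = laplacian g f y / \<tau>"
proof -
  have ch: "christoffel (\<lambda>z is. \<tau> * g z is) k i j y = christoffel g k i j y" for k i j
    unfolding christoffel_def scaled[OF assms(1)] pd_cmult[OF assms(2)]
    using assms(1) by (intro arg_cong[where f = "\<lambda>x. 1/2 * x"] sum.cong refl) (simp add: field_simps)
  show ?thesis unfolding laplacian_def ch scaled[OF assms(1)] by (simp add: sum_divide_distrib)
qed

text \<open>Three inverse metrics contribute the power -3 of \<tau> and the two copies of the form
  the power 2.\<close>

lemma H_norm2_scaled:
  assumes "\<tau> > 0"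
  shows "H_norm2 (\<lambda>z is. \<tau> * g z is) (\<lambda>z is. \<tau> * H z is) y = H_norm2 g H y / \<tau>"
proof -
  have "ginv g y i j / \<tau> * (ginv g y p q / \<tau> * (ginv g y k l / \<tau> * (\<tau> * a * (\<tau> * b)))) =
    ginv g y i j * (ginv g y p q * (ginv g y k l * (a * b))) / \<tau>" for i j p q k l a b
    using assms by (simp add: field_simps)
  then show ?thesis
    unfolding H_norm2_contract contract_def sum_distrib_left scaled[OF assms] sum_divide_distrib by simp
qed

end

context coordinate_change
begin

text \<open>The form at \<open>v\<close> is \<open>g\<close> at the image of \<open>v\<close> under
  the Jacobian, which is nonzero because the Jacobian is invertible.\<close>

lemma metric_at_G: "metric_at G y"
proof
  show "G y [i, j] = G y [j, i]" for i j
    unfolding G2 by (subst sum.swap, intro sum.cong refl) (simp add: g_sym[of _ _] mult_ac)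
  fix v :: "real ^ 'n" assume v: "v \<noteq> 0"
  define w where "w = (\<chi> a i. J a i) *v v"
  have "(\<chi> i a. K i a) *v w = v" by (simp add: w_def matrix_vector_mul_assoc JK_matrix)
  then have w: "w \<noteq> 0" using v by auto
  have wa: "w $ a = (\<Sum>i\<in>UNIV. J a i * v $ i)" for a by (simp add: w_def matrix_vector_mult_def)
  have "0 < (\<Sum>a\<in>UNIV. \<Sum>b\<in>UNIV. g (F y) [a, b] * w $ a * w $ b)" by (rule g_pos[OF w])
  also have "\<dots> = (\<Sum>a\<in>UNIV. \<Sum>b\<in>UNIV. \<Sum>i\<in>UNIV. \<Sum>j\<in>UNIV. J a i * J b j * g (F y) [a, b] * v $ i * v $ j)"
    unfolding wa by (intro sum.cong refl) (simp add: sum_distrib_left sum_distrib_right mult_ac)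
  also have "\<dots> = (\<Sum>i\<in>UNIV. \<Sum>j\<in>UNIV. \<Sum>a\<in>UNIV. \<Sum>b\<in>UNIV. J a i * J b j * g (F y) [a, b] * v $ i * v $ j)"
    by (rule sum_sum_swap)
  also have "\<dots> = (\<Sum>i\<in>UNIV. \<Sum>j\<in>UNIV. G y [i, j] * v $ i * v $ j)"
    unfolding G2 by (simp only: sum_distrib_right)
  finally show "0 < (\<Sum>i\<in>UNIV. \<Sum>j\<in>UNIV. G y [i, j] * v $ i * v $ j)" .
qed

end

section \<open>Second derivative test and continuity of the inverse metric\<close>

lemma second_derivative_test:
  fixes f :: "real ^ 'n \<Rightarrow> real"
  assumes U: "open U" "y \<in> U" and f: "Ck_on (Suc (Suc 0)) f U" and max: "\<And>z. z \<in> U \<Longrightarrow> f z \<le> f y"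
  shows "pd k f y = 0" and "(\<Sum>i\<in>UNIV. \<Sum>j\<in>UNIV. pd i (pd j f) y * v i * v j) \<le> 0"
proof -
  obtain r where r: "r > 0" "ball y r \<subseteq> U" using U open_contains_ball by blast
  have df: "f differentiable (at z)" if "z \<in> U" for z using f that by simp
  have main: "frechet_derivative f (at y) v = 0 \<and> frechet_derivative (\<lambda>x. frechet_derivative f (at x) v) (at y) v \<le> 0"
    if "v \<noteq> 0" for v
  proof -
    define d where "d = r / norm v"
    have d: "d > 0" using r that by (simp add: d_def)
    have inU: "y + s *\<^sub>R v \<in> U" if "\<bar>s\<bar> < d" for s
    proof -
      have "\<bar>s\<bar> * norm v < r" using that \<open>v \<noteq> 0\<close> by (simp add: d_def pos_less_divide_eq)
      then have "y + s *\<^sub>R v \<in> ball y r" by (simp add: dist_norm)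
      then show ?thesis using r by blast
    qed
    let ?D = "\<lambda>x. frechet_derivative f (at x) v"
    have d1: "((\<lambda>s. f (y + s *\<^sub>R v)) has_real_derivative ?D (y + s *\<^sub>R v)) (at s)" if "\<bar>s\<bar> < d" for s
      by (rule DERIV_line[OF df[OF inU[OF that]]])
    have fy: "f (y + s *\<^sub>R v) \<le> f (y + 0 *\<^sub>R v)" if "\<bar>s\<bar> < d" for s using max[OF inU[OF that]] by simp
    have D0: "?D y = 0"
      using DERIV_local_max[OF d1[of 0] d] fy d by simp
    have "?D differentiable (at (y + 0 *\<^sub>R v))" using f U(2) by simp
    from DERIV_line[OF this]
    have d2: "((\<lambda>s. ?D (y + s *\<^sub>R v)) has_real_derivative frechet_derivative ?D (at y) v) (at 0)" by simp
    \<comment> \<open>A positive second derivative would make the first derivative positive just to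
      the right of 0, and the mean value theorem would then lift \<open>f\<close> above its
      maximum.\<close>
    have "frechet_derivative ?D (at y) v \<le> 0"
    proof (rule ccontr)
      assume "\<not> ?thesis"
      then have "0 < frechet_derivative ?D (at y) v" by simp
      from DERIV_pos_inc_right[OF d2 this] obtain e where e: "e > 0"
        "\<And>h. h > 0 \<Longrightarrow> h < e \<Longrightarrow> 0 < ?D (y + h *\<^sub>R v)" using D0 by auto
      define h where "h = min d e / 2"
      have h: "h > 0" "h < d" "h < e" using d e by (auto simp: h_def)
      have "\<exists>z. 0 < z \<and> z < h \<and> f (y + h *\<^sub>R v) - f (y + 0 *\<^sub>R v) = (h - 0) * ?D (y + z *\<^sub>R v)"
        by (rule MVT2[OF h(1)]) (use d1 h in auto)
      then obtain z where z: "0 < z" "z < h" "f (y + h *\<^sub>R v) - f (y + 0 *\<^sub>R v) = h * ?D (y + z *\<^sub>R v)" by auto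
      have "0 < h * ?D (y + z *\<^sub>R v)" using h(1) e(2)[of z] z h by simp
      then show False using z(3) fy[of h] h by simp
    qed
    then show ?thesis using D0 by blast
  qed
  show "pd k f y = 0" unfolding pd_def using main[of "axis k 1"] by simp
  show "(\<Sum>i\<in>UNIV. \<Sum>j\<in>UNIV. pd i (pd j f) y * v i * v j) \<le> 0"
  proof (cases "(\<chi> i. v i) = 0")
    case True
    then have "v i = 0" for i by (simp add: vec_eq_iff)
    then show ?thesis by simp
  next
    case False
    let ?v = "\<chi> i. v i"
    have dpd: "pd j f differentiable (at y)" for j using Ck_on_pd[OF f, of j] U(2) by simp
    have ds: "(\<lambda>x. \<Sum>j\<in>UNIV. v j * pd j f x) differentiable (at y)"
      by (rule differentiable_sum, simp) (intro allI ballI differentiable_mult differentiable_const dpd)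
    have "frechet_derivative (\<lambda>x. frechet_derivative f (at x) ?v) (at y) ?v =
      frechet_derivative (\<lambda>x. \<Sum>j\<in>UNIV. v j * pd j f x) (at y) ?v"
      by (rule fun_cong[OF frechet_derivative_cong[OF U]]) (simp add: frechet_derivative_pd[OF df])
    also have "\<dots> = (\<Sum>i\<in>UNIV. v i * pd i (\<lambda>x. \<Sum>j\<in>UNIV. v j * pd j f x) y)"
      by (simp add: frechet_derivative_pd[OF ds])
    also have "\<dots> = (\<Sum>i\<in>UNIV. \<Sum>j\<in>UNIV. pd i (pd j f) y * v i * v j)"
    proof (intro sum.cong refl)
      fix i
      have "pd i (\<lambda>x. \<Sum>j\<in>UNIV. v j * pd j f x) y = (\<Sum>j\<in>UNIV. pd i (\<lambda>x. v j * pd j f x) y)"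
        by (rule pd_sum) (intro differentiable_mult dpd, simp)
      also have "\<dots> = (\<Sum>j\<in>UNIV. v j * pd i (pd j f) y)" by (simp only: pd_cmult[OF dpd])
      finally show "v i * pd i (\<lambda>x. \<Sum>j\<in>UNIV. v j * pd j f x) y = (\<Sum>j\<in>UNIV. pd i (pd j f) y * v i * v j)"
        by (simp add: sum_distrib_left mult_ac)
    qed
    finally show ?thesis using main[OF False] by simp
  qed
qed

lemma continuous_on_det:
  fixes M :: "'a::topological_space \<Rightarrow> real ^ 'n ^ 'n"
  assumes "\<And>i j. continuous_on S (\<lambda>x. M x $ i $ j)"
  shows "continuous_on S (\<lambda>x. det (M x))"
  unfolding det_def by (intro continuous_on_sum continuous_on_mult continuous_on_const continuous_on_prod assms)

text \<open>Cramer's rule writes every entry of the inverse as a quotient of determinants, which are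
  polynomials in the entries.\<close>

lemma continuous_on_ginv:
  assumes g: "\<And>i j. continuous_on S (\<lambda>y. g y [i, j])" and m: "\<And>y. y \<in> S \<Longrightarrow> metric_at g y"
  shows "continuous_on S (\<lambda>y. ginv g y i j)"
proof -
  let ?M = "\<lambda>y. \<chi> a b. g y [a, b] :: real ^ 'a ^ 'a"
  let ?N = "\<lambda>y. \<chi> a b. if b = i then (axis j 1 :: real ^ 'a) $ a else ?M y $ a $ b"
  have d: "det (?M y) \<noteq> 0" if "y \<in> S" for y
    using metric_at.ginv_matrix[OF m[OF that]] invertible_det_nz unfolding invertible_def by blast
  have "ginv g y i j = det (?N y) / det (?M y)" if "y \<in> S" for y
  proof -
    have "?M y *v (matrix_inv (?M y) *v axis j 1) = axis j 1"
      by (simp add: matrix_vector_mul_assoc metric_at.ginv_matrix[OF m[OF that]])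
    then have "matrix_inv (?M y) *v axis j 1 =
        (\<chi> k. det (\<chi> a b. if b = k then (axis j 1 :: real ^ 'a) $ a else ?M y $ a $ b) / det (?M y))"
      using cramer[OF d[OF that]] by blast
    then have "(matrix_inv (?M y) *v axis j 1) $ i = det (?N y) / det (?M y)" by simp
    moreover have "(matrix_inv (?M y) *v axis j 1) $ i = ginv g y i j"
      by (simp add: matrix_vector_mult_def axis_def ginv_def if_distrib cong: if_cong)
    ultimately show ?thesis by simp
  qed
  moreover have "continuous_on S (\<lambda>y. det (?N y) / det (?M y))"
  proof (intro continuous_on_divide continuous_on_det)
    show "continuous_on S (\<lambda>x. ?N x $ a $ b)" for a b
      using g[of a b] by (cases "b = i") simp_all
    show "continuous_on S (\<lambda>x. ?M x $ a $ b)" for a b using g[of a b] by simp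
  qed (use d in blast)
  ultimately show ?thesis by (simp cong: continuous_on_cong)
qed

context smooth_manifold
begin

lemma chart_at: "chart_at A p \<in> A" "p \<in> fst (chart_at A p)"
proof -
  have "\<exists>c. c \<in> A \<and> p \<in> fst c" using chart_exists by blast
  from someI_ex[OF this] show "chart_at A p \<in> A" "p \<in> fst (chart_at A p)"
    unfolding chart_at_def by blast+
qed

end

section \<open>The induced flow in coordinates\<close>

locale soliton_flow = manifold_vector_field A X
  for A :: "('m::{t2_space, second_countable_topology}, 'n::finite) chart set"
    and X :: "('m, 'n) chart \<Rightarrow> real ^ 'n \<Rightarrow> real ^ 'n" +
  fixes g H :: "('m, 'n) chart \<Rightarrow> 'n cov" and lam :: real
    and \<phi> :: "real \<Rightarrow> 'm \<Rightarrow> 'm" and \<psi> :: "real \<Rightarrow> 'm \<Rightarrow> real"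
  assumes rm: "riemannian_metric A g" and Ht: "tensor_field A 3 H" and lam: "lam > 0"
    and compact_M: "compact (UNIV :: 'm set)"
    and gd: "generated_diffeos A {0..<1/lam} (\<lambda>t c y. (1 / (1 - lam * t)) *\<^sub>R X c y) \<phi>"
    and tb: "torsion_bounding_function A {0..<1/lam}
          (\<lambda>t c y is. (1 - lam * t) * pullback A (\<phi> t) g c y is)
          (\<lambda>t c y is. (1 - lam * t) * pullback A (\<phi> t) H c y is) \<psi>"
begin

abbreviation I :: "real set" where "I \<equiv> {0..<1/lam}"

text \<open>The rescaled time: how long the autonomous field \<open>X\<close> has been followed when
  the flow time is \<open>t\<close>.\<close>

definition \<sigma> :: "real \<Rightarrow> real" where "\<sigma> t = - ln (1 - lam * t) / lam"

definition drift_laplacian :: "('m, 'n) chart \<Rightarrow> (real ^ 'n \<Rightarrow> real) \<Rightarrow> real ^ 'n \<Rightarrow> real" where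
  "drift_laplacian c \<Phi> y = laplacian (g c) \<Phi> y - (\<Sum>k\<in>UNIV. X c y $ k * pd k \<Phi> y)"

lemma tau_pos: "t \<in> I \<Longrightarrow> 1 - lam * t > 0"
  using lam by (simp add: field_simps)

lemma sigma_deriv: "t \<in> I \<Longrightarrow> (\<sigma> has_real_derivative 1 / (1 - lam * t)) (at t)"
  using tau_pos[of t] lam unfolding \<sigma>_def by (auto intro!: derivative_eq_intros simp: field_simps)

lemma gt: "tensor_field A 2 g" using rm unfolding riemannian_metric_def by blast

lemma metric_at_chart: "c \<in> A \<Longrightarrow> y \<in> chart_img c \<Longrightarrow> metric_at (g c) y"
  using rm unfolding riemannian_metric_def metric_at_def by blast

lemma Ck_on_tensor:
  assumes "tensor_field A k T" "c \<in> A" "length is = k"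
  shows "Ck_on j (\<lambda>y. T c y is) (chart_img c)"
proof -
  have "smooth_on (chart_img c) (\<lambda>y. T c y is)" using assms unfolding tensor_field_def by blast
  then show ?thesis using smooth_on_open[OF open_chart_img[OF assms(2)]] by blast
qed

lemma Ck_on_g: "c \<in> A \<Longrightarrow> Ck_on j (\<lambda>y. g c y [a, b]) (chart_img c)"
  by (rule Ck_on_tensor[OF gt]) simp_all

lemma Ck_on_H: "c \<in> A \<Longrightarrow> Ck_on j (\<lambda>y. H c y [a, b, d]) (chart_img c)"
  by (rule Ck_on_tensor[OF Ht]) simp_all

lemma continuous_ginv: "c \<in> A \<Longrightarrow> continuous_on (chart_img c) (\<lambda>y. ginv (g c) y i j)"
  by (rule continuous_on_ginv) (simp_all add: Ck_on_imp_continuous_on[OF Ck_on_g] metric_at_chart)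

lemma continuous_christoffel: "c \<in> A \<Longrightarrow> continuous_on (chart_img c) (christoffel (g c) k i j)"
  unfolding christoffel_def[abs_def]
  by (intro continuous_on_mult continuous_on_const continuous_on_sum continuous_ginv continuous_on_add continuous_on_diff
    Ck_on_imp_continuous_on[of 0] Ck_on_pd Ck_on_g)

lemma continuous_drift_laplacian:
  assumes c: "c \<in> A" and \<Phi>: "Ck_on (Suc (Suc 0)) \<Phi> UNIV"
  shows "continuous_on (chart_img c) (drift_laplacian c \<Phi>)"
proof -
  have 2: "continuous_on (chart_img c) (pd i (pd j \<Phi>))" for i j
    using Ck_on_pd[OF Ck_on_pd[OF \<Phi>], of i j] continuous_on_subset by auto
  have 1: "continuous_on (chart_img c) (pd i \<Phi>)" for i
    using Ck_on_imp_continuous_on[OF Ck_on_pd[OF \<Phi>], of i] continuous_on_subset by blast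
  have x: "continuous_on (chart_img c) (\<lambda>y. X c y $ k)" for k
    by (rule continuous_on_component[OF Ck_on_imp_continuous_on[OF Ck_on_vf[OF c, of 0]]])
  show ?thesis
    unfolding drift_laplacian_def[abs_def] laplacian_def
    by (intro continuous_on_mult continuous_on_const continuous_on_sum continuous_on_diff
        continuous_ginv[OF c] continuous_christoffel[OF c] 1 2 x)
qed

lemma continuous_H_norm2:
  assumes c: "c \<in> A"
  shows "continuous_on (chart_img c) (H_norm2 (g c) (H c))"
  unfolding H_norm2_def[abs_def] H_squared_def
  by (simp, intro continuous_on_mult continuous_on_sum continuous_ginv[OF c]
      Ck_on_imp_continuous_on[OF Ck_on_H[OF c, of 0]])

lemma diffeo_phi: "t \<in> I \<Longrightarrow> diffeo A (\<phi> t)"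
  using gd unfolding generated_diffeos_def by blast

lemma smooth_map_local:
  assumes f: "smooth_map A f" and c: "c \<in> A" "c' \<in> A"
  shows "open {y \<in> chart_img c. f (chart_inv c y) \<in> fst c'}"
    and "Ck_on k (\<lambda>y. snd c' (f (chart_inv c y))) {y \<in> chart_img c. f (chart_inv c y) \<in> fst c'}"
proof -
  have cf: "continuous_on UNIV f" using f unfolding smooth_map_def by blast
  have eq: "snd c ` (fst c \<inter> f -` fst c') = {y \<in> chart_img c. f (chart_inv c y) \<in> fst c'}"
    using image_chart_eq[OF c(1), of "fst c \<inter> f -` fst c'"] chart_inv_in[OF c(1)] by auto
  have "open (f -` fst c')" using open_vimage[OF open_chart_dom[OF c(2)] cf] .
  then have "open (snd c ` (fst c \<inter> f -` fst c'))"
    by (intro open_chart_image[OF c(1)] open_Int open_chart_dom[OF c(1)]) auto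
  then show op: "open {y \<in> chart_img c. f (chart_inv c y) \<in> fst c'}" unfolding eq .
  have "smooth_on (snd c ` (fst c \<inter> f -` fst c')) (snd c' \<circ> f \<circ> chart_inv c)"
    using f c unfolding smooth_map_def by blast
  then have "\<forall>k. Ck_on k (snd c' \<circ> f \<circ> chart_inv c) {y \<in> chart_img c. f (chart_inv c y) \<in> fst c'}"
    unfolding eq smooth_on_open[OF op] .
  then show "Ck_on k (\<lambda>y. snd c' (f (chart_inv c y))) {y \<in> chart_img c. f (chart_inv c y) \<in> fst c'}"
    by (simp add: o_def)
qed

text \<open>\<open>pullback\<close> uses a chosen chart around the image point. The transformation
  law and functoriality replace it by any chart \<open>c0\<close>, which can then stay fixed while
  the base point varies.\<close>

lemma pullback_eq:
  assumes T: "tensor_field A k T" and f: "smooth_map A f" and c: "c \<in> A" "c0 \<in> A"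
    and y: "y \<in> chart_img c" "f (chart_inv c y) \<in> fst c0" and k: "length is = k"
  shows "pullback A f T c y is = comp_pullback (\<lambda>z. snd c0 (f (chart_inv c z))) (T c0) y is"
proof -
  define c' where "c' = chart_at A (f (chart_inv c y))"
  have c': "c' \<in> A" "f (chart_inv c y) \<in> fst c'" using chart_at unfolding c'_def by blast+
  let ?F = "\<lambda>z. snd c' (f (chart_inv c z))" and ?T = "\<lambda>w. snd c0 (chart_inv c' w)"
  let ?U = "{z \<in> chart_img c. f (chart_inv c z) \<in> fst c'}"
  have U: "open ?U" "y \<in> ?U" using smooth_map_local(1)[OF f c(1) c'(1)] y c' by auto
  have Fd: "?F differentiable (at y)" using smooth_map_local(2)[OF f c(1) c'(1), of "Suc 0"] U(2) by simp
  have ov: "?F y \<in> overlap c' c0" using c'(2) y(2) by blast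
  have Td: "?T differentiable (at (?F y))" using Ck_on_Suc_has_derivative[OF Ck_on_transition[OF c'(1) c(2)] ov]
    unfolding differentiable_def by blast
  have tr: "T c' (?F y) js = comp_pullback ?T (T c0) (?F y) js" if "length js = k" for js
  proof -
    have "T c' (?F y) js = comp_pullback (snd c0 \<circ> chart_inv c') (T c0) (?F y) js"
      using T c'(1) c(2) ov that unfolding tensor_field_def by blast
    then show ?thesis by (simp add: o_def)
  qed
  have "pullback A f T c y is = comp_pullback ?F (T c') y is"
    unfolding pullback_def Let_def c'_def[symmetric] by (simp add: o_def)
  also have "\<dots> = comp_pullback ?F (comp_pullback ?T (T c0)) y is"
    by (rule comp_pullback_cong[OF U]) (use tr k in auto)
  also have "\<dots> = comp_pullback (\<lambda>z. ?T (?F z)) (T c0) y is"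
    by (rule comp_pullback_compose[OF Fd Td, symmetric])
  also have "\<dots> = comp_pullback (\<lambda>z. snd c0 (f (chart_inv c z))) (T c0) y is"
    by (rule comp_pullback_cong[OF U]) (use chart_inv_left[OF c'(1)] in auto)
  finally show ?thesis .
qed

text \<open>Supplies the metric rescaled by \<open>\<tau>\<close> and, as \<open>K\<close>, the
  Jacobian of the inverse diffeomorphism. The chain rule for the composition with the identity as
  result gives a left inverse, and for square matrices a left inverse is a right inverse.\<close>

lemma coordinate_change_phi:
  assumes t: "t \<in> I" and c: "c \<in> A" "c0 \<in> A" and y: "y \<in> chart_img c" "\<phi> t (chart_inv c y) \<in> fst c0"
    and \<tau>: "\<tau> > 0"
  shows "\<exists>K. coordinate_change (\<lambda>z is. \<tau> * g c0 z is) (\<lambda>z. snd c0 (\<phi> t (chart_inv c z))) y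
    {z \<in> chart_img c. \<phi> t (chart_inv c z) \<in> fst c0} (chart_img c0) K"
proof -
  let ?f = "\<phi> t" and ?f' = "inv (\<phi> t)"
  have f: "smooth_map A ?f" "smooth_map A ?f'" "bij ?f" using diffeo_phi[OF t] unfolding diffeo_def by auto
  let ?F = "\<lambda>z. snd c0 (?f (chart_inv c z))" and ?F' = "\<lambda>z. snd c (?f' (chart_inv c0 z))"
  let ?U = "{z \<in> chart_img c. ?f (chart_inv c z) \<in> fst c0}"
  let ?U' = "{z \<in> chart_img c0. ?f' (chart_inv c0 z) \<in> fst c}"
  have U: "open ?U" "y \<in> ?U" using smooth_map_local(1)[OF f(1) c] y by auto
  have id: "?F' (?F z) = z" "?F z \<in> ?U'" if "z \<in> ?U" for z
  proof -
    have "chart_inv c0 (?F z) = ?f (chart_inv c z)" using chart_inv_left[OF c(2)] that by simp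
    then have e: "?f' (chart_inv c0 (?F z)) = chart_inv c z" using bij_is_inj[OF f(3)] by (simp add: inv_f_f)
    show "?F' (?F z) = z" unfolding e using chart_inv_right[OF c(1)] that by simp
    show "?F z \<in> ?U'" using e chart_in[of "?f (chart_inv c z)" c0] chart_inv_in[OF c(1)] that by simp
  qed
  have Fd: "?F differentiable (at y)" using smooth_map_local(2)[OF f(1) c, of "Suc 0"] U(2) by simp
  have Fd': "?F' differentiable (at (?F y))"
    using smooth_map_local(2)[OF f(2) c(2,1), of "Suc 0"] id(2)[OF U(2)] by simp
  define K where "K i a = pd a (\<lambda>w. ?F' w $ i) (?F y)" for i a
  let ?J = "\<lambda>a i. pd i (\<lambda>z. ?F z $ a) y"
  have "(\<Sum>l\<in>UNIV. K a l * ?J l b) = (if a = b then 1 else 0)" for a b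
  proof -
    have "(\<Sum>l\<in>UNIV. K a l * ?J l b) = pd b (\<lambda>z. ?F' (?F z) $ a) y"
      unfolding pd_compose[OF frechet_derivative_component(2)[OF Fd'] Fd] K_def by (simp only: mult.commute)
    also have "\<dots> = pd b (\<lambda>z. z $ a) y" by (rule pd_cong_open[OF U]) (simp only: id(1))
    also have "\<dots> = axis b 1 $ a"
      by (rule pd_eq) (rule bounded_linear_imp_has_derivative[OF bounded_linear_vec_nth])
    finally show ?thesis by (simp add: axis_def)
  qed
  then have "(\<chi> i a. K i a) ** (\<chi> a i. ?J a i) = mat 1"
    by (simp add: vec_eq_iff matrix_matrix_mult_def mat_def)
  then have "(\<chi> a i. ?J a i) ** (\<chi> i a. K i a) = mat 1" using matrix_left_right_inverse by blast
  then have JK: "(\<Sum>i\<in>UNIV. ?J a i * K i b) = (if a = b then 1 else 0)" for a b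
    by (simp add: vec_eq_iff matrix_matrix_mult_def mat_def)
  have m: "metric_at (g c0) z" if "z \<in> chart_img c0" for z using metric_at_chart[OF c(2) that] .
  have Fy: "?F y \<in> chart_img c0" using chart_in[OF y(2)] .
  show ?thesis
  proof (intro exI[of _ K], unfold_locales)
    show "\<tau> * g c0 z [i, j] = \<tau> * g c0 z [j, i]" if "z \<in> chart_img c0" for z i j
      using metric_at.g_sym[OF m[OF that]] by simp
    show "\<tau> * g c0 (?F y) [i, j] = \<tau> * g c0 (?F y) [j, i]" for i j
      using metric_at.g_sym[OF m[OF Fy]] by simp
    show "0 < (\<Sum>i\<in>UNIV. \<Sum>j\<in>UNIV. \<tau> * g c0 (?F y) [i, j] * v $ i * v $ j)" if "v \<noteq> 0" for v
      using mult_pos_pos[OF \<tau> metric_at.g_pos[OF m[OF Fy] that]] by (simp add: sum_distrib_left mult.assoc)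
    show "open ?U" "y \<in> ?U" by (fact U)+
    show "open (chart_img c0)" by (rule open_chart_img[OF c(2)])
    show "?F ` ?U \<subseteq> chart_img c0" using chart_in[of _ c0] by auto
    show "Ck_on (Suc (Suc 0)) ?F ?U" by (rule smooth_map_local(2)[OF f(1) c])
    show "Ck_on (Suc 0) (\<lambda>z. \<tau> * g c0 z [i, j]) (chart_img c0)" for i j
      by (intro Ck_on_mult open_chart_img c(2) Ck_on_const Ck_on_g)
    show "(\<Sum>i\<in>UNIV. ?J a i * K i b) = (if a = b then 1 else 0)" for a b by (rule JK)
  qed
qed

end

section \<open>The maximum principle\<close>

lemma smooth_onE:
  assumes "smooth_on S f" "x \<in> S"
  obtains U F where "open U" "x \<in> U" "\<forall>k. Ck_on k F U" "\<forall>z\<in>S. z \<in> U \<longrightarrow> F z = f z"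
proof -
  have "\<exists>U F. open U \<and> x \<in> U \<and> (\<forall>k. Ck_on k F U) \<and> (\<forall>z\<in>S \<inter> U. F z = f z)"
    using assms unfolding smooth_on_def by (rule bspec)
  then obtain U F where UF: "open U \<and> x \<in> U \<and> (\<forall>k. Ck_on k F U) \<and> (\<forall>z\<in>S \<inter> U. F z = f z)"
    by (elim exE)
  show ?thesis by (rule that[of U F]) (use UF in simp_all)
qed

lemma smooth_on_imp_continuous_on:
  assumes "smooth_on S f"
  shows "continuous_on S f"
  unfolding continuous_on_eq_continuous_within
proof
  fix x assume x: "x \<in> S"
  obtain U F where UF': "open U" "x \<in> U" "\<forall>k. Ck_on k F U" "\<forall>z\<in>S. z \<in> U \<longrightarrow> F z = f z"
    using smooth_onE[OF assms x] .
  note UF = UF'[rule_format]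
  have "continuous_on (S \<inter> U) F"
    by (rule continuous_on_subset[OF Ck_on_imp_continuous_on[OF UF(3)]]) simp
  then have "continuous_on (S \<inter> U) f"
    by (rule continuous_on_eq) (simp add: UF(4))
  then have "continuous (at x within S \<inter> U) f" using x UF(2) by (simp add: continuous_on_eq_continuous_within)
  moreover have "at x within S \<inter> U = at x within S"
    by (rule at_within_nhd[OF UF(2,1)]) blast
  ultimately show "continuous (at x within S) f" by simp
qed

context soliton_flow
begin

lemma psi_smooth: "c \<in> A \<Longrightarrow> smooth_on (I \<times> chart_img c) (\<lambda>(t, y). \<psi> t (chart_inv c y))"
  using tb unfolding torsion_bounding_function_def by blast

lemma psi_nonneg: "t \<in> I \<Longrightarrow> 0 \<le> \<psi> t p"
  using tb unfolding torsion_bounding_function_def by blast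

lemma psi_ineq:
  "t \<in> I \<Longrightarrow> c \<in> A \<Longrightarrow> y \<in> chart_img c \<Longrightarrow>
    vector_derivative (\<lambda>s. \<psi> s (chart_inv c y)) (at t within I)
      - laplacian (\<lambda>y is. (1 - lam * t) * pullback A (\<phi> t) g c y is) (\<lambda>z. \<psi> t (chart_inv c z)) y
    \<le> - H_norm2 (\<lambda>y is. (1 - lam * t) * pullback A (\<phi> t) g c y is)
          (\<lambda>y is. (1 - lam * t) * pullback A (\<phi> t) H c y is) y"
  using tb unfolding torsion_bounding_function_def by blast

lemma psi_continuous: "continuous_on (I \<times> UNIV) (\<lambda>(t, p). \<psi> t p)"
  unfolding continuous_on_eq_continuous_within
proof
  fix x :: "real \<times> 'm" assume x: "x \<in> I \<times> UNIV"
  obtain c where c: "c \<in> A" "snd x \<in> fst c" using chart_exists by blast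
  let ?f = "\<lambda>(t, y). \<psi> t (chart_inv c y)"
  have "continuous_on (I \<times> fst c) (\<lambda>x. (fst x, snd c (snd x)))"
    by (intro continuous_on_Pair continuous_on_fst continuous_on_id
        continuous_on_compose2[OF chart_continuous[OF c(1)] continuous_on_snd[OF continuous_on_id]]) auto
  then have "continuous_on (I \<times> fst c) (\<lambda>x. ?f (fst x, snd c (snd x)))"
    by (rule continuous_on_compose2[OF smooth_on_imp_continuous_on[OF psi_smooth[OF c(1)]]])
      (use chart_in[of _ c] in auto)
  then have "continuous_on (I \<times> fst c) (\<lambda>(t, p). \<psi> t p)"
    by (rule continuous_on_eq) (use chart_inv_left[OF c(1)] in auto)
  then have "continuous (at x within I \<times> fst c) (\<lambda>(t, p). \<psi> t p)"
    using x c(2) by (cases x) (simp add: continuous_on_eq_continuous_within)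
  moreover have "at x within I \<times> fst c = at x within I \<times> UNIV"
    by (rule at_within_nhd[of _ "UNIV \<times> fst c"])
      (use c open_chart_dom[OF c(1)] in \<open>auto simp: open_Times mem_Times_iff\<close>)
  ultimately show "continuous (at x within I \<times> UNIV) (\<lambda>(t, p). \<psi> t p)" by simp
qed

lemma phi_continuous: "continuous_on (I \<times> UNIV) (\<lambda>(t, p). \<phi> t p)"
  using gd unfolding generated_diffeos_def by blast

lemma phi_deriv:
  "t \<in> I \<Longrightarrow> c \<in> A \<Longrightarrow> \<phi> t p \<in> fst c \<Longrightarrow>
    ((\<lambda>s. snd c (\<phi> s p)) has_vector_derivative (1 / (1 - lam * t)) *\<^sub>R X c (snd c (\<phi> t p))) (at t within I)"
  using gd unfolding generated_diffeos_def by blast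

lemma at_within_I: "0 < t \<Longrightarrow> t \<in> I \<Longrightarrow> at t within I = at t"
  by (rule at_within_interior) (simp add: interior_atLeastLessThan)

text \<open>The local extension agrees with \<open>\<psi>\<close> on a full spatial neighbourhood at
  the fixed time, so slices are smooth in space even at the initial time.\<close>

lemma psi_slice:
  assumes t: "t \<in> I" and c: "c \<in> A" and y: "y \<in> chart_img c"
  shows "\<exists>N. open N \<and> y \<in> N \<and> (\<forall>k. Ck_on k (\<lambda>z. \<psi> t (chart_inv c z)) N)"
proof -
  have "(t, y) \<in> I \<times> chart_img c" using t y by blast
  from smooth_onE[OF psi_smooth[OF c] this]
  obtain U F where UF': "open U" "(t, y) \<in> U" "\<forall>k. Ck_on k F U"
    "\<forall>z\<in>I \<times> chart_img c. z \<in> U \<longrightarrow> F z = (\<lambda>(t, y). \<psi> t (chart_inv c y)) z" .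
  note UF = UF'[rule_format]
  let ?N = "(\<lambda>z. (t, z)) -` U \<inter> chart_img c"
  have N: "open ?N" using UF(1) open_chart_img[OF c] by (intro open_Int open_vimage continuous_intros)
  have "Ck_on k (\<lambda>z. F (t, z)) ?N" for k
    by (rule Ck_on_compose[OF N UF(1) UF(3) Ck_on_Pair[OF N Ck_on_const Ck_on_linear[OF bounded_linear_ident]]]) auto
  moreover have "F (t, z) = \<psi> t (chart_inv c z)" if "z \<in> ?N" for z using UF(4)[of "(t, z)"] that t by auto
  ultimately have "Ck_on k (\<lambda>z. \<psi> t (chart_inv c z)) ?N" for k
    using Ck_on_cong[OF N, of "\<lambda>z. F (t, z)" "\<lambda>z. \<psi> t (chart_inv c z)" k] by simp
  then show ?thesis using N UF(2) y by (intro exI[of _ ?N] conjI allI) simp_all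
qed

lemma psi_time:
  assumes t: "0 < t" "t \<in> I"
  shows "((\<lambda>s. \<psi> s p) has_real_derivative vector_derivative (\<lambda>s. \<psi> s p) (at t within I)) (at t)"
proof -
  obtain c where c: "c \<in> A" "p \<in> fst c" using chart_exists by blast
  let ?y = "snd c p"
  have y: "?y \<in> chart_img c" "chart_inv c ?y = p" using chart_in[OF c(2)] chart_inv_left[OF c] by auto
  have "(t, ?y) \<in> I \<times> chart_img c" using t y by blast
  from smooth_onE[OF psi_smooth[OF c(1)] this]
  obtain U F where UF': "open U" "(t, ?y) \<in> U" "\<forall>k. Ck_on k F U"
    "\<forall>z\<in>I \<times> chart_img c. z \<in> U \<longrightarrow> F z = (\<lambda>(t, y). \<psi> t (chart_inv c y)) z" .
  note UF = UF'[rule_format]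
  have fd: "(F has_derivative frechet_derivative F (at (t, ?y))) (at (t, ?y))"
    using Ck_on_Suc_has_derivative[OF UF(3,2)] .
  have "((\<lambda>s::real. (s, ?y)) has_derivative (\<lambda>h. (h, 0))) (at t)"
    by (intro has_derivative_Pair has_derivative_ident has_derivative_const)
  from has_derivative_compose[OF this fd]
  have F1: "((\<lambda>s. F (s, ?y)) has_derivative (\<lambda>h. frechet_derivative F (at (t, ?y)) (h, 0))) (at t)" .
  have "frechet_derivative F (at (t, ?y)) (h, 0) = h *\<^sub>R frechet_derivative F (at (t, ?y)) (1, 0)" for h
    using linear_cmul[OF has_derivative_linear[OF fd], of h "(1, 0)"] by simp
  then have "(\<lambda>h. frechet_derivative F (at (t, ?y)) (h, 0)) = (\<lambda>h. h *\<^sub>R frechet_derivative F (at (t, ?y)) (1, 0))"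
    by (rule ext)
  from has_derivative_eq_rhs[OF F1 this]
  have "((\<lambda>s. F (s, ?y)) has_vector_derivative frechet_derivative F (at (t, ?y)) (1, 0)) (at t)"
    unfolding has_vector_derivative_def .
  moreover let ?S = "(\<lambda>s. (s, ?y)) -` U \<inter> {0<..<1/lam}"
  have "open ?S" using UF(1) by (intro open_Int open_vimage continuous_intros) auto
  moreover have "t \<in> ?S" using UF(2) t by auto
  moreover have "F (s, ?y) = \<psi> s p" if "s \<in> ?S" for s using UF(4)[of "(s, ?y)"] that y by auto
  ultimately have v: "((\<lambda>s. \<psi> s p) has_vector_derivative frechet_derivative F (at (t, ?y)) (1, 0)) (at t)"
    by (rule has_vector_derivative_transform_within_open)
  show ?thesis
    unfolding at_within_I[OF t] has_real_derivative_iff_has_vector_derivative vector_derivative_at[OF v]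
    by (rule v)
qed

text \<open>The parabolic maximum condition for \<open>\<psi>\<close> minus the pulled-back test
  function plus \<open>\<kappa> * \<sigma>\<close>. The test function depends on time through
  \<open>\<phi>\<close>, which produces the drift term. Every term except the derivatives of
  \<open>\<psi>\<close> carries the factor 1/\<tau>, and multiplying by \<tau> leaves an inequality
  for the fixed metric at the image point.\<close>

lemma interior_max:
  assumes t: "0 < t" "t \<in> I" and c0: "c0 \<in> A" "\<phi> t p \<in> fst c0" and \<Phi>: "\<And>k. Ck_on k \<Phi> UNIV"
    and time: "d > 0" "\<And>s. t - d < s \<Longrightarrow> s < t \<Longrightarrow>
      \<psi> s p - \<Phi> (snd c0 (\<phi> s p)) + \<kappa> * \<sigma> s \<le> \<psi> t p - \<Phi> (snd c0 (\<phi> t p)) + \<kappa> * \<sigma> t"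
    and space: "open N" "p \<in> N" "\<And>q. q \<in> N \<Longrightarrow>
      \<psi> t q - \<Phi> (snd c0 (\<phi> t q)) \<le> \<psi> t p - \<Phi> (snd c0 (\<phi> t p))"
  shows "H_norm2 (g c0) (H c0) (snd c0 (\<phi> t p)) - \<kappa> \<le> drift_laplacian c0 \<Phi> (snd c0 (\<phi> t p))"
proof -
  define Y where "Y = snd c0 (\<phi> t p)"
  define \<tau> where "\<tau> = 1 - lam * t"
  have \<tau>: "\<tau> > 0" using tau_pos[OF t(2)] by (simp add: \<tau>_def)
  define D where "D = vector_derivative (\<lambda>s. \<psi> s p) (at t within I)"
  have Yc: "Y \<in> chart_img c0" using chart_in[OF c0(2)] by (simp add: Y_def)
  have \<Phi>d: "\<Phi> differentiable (at z)" for z using \<Phi>[of "Suc 0"] by simp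

  \<comment> \<open>The maximum is compared with earlier times only, so the time derivative is
    nonnegative rather than zero. This also covers a maximum at the end of a time interval.\<close>
  have time_ineq: "0 \<le> D - (1/\<tau>) * (\<Sum>k\<in>UNIV. X c0 Y $ k * pd k \<Phi> Y) + \<kappa> / \<tau>"
  proof -
    have 1: "((\<lambda>s. \<psi> s p) has_real_derivative D) (at t)" unfolding D_def by (rule psi_time[OF t])
    have "((\<lambda>s. snd c0 (\<phi> s p)) has_derivative (\<lambda>h. h *\<^sub>R ((1/\<tau>) *\<^sub>R X c0 Y))) (at t)"
      using phi_deriv[OF t(2) c0] unfolding at_within_I[OF t] has_vector_derivative_def Y_def \<tau>_def .
    moreover have "(\<Phi> has_derivative frechet_derivative \<Phi> (at Y)) (at (snd c0 (\<phi> t p)))"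
      using \<Phi>d[of Y] by (simp add: Y_def frechet_derivative_works)
    ultimately have "((\<lambda>s. \<Phi> (snd c0 (\<phi> s p))) has_derivative
        (\<lambda>h. frechet_derivative \<Phi> (at Y) (h *\<^sub>R ((1/\<tau>) *\<^sub>R X c0 Y)))) (at t)"
      by (rule has_derivative_compose)
    moreover have "frechet_derivative \<Phi> (at Y) (h *\<^sub>R ((1/\<tau>) *\<^sub>R X c0 Y)) =
        (1/\<tau>) * (\<Sum>k\<in>UNIV. X c0 Y $ k * pd k \<Phi> Y) * h" for h
      unfolding frechet_derivative_pd[OF \<Phi>d] by (simp add: sum_distrib_left sum_distrib_right sum_divide_distrib mult_ac)
    ultimately have 2: "((\<lambda>s. \<Phi> (snd c0 (\<phi> s p))) has_real_derivative (1/\<tau>) * (\<Sum>k\<in>UNIV. X c0 Y $ k * pd k \<Phi> Y)) (at t)"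
      unfolding has_field_derivative_def by (simp only:)
    have 3: "((\<lambda>s. \<kappa> * \<sigma> s) has_real_derivative \<kappa> * (1/\<tau>)) (at t)"
      by (rule DERIV_cmult) (use sigma_deriv[OF t(2)] in \<open>simp add: \<tau>_def\<close>)
    let ?u = "\<lambda>s. \<psi> s p - \<Phi> (snd c0 (\<phi> s p)) + \<kappa> * \<sigma> s"
    let ?l = "D - (1/\<tau>) * (\<Sum>k\<in>UNIV. X c0 Y $ k * pd k \<Phi> Y) + \<kappa> * (1/\<tau>)"
    have u: "(?u has_real_derivative ?l) (at t)" by (intro DERIV_add DERIV_diff 1 2 3)
    have "0 \<le> ?l"
    proof (rule ccontr)
      assume "\<not> 0 \<le> ?l"
      then have "?l < 0" by simp
      from DERIV_neg_dec_left[OF u this] obtain e where e: "e > 0" "\<And>h. 0 < h \<Longrightarrow> h < e \<Longrightarrow> ?u t < ?u (t - h)" by blast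
      define h where "h = min d e / 2"
      have h: "0 < h" "h < e" "h < d" using e(1) time(1) by (auto simp: h_def)
      have "?u (t - h) \<le> ?u t" by (rule time(2)) (use h in auto)
      moreover have "?u t < ?u (t - h)" by (rule e(2)[OF h(1,2)])
      ultimately show False by linarith
    qed
    then show ?thesis by simp
  qed

  obtain c where c: "c \<in> A" "p \<in> fst c" using chart_exists by blast
  define y where "y = snd c p"
  have y: "y \<in> chart_img c" "chart_inv c y = p" using chart_in[OF c(2)] chart_inv_left[OF c] by (auto simp: y_def)
  let ?F = "\<lambda>z. snd c0 (\<phi> t (chart_inv c z))"
  let ?U = "{z \<in> chart_img c. \<phi> t (chart_inv c z) \<in> fst c0}"
  have sm: "smooth_map A (\<phi> t)" using diffeo_phi[OF t(2)] unfolding diffeo_def by blast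
  have y2: "\<phi> t (chart_inv c y) \<in> fst c0" using y(2) c0(2) by simp
  have Fy: "?F y = Y" using y(2) by (simp add: Y_def)
  have U: "open ?U" "y \<in> ?U" using smooth_map_local(1)[OF sm c(1) c0(1)] y y2 by auto
  obtain K where "coordinate_change (\<lambda>z is. \<tau> * g c0 z is) ?F y ?U (chart_img c0) K"
    using coordinate_change_phi[OF t(2) c(1) c0(1) y(1) y2 \<tau>] by blast
  then interpret cc: coordinate_change "\<lambda>z is. \<tau> * g c0 z is" ?F y ?U "chart_img c0" K .
  interpret ma: metric_at "g c0" Y by (rule metric_at_chart[OF c0(1) Yc])
  interpret mG: metric_at cc.G y by (rule cc.metric_at_G)
  let ?Gt = "\<lambda>y is. (1 - lam * t) * pullback A (\<phi> t) g c y is"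
  let ?Ht = "\<lambda>y is. (1 - lam * t) * pullback A (\<phi> t) H c y is"
  have Gt: "?Gt z [i, j] = cc.G z [i, j]" if "z \<in> ?U" for z i j
    unfolding comp_pullback_scale \<tau>_def using pullback_eq[OF gt sm c(1) c0(1), of z "[i, j]"] that by simp
  have Htt: "?Ht y [i, j, k] = comp_pullback ?F (\<lambda>z is. \<tau> * H c0 z is) y [i, j, k]" for i j k
    unfolding comp_pullback_scale \<tau>_def using pullback_eq[OF Ht sm c(1) c0(1), of y "[i, j, k]"] U(2) by simp
  have hn: "H_norm2 ?Gt ?Ht y = H_norm2 (g c0) (H c0) Y / \<tau>"
  proof -
    have "H_norm2 ?Gt ?Ht y = H_norm2 cc.G (comp_pullback ?F (\<lambda>z is. \<tau> * H c0 z is)) y"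
      by (rule H_norm2_cong) (use Gt[OF U(2)] Htt in auto)
    also have "\<dots> = H_norm2 (\<lambda>z is. \<tau> * g c0 z is) (\<lambda>z is. \<tau> * H c0 z is) Y"
      unfolding cc.H_norm2_pullback Fy by (rule refl)
    also have "\<dots> = H_norm2 (g c0) (H c0) Y / \<tau>" by (rule ma.H_norm2_scaled[OF \<tau>])
    finally show ?thesis .
  qed
  let ?f = "\<lambda>z. \<psi> t (chart_inv c z)"
  \<comment> \<open>At a spatial maximum the gradients of the two functions agree and the Hessian of
    the difference is nonpositive, so its trace with the inverse metric is too. The Laplacian of the
    pulled-back test function is then transported and scaled.\<close>
  have space_ineq: "laplacian ?Gt ?f y \<le> laplacian (g c0) \<Phi> Y / \<tau>"
  proof -
    obtain N1 where N1: "open N1" "y \<in> N1" "\<And>k. Ck_on k ?f N1" using psi_slice[OF t(2) c(1) y(1)] by blast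
    let ?W = "N1 \<inter> ?U \<inter> (chart_img c \<inter> chart_inv c -` N)"
    have W: "open ?W" "y \<in> ?W"
      using N1 U y space(2) continuous_open_preimage[OF chart_inv_continuous[OF c(1)] open_chart_img[OF c(1)] space(1)]
      by (auto intro!: open_Int)
    have f2: "Ck_on (Suc (Suc 0)) ?f ?W" using N1(3) by (rule Ck_on_subset) blast
    have p2: "Ck_on (Suc (Suc 0)) (\<lambda>z. \<Phi> (?F z)) ?W"
    proof (rule Ck_on_compose[OF W(1) open_UNIV \<Phi>])
      show "Ck_on (Suc (Suc 0)) ?F ?W" using cc.F by (rule Ck_on_subset) blast
    qed simp
    let ?v = "\<lambda>z. ?f z - \<Phi> (?F z)"
    have v2: "Ck_on (Suc (Suc 0)) ?v ?W" by (rule Ck_on_diff[OF W(1) f2 p2])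
    have vmax: "?v z \<le> ?v y" if "z \<in> ?W" for z using space(3)[of "chart_inv c z"] that y(2) by simp
    have pdv: "pd k ?v z = pd k ?f z - pd k (\<lambda>z. \<Phi> (?F z)) z" if "z \<in> ?W" for k z
      by (rule pd_diff) (use f2 p2 that in auto)
    have pd1: "pd k ?f y = pd k (\<lambda>z. \<Phi> (?F z)) y" for k
      using second_derivative_test(1)[OF W v2 vmax] pdv[OF W(2)] by simp
    have pd2: "pd i (pd j ?v) y = pd i (pd j ?f) y - pd i (pd j (\<lambda>z. \<Phi> (?F z))) y" for i j
    proof -
      have "pd i (pd j ?v) y = pd i (\<lambda>z. pd j ?f z - pd j (\<lambda>z. \<Phi> (?F z)) z) y"
        by (rule pd_cong_open[OF W]) (rule pdv)
      also have "\<dots> = pd i (pd j ?f) y - pd i (pd j (\<lambda>z. \<Phi> (?F z))) y"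
        by (rule pd_diff) (use Ck_on_pd[OF f2, of j] Ck_on_pd[OF p2, of j] W(2) in auto)
      finally show ?thesis .
    qed
    have "0 \<le> contract (ginv cc.G y) (\<lambda>i j. - pd i (pd j ?v) y)"
      by (rule mG.contract_ginv_nonneg)
        (use second_derivative_test(2)[OF W v2 vmax] in \<open>simp add: sum_negf\<close>)
    then have "contract (ginv cc.G y) (\<lambda>i j. pd i (pd j ?v) y) \<le> 0"
      by (simp add: contract_def sum_negf)
    moreover have "contract (ginv cc.G y) (\<lambda>i j. pd i (pd j ?v) y) =
        laplacian cc.G ?f y - laplacian cc.G (\<lambda>z. \<Phi> (?F z)) y"
      unfolding laplacian_contract pd1 pd2 contract_def sum_subtractf[symmetric]
      by (intro sum.cong refl) (simp add: algebra_simps)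
    moreover have "laplacian cc.G (\<lambda>z. \<Phi> (?F z)) y = laplacian (\<lambda>z is. \<tau> * g c0 z is) \<Phi> Y"
      using cc.laplacian_pullback[OF \<Phi>] by (simp only: Fy)
    moreover have "laplacian (\<lambda>z is. \<tau> * g c0 z is) \<Phi> Y = laplacian (g c0) \<Phi> Y / \<tau>"
    proof (rule ma.laplacian_scaled[OF \<tau>])
      show "(\<lambda>z. g c0 z [i, j]) differentiable at Y" for i j
        using Ck_on_g[OF c0(1), of "Suc 0" i j] Yc by simp
    qed
    moreover have "laplacian ?Gt ?f y = laplacian cc.G ?f y"
      by (rule laplacian_cong[OF U]) (use Gt in auto)
    ultimately show ?thesis by linarith
  qed
  have "D - laplacian ?Gt ?f y \<le> - (H_norm2 (g c0) (H c0) Y / \<tau>)"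
    using psi_ineq[OF t(2) c(1) y(1)] unfolding hn y(2) D_def .
  then have "0 \<le> (laplacian (g c0) \<Phi> Y / \<tau> - (1/\<tau>) * (\<Sum>k\<in>UNIV. X c0 Y $ k * pd k \<Phi> Y)) + \<kappa> / \<tau> - H_norm2 (g c0) (H c0) Y / \<tau>"
    using time_ineq space_ineq by linarith
  also have "\<dots> = (drift_laplacian c0 \<Phi> Y + \<kappa> - H_norm2 (g c0) (H c0) Y) / \<tau>"
    by (simp add: drift_laplacian_def diff_divide_distrib add_divide_distrib)
  finally have "0 \<le> drift_laplacian c0 \<Phi> Y + \<kappa> - H_norm2 (g c0) (H c0) Y"
    using \<tau> by (simp add: zero_le_divide_iff)
  then show ?thesis by (simp add: Y_def)
qed

lemma H_norm2_chart_nonneg: "c \<in> A \<Longrightarrow> y \<in> chart_img c \<Longrightarrow> 0 \<le> H_norm2 (g c) (H c) y"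
  by (rule metric_at.H_norm2_nonneg[OF metric_at_chart])

section \<open>Rescaled time and boundedness\<close>

lemma sigma_mono: "s \<in> I \<Longrightarrow> t \<in> I \<Longrightarrow> s \<le> t \<Longrightarrow> \<sigma> s \<le> \<sigma> t"
proof -
  assume st: "s \<in> I" "t \<in> I" "s \<le> t"
  have "1 - lam * t \<le> 1 - lam * s" using st lam by simp
  then have "ln (1 - lam * t) \<le> ln (1 - lam * s)" using tau_pos[OF st(2)] by simp
  then show ?thesis using lam by (simp add: \<sigma>_def divide_right_mono)
qed

lemma sigma_0 [simp]: "\<sigma> 0 = 0"
  by (simp add: \<sigma>_def)

text \<open>Solving for \<open>s\<close> gives 1 - lam s = (1 - lam t) exp(- lam q), which is
  positive for every q: an unlimited amount of rescaled time is available before 1/lam.\<close>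

lemma sigma_unbounded:
  assumes "t \<in> I" "0 \<le> q"
  shows "\<exists>s\<in>I. t \<le> s \<and> \<sigma> s = \<sigma> t + q"
proof -
  define e where "e = exp (- (lam * q))"
  have e: "0 < e" "e \<le> 1" using assms(2) lam by (auto simp: e_def)
  define s where "s = (1 - (1 - lam * t) * e) / lam"
  have s: "1 - lam * s = (1 - lam * t) * e" using lam by (simp add: s_def)
  have pos: "0 < (1 - lam * t) * e" using tau_pos[OF assms(1)] e by simp
  have le: "(1 - lam * t) * e \<le> 1 - lam * t" using tau_pos[OF assms(1)] e by (simp add: mult_left_le)
  have ts: "lam * t \<le> lam * s" using s le by linarith
  then have "t \<le> s" using lam by simp
  moreover have "s < 1 / lam" using s pos lam by (simp add: field_simps)
  moreover have "\<sigma> s = \<sigma> t + q"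
  proof -
    have "ln (1 - lam * s) = ln (1 - lam * t) + - (lam * q)"
      unfolding s using tau_pos[OF assms(1)] e by (simp add: ln_mult e_def)
    then show ?thesis using lam unfolding \<sigma>_def by (simp add: field_simps)
  qed
  ultimately show ?thesis using assms(1) by (intro bexI[of _ s]) auto
qed

lemma sigma_continuous: "continuous_on I \<sigma>"
  by (rule continuous_at_imp_continuous_on) (use sigma_deriv DERIV_isCont in blast)

text \<open>Subtracting \<open>e * \<sigma>\<close> makes the inequality strict, so over a compact
  time interval the maximum sits at time 0: otherwise \<open>interior_max\<close> with the zero test
  function and \<kappa> = -e would give |H|^2 + e \<le> 0. Then e tends to 0.\<close>

lemma psi_bounded: "\<exists>C. \<forall>t\<in>I. \<forall>p. \<psi> t p \<le> C"
proof (cases "(UNIV :: 'm set) = {}")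
  case False
  have I0: "0 \<in> I" using lam by simp
  have "continuous_on UNIV (\<lambda>p. (\<lambda>(t, p). \<psi> t p) (0, p))"
    by (rule continuous_on_compose2[OF psi_continuous continuous_on_Pair[OF continuous_on_const continuous_on_id]])
      (use I0 in auto)
  from continuous_attains_sup[OF compact_M False this]
  obtain p0 where p0: "\<And>p. \<psi> 0 p \<le> \<psi> 0 p0" by auto
  have "\<psi> T p \<le> \<psi> 0 p0 + e * \<sigma> T" if T: "T \<in> I" and e: "e > 0" for T p e
  proof -
    let ?S = "{0..T} \<times> (UNIV :: 'm set)"
    have TI: "{0..T} \<subseteq> I" using T by auto
    have S: "compact ?S" by (intro compact_Times compact_M) auto
    have ne: "?S \<noteq> {}" using T by auto
    have "continuous_on ?S (\<lambda>x. (\<lambda>(t, p). \<psi> t p) x + (- e) * \<sigma> (fst x))"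
      by (intro continuous_on_add continuous_on_mult continuous_on_const continuous_on_subset[OF psi_continuous]
          continuous_on_compose2[OF sigma_continuous continuous_on_fst[OF continuous_on_id]]) (use TI in auto)
    from continuous_attains_sup[OF S ne this]
    obtain x where x: "x \<in> ?S" "\<And>z. z \<in> ?S \<Longrightarrow> (\<lambda>(t, p). \<psi> t p) z + (- e) * \<sigma> (fst z) \<le> (\<lambda>(t, p). \<psi> t p) x + (- e) * \<sigma> (fst x)"
      by blast
    obtain t q where tq: "x = (t, q)" "t \<in> {0..T}" using x(1) by auto
    have max: "\<psi> s r + (- e) * \<sigma> s \<le> \<psi> t q + (- e) * \<sigma> t" if "s \<in> {0..T}" for s r
      using x(2)[of "(s, r)"] that tq by auto
    have "t = 0"
    proof (rule ccontr)
      assume "t \<noteq> 0"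
      then have t: "0 < t" "t \<in> I" using tq TI by auto
      obtain c where c: "c \<in> A" "\<phi> t q \<in> fst c" using chart_exists by blast
      have "H_norm2 (g c) (H c) (snd c (\<phi> t q)) - (- e) \<le> drift_laplacian c (\<lambda>z. 0) (snd c (\<phi> t q))"
      proof (rule interior_max[OF t c, where d = t and N = UNIV])
        show "\<psi> s q - 0 + - e * \<sigma> s \<le> \<psi> t q - 0 + - e * \<sigma> t" if "t - t < s" "s < t" for s
          using max[of s q] that tq by simp
        show "\<psi> t r - 0 \<le> \<psi> t q - 0" for r using max[of t r] tq by simp
      qed (use t in auto)
      moreover have "drift_laplacian c (\<lambda>z. 0) (snd c (\<phi> t q)) = 0"
      proof -
        have "pd j (\<lambda>z. 0 :: real) = (\<lambda>z. 0)" for j :: 'n by (rule ext) (rule pd_const)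
        then show ?thesis by (simp add: drift_laplacian_def laplacian_def)
      qed
      ultimately show False using H_norm2_chart_nonneg[OF c(1) chart_in[OF c(2)]] e by simp
    qed
    then show ?thesis using max[of T p] p0[of q] T by simp
  qed
  note bound = this
  have "\<psi> T p \<le> \<psi> 0 p0" if T: "T \<in> I" for T p
  proof (rule field_le_epsilon)
    fix e :: real assume e: "e > 0"
    have s: "\<sigma> T \<ge> 0" using sigma_mono[OF I0 T] T by simp
    \<comment> \<open>The 1 in the denominator avoids dividing by zero when the rescaled time is
      still 0.\<close>
    have "\<psi> T p \<le> \<psi> 0 p0 + e / (\<sigma> T + 1) * \<sigma> T" by (rule bound[OF T]) (use e s in simp)
    also have "e / (\<sigma> T + 1) * \<sigma> T \<le> e" using e s by (simp add: field_simps)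
    finally show "\<psi> T p \<le> \<psi> 0 p0 + e" by simp
  qed
  then show ?thesis by blast
qed auto

end

section \<open>Quadratic and Gaussian test functions\<close>

lemma Ck_on_q: "Ck_on k (\<lambda>z. (z - w) \<bullet> (z - w)) UNIV"
  by (intro Ck_on_inner open_UNIV Ck_on_diff Ck_on_const Ck_on_linear bounded_linear_ident)

lemma Ck_on_gauss: "Ck_on k (\<lambda>z. exp (- \<alpha> * ((z - w) \<bullet> (z - w)))) UNIV"
  by (rule Ck_on_compose[OF open_UNIV open_UNIV Ck_on_exp])
    (intro Ck_on_mult open_UNIV Ck_on_const Ck_on_q, simp)

lemma pd_gauss:
  "pd k (\<lambda>z. exp (- \<alpha> * ((z - w) \<bullet> (z - w)))) z = -2 * \<alpha> * (z - w) $ k * exp (- \<alpha> * ((z - w) \<bullet> (z - w)))"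
proof -
  have "((\<lambda>z. exp (- \<alpha> * ((z - w) \<bullet> (z - w)))) has_derivative
      (\<lambda>h. exp (- \<alpha> * ((z - w) \<bullet> (z - w))) * (- \<alpha> * ((z - w) \<bullet> h + h \<bullet> (z - w))))) (at z)"
    by (auto intro!: derivative_eq_intros)
  from pd_eq[OF this] show ?thesis by (simp add: inner_axis inner_commute[of "axis k 1"])
qed

lemma pd_pd_gauss:
  "pd i (pd k (\<lambda>z. exp (- \<alpha> * ((z - w) \<bullet> (z - w))))) z =
    (4 * \<alpha>\<^sup>2 * (z - w) $ i * (z - w) $ k - (if i = k then 2 * \<alpha> else 0)) * exp (- \<alpha> * ((z - w) \<bullet> (z - w)))"
proof -
  let ?v = "\<lambda>z. exp (- \<alpha> * ((z - w) \<bullet> (z - w)))"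
  have l: "((\<lambda>z. -2 * \<alpha> * (z - w) $ k) has_derivative (\<lambda>h. -2 * \<alpha> * h $ k)) (at z)"
    by (auto intro!: derivative_eq_intros bounded_linear.has_derivative[OF bounded_linear_vec_nth] simp: algebra_simps)
  have vd: "?v differentiable (at z)" using Ck_on_gauss[of "Suc 0" \<alpha> w] by simp
  have ld: "(\<lambda>z. -2 * \<alpha> * (z - w) $ k) differentiable (at z)" using l unfolding differentiable_def by blast
  have "pd i (pd k ?v) z = pd i (\<lambda>z. (-2 * \<alpha> * (z - w) $ k) * ?v z) z"
    by (rule arg_cong[where f = "\<lambda>h. pd i h z"]) (rule ext, rule pd_gauss)
  also have "\<dots> = -2 * \<alpha> * axis i 1 $ k * ?v z + (-2 * \<alpha> * (z - w) $ k) * (-2 * \<alpha> * (z - w) $ i * ?v z)"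
    unfolding pd_mult[OF ld vd] pd_eq[OF l] pd_gauss by (rule refl)
  also have "\<dots> = (4 * \<alpha>\<^sup>2 * (z - w) $ i * (z - w) $ k - (if i = k then 2 * \<alpha> else 0)) * ?v z"
    by (auto simp: axis_def power2_eq_square algebra_simps)
  finally show ?thesis .
qed

section \<open>The half-relaxed limit\<close>

context soliton_flow
begin

text \<open>\<open>low x a\<close> says that the upper half-relaxed limit of \<open>\<psi>\<close>, that is, the limes superior of
  \<open>\<psi> t p\<close> as \<open>t\<close> tends to the singular time and \<open>\<phi> t p\<close> tends to \<open>x\<close>, is less than \<open>a\<close>.\<close>

definition low :: "'m \<Rightarrow> real \<Rightarrow> bool" where
  "low x a \<longleftrightarrow> (\<exists>U t1 a'. open U \<and> x \<in> U \<and> t1 \<in> I \<and> a' < a \<and>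
     (\<forall>t\<in>I. \<forall>p. t1 \<le> t \<longrightarrow> \<phi> t p \<in> U \<longrightarrow> \<psi> t p \<le> a'))"

lemma lowI:
  "open U \<Longrightarrow> x \<in> U \<Longrightarrow> t1 \<in> I \<Longrightarrow> a' < a \<Longrightarrow>
    (\<And>t p. t \<in> I \<Longrightarrow> t1 \<le> t \<Longrightarrow> \<phi> t p \<in> U \<Longrightarrow> \<psi> t p \<le> a') \<Longrightarrow> low x a"
  unfolding low_def by blast

lemma lowE:
  assumes "low x a"
  obtains U t1 a' where "open U" "x \<in> U" "t1 \<in> I" "a' < a" "\<forall>t\<in>I. \<forall>p. t1 \<le> t \<longrightarrow> \<phi> t p \<in> U \<longrightarrow> \<psi> t p \<le> a'"
  using assms unfolding low_def by (elim exE conjE)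

lemma low_mono: "low x a \<Longrightarrow> a \<le> b \<Longrightarrow> low x b"
  by (erule lowE, rule lowI) auto

text \<open>This is upper semicontinuity of the half-relaxed limit: the neighbourhood that witnesses
  \<open>low\<close> at \<open>x\<close> serves all of its points.\<close>

lemma open_low: "open {x. low x a}"
proof (subst open_subopen, rule ballI)
  fix x assume "x \<in> {x. low x a}"
  then have "low x a" by simp
  then obtain U t1 a' where U: "open U" "x \<in> U" "t1 \<in> I" "a' < a"
    "\<forall>t\<in>I. \<forall>p. t1 \<le> t \<longrightarrow> \<phi> t p \<in> U \<longrightarrow> \<psi> t p \<le> a'" by (rule lowE)
  have "U \<subseteq> {x. low x a}"
    using lowI[OF U(1) _ U(3,4)] U(5) by blast
  then show "\<exists>T. open T \<and> x \<in> T \<and> T \<subseteq> {x. low x a}" using U by blast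
qed

text \<open>Since \<open>\<phi> t1\<close> is onto, some value of \<open>\<psi>\<close> really is
  constrained by the witness, and \<open>\<psi>\<close> is nonnegative.\<close>

lemma low_pos:
  assumes "low x a"
  shows "0 < a"
proof -
  obtain U t1 a' where U: "open U" "x \<in> U" "t1 \<in> I" "a' < a"
    "\<forall>t\<in>I. \<forall>p. t1 \<le> t \<longrightarrow> \<phi> t p \<in> U \<longrightarrow> \<psi> t p \<le> a'" using assms by (rule lowE)
  have "bij (\<phi> t1)" using diffeo_phi[OF U(3)] unfolding diffeo_def by blast
  then have "\<phi> t1 (inv (\<phi> t1) x) = x" by (simp add: bij_is_surj surj_f_inv_f)
  then have "\<psi> t1 (inv (\<phi> t1) x) \<le> a'" using U by simp
  then show ?thesis using psi_nonneg[OF U(3)] U(4) by (meson le_less_trans order_trans)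
qed

text \<open>An upper semicontinuous function attains its maximum on a compact set, so a strict bound
  on the set can be improved to a smaller one. The cover is by the open sets of points that are low
  for some b < a.\<close>

lemma low_compact:
  assumes K: "compact K" "K \<noteq> {}" and low: "\<And>x. x \<in> K \<Longrightarrow> low x a"
  shows "\<exists>b<a. \<forall>x\<in>K. low x b"
proof -
  have "\<exists>b<a. low x b" if xK: "x \<in> K" for x
  proof -
    obtain U t1 a' where U: "open U" "x \<in> U" "t1 \<in> I" "a' < a"
      "\<forall>t\<in>I. \<forall>p. t1 \<le> t \<longrightarrow> \<phi> t p \<in> U \<longrightarrow> \<psi> t p \<le> a'" using low[OF xK] by (rule lowE)
    obtain b where b: "a' < b" "b < a" using dense[OF U(4)] by blast
    have "low x b" by (rule lowI[OF U(1,2,3) b(1)]) (use U(5) in blast)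
    then show ?thesis using b by blast
  qed
  then have cov: "K \<subseteq> (\<Union>b\<in>{..<a}. {x. low x b})" by blast
  obtain F where F: "F \<subseteq> {..<a}" "finite F" "K \<subseteq> (\<Union>b\<in>F. {x. low x b})"
    using compactE_image[OF K(1), of "{..<a}" "\<lambda>b. {x. low x b}", OF open_low cov] .
  have Fne: "F \<noteq> {}" using F(3) K(2) by auto
  have "Max F < a" using F Fne by (simp add: subset_iff)
  moreover have "low x (Max F)" if xK: "x \<in> K" for x
  proof -
    obtain b where b: "b \<in> F" "low x b" using F(3) xK by blast
    show ?thesis by (rule low_mono[OF b(2) Max_ge[OF F(2) b(1)]])
  qed
  ultimately show ?thesis by blast
qed

text \<open>Translates the pointwise bound on the limit into a bound on \<open>\<psi>\<close>
  itself, with a margin and a starting time that serve all of \<open>S\<close>.\<close>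

lemma low_compact_fun:
  assumes c: "c \<in> A" and S: "compact S" "S \<subseteq> chart_img c" and \<Phi>: "continuous_on UNIV \<Phi>"
    and low: "\<And>y. y \<in> S \<Longrightarrow> low (chart_inv c y) (\<Phi> y)"
  shows "\<exists>\<delta>>0. \<exists>t1\<in>I. \<forall>t\<in>I. \<forall>p. \<forall>y\<in>S. t1 \<le> t \<longrightarrow> \<phi> t p = chart_inv c y \<longrightarrow> \<psi> t p \<le> \<Phi> y - \<delta>"
proof -
  define good where "good \<delta> t1 z \<longleftrightarrow> (\<forall>t\<in>I. \<forall>p. t1 \<le> t \<longrightarrow> \<phi> t p = chart_inv c z \<longrightarrow> \<psi> t p \<le> \<Phi> z - \<delta>)" for \<delta> t1 z
  have "\<forall>y\<in>S. \<exists>W \<delta> t1. open W \<and> y \<in> W \<and> \<delta> > 0 \<and> t1 \<in> I \<and> (\<forall>z\<in>W. good \<delta> t1 z)"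
  proof
    fix y assume y: "y \<in> S"
    obtain U t1 a' where U: "open U" "chart_inv c y \<in> U" "t1 \<in> I" "a' < \<Phi> y"
      "\<forall>t\<in>I. \<forall>p. t1 \<le> t \<longrightarrow> \<phi> t p \<in> U \<longrightarrow> \<psi> t p \<le> a'" using low[OF y] by (rule lowE)
    \<comment> \<open>Half of the gap becomes the margin; the other half absorbs the variation of
      \<Phi> over the neighbourhood.\<close>
    define \<delta> where "\<delta> = (\<Phi> y - a') / 2"
    let ?W = "(chart_img c \<inter> chart_inv c -` U) \<inter> \<Phi> -` {a' + \<delta><..}"
    have W: "open ?W"
      by (rule open_Int[OF continuous_open_preimage[OF chart_inv_continuous[OF c] open_chart_img[OF c] U(1)]
          open_vimage[OF open_greaterThan \<Phi>]])
    have \<delta>: "\<delta> > 0" using U(4) by (simp add: \<delta>_def)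
    have "a' + \<delta> < \<Phi> y" using U(4) by (simp add: \<delta>_def field_simps)
    then have yW: "y \<in> ?W" using y S(2) U(2) by auto
    have "good \<delta> t1 z" if "z \<in> ?W" for z
      unfolding good_def
    proof (intro ballI allI impI)
      fix t p assume t: "t \<in> I" "t1 \<le> t" "\<phi> t p = chart_inv c z"
      have "\<phi> t p \<in> U" using that t(3) by simp
      then have "\<psi> t p \<le> a'" using U(5) t(1,2) by blast
      then show "\<psi> t p \<le> \<Phi> z - \<delta>" using that by simp
    qed
    then show "\<exists>W \<delta> t1. open W \<and> y \<in> W \<and> \<delta> > 0 \<and> t1 \<in> I \<and> (\<forall>z\<in>W. good \<delta> t1 z)"
      using W yW \<delta> U(3) by (intro exI[of _ ?W] exI[of _ \<delta>] exI[of _ t1] conjI ballI)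
  qed
  from bchoice[OF this] obtain W where "\<forall>y\<in>S. \<exists>\<delta> t1. open (W y) \<and> y \<in> W y \<and> \<delta> > 0 \<and> t1 \<in> I \<and> (\<forall>z\<in>W y. good \<delta> t1 z)" ..
  from bchoice[OF this] obtain \<Delta> where "\<forall>y\<in>S. \<exists>t1. open (W y) \<and> y \<in> W y \<and> \<Delta> y > 0 \<and> t1 \<in> I \<and> (\<forall>z\<in>W y. good (\<Delta> y) t1 z)" ..
  from bchoice[OF this] obtain T where T: "\<forall>y\<in>S. open (W y) \<and> y \<in> W y \<and> \<Delta> y > 0 \<and> T y \<in> I \<and> (\<forall>z\<in>W y. good (\<Delta> y) (T y) z)" ..
  have oW: "open (W y)" if "y \<in> S" for y using T that by simp
  have cov: "S \<subseteq> (\<Union>y\<in>S. W y)" using T by auto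
  obtain F where F: "F \<subseteq> S" "finite F" "S \<subseteq> (\<Union>y\<in>F. W y)"
    using compactE_image[OF S(1), of S W, OF oW cov] .
  \<comment> \<open>The default values 1 and 0 cover an empty \<open>S\<close>; 0 is an admissible
    time.\<close>
  define \<delta> where "\<delta> = Min (insert 1 (\<Delta> ` F))"
  define t1 where "t1 = Max (insert 0 (T ` F))"
  have fin: "finite (insert 1 (\<Delta> ` F))" "finite (insert 0 (T ` F))" using F(2) by simp_all
  have "\<delta> > 0" unfolding \<delta>_def by (subst Min_gr_iff[OF fin(1)]) (use T F(1) in auto)
  moreover have "t1 \<in> I"
  proof -
    have "t1 \<in> insert 0 (T ` F)" unfolding t1_def by (rule Max_in[OF fin(2)]) simp
    then show ?thesis using T F(1) lam by auto
  qed
  moreover have "\<psi> t p \<le> \<Phi> y - \<delta>" if t: "t \<in> I" "t1 \<le> t" and y: "y \<in> S" "\<phi> t p = chart_inv c y" for t p y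
  proof -
    obtain x where x: "x \<in> F" "y \<in> W x" using F(3) y(1) by blast
    have "\<delta> \<le> \<Delta> x" unfolding \<delta>_def by (rule Min_le[OF fin(1)]) (use x in simp)
    moreover have "T x \<le> t1" unfolding t1_def by (rule Max_ge[OF fin(2)]) (use x in simp)
    moreover have "good (\<Delta> x) (T x) y" using T F(1) x by blast
    ultimately show ?thesis using t y(2) unfolding good_def by fastforce
  qed
  ultimately show ?thesis by (intro exI[of _ \<delta>] conjI bexI[of _ t1] ballI allI impI)
qed

text \<open>The upper half-relaxed limit is a viscosity subsolution of \<open>drift_laplacian f \<ge> H_norm2\<close>:
  a smooth \<open>\<Phi>\<close> with \<open>drift_laplacian \<Phi> \<le> H_norm2 - \<eta>\<close> that lies above it on a sphere also lies
  above it at the centre. Running the flow for a long time makes the initial values irrelevant, since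
  the term \<open>(\<eta>/2) \<sigma>\<close> is unbounded.\<close>

lemma comparison:
  assumes c: "c \<in> A" and \<rho>: "\<rho> > 0" "cball y0 \<rho> \<subseteq> chart_img c" and \<Phi>: "\<And>k. Ck_on k \<Phi> UNIV" and \<eta>: "\<eta> > 0"
    and sub: "\<And>y. y \<in> cball y0 \<rho> \<Longrightarrow> drift_laplacian c \<Phi> y \<le> H_norm2 (g c) (H c) y - \<eta>"
    and sph: "\<And>y. y \<in> sphere y0 \<rho> \<Longrightarrow> low (chart_inv c y) (\<Phi> y)"
  shows "low (chart_inv c y0) (\<Phi> y0)"
proof (rule ccontr)
  assume nlow: "\<not> low (chart_inv c y0) (\<Phi> y0)"
  have c\<Phi>: "continuous_on UNIV \<Phi>" by (rule Ck_on_imp_continuous_on[OF \<Phi>[of 0]])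
  have sphere_img: "sphere y0 \<rho> \<subseteq> chart_img c" using \<rho>(2) by auto
  obtain \<delta> t1 where \<delta>: "\<delta> > 0" and t1: "t1 \<in> I"
    and sl': "\<forall>t\<in>I. \<forall>p. \<forall>y\<in>sphere y0 \<rho>. t1 \<le> t \<longrightarrow> \<phi> t p = chart_inv c y \<longrightarrow> \<psi> t p \<le> \<Phi> y - \<delta>"
    using low_compact_fun[OF c compact_sphere sphere_img c\<Phi> sph] by blast
  obtain C where C: "\<forall>t\<in>I. \<forall>p. \<psi> t p \<le> C" using psi_bounded by blast
  have ne: "cball y0 \<rho> \<noteq> {}" using \<rho>(1) by simp
  obtain ym where ym: "\<forall>y\<in>cball y0 \<rho>. \<Phi> ym \<le> \<Phi> y"
    using continuous_attains_inf[OF compact_cball ne continuous_on_subset[OF c\<Phi>]] by blast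
  \<comment> \<open>Strictly below \<eta>, so that an interior maximum contradicts the hypothesis on
    \<Phi>, yet positive, so that late times are favoured.\<close>
  define \<kappa> where "\<kappa> = \<eta> / 2"
  have \<kappa>: "0 < \<kappa>" "\<kappa> < \<eta>" using \<eta> by (auto simp: \<kappa>_def)
  \<comment> \<open>The waiting time: over a rescaled time \<open>q\<close> the term
    \<open>\<kappa> * \<sigma>\<close> grows by more than an initial value of \<open>\<psi>\<close>
    minus \<Phi> could make up for.\<close>
  define q where "q = (\<bar>C\<bar> + \<bar>\<Phi> ym\<bar> + \<delta>) / \<kappa>"
  have q: "0 \<le> q" "\<kappa> * q = \<bar>C\<bar> + \<bar>\<Phi> ym\<bar> + \<delta>" using \<kappa> \<delta> by (auto simp: q_def)
  obtain t2 where t2: "t2 \<in> I" "t1 \<le> t2" "\<sigma> t2 = \<sigma> t1 + q" using sigma_unbounded[OF t1 q(1)] by blast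
  have y0: "y0 \<in> chart_img c" using \<rho> by auto
  have bimg: "ball y0 \<rho> \<subseteq> chart_img c" using \<rho>(2) by auto
  let ?B = "chart_inv c ` ball y0 \<rho>" and ?K = "chart_inv c ` cball y0 \<rho>"
  have B: "open ?B" by (rule open_chart_inv_image[OF c open_ball bimg])
  have "open (\<Phi> -` {..<\<Phi> y0 + \<delta> / 4})" by (rule open_vimage[OF open_lessThan c\<Phi>])
  then have oN: "open (ball y0 \<rho> \<inter> \<Phi> -` {..<\<Phi> y0 + \<delta> / 4})" (is "open ?N") by (rule open_Int[OF open_ball])
  have oU: "open (chart_inv c ` ?N)" by (rule open_chart_inv_image[OF c oN]) (use bimg in blast)
  \<comment> \<open>On the neighbourhood \<open>?N\<close> one has \<Phi> < \<Phi> y0 + \<delta>/4.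
    As \<open>low\<close> fails at the centre, some late point over \<open>?N\<close> has
    \<open>\<psi>\<close> above \<Phi> y0 - \<delta>/4, so there \<open>\<psi>\<close> exceeds
    \<Phi> - \<delta>/2.\<close>
  have "\<exists>t\<in>I. \<exists>p. t2 \<le> t \<and> \<phi> t p \<in> chart_inv c ` ?N \<and> \<not> \<psi> t p \<le> \<Phi> y0 - \<delta> / 4"
  proof (rule ccontr)
    assume no: "\<not> ?thesis"
    have "low (chart_inv c y0) (\<Phi> y0)"
      by (rule lowI[OF oU _ t2(1), where a' = "\<Phi> y0 - \<delta> / 4"]) (use \<rho> \<delta> no in auto)
    then show False using nlow by simp
  qed
  then obtain t3 p3 where t3: "t3 \<in> I" "t2 \<le> t3" and p3': "\<phi> t3 p3 \<in> chart_inv c ` ?N" "\<not> \<psi> t3 p3 \<le> \<Phi> y0 - \<delta> / 4"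
    by blast
  from p3'(1) obtain y3 where "\<phi> t3 p3 = chart_inv c y3" "y3 \<in> ?N" by (rule imageE)
  with p3'(2) have p3: "\<phi> t3 p3 = chart_inv c y3" "y3 \<in> ?N" "\<Phi> y0 - \<delta> / 4 < \<psi> t3 p3" by (simp_all add: not_le)
  have y3: "snd c (\<phi> t3 p3) = y3" using chart_inv_right[OF c, of y3] p3 bimg by auto
  let ?u = "\<lambda>x. (\<lambda>(t, p). \<psi> t p) x - \<Phi> (snd c ((\<lambda>(t, p). \<phi> t p) x)) + \<kappa> * \<sigma> (fst x)"
  let ?T = "{t1..t3}"
  have TI: "?T \<subseteq> I" using t1 t3 by auto
  have K: "compact ?K" by (intro compact_continuous_image continuous_on_subset[OF chart_inv_continuous[OF c] \<rho>(2)] compact_cball)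
  have Kdom: "?K \<subseteq> fst c" using chart_inv_in[OF c] \<rho>(2) by auto
  \<comment> \<open>The tube of space-time points carried by the flow into the closed coordinate
    ball; it is compact because the manifold is.\<close>
  let ?S = "(?T \<times> UNIV) \<inter> (\<lambda>(t, p). \<phi> t p) -` ?K"
  have "closed ?S"
    by (rule continuous_closed_preimage[OF continuous_on_subset[OF phi_continuous]])
      (use TI K in \<open>auto intro: closed_Times compact_imp_closed\<close>)
  then have "compact ((?T \<times> UNIV) \<inter> ?S)" by (intro compact_Int_closed compact_Times compact_M) auto
  then have S: "compact ?S" by (simp add: Int_assoc[symmetric])
  have x3: "(t3, p3) \<in> ?S" using t2 t3 p3 by auto
  have SI: "?S \<subseteq> I \<times> UNIV" using TI by auto
  have cu: "continuous_on ?S ?u"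
  proof (intro continuous_on_add continuous_on_diff continuous_on_mult continuous_on_const continuous_on_subset[OF psi_continuous SI])
    show "continuous_on ?S (\<lambda>x. \<sigma> (fst x))"
      by (rule continuous_on_compose2[OF sigma_continuous continuous_on_fst[OF continuous_on_id]]) (use SI in auto)
    have "continuous_on ?S (\<lambda>x. snd c ((\<lambda>(t, p). \<phi> t p) x))"
      by (rule continuous_on_compose2[OF chart_continuous[OF c] continuous_on_subset[OF phi_continuous SI]]) (use Kdom in auto)
    then show "continuous_on ?S (\<lambda>x. \<Phi> (snd c ((\<lambda>(t, p). \<phi> t p) x)))"
      by (rule continuous_on_compose2[OF c\<Phi>]) simp
  qed
  obtain xm where xm: "xm \<in> ?S" "\<forall>x\<in>?S. ?u x \<le> ?u xm"
    using continuous_attains_sup[OF S _ cu] x3 by blast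
  obtain t p where tp: "xm = (t, p)" by (cases xm)
  have tT: "t1 \<le> t" "t \<le> t3" and pK: "\<phi> t p \<in> ?K" using xm(1) tp by auto
  have tI: "t \<in> I" using tT TI by auto
  have max: "\<psi> s r - \<Phi> (snd c (\<phi> s r)) + \<kappa> * \<sigma> s \<le> \<psi> t p - \<Phi> (snd c (\<phi> t p)) + \<kappa> * \<sigma> t"
    if "t1 \<le> s" "s \<le> t3" "\<phi> s r \<in> ?K" for s r
  proof -
    have "(s, r) \<in> ?S" using that by auto
    from xm(2)[rule_format, OF this] show ?thesis by (simp add: tp)
  qed
  obtain y where y: "y \<in> cball y0 \<rho>" "\<phi> t p = chart_inv c y" using pK by auto
  have yc: "snd c (\<phi> t p) = y" using chart_inv_right[OF c, of y] y \<rho>(2) by auto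
  have s3: "\<kappa> * \<sigma> t \<le> \<kappa> * \<sigma> t3" using sigma_mono[OF tI t3(1) tT(2)] \<kappa> by simp
  \<comment> \<open>The maximum is at least the value at the late point \<open>(t3, p3)\<close>.
    This excludes first the sphere, where \<open>\<psi>\<close> is at most \<Phi> - \<delta>, and
    then the initial time.\<close>
  have big: "\<psi> t p - \<Phi> y + \<kappa> * \<sigma> t > - \<delta> / 2 + \<kappa> * \<sigma> t3"
    using max[of t3 p3] x3 p3(2,3) y3 yc tT by auto
  have ball: "y \<in> ball y0 \<rho>"
  proof (rule ccontr)
    assume "y \<notin> ball y0 \<rho>"
    then have "y \<in> sphere y0 \<rho>" using y(1) by auto
    then have "\<psi> t p \<le> \<Phi> y - \<delta>" using sl' tI tT(1) y(2) by blast
    then show False using big s3 \<delta> by linarith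
  qed
  have "t \<noteq> t1"
  proof
    assume "t = t1"
    then have "\<sigma> t = \<sigma> t1" by simp
    moreover have "\<kappa> * \<sigma> t2 = \<kappa> * \<sigma> t1 + (\<bar>C\<bar> + \<bar>\<Phi> ym\<bar> + \<delta>)" using t2(3) q(2) by (simp add: distrib_left)
    moreover have "\<kappa> * \<sigma> t2 \<le> \<kappa> * \<sigma> t3" using sigma_mono[OF t2(1) t3] \<kappa> by simp
    moreover have "\<psi> t p \<le> C" using C tI by blast
    moreover have "\<Phi> ym \<le> \<Phi> y" using ym y(1) by blast
    ultimately show False using big[unfolded \<open>\<sigma> t = \<sigma> t1\<close>] \<delta> abs_ge_self[of C] abs_ge_minus_self[of "\<Phi> ym"] by linarith
  qed
  then have t: "0 < t" "t1 < t" using tT(1) t1 by auto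
  have pB: "\<phi> t p \<in> ?B" using y(2) ball by blast
  have pdom: "\<phi> t p \<in> fst c" using pK Kdom by blast
  have BK: "?B \<subseteq> ?K" by auto
  have cs: "isCont (\<lambda>s. \<phi> s p) t"
  proof -
    have "continuous_on I (\<lambda>s. (\<lambda>(t, p). \<phi> t p) (s, p))"
      by (rule continuous_on_compose2[OF phi_continuous continuous_on_Pair[OF continuous_on_id continuous_on_const]]) auto
    then have "continuous (at t within I) (\<lambda>s. \<phi> s p)" using tI by (simp add: continuous_on_eq_continuous_within)
    then show ?thesis by (simp only: at_within_I[OF t(1) tI])
  qed
  have "((\<lambda>s. \<phi> s p) \<longlongrightarrow> \<phi> t p) (nhds t)"
    using cs tendsto_at_iff_tendsto_nhds[of "\<lambda>s. \<phi> s p" t] unfolding isCont_def by simp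
  from topological_tendstoD[OF this B pB] obtain d0 where d0: "d0 > 0" "\<And>s. dist s t < d0 \<Longrightarrow> \<phi> s p \<in> ?B"
    unfolding eventually_nhds_metric by blast
  \<comment> \<open>Only times before \<open>t\<close> are looked at, so nothing is required of the
    other end and \<open>t = t3\<close> is allowed.\<close>
  define d where "d = min d0 (t - t1)"
  have d: "d > 0" using d0 t by (simp add: d_def)
  let ?N' = "(\<phi> t) -` ?B"
  have "continuous_on UNIV (\<phi> t)" using diffeo_phi[OF tI] unfolding diffeo_def smooth_map_def by blast
  then have oN': "open ?N'" using open_vimage[OF B] by blast
  have "H_norm2 (g c) (H c) (snd c (\<phi> t p)) - \<kappa> \<le> drift_laplacian c \<Phi> (snd c (\<phi> t p))"
  proof (rule interior_max[OF t(1) tI c pdom \<Phi> d _ oN'])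
    show "p \<in> ?N'" using pB by simp
    show "\<psi> s p - \<Phi> (snd c (\<phi> s p)) + \<kappa> * \<sigma> s \<le> \<psi> t p - \<Phi> (snd c (\<phi> t p)) + \<kappa> * \<sigma> t"
      if "t - d < s" "s < t" for s
    proof (rule max)
      show "t1 \<le> s" "s \<le> t3" using that tT by (auto simp: d_def)
      have "dist s t < d0" using that by (simp add: d_def dist_real_def)
      then show "\<phi> s p \<in> ?K" using d0(2) BK by blast
    qed
    show "\<psi> t r - \<Phi> (snd c (\<phi> t r)) \<le> \<psi> t p - \<Phi> (snd c (\<phi> t p))" if "r \<in> ?N'" for r
      using max[of t r] that tT BK by auto
  qed
  then show False using sub[OF y(1)] \<kappa> by (simp add: yc)
qed

section \<open>Barriers and Hopf's argument\<close>

lemma drift_laplacian_affine: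
  assumes f: "Ck_on (Suc (Suc 0)) f UNIV"
  shows "drift_laplacian c (\<lambda>z. a + b * f z) y = b * drift_laplacian c f y"
proof -
  have fd: "f differentiable (at z)" for z using f by simp
  have p1: "pd k (\<lambda>z. a + b * f z) z = b * pd k f z" for k z
    using pd_add[of "\<lambda>z. a" z "\<lambda>z. b * f z" k] pd_cmult[OF fd, of k b z] fd by simp
  have p2: "pd i (pd j (\<lambda>z. a + b * f z)) z = b * pd i (pd j f) z" for i j z
  proof -
    have "pd j f differentiable (at z)" using Ck_on_pd[OF f, of j] by simp
    from pd_cmult[OF this, of i b] show ?thesis unfolding p1[abs_def] .
  qed
  have e: "b * pd i (pd j f) y - (\<Sum>k\<in>UNIV. christoffel (g c) k i j y * (b * pd k f y)) =
    b * (pd i (pd j f) y - (\<Sum>k\<in>UNIV. christoffel (g c) k i j y * pd k f y))" for i j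
    by (simp add: right_diff_distrib sum_distrib_left mult_ac)
  have x: "(\<Sum>k\<in>UNIV. X c y $ k * (b * pd k f y)) = b * (\<Sum>k\<in>UNIV. X c y $ k * pd k f y)"
    by (simp add: sum_distrib_left mult_ac)
  show ?thesis
    unfolding drift_laplacian_def laplacian_def p1 p2 e x
    by (simp add: right_diff_distrib sum_distrib_left mult_ac)
qed

text \<open>Two derivatives of the Gaussian give a positive term quadratic in \<alpha>, whereas the
  trace, Christoffel and drift terms are only linear in \<alpha>, so a large \<alpha> wins.
  Ellipticity enters as \<open>Q > 0\<close>, which needs \<open>y \<noteq> w\<close>.\<close>

lemma barrier_exists:
  assumes c: "c \<in> A" and y: "y \<in> chart_img c" and w: "y \<noteq> w"
  shows "\<exists>\<alpha>>0. 0 < drift_laplacian c (\<lambda>z. exp (- \<alpha> * ((z - w) \<bullet> (z - w)))) y"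
proof -
  interpret m: metric_at "g c" y by (rule metric_at_chart[OF c y])
  let ?d = "y - w"
  define Q where "Q = (\<Sum>i\<in>UNIV. \<Sum>j\<in>UNIV. ginv (g c) y i j * ?d $ i * ?d $ j)"
  define tr where "tr = (\<Sum>i\<in>UNIV. ginv (g c) y i i)"
  define ga where "ga = (\<Sum>i\<in>UNIV. \<Sum>j\<in>UNIV. ginv (g c) y i j * (\<Sum>k\<in>UNIV. christoffel (g c) k i j y * ?d $ k))"
  define xd where "xd = (\<Sum>k\<in>UNIV. X c y $ k * ?d $ k)"
  \<comment> \<open>Everything that is linear in \<alpha>. The operator applied to the Gaussian
    equals 2\<alpha> (2\<alpha> Q - R) E, with E the value of the Gaussian at
    \<open>y\<close>.\<close>
  define R where "R = tr - ga - xd"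
  have Q: "Q > 0" unfolding Q_def by (rule m.ginv_pos) (use w in simp)
  \<comment> \<open>Makes 2\<alpha> Q - R equal to 2|R| + 2 - R, which is positive whatever the sign
    of R.\<close>
  define \<alpha> where "\<alpha> = (\<bar>R\<bar> + 1) / Q"
  have \<alpha>: "\<alpha> > 0" "\<alpha> * Q = \<bar>R\<bar> + 1" using Q by (auto simp: \<alpha>_def)
  define E where "E = exp (- \<alpha> * (?d \<bullet> ?d))"
  have 1: "(\<Sum>i\<in>UNIV. \<Sum>j\<in>UNIV. ginv (g c) y i j * ((4 * \<alpha>\<^sup>2 * ?d $ i * ?d $ j - (if i = j then 2 * \<alpha> else 0)) * E)) =
      (4 * \<alpha>\<^sup>2 * Q - 2 * \<alpha> * tr) * E"
  proof -
    have "(\<Sum>i\<in>UNIV. \<Sum>j\<in>UNIV. ginv (g c) y i j * ((4 * \<alpha>\<^sup>2 * ?d $ i * ?d $ j - (if i = j then 2 * \<alpha> else 0)) * E)) =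
      (\<Sum>i\<in>UNIV. \<Sum>j\<in>UNIV. 4 * \<alpha>\<^sup>2 * E * (ginv (g c) y i j * ?d $ i * ?d $ j) - (if i = j then 2 * \<alpha> * E * ginv (g c) y i j else 0))"
      by (intro sum.cong refl) (simp add: algebra_simps)
    also have "\<dots> = 4 * \<alpha>\<^sup>2 * E * Q - 2 * \<alpha> * E * tr"
      by (simp add: sum_subtractf sum_distrib_left Q_def tr_def)
    finally show ?thesis by (simp add: algebra_simps)
  qed
  have 2: "(\<Sum>i\<in>UNIV. \<Sum>j\<in>UNIV. ginv (g c) y i j * (\<Sum>k\<in>UNIV. christoffel (g c) k i j y * (-2 * \<alpha> * ?d $ k * E))) =
    - (2 * \<alpha> * E * ga)"
    unfolding ga_def by (simp add: sum_distrib_left sum_negf mult_ac)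
  have 3: "(\<Sum>k\<in>UNIV. X c y $ k * (-2 * \<alpha> * ?d $ k * E)) = - (2 * \<alpha> * E * xd)"
    unfolding xd_def by (simp add: sum_distrib_left sum_negf mult_ac)
  have "drift_laplacian c (\<lambda>z. exp (- \<alpha> * ((z - w) \<bullet> (z - w)))) y = (4 * \<alpha>\<^sup>2 * Q - 2 * \<alpha> * R) * E"
    unfolding drift_laplacian_def laplacian_def pd_gauss pd_pd_gauss E_def[symmetric]
    by (simp only: right_diff_distrib[of "ginv (g c) y _ _"] sum_subtractf 1 2 3) (simp add: R_def algebra_simps)
  also have "4 * \<alpha>\<^sup>2 * Q - 2 * \<alpha> * R = 2 * \<alpha> * (2 * (\<alpha> * Q) - R)" by (simp add: power2_eq_square algebra_simps)
  finally have "drift_laplacian c (\<lambda>z. exp (- \<alpha> * ((z - w) \<bullet> (z - w)))) y = 2 * \<alpha> * (2 * (\<bar>R\<bar> + 1) - R) * E"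
    by (simp only: \<alpha>(2))
  moreover have "0 < 2 * \<alpha> * (2 * (\<bar>R\<bar> + 1) - R) * E" using \<alpha>(1) by (simp add: E_def)
  ultimately show ?thesis using \<alpha>(1) by auto
qed

end

context soliton_flow
begin

lemma ball_where_greater:
  fixes f :: "real ^ 'n \<Rightarrow> real"
  assumes c: "c \<in> A" and f: "continuous_on (chart_img c) f" and y: "y \<in> chart_img c" "a < f y"
  shows "\<exists>\<rho>>0. cball y \<rho> \<subseteq> chart_img c \<and> (\<forall>z\<in>cball y \<rho>. a < f z)"
proof -
  have "open (chart_img c \<inter> f -` {a<..})"
    by (rule continuous_open_preimage[OF f open_chart_img[OF c] open_greaterThan])
  moreover have "y \<in> chart_img c \<inter> f -` {a<..}" using y by simp
  ultimately obtain \<rho> where "\<rho> > 0" "cball y \<rho> \<subseteq> chart_img c \<inter> f -` {a<..}"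
    using open_contains_cball by blast
  then show ?thesis by (intro exI[of _ \<rho>]) auto
qed

lemma open_low_chart: "c \<in> A \<Longrightarrow> open (chart_img c \<inter> chart_inv c -` {x. low x a})"
  by (rule continuous_open_preimage[OF chart_inv_continuous open_chart_img open_low])

text \<open>Hopf's argument: at a boundary point of the set where the half-relaxed limit attains its
  maximum \<open>m\<close> one compares with a strict subsolution vanishing on an interior sphere.\<close>

lemma max_set_open:
  assumes c: "c \<in> A" and r: "r > 0" "ball y0 (4 * r) \<subseteq> chart_img c"
    and le: "\<And>y a. y \<in> ball y0 (4 * r) \<Longrightarrow> m < a \<Longrightarrow> low (chart_inv c y) a"
    and y0: "\<not> low (chart_inv c y0) m" and y1: "y1 \<in> ball y0 r"
  shows "\<not> low (chart_inv c y1) m"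
proof
  assume l1: "low (chart_inv c y1) m"
  \<comment> \<open>The points of the closed ball where the limit is at least \<open>m\<close>.
    Radii: the point of \<open>S\<close> nearest to \<open>y1\<close> is less than
    \<open>2 * r\<close> away from \<open>y0\<close>, and a ball of radius at most \<open>r\<close>
    around it remains in the ball of radius \<open>4 * r\<close>.\<close>
  define S where "S = cball y0 (2 * r) - (chart_img c \<inter> chart_inv c -` {x. low x m})"
  have sub: "cball y0 (2 * r) \<subseteq> ball y0 (4 * r)" using r(1) by auto
  have S: "compact S" unfolding S_def by (rule compact_diff[OF compact_cball open_low_chart[OF c]])
  have y0S: "y0 \<in> S" using r(1) y0 by (simp add: S_def)
  then have Sne: "S \<noteq> {}" by blast
  obtain y2 where y2: "y2 \<in> S" "\<And>y. y \<in> S \<Longrightarrow> dist y1 y2 \<le> dist y1 y"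
    using distance_attains_inf[OF compact_imp_closed[OF S] Sne, of y1] by blast
  define d where "d = dist y1 y2"
  have "d \<le> dist y1 y0" using y2(2)[OF y0S] by (simp add: d_def)
  then have dr: "d < r" using y1 by (simp add: dist_commute)
  have y2b: "y2 \<in> cball y0 (2 * r)" using y2(1) by (simp add: S_def)
  then have y2c: "y2 \<in> chart_img c" using sub r(2) by blast
  have y2n: "\<not> low (chart_inv c y2) m" using y2(1) y2c by (simp add: S_def)
  have d0: "d > 0" using l1 y2n unfolding d_def by auto
  have y02: "dist y0 y2 < 2 * r"
    using dist_triangle[of y0 y2 y1] y1 dr by (simp add: d_def)
  have lowin: "low (chart_inv c y) m" if "dist y1 y < d" for y
  proof (rule ccontr)
    assume n: "\<not> ?thesis"
    have "dist y0 y \<le> 2 * r" using dist_triangle[of y0 y y1] y1 dr that by simp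
    then have "y \<in> S" using n by (simp add: S_def)
    from y2(2)[OF this] show False using that by (simp add: d_def)
  qed
  \<comment> \<open>The midpoint: the closed ball around \<open>w\<close> through \<open>y2\<close>
    touches the boundary of the ball around \<open>y1\<close> in \<open>y2\<close> alone, so the
    limit is below \<open>m\<close> everywhere else on it.\<close>
  define w where "w = (1/2) *\<^sub>R (y1 + y2)"
  have strict: "dist y1 y < d" if le: "(y - w) \<bullet> (y - w) \<le> (y2 - w) \<bullet> (y2 - w)" and ne: "y \<noteq> y2" for y
  proof -
    define p where "p = y - y1"
    define q where "q = y2 - y1"
    have yw: "y - w = p - (1/2) *\<^sub>R q" "y2 - w = (1/2) *\<^sub>R q"
      unfolding p_def q_def w_def by (simp_all add: vec_eq_iff field_simps)
    have "p \<bullet> p \<le> p \<bullet> q" using le unfolding yw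
      by (simp add: inner_diff_left inner_diff_right inner_commute algebra_simps)
    moreover have "(p - q) \<bullet> (p - q) = p \<bullet> p - 2 * (p \<bullet> q) + q \<bullet> q"
      by (simp add: inner_diff_left inner_diff_right inner_commute algebra_simps)
    moreover have "0 < (p - q) \<bullet> (p - q)" using ne by (simp add: p_def q_def)
    ultimately have "p \<bullet> p < q \<bullet> q" by linarith
    then have "norm p < norm q" by (simp add: norm_eq_sqrt_inner)
    then show ?thesis by (simp add: p_def q_def d_def dist_norm norm_minus_commute)
  qed
  have y2w: "y2 \<noteq> w"
  proof
    assume "y2 = w"
    then have "y2 = y1" unfolding w_def by (simp add: vec_eq_iff field_simps)
    then show False using d0 by (simp add: d_def)
  qed
  obtain \<alpha> where \<alpha>: "\<alpha> > 0" "0 < drift_laplacian c (\<lambda>z. exp (- \<alpha> * ((z - w) \<bullet> (z - w)))) y2"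
    using barrier_exists[OF c y2c y2w] by blast
  let ?v = "\<lambda>z. exp (- \<alpha> * ((z - w) \<bullet> (z - w)))"
  define \<kappa> where "\<kappa> = drift_laplacian c ?v y2 / 2"
  have \<kappa>: "\<kappa> > 0" "\<kappa> < drift_laplacian c ?v y2" using \<alpha> by (auto simp: \<kappa>_def)
  obtain \<rho>1 where \<rho>1: "\<rho>1 > 0" "cball y2 \<rho>1 \<subseteq> chart_img c" "\<forall>z\<in>cball y2 \<rho>1. \<kappa> < drift_laplacian c ?v z"
    using ball_where_greater[OF c continuous_drift_laplacian[OF c Ck_on_gauss] y2c \<kappa>(2)] by blast
  define \<rho> where "\<rho> = min \<rho>1 r"
  have \<rho>: "\<rho> > 0" "\<rho> \<le> \<rho>1" "\<rho> \<le> r" using \<rho>1 r by (auto simp: \<rho>_def)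
  have near: "y \<in> ball y0 (4 * r)" if "y \<in> cball y2 \<rho>" for y
    using dist_triangle[of y0 y y2] y02 that \<rho> r(1) by auto
  \<comment> \<open>The part of the small sphere inside the ball around \<open>w\<close>. It is
    compact and the limit is below \<open>m\<close> on it, hence below some
    \<open>b < m\<close>.\<close>
  let ?T = "chart_inv c ` (sphere y2 \<rho> \<inter> {y. (y - w) \<bullet> (y - w) \<le> (y2 - w) \<bullet> (y2 - w)})"
  have "closed {y. (y - w) \<bullet> (y - w) \<le> (y2 - w) \<bullet> (y2 - w)}"
    by (intro closed_Collect_le continuous_intros)
  then have "compact (sphere y2 \<rho> \<inter> {y. (y - w) \<bullet> (y - w) \<le> (y2 - w) \<bullet> (y2 - w)})"
    by (intro compact_Int_closed compact_sphere)
  moreover have "sphere y2 \<rho> \<subseteq> chart_img c" using \<rho> \<rho>1(2) by auto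
  ultimately have T: "compact ?T"
    by (intro compact_continuous_image continuous_on_subset[OF chart_inv_continuous[OF c]]) auto
  have Tlow: "low x m" if xT: "x \<in> ?T" for x
  proof -
    obtain y where y: "x = chart_inv c y" "y \<in> sphere y2 \<rho>" "(y - w) \<bullet> (y - w) \<le> (y2 - w) \<bullet> (y2 - w)"
      using xT by blast
    have "y \<noteq> y2" using y(2) \<rho>(1) by auto
    then show ?thesis using lowin[OF strict[OF y(3)]] y(1) by simp
  qed
  obtain b where b: "b < m" "\<forall>x\<in>?T. low x b"
  proof (cases "?T = {}")
    \<comment> \<open>The small sphere may miss the ball around \<open>w\<close>; then any value
      below \<open>m\<close> does.\<close>
    case True
    have "m - 1 < m" by simp
    then show ?thesis using that[of "m - 1"] True by blast
  next
    case False
    then show ?thesis using low_compact[OF T False Tlow] that by blast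
  qed
  define \<epsilon> where "\<epsilon> = m - b"
  have \<epsilon>: "\<epsilon> > 0" using b by (simp add: \<epsilon>_def)
  \<comment> \<open>Equals \<open>m\<close> at the contact point \<open>y2\<close>, so comparison
    yields the contradiction. On \<open>?T\<close> it is at least m - \<epsilon> = b because the
    Gaussian is at most 1; on the rest of the sphere the Gaussian is smaller than at
    \<open>y2\<close>, so \<open>?\<Phi>\<close> exceeds \<open>m\<close>.\<close>
  let ?\<Phi> = "\<lambda>z. (m + \<epsilon> * ?v y2) + (- \<epsilon>) * ?v z"
  have "low (chart_inv c y2) (?\<Phi> y2)"
  proof (rule comparison[OF c \<rho>(1), where \<Phi> = ?\<Phi> and \<eta> = "\<epsilon> * \<kappa>"])
    show "cball y2 \<rho> \<subseteq> chart_img c" using \<rho>1(2) \<rho>(2) by auto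
    show "Ck_on k ?\<Phi> UNIV" for k
      by (rule Ck_on_add[OF open_UNIV Ck_on_const Ck_on_mult[OF open_UNIV Ck_on_const Ck_on_gauss]])
    show "\<epsilon> * \<kappa> > 0" using \<epsilon> \<kappa> by simp
    show "drift_laplacian c ?\<Phi> y \<le> H_norm2 (g c) (H c) y - \<epsilon> * \<kappa>" if "y \<in> cball y2 \<rho>" for y
    proof -
      have y: "y \<in> cball y2 \<rho>1" using that \<rho>(2) by auto
      have "drift_laplacian c ?\<Phi> y = - \<epsilon> * drift_laplacian c ?v y"
        by (rule drift_laplacian_affine[OF Ck_on_gauss])
      also have "\<dots> \<le> - \<epsilon> * \<kappa>" using \<rho>1(3) y \<epsilon> by (simp add: less_imp_le)
      also have "\<dots> \<le> H_norm2 (g c) (H c) y - \<epsilon> * \<kappa>" using H_norm2_chart_nonneg[OF c, of y] \<rho>1(2) y by auto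
      finally show ?thesis .
    qed
    show "low (chart_inv c y) (?\<Phi> y)" if ys: "y \<in> sphere y2 \<rho>" for y
    proof (cases "(y - w) \<bullet> (y - w) \<le> (y2 - w) \<bullet> (y2 - w)")
      case True
      have "low (chart_inv c y) b" using b(2) ys True by blast
      moreover have "b \<le> ?\<Phi> y"
      proof -
        have "?v y \<le> 1" using \<alpha>(1) by simp
        then have "\<epsilon> * ?v y \<le> \<epsilon> * 1" using \<epsilon> by (intro mult_left_mono) auto
        moreover have "0 \<le> \<epsilon> * ?v y2" using \<epsilon> by simp
        moreover have "b = m - \<epsilon>" by (simp add: \<epsilon>_def)
        ultimately show ?thesis unfolding mult_minus_left by linarith
      qed
      ultimately show ?thesis by (rule low_mono)
    next
      case False
      then have "\<alpha> * ((y2 - w) \<bullet> (y2 - w)) < \<alpha> * ((y - w) \<bullet> (y - w))" using \<alpha>(1) by (intro mult_strict_left_mono) auto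
      then have "?v y < ?v y2" by simp
      then have "\<epsilon> * ?v y < \<epsilon> * ?v y2" using \<epsilon> by (rule mult_strict_left_mono)
      then have "m < ?\<Phi> y" by simp
      then show ?thesis using le near ys by auto
    qed
  qed
  then show False using y2n by simp
qed

section \<open>Vanishing of H\<close>

text \<open>On the component of the given point the limit attains its maximum \<open>m\<close>, and
  by \<open>max_set_open\<close> it equals \<open>m\<close> throughout. If the norm of the form were
  positive at the point, a small upward paraboloid with vertex value \<open>m\<close> would be an
  admissible test function lying above the constant on a sphere, and comparison would push the limit
  below \<open>m\<close> at the vertex.\<close>

lemma H_norm2_vanishes:
  assumes c1: "c1 \<in> A" and z1: "z1 \<in> chart_img c1"
  shows "H_norm2 (g c1) (H c1) z1 \<le> 0"
proof (rule ccontr)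
  assume "\<not> ?thesis"
  then have hpos: "0 < H_norm2 (g c1) (H c1) z1" by simp
  define x1 where "x1 = chart_inv c1 z1"
  let ?C = "connected_component_set UNIV x1"
  have x1C: "x1 \<in> ?C" by (simp add: connected_component_refl)
  have C: "connected ?C" "closed ?C" by (simp_all add: connected_connected_component closed_connected_component)
  have "compact (UNIV \<inter> ?C)" by (rule compact_Int_closed[OF compact_M C(2)])
  then have cC: "compact ?C" by simp
  \<comment> \<open>A coordinate ball is connected, so it lies in the component as soon as its
    centre does; components of a manifold are therefore open.\<close>
  have ballC: "chart_inv c ` ball y r \<subseteq> ?C"
    if c: "c \<in> A" "ball y r \<subseteq> chart_img c" "r > 0" and y: "chart_inv c y \<in> ?C" for c y r
  proof -
    have "connected (chart_inv c ` ball y r)"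
      by (intro connected_continuous_image continuous_on_subset[OF chart_inv_continuous[OF c(1)] c(2)] connected_ball)
    moreover have "chart_inv c y \<in> chart_inv c ` ball y r" using c(3) by simp
    ultimately have "chart_inv c ` ball y r \<subseteq> connected_component_set UNIV (chart_inv c y)"
      by (intro connected_component_maximal) auto
    then show ?thesis using connected_component_eq[OF y] by simp
  qed
  let ?L = "{a. \<forall>x\<in>?C. low x a}"
  \<comment> \<open>The supremum of the half-relaxed limit over the component, expressed through its
    strict upper bounds: these exist since \<open>\<psi>\<close> is bounded above, and are positive
    since \<open>\<psi>\<close> is nonnegative.\<close>
  define m where "m = Inf ?L"
  obtain C0 where C0: "\<forall>t\<in>I. \<forall>p. \<psi> t p \<le> C0" using psi_bounded by blast
  have I0: "0 \<in> I" using lam by simp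
  have "low x (C0 + 1)" for x
    by (rule lowI[OF open_UNIV UNIV_I I0, where a' = C0]) (use C0 in auto)
  then have Lne: "C0 + 1 \<in> ?L" by simp
  have bdd: "bdd_below ?L"
  proof (rule bdd_belowI[where m = 0])
    fix a assume "a \<in> ?L"
    then have "low x1 a" using x1C by blast
    then show "0 \<le> a" using low_pos[of x1 a] by simp
  qed
  have above: "low x a" if x: "x \<in> ?C" and a: "m < a" for x a
  proof -
    obtain b where b: "b \<in> ?L" "b < a" using cInf_lessD[of ?L a] Lne a unfolding m_def by blast
    then have "low x b" using x by blast
    then show ?thesis by (rule low_mono) (use b in simp)
  qed
  let ?Z = "{x \<in> ?C. \<not> low x m}"
  \<comment> \<open>The supremum is attained: otherwise \<open>low_compact\<close> would provide a
    smaller upper bound on the compact component.\<close>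
  have Zne: "?Z \<noteq> {}"
  proof
    assume "?Z = {}"
    then have "low x m" if "x \<in> ?C" for x using that by blast
    from low_compact[OF cC _ this] x1C obtain b where b: "b < m" "\<forall>x\<in>?C. low x b" by blast
    then have "b \<in> ?L" by blast
    then have "m \<le> b" unfolding m_def by (rule cInf_lower[OF _ bdd])
    then show False using b by simp
  qed
  have Zclosed: "closed ?Z"
  proof -
    have "?Z = ?C \<inter> - {x. low x m}" by blast
    then show ?thesis using C(2) open_low by (simp add: closed_Int closed_Compl)
  qed
  have Zopen: "open ?Z"
  proof (subst open_subopen, rule ballI)
    fix x assume x: "x \<in> ?Z"
    obtain c where c: "c \<in> A" "x \<in> fst c" using chart_exists by blast
    let ?y = "snd c x"
    have y: "?y \<in> chart_img c" "chart_inv c ?y = x" using chart_in[OF c(2)] chart_inv_left[OF c] by simp_all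
    obtain R where R: "R > 0" "ball ?y R \<subseteq> chart_img c" using open_chart_img[OF c(1)] y(1) open_contains_ball by blast
    define r where "r = R / 4"
    have r: "r > 0" "ball ?y (4 * r) \<subseteq> chart_img c" using R by (auto simp: r_def)
    have r4: "4 * r > 0" using r(1) by simp
    have yC: "chart_inv c ?y \<in> ?C" using x y(2) by simp
    have bC: "chart_inv c ` ball ?y (4 * r) \<subseteq> ?C" by (rule ballC[OF c(1) r(2) r4 yC])
    have sub: "ball ?y r \<subseteq> ball ?y (4 * r)" using r(1) by auto
    have "chart_inv c ` ball ?y r \<subseteq> ?Z"
    proof
      fix x' assume "x' \<in> chart_inv c ` ball ?y r"
      then obtain y' where y': "x' = chart_inv c y'" "y' \<in> ball ?y r" by blast
      have "\<not> low (chart_inv c y') m"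
      proof (rule max_set_open[OF c(1) r _ _ y'(2)])
        show "low (chart_inv c y) a" if "y \<in> ball ?y (4 * r)" "m < a" for y a
          using above[OF _ that(2)] bC that(1) by blast
        show "\<not> low (chart_inv c ?y) m" using x y(2) by simp
      qed
      moreover have "x' \<in> ?C" using y' bC sub by blast
      ultimately show "x' \<in> ?Z" using y' by simp
    qed
    moreover have "open (chart_inv c ` ball ?y r)"
      by (rule open_chart_inv_image[OF c(1) open_ball]) (use sub r(2) in blast)
    moreover have "x \<in> chart_inv c ` ball ?y r" using r(1) y(2) by (intro image_eqI[where x = ?y]) simp_all
    ultimately show "\<exists>T. open T \<and> x \<in> T \<and> T \<subseteq> ?Z" by blast
  qed
  \<comment> \<open>The maximum set is open and closed in the connected component and not empty, so
    it contains the given point.\<close>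
  have "?Z \<inter> ?C = {} \<or> (- ?Z) \<inter> ?C = {}"
    by (rule connectedD[OF C(1) Zopen]) (use Zclosed in auto)
  then have x1Z: "\<not> low x1 m" using Zne x1C by blast
  define \<eta> where "\<eta> = H_norm2 (g c1) (H c1) z1 / 2"
  have \<eta>: "\<eta> > 0" "\<eta> < H_norm2 (g c1) (H c1) z1" using hpos by (auto simp: \<eta>_def)
  let ?q = "\<lambda>z. (z - z1) \<bullet> (z - z1)"
  define B where "B = \<bar>drift_laplacian c1 ?q z1\<bar> + 1"
  have cq: "continuous_on (chart_img c1) (\<lambda>z. - drift_laplacian c1 ?q z)"
    by (intro continuous_on_minus continuous_drift_laplacian[OF c1 Ck_on_q])
  have Bq: "- B < - drift_laplacian c1 ?q z1" by (simp add: B_def)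
  obtain \<rho>1 where \<rho>1: "\<rho>1 > 0" "cball z1 \<rho>1 \<subseteq> chart_img c1" "\<forall>z\<in>cball z1 \<rho>1. \<eta> < H_norm2 (g c1) (H c1) z"
    using ball_where_greater[OF c1 continuous_H_norm2[OF c1] z1 \<eta>(2)] by blast
  obtain \<rho>2 where \<rho>2: "\<rho>2 > 0" "\<forall>z\<in>cball z1 \<rho>2. - B < - drift_laplacian c1 ?q z"
    using ball_where_greater[OF c1 cq z1 Bq] by blast
  define \<rho> where "\<rho> = min \<rho>1 \<rho>2 / 2"
  have \<rho>: "\<rho> > 0" "\<rho> < \<rho>1" "\<rho> < \<rho>2" using \<rho>1(1) \<rho>2(1) by (auto simp: \<rho>_def)
  \<comment> \<open>The paraboloid is so flat that the operator applied to it is at most \<eta>/2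
    near the point, while the norm of the form exceeds \<eta> there.\<close>
  define \<epsilon> where "\<epsilon> = \<eta> / (2 * B)"
  have B: "B > 0" by (simp add: B_def)
  have \<epsilon>: "\<epsilon> > 0" "\<epsilon> * B = \<eta> / 2" using \<eta> B by (auto simp: \<epsilon>_def)
  have "low (chart_inv c1 z1) (m + \<epsilon> * ?q z1)"
  proof (rule comparison[OF c1 \<rho>(1), where \<Phi> = "\<lambda>z. m + \<epsilon> * ?q z" and \<eta> = "\<eta> / 2"])
    show "cball z1 \<rho> \<subseteq> chart_img c1" using \<rho>1(2) \<rho>(2) by auto
    show "Ck_on k (\<lambda>z. m + \<epsilon> * ?q z) UNIV" for k
      by (rule Ck_on_add[OF open_UNIV Ck_on_const Ck_on_mult[OF open_UNIV Ck_on_const Ck_on_q]])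
    show "\<eta> / 2 > 0" using \<eta> by simp
    show "drift_laplacian c1 (\<lambda>z. m + \<epsilon> * ?q z) y \<le> H_norm2 (g c1) (H c1) y - \<eta> / 2" if "y \<in> cball z1 \<rho>" for y
    proof -
      have y: "y \<in> cball z1 \<rho>1" "y \<in> cball z1 \<rho>2" using that \<rho> by auto
      have "drift_laplacian c1 (\<lambda>z. m + \<epsilon> * ?q z) y = \<epsilon> * drift_laplacian c1 ?q y"
        by (rule drift_laplacian_affine[OF Ck_on_q])
      also have "\<dots> \<le> \<epsilon> * B"
        using bspec[OF \<rho>2(2) y(2)] \<epsilon>(1) by (intro mult_left_mono) simp_all
      also have "\<dots> \<le> H_norm2 (g c1) (H c1) y - \<eta> / 2" using \<rho>1(3) y(1) unfolding \<epsilon>(2) by fastforce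
      finally show ?thesis .
    qed
    show "low (chart_inv c1 y) (m + \<epsilon> * ?q y)" if "y \<in> sphere z1 \<rho>" for y
    proof (rule above)
      have "ball z1 \<rho>1 \<subseteq> chart_img c1" using \<rho>1(2) by auto
      then have "chart_inv c1 ` ball z1 \<rho>1 \<subseteq> ?C" using ballC[OF c1 _ \<rho>1(1)] x1C x1_def by blast
      moreover have "y \<in> ball z1 \<rho>1" using that \<rho> by simp
      ultimately show "chart_inv c1 y \<in> ?C" by blast
      have "y \<noteq> z1" using that \<rho>(1) by auto
      then show "m < m + \<epsilon> * ?q y" using \<epsilon>(1) by simp
    qed
  qed
  then show False using x1Z by (simp add: x1_def)
qed

lemma H_vanishes: "tensor_eq A 3 H (\<lambda>c y is. 0)"
  unfolding tensor_eq_def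
proof (intro ballI allI impI)
  fix c y "is" assume c: "c \<in> A" "y \<in> chart_img c" and "length (is :: 'n list) = 3"
  then obtain i p k where "is = [i, p, k]"
    by (auto simp: numeral_3_eq_3 length_Suc_conv)
  then show "H c y is = 0"
    using metric_at.H_norm2_eq_0[OF metric_at_chart[OF c] H_norm2_vanishes[OF c]] by simp
qed

end

section \<open>The converse and the equivalence\<close>

lemma (in smooth_manifold) pullback_zero:
  assumes "tensor_eq A k T (\<lambda>c y is. 0)" "length is = k"
  shows "pullback A f T c y is = 0"
proof -
  define c' where "c' = chart_at A (f (chart_inv c y))"
  have "c' \<in> A" "f (chart_inv c y) \<in> fst c'" using chart_at unfolding c'_def by blast+
  then have "T c' (snd c' (f (chart_inv c y))) js = 0" if "length js = k" for js
    using assms(1) chart_in[of "f (chart_inv c y)" c'] that unfolding tensor_eq_def by blast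
  then show ?thesis
    unfolding pullback_def Let_def c'_def[symmetric] comp_pullback_def
    using assms(2) by (intro sum.neutral) auto
qed

lemma (in smooth_manifold) zero_torsion_bounding_function:
  assumes H: "tensor_eq A 3 H (\<lambda>c y is. 0)"
  shows "torsion_bounding_function A {0..<b} G (\<lambda>t c y is. \<tau> t * pullback A (\<phi> t) H c y is) (\<lambda>t p. 0)"
  unfolding torsion_bounding_function_def
proof (intro conjI ballI allI)
  show "smooth_on ({0..<b} \<times> chart_img c) (\<lambda>(t, y). 0 :: real)" for c
    unfolding smooth_on_def by (intro ballI exI[of _ UNIV] exI[of _ "\<lambda>x. 0"]) auto
  fix t c y assume t: "t \<in> {0..<b}" and c: "c \<in> A" and y: "y \<in> chart_img c"
  \<comment> \<open>A derivative within a set is determined only at points that are not isolated.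
    The half-open interval contains \<open>t\<close> and also the midpoint between \<open>t\<close>
    and \<open>b\<close>, so it is not a single point, and connectedness makes it perfect.\<close>
  have "{0..<b} \<noteq> {a}" for a
  proof
    assume e: "{0..<b} = {a}"
    have "t \<in> {a}" "(t + b) / 2 \<in> {a}" using t unfolding e[symmetric] by auto
    then show False using t by simp
  qed
  then have "t islimpt {0..<b}"
    using connected_imp_perfect[OF connected_Ico, of t 0 b] t by blast
  then have "at t within {0..<b} \<noteq> bot" using trivial_limit_within by blast
  then have "vector_derivative (\<lambda>s. 0 :: real) (at t within {0..<b}) = 0"
    by (rule vector_derivative_within[OF _ has_vector_derivative_const])
  moreover have "laplacian (G t c) (\<lambda>z. 0) y = 0"
  proof -
    have "pd j (\<lambda>z. 0 :: real) = (\<lambda>z. 0)" for j :: 'n by (rule ext) (rule pd_const)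
    then show ?thesis by (simp add: laplacian_def)
  qed
  moreover have "H_norm2 (G t c) (\<lambda>y is. \<tau> t * pullback A (\<phi> t) H c y is) y = 0"
    unfolding H_norm2_contract using pullback_zero[OF H] by (simp add: contract_def)
  ultimately show "vector_derivative (\<lambda>s. 0) (at t within {0..<b}) - laplacian (G t c) (\<lambda>z. 0) y
      \<le> - H_norm2 (G t c) (\<lambda>y is. \<tau> t * pullback A (\<phi> t) H c y is) y"
    by simp
qed auto

theorem proposition4p7:
  fixes A :: "('m::{t2_space, second_countable_topology}, 'n::finite) chart set"
    and g H :: "('m, 'n) chart \<Rightarrow> 'n cov"
    and X :: "('m, 'n) chart \<Rightarrow> real ^ 'n \<Rightarrow> real ^ 'n"
    and lam :: real
  assumes "smooth_atlas A"
    and "compact (UNIV :: 'm set)"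
    and "generalized_soliton A g H X lam"
    and "lam > 0"
  shows "admits_torsion_bounding_function A g H X lam \<longleftrightarrow> tensor_eq A 3 H (\<lambda>c y is. 0)"
proof
  have rm: "riemannian_metric A g" and Ht: "tensor_field A 3 H" and vf: "vector_field A X"
    using assms(3) unfolding generalized_soliton_def closed_3form_def differential_form_def by blast+
  {
    assume "admits_torsion_bounding_function A g H X lam"
    then obtain \<phi> \<psi> where gd: "generated_diffeos A {0..<1/lam} (\<lambda>t c y. (1 / (1 - lam * t)) *\<^sub>R X c y) \<phi>"
      and tb: "torsion_bounding_function A {0..<1/lam}
          (\<lambda>t c y is. (1 - lam * t) * pullback A (\<phi> t) g c y is)
          (\<lambda>t c y is. (1 - lam * t) * pullback A (\<phi> t) H c y is) \<psi>"
      unfolding admits_torsion_bounding_function_def by (elim exE conjE)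
    interpret soliton_flow A X g H lam \<phi> \<psi>
      by unfold_locales (fact assms(1) vf rm Ht assms(4) assms(2) gd tb)+
    show "tensor_eq A 3 H (\<lambda>c y is. 0)" by (rule H_vanishes)
  }
  {
    assume H: "tensor_eq A 3 H (\<lambda>c y is. 0)"
    interpret compact_vector_field A X
      by unfold_locales (fact assms(1) vf assms(2))+
    obtain \<phi> where gd: "generated_diffeos A {0..<1/lam} (\<lambda>t c y. (1 / (1 - lam * t)) *\<^sub>R X c y) \<phi>"
      using generated_diffeos_exist[OF assms(4)] by (elim exE)
    show "admits_torsion_bounding_function A g H X lam"
      unfolding admits_torsion_bounding_function_def
      by (rule exI[of _ \<phi>], rule exI[of _ "\<lambda>t p. 0"], rule conjI, rule gd, rule zero_torsion_bounding_function[OF H])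
  }
qed

end
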